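(* Let $p$ be a prime, $\delta, \varepsilon > 0$ real numbers, and $B$ a finite abelian $p$-group. For each positive integer $n$, let $M(n)$ be a random matrix valued in $\mathrm{M}_{n \times n}(\mathbb{Z}_p)$ with independent entries $M(n)_{ij}$, such that $M(n)_{ij}$ is $\varepsilon$-balanced if $|i-j| \leq (\log n)^{1+\delta}$ and has an arbitrary distribution otherwise. Then \[\lim_{n \to \infty} \mathbb{P}(\mathrm{cok}(M(n)) \simeq B) = \frac{\prod_{k=1}^\infty (1-p^{-k})}{|\mathrm{Aut}(B)|}.\]
   Context: $\mathbb{Z}_p$ denotes the $p$-adic integers and $\log$ is the natural logarithm. For $R \in \mathrm{M}_{n\times n}(\mathbb{Z}_p)$, $\mathrm{cok}(R) := \mathbb{Z}_p^n / R\,\mathbb{Z}_p^{n}$. A random variable $X$ valued in $\mathbb{Z}_p$ is $\varepsilon$-balanced if $\mathbb{P}(X \equiv t \pmod p) \leq 1-\varepsilon$ for all $t \in \mathbb{Z}/p\mathbb{Z}$. The entries are not assumed identically distributed. *)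

theory Defs
  imports
    "HOL-Probability.Probability"
    "HOL-Number_Theory.Cong"
    "HOL-Algebra.Product_Groups"
    "HOL-Algebra.Bij"
    "HOL-Algebra.Ring"
begin

text \<open>
  The ring of p-adic integers, as the inverse limit of the rings Z/p^k: an element \<open>x\<close> is a
  compatible sequence of residues, where \<open>x k\<close> is the representative in \<open>{0..<p^k}\<close> of the
  class of \<open>x\<close> modulo \<open>p^k\<close>. In particular \<open>x 0 = 0\<close>, and \<open>x 1\<close> is the reduction of \<open>x\<close> mod \<open>p\<close>.
\<close>

definition padic_int_ring :: "nat \<Rightarrow> (nat \<Rightarrow> int) ring" where
  "padic_int_ring p =
     \<lparr>carrier = {x. \<forall>k. x k \<in> {0..<int p ^ k} \<and> x (Suc k) mod int p ^ k = x k},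
      mult = (\<lambda>x y k. x k * y k mod int p ^ k),
      one = (\<lambda>k. 1 mod int p ^ k),
      zero = (\<lambda>k. 0),
      add = (\<lambda>x y k. (x k + y k) mod int p ^ k)\<rparr>"

text \<open>
  On \<open>nat \<Rightarrow> int\<close> the library topology is the product of the discrete topologies, so the
  subspace topology on the carrier is the p-adic one.
\<close>

definition padic_borel :: "nat \<Rightarrow> (nat \<Rightarrow> int) measure" where
  "padic_borel p = restrict_space borel (carrier (padic_int_ring p))"

definition padic_balanced :: "nat \<Rightarrow> real \<Rightarrow> 'w measure \<Rightarrow> ('w \<Rightarrow> nat \<Rightarrow> int) \<Rightarrow> bool" where
  "padic_balanced p \<epsilon> \<Omega> X \<longleftrightarrow>
     (\<forall>t::int. measure \<Omega> {\<omega> \<in> space \<Omega>. [X \<omega> 1 = t] (mod int p)} \<le> 1 - \<epsilon>)"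

text \<open>Column vectors are extensional functions on the index set \<open>{1..n}\<close>.\<close>

definition padic_vec_group :: "nat \<Rightarrow> nat \<Rightarrow> (nat \<Rightarrow> nat \<Rightarrow> int) monoid" where
  "padic_vec_group p n = product_group {1..n} (\<lambda>_. add_monoid (padic_int_ring p))"

definition padic_mat_vec ::
  "nat \<Rightarrow> nat \<Rightarrow> (nat \<Rightarrow> nat \<Rightarrow> nat \<Rightarrow> int) \<Rightarrow> (nat \<Rightarrow> nat \<Rightarrow> int) \<Rightarrow> nat \<Rightarrow> nat \<Rightarrow> int" where
  "padic_mat_vec p n R v =
     (\<lambda>i\<in>{1..n}. finsum (padic_int_ring p) (\<lambda>j. R i j \<otimes>\<^bsub>padic_int_ring p\<^esub> v j) {1..n})"

definition padic_cok ::
  "nat \<Rightarrow> nat \<Rightarrow> (nat \<Rightarrow> nat \<Rightarrow> nat \<Rightarrow> int) \<Rightarrow> (nat \<Rightarrow> nat \<Rightarrow> int) set monoid" where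
  "padic_cok p n R =
     padic_vec_group p n Mod (padic_mat_vec p n R ` carrier (padic_vec_group p n))"

end

theory Submission
  imports
    Defs
    "HOL-Algebra.Multiplicative_Group"
    "HOL-Real_Asymp.Real_Asymp"
begin

text \<open>
  Let \<open>|B| = p^e\<close> and \<open>V = (Z/p^(e+1))^n\<close>. Whether the cokernel is isomorphic to \<open>B\<close> only depends on the
  matrix modulo \<open>p^(e+1)\<close>: it means that the columns generate a subgroup \<open>L\<close> of \<open>V\<close> with \<open>V/L\<close>
  isomorphic to \<open>B\<close>. Vectors of \<open>L\<close> generate \<open>L\<close> unless they are all killed by a character of \<open>L\<close> of
  order \<open>p\<close>, so inclusion-exclusion (as Bonferroni inequalities) over lists of \<open>r\<close> independent such
  characters reduces the claim to the probabilities that all columns lie in a subgroup \<open>H\<close> of \<open>V\<close> of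
  index \<open>N = p^(e+r)\<close>; if these are \<open>N^(-n)\<close> up to an error with sum \<open>o(1)\<close> over all \<open>H\<close>, the main terms add up to
  Euler's expansion of the infinite product.

  By Fourier analysis the error is at most a sum, over the images \<open>f i\<close> of the unit vectors in
  \<open>A = V/H\<close> and nontrivial families \<open>\<psi> j\<close> of characters of \<open>A\<close>, of \<open>N^(-n) \<rho>^E\<close>, where \<open>E\<close> counts the
  positions \<open>(i, j)\<close> of the band with \<open>\<psi> j (f i) \<noteq> 1\<close>. On a window of indices shorter than the bandwidth, all
  but a superpolynomially small part of the weight comes from configurations where \<open>f\<close> spans a subgroup
  and \<open>\<psi>\<close> its full annihilator. Overlapping windows force the same subgroup throughout; as \<open>f\<close>
  generates \<open>A\<close>, this makes \<open>\<psi>\<close> trivial, so only defective configurations contribute.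
\<close>


section \<open>Energies of banded pairings\<close>

text \<open>The factors of entries outside the band have no bound better than 1, so only pairs near
  the diagonal are penalised and the analysis must be local. Neighbouring windows can disagree at up
  to \<open>n\<close> places, each costing \<open>\<theta> ^ l\<close> with \<open>l\<close> of
  order \<open>ln n powr (1 + \<delta>)\<close>; \<delta> > 0 is what lets this beat the factor
  \<open>n\<close>. The groups \<open>V/H\<close> vary with \<open>H\<close> and \<open>n\<close>,
  while the bound must be uniform and summable over \<open>H\<close>. Hence only a relation between
  two sets of size \<open>N\<close> is kept, with \<open>card S * card T \<le> N\<close> for
  orthogonal sets in place of duality; on \<open>{..<N}\<close> there are finitely many such
  relations, treated one at a time. The errors are controlled for each fixed number \<open>r\<close>
  of characters only, so the alternating sum is truncated before \<open>n\<close> tends to infinity,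
  and partial sums of both parities enclose the probability. The coefficient of an
  \<open>r\<close>-list is the Moebius value \<open>(-1) ^ r * p ^ (r choose 2)\<close> of the
  lattice of subspaces over \<open>F_p\<close>, divided by the order of \<open>GL_r(F_p)\<close>,
  the number of ordered bases of one subspace; this is \<open>bonf_coeff p r\<close>.\<close>

locale pairing_bound =
  fixes A :: "'a set" and X :: "'b set" and perp :: "'a \<Rightarrow> 'b \<Rightarrow> bool" and N :: nat and \<rho> :: real
  assumes finite_A: "finite A" and finite_X: "finite X"
    and card_A: "card A = N" and card_X: "card X = N" and N_pos: "N > 0"
    and card_perp: "\<And>S T. S \<subseteq> A \<Longrightarrow> T \<subseteq> X \<Longrightarrow> (\<And>s t. s \<in> S \<Longrightarrow> t \<in> T \<Longrightarrow> perp s t) \<Longrightarrow> card S * card T \<le> N"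
    and rho_pos: "0 < \<rho>" and rho_less_1: "\<rho> < 1"
begin

definition annX :: "(nat \<Rightarrow> 'a) \<Rightarrow> nat set \<Rightarrow> 'b set" where
  "annX f I = {t \<in> X. \<forall>i\<in>I. perp (f i) t}"

definition annA :: "(nat \<Rightarrow> 'b) \<Rightarrow> nat set \<Rightarrow> 'a set" where
  "annA \<psi> I = {a \<in> A. \<forall>i\<in>I. perp a (\<psi> i)}"

definition energy :: "nat \<Rightarrow> nat set \<Rightarrow> (nat \<Rightarrow> 'a) \<Rightarrow> (nat \<Rightarrow> 'b) \<Rightarrow> nat" where
  "energy w I f \<psi> = card {(i, j) \<in> I \<times> I. i \<le> j + w \<and> j \<le> i + w \<and> \<not> perp (f i) (\<psi> j)}"

definition orthogonal :: "nat set \<Rightarrow> (nat \<Rightarrow> 'a) \<Rightarrow> (nat \<Rightarrow> 'b) \<Rightarrow> bool" where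
  "orthogonal I f \<psi> \<longleftrightarrow> (\<forall>i\<in>I. \<forall>j\<in>I. perp (f i) (\<psi> j))"

text \<open>For a finite abelian group and its dual this says that the span of \<psi> is the full
  annihilator of the span of \<open>f\<close>: orthogonality gives one inclusion, orthogonality of
  the two annihilators the other. Equality in \<open>card_perp\<close> records this without group
  structure.\<close>

definition ground :: "nat set \<Rightarrow> (nat \<Rightarrow> 'a) \<Rightarrow> (nat \<Rightarrow> 'b) \<Rightarrow> bool" where
  "ground I f \<psi> \<longleftrightarrow> orthogonal I f \<psi> \<and> (\<forall>a\<in>annA \<psi> I. \<forall>t\<in>annX f I. perp a t)
     \<and> card (annA \<psi> I) * card (annX f I) = N"

text \<open>The normalisation makes all configurations inside one pair \<open>(H, K)\<close> with
  \<open>card H * card K = N\<close> weigh at most 1, whatever the length of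
  \<open>I\<close>.\<close>

definition weight :: "nat \<Rightarrow> nat set \<Rightarrow> ((nat \<Rightarrow> 'a) \<Rightarrow> (nat \<Rightarrow> 'b) \<Rightarrow> bool) \<Rightarrow> real" where
  "weight w I P = (\<Sum>(f, \<psi>) \<in> {(f, \<psi>). f \<in> I \<rightarrow>\<^sub>E A \<and> \<psi> \<in> I \<rightarrow>\<^sub>E X \<and> P f \<psi>}. \<rho> ^ energy w I f \<psi>)
     / real N ^ card I"

lemma finite_configs: "finite I \<Longrightarrow> finite {(f, \<psi>). f \<in> I \<rightarrow>\<^sub>E A \<and> \<psi> \<in> I \<rightarrow>\<^sub>E X \<and> P f \<psi>}"
  by (rule finite_subset[of _ "(I \<rightarrow>\<^sub>E A) \<times> (I \<rightarrow>\<^sub>E X)"]) (auto intro!: finite_PiE simp: finite_A finite_X)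

lemma finite_annX: "finite (annX f I)" and finite_annA: "finite (annA \<psi> I)"
  by (auto simp: annX_def annA_def finite_A finite_X)

lemma annX_subset: "annX f I \<subseteq> X" and annA_subset: "annA \<psi> I \<subseteq> A"
  by (auto simp: annX_def annA_def)

lemma weight_nonneg: "0 \<le> weight w I P"
  unfolding weight_def using rho_pos by (auto intro!: divide_nonneg_nonneg sum_nonneg)

lemma weight_mono:
  assumes "finite I" and "\<And>f \<psi>. f \<in> I \<rightarrow>\<^sub>E A \<Longrightarrow> \<psi> \<in> I \<rightarrow>\<^sub>E X \<Longrightarrow> P f \<psi> \<Longrightarrow> Q f \<psi>"
  shows "weight w I P \<le> weight w I Q"
  unfolding weight_def using rho_pos assms
  by (intro divide_right_mono sum_mono2 finite_configs) auto

lemma weight_disj: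
  assumes "finite I"
  shows "weight w I (\<lambda>f \<psi>. P f \<psi> \<or> Q f \<psi>) \<le> weight w I P + weight w I Q"
proof -
  have "(\<Sum>(f, \<psi>) \<in> {(f, \<psi>). f \<in> I \<rightarrow>\<^sub>E A \<and> \<psi> \<in> I \<rightarrow>\<^sub>E X \<and> (P f \<psi> \<or> Q f \<psi>)}. \<rho> ^ energy w I f \<psi>)
      = (\<Sum>(f, \<psi>) \<in> {(f, \<psi>). f \<in> I \<rightarrow>\<^sub>E A \<and> \<psi> \<in> I \<rightarrow>\<^sub>E X \<and> P f \<psi>} \<union> {(f, \<psi>). f \<in> I \<rightarrow>\<^sub>E A \<and> \<psi> \<in> I \<rightarrow>\<^sub>E X \<and> Q f \<psi>}. \<rho> ^ energy w I f \<psi>)"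
    by (intro sum.cong) auto
  also have "\<dots> \<le> (\<Sum>(f, \<psi>) \<in> {(f, \<psi>). f \<in> I \<rightarrow>\<^sub>E A \<and> \<psi> \<in> I \<rightarrow>\<^sub>E X \<and> P f \<psi>}. \<rho> ^ energy w I f \<psi>)
      + (\<Sum>(f, \<psi>) \<in> {(f, \<psi>). f \<in> I \<rightarrow>\<^sub>E A \<and> \<psi> \<in> I \<rightarrow>\<^sub>E X \<and> Q f \<psi>}. \<rho> ^ energy w I f \<psi>)"
    using rho_pos by (subst sum.union_inter[symmetric, OF finite_configs finite_configs, OF assms assms])
      (auto intro!: sum_nonneg)
  finally show ?thesis
    unfolding weight_def by (simp add: add_divide_distrib[symmetric] divide_right_mono)
qed

lemma weight_Bex:
  assumes "finite I" "finite \<T>"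
  shows "weight w I (\<lambda>f \<psi>. \<exists>\<tau>\<in>\<T>. P \<tau> f \<psi>) \<le> (\<Sum>\<tau>\<in>\<T>. weight w I (P \<tau>))"
  using assms(2)
proof (induction \<T>)
  case empty
  then show ?case by (simp add: weight_def)
next
  case (insert \<tau> \<T>)
  have "weight w I (\<lambda>f \<psi>. \<exists>\<tau>\<in>insert \<tau> \<T>. P \<tau> f \<psi>) = weight w I (\<lambda>f \<psi>. P \<tau> f \<psi> \<or> (\<exists>\<tau>\<in>\<T>. P \<tau> f \<psi>))"
    by (simp add: weight_def)
  then show ?case
    using weight_disj[OF assms(1), of w "P \<tau>" "\<lambda>f \<psi>. \<exists>\<tau>\<in>\<T>. P \<tau> f \<psi>"] insert by simp
qed

lemma energy_Un:
  assumes "I \<inter> J = {}" "finite I" "finite J"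
  shows "energy w I f \<psi> + energy w J f \<psi> \<le> energy w (I \<union> J) f \<psi>"
proof -
  let ?S = "\<lambda>I. {(i, j) \<in> I \<times> I. i \<le> j + w \<and> j \<le> i + w \<and> \<not> perp (f i) (\<psi> j)}"
  have fin: "finite (?S I)" if "finite I" for I
    by (rule finite_subset[of _ "I \<times> I"]) (use that in auto)
  have "card (?S I) + card (?S J) = card (?S I \<union> ?S J)"
    using assms fin[of I] fin[of J] by (subst card_Un_disjoint) auto
  also have "\<dots> \<le> card (?S (I \<union> J))"
    using assms fin[of "I \<union> J"] by (intro card_mono) auto
  finally show ?thesis unfolding energy_def .
qed

lemma energy_restrict:
  "energy w I (restrict f I) (restrict \<psi> I) = energy w I f \<psi>"
  unfolding energy_def by (rule arg_cong[where f=card]) auto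

text \<open>Submultiplicativity: dropping the pairs between \<open>I\<close> and \<open>J\<close>
  only lowers the energy, a configuration is determined by its two restrictions, and the normalising
  powers of \<open>N\<close> multiply.\<close>

lemma weight_Un:
  assumes "I \<inter> J = {}" "finite I" "finite J"
    and imp: "\<And>f \<psi>. P f \<psi> \<Longrightarrow> Q (restrict f I) (restrict \<psi> I) \<and> R (restrict f J) (restrict \<psi> J)"
  shows "weight w (I \<union> J) P \<le> weight w I Q * weight w J R"
proof -
  let ?C = "\<lambda>I P. {(f, \<psi>). f \<in> I \<rightarrow>\<^sub>E A \<and> \<psi> \<in> I \<rightarrow>\<^sub>E X \<and> P f \<psi>}"
  let ?r = "\<lambda>(f, \<psi>). ((restrict f I, restrict \<psi> I), (restrict f J, restrict \<psi> J))"
  have inj: "inj_on ?r (?C (I \<union> J) P)"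
  proof (rule inj_onI; clarify)
    fix f \<psi> f' \<psi>'
    assume *: "f \<in> I \<union> J \<rightarrow>\<^sub>E A" "f' \<in> I \<union> J \<rightarrow>\<^sub>E A" "\<psi> \<in> I \<union> J \<rightarrow>\<^sub>E X" "\<psi>' \<in> I \<union> J \<rightarrow>\<^sub>E X"
      "restrict f I = restrict f' I" "restrict \<psi> I = restrict \<psi>' I"
      "restrict f J = restrict f' J" "restrict \<psi> J = restrict \<psi>' J"
    have "f x = f' x \<and> \<psi> x = \<psi>' x" for x
      using *(1-4) fun_cong[OF *(5), of x] fun_cong[OF *(6), of x] fun_cong[OF *(7), of x] fun_cong[OF *(8), of x]
      by (auto simp: PiE_def extensional_def restrict_def split: if_splits)
    then show "f = f' \<and> \<psi> = \<psi>'" by auto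
  qed
  have "(\<Sum>(f, \<psi>) \<in> ?C (I \<union> J) P. \<rho> ^ energy w (I \<union> J) f \<psi>)
      \<le> (\<Sum>(f, \<psi>) \<in> ?C (I \<union> J) P. \<rho> ^ energy w I f \<psi> * \<rho> ^ energy w J f \<psi>)"
    using rho_pos rho_less_1 energy_Un[OF assms(1-3), of w]
    by (auto intro!: sum_mono power_decreasing simp: power_add[symmetric])
  also have "\<dots> = (\<Sum>(x, y) \<in> ?r ` ?C (I \<union> J) P. (case x of (f, \<psi>) \<Rightarrow> \<rho> ^ energy w I f \<psi>) * (case y of (f, \<psi>) \<Rightarrow> \<rho> ^ energy w J f \<psi>))"
    by (subst sum.reindex[OF inj]) (auto intro!: sum.cong simp: energy_restrict)
  also have "\<dots> \<le> (\<Sum>(x, y) \<in> ?C I Q \<times> ?C J R. (case x of (f, \<psi>) \<Rightarrow> \<rho> ^ energy w I f \<psi>) * (case y of (f, \<psi>) \<Rightarrow> \<rho> ^ energy w J f \<psi>))"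
  proof (rule sum_mono2)
    show "?r ` ?C (I \<union> J) P \<subseteq> ?C I Q \<times> ?C J R"
    proof clarify
      fix f \<psi> assume *: "f \<in> I \<union> J \<rightarrow>\<^sub>E A" "\<psi> \<in> I \<union> J \<rightarrow>\<^sub>E X" "P f \<psi>"
      then show "(restrict f I, restrict \<psi> I) \<in> ?C I Q \<and> (restrict f J, restrict \<psi> J) \<in> ?C J R"
        using imp[OF *(3)] by (auto simp: PiE_iff)
    qed
  qed (use assms rho_pos in \<open>auto intro!: finite_cartesian_product finite_configs\<close>)
  also have "\<dots> = (\<Sum>(f, \<psi>) \<in> ?C I Q. \<rho> ^ energy w I f \<psi>) * (\<Sum>(f, \<psi>) \<in> ?C J R. \<rho> ^ energy w J f \<psi>)"
    by (simp add: sum_product sum.cartesian_product)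
  finally show ?thesis
    unfolding weight_def using N_pos
    by (simp add: card_Un_disjoint assms power_add divide_right_mono)
qed


section \<open>Configurations on a single window\<close>

definition viol :: "nat set \<Rightarrow> 'a \<Rightarrow> (nat \<Rightarrow> 'b) \<Rightarrow> nat" where
  "viol I a \<psi> = card {j \<in> I. \<not> perp a (\<psi> j)}"

text \<open>A threshold proportional to the window, instead of no violation at all, makes each
  remaining element contribute at most \<open>(\<rho> powr \<kappa>) ^ card I\<close>, uniformly in
  \<psi>.\<close>

definition small :: "real \<Rightarrow> nat set \<Rightarrow> (nat \<Rightarrow> 'b) \<Rightarrow> 'a set" where
  "small \<kappa> I \<psi> = {a \<in> A. real (viol I a \<psi>) \<le> \<kappa> * real (card I)}"

definition smallX :: "real \<Rightarrow> nat set \<Rightarrow> (nat \<Rightarrow> 'b) \<Rightarrow> 'b set" where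
  "smallX \<kappa> I \<psi> = {t \<in> X. \<forall>a\<in>small \<kappa> I \<psi>. perp a t}"

lemma energy_eq_sum_viol:
  assumes "finite I" "\<And>i j. i \<in> I \<Longrightarrow> j \<in> I \<Longrightarrow> i \<le> j + w"
  shows "energy w I f \<psi> = (\<Sum>i\<in>I. viol I (f i) \<psi>)"
proof -
  have "{(i, j) \<in> I \<times> I. i \<le> j + w \<and> j \<le> i + w \<and> \<not> perp (f i) (\<psi> j)}
      = Sigma I (\<lambda>i. {j \<in> I. \<not> perp (f i) (\<psi> j)})"
    using assms by auto
  then show ?thesis
    unfolding energy_def viol_def using assms(1) by simp
qed

text \<open>When every pair of the window lies in the band, the energy is a sum over
  \<open>i\<close> of terms in \<open>f i\<close> alone, so for fixed \<psi> the sum over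
  \<open>f\<close> factorises.\<close>

lemma sum_rho_energy:
  assumes "finite I" "\<And>i j. i \<in> I \<Longrightarrow> j \<in> I \<Longrightarrow> i \<le> j + w" "finite B"
  shows "(\<Sum>f \<in> I \<rightarrow>\<^sub>E B. \<rho> ^ energy w I f \<psi>) = (\<Sum>a\<in>B. \<rho> ^ viol I a \<psi>) ^ card I"
proof -
  have "(\<Sum>f \<in> I \<rightarrow>\<^sub>E B. \<rho> ^ energy w I f \<psi>) = (\<Sum>f \<in> I \<rightarrow>\<^sub>E B. \<Prod>i\<in>I. \<rho> ^ viol I (f i) \<psi>)"
    by (simp add: energy_eq_sum_viol[OF assms(1,2)] power_sum)
  also have "\<dots> = (\<Prod>i\<in>I. \<Sum>a\<in>B. \<rho> ^ viol I a \<psi>)"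
    using assms by (subst prod_sum_PiE) auto
  finally show ?thesis by simp
qed

lemma rho_powr_power: "(\<rho> powr \<kappa>) ^ n = \<rho> powr (\<kappa> * real n)"
  using rho_pos by (simp add: powr_realpow[symmetric] powr_powr)

lemma small_subset: "small \<kappa> I \<psi> \<subseteq> A" and finite_small: "finite (small \<kappa> I \<psi>)"
  using finite_A by (auto simp: small_def)

lemma card_small_smallX: "card (small \<kappa> I \<psi>) * card (smallX \<kappa> I \<psi>) \<le> N"
  by (rule card_perp) (auto simp: small_def smallX_def)

lemma sum_viol_le:
  "(\<Sum>a\<in>A. \<rho> ^ viol I a \<psi>) \<le> (\<Sum>a\<in>small \<kappa> I \<psi>. \<rho> ^ viol I a \<psi>) + real N * (\<rho> powr \<kappa>) ^ card I"
proof -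
  have "(\<Sum>a\<in>A. \<rho> ^ viol I a \<psi>) = (\<Sum>a\<in>small \<kappa> I \<psi>. \<rho> ^ viol I a \<psi>) + (\<Sum>a\<in>A - small \<kappa> I \<psi>. \<rho> ^ viol I a \<psi>)"
    using sum.subset_diff[OF small_subset finite_A] by (simp add: add.commute)
  also have "(\<Sum>a\<in>A - small \<kappa> I \<psi>. \<rho> ^ viol I a \<psi>) \<le> (\<Sum>a\<in>A - small \<kappa> I \<psi>. (\<rho> powr \<kappa>) ^ card I)"
  proof (rule sum_mono)
    fix a assume "a \<in> A - small \<kappa> I \<psi>"
    then have "\<kappa> * real (card I) \<le> real (viol I a \<psi>)" by (auto simp: small_def)
    then have "\<rho> powr real (viol I a \<psi>) \<le> \<rho> powr (\<kappa> * real (card I))"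
      using rho_pos rho_less_1 by (intro powr_mono') auto
    then show "\<rho> ^ viol I a \<psi> \<le> (\<rho> powr \<kappa>) ^ card I"
      using rho_pos by (simp add: rho_powr_power powr_realpow)
  qed
  also have "\<dots> \<le> real N * (\<rho> powr \<kappa>) ^ card I"
  proof -
    have "card (A - small \<kappa> I \<psi>) \<le> N" using card_A finite_A by (metis Diff_subset card_mono)
    then show ?thesis by (simp add: mult_right_mono)
  qed
  finally show ?thesis by simp
qed

text \<open>Each exceptional index is violated by one of the at most \<open>N\<close> small
  elements, and each of these violates at most \<open>\<kappa> * card I\<close> indices.\<close>

lemma card_exceptions:
  assumes "finite I" "\<kappa> \<ge> 0"
  shows "real (card {j \<in> I. \<psi> j \<in> X \<and> \<psi> j \<notin> smallX \<kappa> I \<psi>}) \<le> real N * \<kappa> * real (card I)"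
proof -
  have "{j \<in> I. \<psi> j \<in> X \<and> \<psi> j \<notin> smallX \<kappa> I \<psi>} \<subseteq> (\<Union>a\<in>small \<kappa> I \<psi>. {j \<in> I. \<not> perp a (\<psi> j)})"
    by (auto simp: smallX_def)
  then have "card {j \<in> I. \<psi> j \<in> X \<and> \<psi> j \<notin> smallX \<kappa> I \<psi>} \<le> card (\<Union>a\<in>small \<kappa> I \<psi>. {j \<in> I. \<not> perp a (\<psi> j)})"
    using assms finite_small by (intro card_mono) auto
  also have "\<dots> \<le> (\<Sum>a\<in>small \<kappa> I \<psi>. viol I a \<psi>)"
    unfolding viol_def by (rule card_UN_le[OF finite_small])
  finally have "real (card {j \<in> I. \<psi> j \<in> X \<and> \<psi> j \<notin> smallX \<kappa> I \<psi>}) \<le> (\<Sum>a\<in>small \<kappa> I \<psi>. real (viol I a \<psi>))"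
    unfolding of_nat_sum[symmetric] by (rule of_nat_mono)
  also have "\<dots> \<le> (\<Sum>a\<in>small \<kappa> I \<psi>. \<kappa> * real (card I))"
    by (intro sum_mono) (auto simp: small_def)
  also have "\<dots> \<le> real N * (\<kappa> * real (card I))"
  proof -
    have "card (small \<kappa> I \<psi>) \<le> N" using card_A finite_A small_subset by (metis card_mono)
    then show ?thesis using assms by (simp add: mult_right_mono)
  qed
  finally show ?thesis by (simp add: mult.assoc)
qed

text \<open>Exponential Markov bound: every index outside \<open>T\<close> gets the factor
  \<open>x\<close>, and the sum of the resulting products over all \<psi> factorises.\<close>

lemma card_few_exceptions:
  assumes "finite I" "T \<subseteq> X" "0 < x" "x \<le> 1"
  shows "real (card {\<psi> \<in> I \<rightarrow>\<^sub>E X. real (card {j \<in> I. \<psi> j \<notin> T}) \<le> c}) * x powr c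
      \<le> (real (card T) + x * real N) ^ card I"
proof -
  let ?S = "{\<psi> \<in> I \<rightarrow>\<^sub>E X. real (card {j \<in> I. \<psi> j \<notin> T}) \<le> c}"
  have fin: "finite (I \<rightarrow>\<^sub>E X)" using assms finite_X by (intro finite_PiE) auto
  have "real (card ?S) * x powr c = (\<Sum>\<psi>\<in>?S. x powr c)" by simp
  also have "\<dots> \<le> (\<Sum>\<psi>\<in>?S. \<Prod>j\<in>I. if \<psi> j \<in> T then 1 else x)"
  proof (rule sum_mono)
    fix \<psi> assume "\<psi> \<in> ?S"
    then have "x powr c \<le> x powr real (card {j \<in> I. \<psi> j \<notin> T})"
      using assms by (intro powr_mono') auto
    also have "\<dots> = x ^ card {j \<in> I. \<psi> j \<notin> T}" using assms by (simp add: powr_realpow)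
    also have "\<dots> = (\<Prod>j\<in>I. if \<psi> j \<in> T then 1 else x)"
      using assms(1) by (simp add: prod.If_cases Int_def)
    finally show "x powr c \<le> (\<Prod>j\<in>I. if \<psi> j \<in> T then 1 else x)" .
  qed
  also have "\<dots> \<le> (\<Sum>\<psi>\<in>I \<rightarrow>\<^sub>E X. \<Prod>j\<in>I. if \<psi> j \<in> T then 1 else x)"
    using assms fin by (intro sum_mono2) (auto intro!: prod_nonneg)
  also have "\<dots> = (\<Prod>j\<in>I. \<Sum>t\<in>X. if t \<in> T then 1 else x)"
    using assms finite_X by (subst prod_sum_PiE) auto
  also have "\<dots> = (\<Sum>t\<in>X. if t \<in> T then 1 else x) ^ card I" by simp
  also have "(\<Sum>t\<in>X. if t \<in> T then 1 else x) = real (card T) + x * real (card (X - T))"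
  proof -
    have "X \<inter> {t. t \<in> T} = T" "X \<inter> - {t. t \<in> T} = X - T" using assms by auto
    then show ?thesis using finite_X by (simp add: sum.If_cases)
  qed
  also have "(real (card T) + x * real (card (X - T))) ^ card I \<le> (real (card T) + x * real N) ^ card I"
  proof -
    have "card (X - T) \<le> N" using card_X finite_X by (metis Diff_subset card_mono)
    then show ?thesis using assms by (intro power_mono add_mono mult_left_mono) auto
  qed
  finally show ?thesis .
qed

lemma weight_eq_sum_sum:
  assumes "finite I"
  shows "weight w I (\<lambda>f \<psi>. Q \<psi> \<and> P f \<psi>)
    = (\<Sum>\<psi>\<in>{\<psi> \<in> I \<rightarrow>\<^sub>E X. Q \<psi>}. \<Sum>f\<in>{f \<in> I \<rightarrow>\<^sub>E A. P f \<psi>}. \<rho> ^ energy w I f \<psi>) / real N ^ card I"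
proof -
  have fin: "finite (I \<rightarrow>\<^sub>E X)" "finite (I \<rightarrow>\<^sub>E A)" using assms finite_X finite_A by (auto intro!: finite_PiE)
  have "(\<Sum>\<psi>\<in>{\<psi> \<in> I \<rightarrow>\<^sub>E X. Q \<psi>}. \<Sum>f\<in>{f \<in> I \<rightarrow>\<^sub>E A. P f \<psi>}. \<rho> ^ energy w I f \<psi>)
     = (\<Sum>(\<psi>, f) \<in> Sigma {\<psi> \<in> I \<rightarrow>\<^sub>E X. Q \<psi>} (\<lambda>\<psi>. {f \<in> I \<rightarrow>\<^sub>E A. P f \<psi>}). \<rho> ^ energy w I f \<psi>)"
    using fin by (intro sum.Sigma) auto
  also have "\<dots> = (\<Sum>(f, \<psi>) \<in> {(f, \<psi>). f \<in> I \<rightarrow>\<^sub>E A \<and> \<psi> \<in> I \<rightarrow>\<^sub>E X \<and> Q \<psi> \<and> P f \<psi>}. \<rho> ^ energy w I f \<psi>)"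
    by (rule sum.reindex_bij_witness[of _ "\<lambda>(f, \<psi>). (\<psi>, f)" "\<lambda>(\<psi>, f). (f, \<psi>)"]) auto
  finally show ?thesis unfolding weight_def by simp
qed


text \<open>An exception costs a fixed factor at each of the \<open>card I\<close> positions of
  \<open>f\<close>, because it lowers the sum over the small elements by \<open>1 - \<rho>\<close>.
  The entropy of \<psi> with at most \<open>N * \<kappa> * card I\<close> exceptions exceeds
  \<open>card T ^ card I\<close> only by a factor that is close to 1 per position for suitable
  \<open>x\<close> and \<kappa>.\<close>

lemma weight_exceptional:
  assumes I: "finite I" "I \<noteq> {}" and w: "\<And>i j. i \<in> I \<Longrightarrow> j \<in> I \<Longrightarrow> i \<le> j + w"
    and T: "T \<subseteq> X" and x: "0 < x" "x \<le> 1" and \<kappa>: "0 \<le> \<kappa>" "real N * \<kappa> < 1"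
  shows "weight w I (\<lambda>f \<psi>. smallX \<kappa> I \<psi> = T \<and> (\<exists>j\<in>I. \<psi> j \<notin> T))
    \<le> (x powr (- real N * \<kappa>) * (1 + x * real N) * (1 - (1 - \<rho>) / real N + real N * (\<rho> powr \<kappa>) ^ card I)) ^ card I"
proof -
  define L where "L = card I"
  define u where "u = real N * (\<rho> powr \<kappa>) ^ L"
  have u0: "u \<ge> 0" unfolding u_def by simp
  have L0: "L > 0" unfolding L_def using I by (simp add: card_gt_0_iff)
  let ?c = "real N * \<kappa> * real L"
  let ?Q = "\<lambda>\<psi>. smallX \<kappa> I \<psi> = T \<and> (\<exists>j\<in>I. \<psi> j \<notin> T)"
  let ?S = "{\<psi> \<in> I \<rightarrow>\<^sub>E X. ?Q \<psi>}"
  let ?R = "{\<psi> \<in> I \<rightarrow>\<^sub>E X. real (card {j \<in> I. \<psi> j \<notin> T}) \<le> ?c}"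
  have fin: "finite (I \<rightarrow>\<^sub>E X)" using I finite_X by (intro finite_PiE) auto
  have few: "\<psi> \<in> ?R" if "\<psi> \<in> ?S" for \<psi>
  proof -
    have "{j \<in> I. \<psi> j \<notin> T} = {j \<in> I. \<psi> j \<in> X \<and> \<psi> j \<notin> smallX \<kappa> I \<psi>}" using that by auto
    then show ?thesis using that card_exceptions[of I \<kappa> \<psi>] I \<kappa> by (auto simp: L_def)
  qed
  define b where "b = (1 + x * real N) * (1 - (1 - \<rho>) / real N + u)"
  have base: "(real (card T) + x * real N) * (\<Sum>a\<in>A. \<rho> ^ viol I a \<psi>) \<le> real N * b"
    and pos: "card T > 0" if S: "\<psi> \<in> ?S" for \<psi>
  proof -
    \<comment> \<open>An empty \<open>T\<close> would make every index exceptional, more than the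
      allowed proportion \<open>N * \<kappa> < 1\<close>.\<close>
    show cT: "card T > 0"
    proof (rule ccontr)
      assume "\<not> card T > 0"
      then have "T = {}" using T finite_X finite_subset by fastforce
      then have "real L \<le> ?c" using few[OF S] by (simp add: L_def)
      also have "\<dots> < 1 * real L" using L0 \<kappa> by (intro mult_strict_right_mono) auto
      finally show False by simp
    qed
    let ?A = "small \<kappa> I \<psi>"
    \<comment> \<open>The exceptional index supplies a small element with at least one violation;
      its term is at most \<rho> instead of 1, which is the loss that the estimate lives on.\<close>
    obtain j where j: "j \<in> I" "\<psi> j \<in> X" "\<psi> j \<notin> smallX \<kappa> I \<psi>" using S by auto
    then obtain a where a: "a \<in> ?A" "\<not> perp a (\<psi> j)" by (auto simp: smallX_def)
    have "viol I a \<psi> \<ge> 1"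
      unfolding viol_def using a j I by (auto simp: Suc_le_eq card_gt_0_iff)
    then have va: "\<rho> ^ viol I a \<psi> \<le> \<rho>" using rho_pos rho_less_1
      by (metis less_eq_real_def power_decreasing power_one_right)
    have "(\<Sum>a\<in>?A. \<rho> ^ viol I a \<psi>) = \<rho> ^ viol I a \<psi> + (\<Sum>a\<in>?A - {a}. \<rho> ^ viol I a \<psi>)"
      using a finite_small by (simp add: sum.remove)
    also have "\<dots> \<le> \<rho> + (\<Sum>a\<in>?A - {a}. 1)"
      using va rho_pos rho_less_1 by (intro add_mono sum_mono) (auto simp: power_le_one)
    also have "\<dots> = real (card ?A) - (1 - \<rho>)"
    proof -
      have "card ?A > 0" using a finite_small by (auto simp: card_gt_0_iff)
      then show ?thesis using a finite_small by (simp add: of_nat_diff)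
    qed
    finally have "(\<Sum>a\<in>A. \<rho> ^ viol I a \<psi>) \<le> real (card ?A) - (1 - \<rho>) + u"
      using sum_viol_le[of I \<psi> \<kappa>] by (simp add: u_def L_def)
    moreover have "0 \<le> (\<Sum>a\<in>A. \<rho> ^ viol I a \<psi>)" using rho_pos by (intro sum_nonneg) auto
    ultimately have "(real (card T) + x * real N) * (\<Sum>a\<in>A. \<rho> ^ viol I a \<psi>)
        \<le> (real (card T) * (1 + x * real N)) * (real (card ?A) - (1 - \<rho>) + u)"
    proof (intro mult_mono)
      have "x * real N * 1 \<le> x * real N * real (card T)" using cT x by (intro mult_left_mono) auto
      then show "real (card T) + x * real N \<le> real (card T) * (1 + x * real N)" by (simp add: algebra_simps)
    qed (use x in auto)
    also have "\<dots> = (1 + x * real N) * (real (card ?A * card T) - real (card T) * (1 - \<rho>) + real (card T) * u)"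
      by (simp add: algebra_simps)
    \<comment> \<open>The loss appears multiplied by \<open>card T\<close>, which is at least 1 by
      \<open>cT\<close>; the error \<open>u\<close> is multiplied by at most
      \<open>N\<close>.\<close>
    also have "\<dots> \<le> (1 + x * real N) * (real N - 1 * (1 - \<rho>) + real N * u)"
    proof (intro mult_left_mono add_mono diff_mono mult_right_mono)
      show "real (card ?A * card T) \<le> real N" unfolding of_nat_le_iff using card_small_smallX[of \<kappa> I \<psi>] S by simp
      show "real (card T) \<le> real N" using T finite_X card_X by (metis card_mono of_nat_le_iff)
    qed (use x cT rho_less_1 u0 in auto)
    also have "\<dots> = real N * b" using N_pos by (simp add: b_def field_simps)
    finally show "(real (card T) + x * real N) * (\<Sum>a\<in>A. \<rho> ^ viol I a \<psi>) \<le> real N * b" .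
  qed
  show ?thesis
  proof (cases "?S = {}")
    case True
    have "0 \<le> 1 - (1 - \<rho>) / real N" using rho_less_1 rho_pos N_pos by (simp add: field_simps)
    then have "b \<ge> 0" unfolding b_def using x u0 by (intro mult_nonneg_nonneg add_nonneg_nonneg) auto
    moreover have "weight w I (\<lambda>f \<psi>. ?Q \<psi> \<and> True) = 0"
      unfolding weight_eq_sum_sum[OF I(1)] True by simp
    ultimately show ?thesis by (auto simp: b_def u_def L_def mult.assoc intro!: zero_le_power)
  next
    case False
    then obtain \<psi>0 where "\<psi>0 \<in> ?S" by auto
    then have cT: "real (card T) > 0" using pos by auto
    have "(\<Sum>\<psi>\<in>?S. \<Sum>f\<in>{f \<in> I \<rightarrow>\<^sub>E A. True}. \<rho> ^ energy w I f \<psi>) = (\<Sum>\<psi>\<in>?S. (\<Sum>a\<in>A. \<rho> ^ viol I a \<psi>) ^ L)"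
      using sum_rho_energy[OF I(1) w finite_A] by (simp add: L_def)
    also have "\<dots> \<le> (\<Sum>\<psi>\<in>?S. (real N * b / (real (card T) + x * real N)) ^ L)"
    proof (intro sum_mono power_mono)
      fix \<psi> assume "\<psi> \<in> ?S"
      then show "(\<Sum>a\<in>A. \<rho> ^ viol I a \<psi>) \<le> real N * b / (real (card T) + x * real N)"
        using base[of \<psi>] cT x by (simp add: field_simps add_pos_nonneg)
    qed (use rho_pos in \<open>auto intro!: sum_nonneg\<close>)
    also have "\<dots> = real (card ?S) * (real N * b / (real (card T) + x * real N)) ^ L" by simp
    also have "\<dots> \<le> real (card ?R) * (real N * b / (real (card T) + x * real N)) ^ L"
    proof (intro mult_right_mono)
      show "real (card ?S) \<le> real (card ?R)"
        unfolding of_nat_le_iff using few fin by (intro card_mono) auto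
      have "0 \<le> real N * b"
        by (rule order_trans[OF _ base[OF \<open>\<psi>0 \<in> ?S\<close>]])
          (use x rho_pos in \<open>auto intro!: mult_nonneg_nonneg sum_nonneg\<close>)
      then show "0 \<le> (real N * b / (real (card T) + x * real N)) ^ L"
        using x by (intro zero_le_power divide_nonneg_nonneg) auto
    qed
    also have "\<dots> \<le> ((real (card T) + x * real N) ^ L / x powr ?c) * (real N * b / (real (card T) + x * real N)) ^ L"
    proof (intro mult_right_mono)
      show "real (card ?R) \<le> (real (card T) + x * real N) ^ L / x powr ?c"
        using card_few_exceptions[OF I(1) T x, of ?c] x by (simp add: L_def field_simps)
      have "0 \<le> real N * b"
        by (rule order_trans[OF _ base[OF \<open>\<psi>0 \<in> ?S\<close>]])
          (use x rho_pos in \<open>auto intro!: mult_nonneg_nonneg sum_nonneg\<close>)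
      then show "0 \<le> (real N * b / (real (card T) + x * real N)) ^ L"
        using x by (intro zero_le_power divide_nonneg_nonneg) auto
    qed
    also have "\<dots> = real N ^ L * (b ^ L / x powr ?c)"
    proof -
      have "real (card T) + x * real N \<noteq> 0" using cT x by (metis add_pos_nonneg less_irrefl mult_nonneg_nonneg less_imp_le of_nat_0_le_iff)
      then show ?thesis by (simp add: power_divide power_mult_distrib)
    qed
    also have "b ^ L / x powr ?c = (x powr (- real N * \<kappa>) * b) ^ L"
    proof -
      have "(x powr (- real N * \<kappa>)) ^ L = x powr (- ?c)"
        using x by (simp add: powr_realpow[symmetric] powr_powr)
      moreover have "b ^ L / x powr ?c = b ^ L * x powr (- ?c)" by (simp only: powr_minus_divide) simp
      ultimately show ?thesis by (simp only: power_mult_distrib mult.commute)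
    qed
    finally have "weight w I (\<lambda>f \<psi>. ?Q \<psi> \<and> True) \<le> (x powr (- real N * \<kappa>) * b) ^ L"
      unfolding weight_eq_sum_sum[OF I(1)] L_def[symmetric] using N_pos
      by (simp add: divide_le_eq mult.commute)
    then show ?thesis by (simp add: b_def u_def L_def mult.assoc)
  qed
qed

text \<open>Applied to \<open>(h + u) ^ L - h ^ L\<close> after multiplication by
  \<open>card T ^ L\<close>: the product of \<open>h\<close> and \<open>card T\<close> may be
  replaced by \<open>N\<close> inside the difference, which a bound of each power separately would
  not allow.\<close>

lemma diff_power_mono:
  fixes y v Y V :: real
  assumes "0 \<le> y" "y \<le> Y" "0 \<le> v" "v \<le> V"
  shows "(y + v) ^ n - y ^ n \<le> (Y + V) ^ n - Y ^ n"
proof (induction n)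
  case (Suc n)
  have "(y + v) ^ Suc n - y ^ Suc n = (y + v) * ((y + v) ^ n - y ^ n) + v * y ^ n"
    by (simp add: algebra_simps)
  also have "\<dots> \<le> (Y + V) * ((Y + V) ^ n - Y ^ n) + V * Y ^ n"
  proof (intro add_mono mult_mono power_mono Suc)
    show "0 \<le> (y + v) ^ n - y ^ n" using assms by (simp add: power_mono)
  qed (use assms in auto)
  finally show ?case by (simp add: algebra_simps)
qed simp

text \<open>If all values of \<psi> lie in \<open>T\<close>, a small element has no violation at
  all, so the small elements form \<open>annA \<psi> I\<close>. Tuples \<open>f\<close> inside this
  set are subtracted exactly, and what remains contains at least one factor \<open>u\<close>,
  exponentially small in the window.\<close>

lemma weight_outside:
  assumes I: "finite I" and w: "\<And>i j. i \<in> I \<Longrightarrow> j \<in> I \<Longrightarrow> i \<le> j + w" and T: "T \<subseteq> X" and \<kappa>: "0 \<le> \<kappa>"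
  shows "weight w I (\<lambda>f \<psi>. (smallX \<kappa> I \<psi> = T \<and> (\<forall>j\<in>I. \<psi> j \<in> T)) \<and> f \<notin> I \<rightarrow>\<^sub>E annA \<psi> I)
    \<le> (1 + real N * (\<rho> powr \<kappa>) ^ card I) ^ card I - 1"
proof -
  define L where "L = card I"
  define u where "u = real N * (\<rho> powr \<kappa>) ^ L"
  have u0: "u \<ge> 0" unfolding u_def by simp
  let ?Q = "\<lambda>\<psi>. smallX \<kappa> I \<psi> = T \<and> (\<forall>j\<in>I. \<psi> j \<in> T)"
  let ?S = "{\<psi> \<in> I \<rightarrow>\<^sub>E X. ?Q \<psi>}"
  have finT: "finite T" using T finite_X finite_subset by auto
  have fin: "finite (I \<rightarrow>\<^sub>E A)" using I finite_A by (intro finite_PiE) auto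
  have cTN: "card T \<le> N" using T finite_X card_X by (metis card_mono)
  have inner: "real (card T) ^ L * (\<Sum>f\<in>{f \<in> I \<rightarrow>\<^sub>E A. f \<notin> I \<rightarrow>\<^sub>E annA \<psi> I}. \<rho> ^ energy w I f \<psi>)
     \<le> real N ^ L * ((1 + u) ^ L - 1)" if S: "\<psi> \<in> ?S" for \<psi>
  proof -
    have vz: "viol I a \<psi> = 0" if "a \<in> annA \<psi> I" for a
    proof -
      have "{j \<in> I. \<not> perp a (\<psi> j)} = {}" using that by (auto simp: annA_def)
      then show ?thesis unfolding viol_def by (metis card.empty)
    qed
    have eq: "small \<kappa> I \<psi> = annA \<psi> I"
    proof
      show "annA \<psi> I \<subseteq> small \<kappa> I \<psi>" using vz \<kappa> annA_subset by (auto simp: small_def)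
      show "small \<kappa> I \<psi> \<subseteq> annA \<psi> I"
        using S by (auto simp: annA_def smallX_def small_def)
    qed
    let ?h = "real (card (annA \<psi> I))"
    have hT: "?h * real (card T) \<le> real N"
      unfolding of_nat_mult[symmetric] of_nat_le_iff
      using card_small_smallX[of \<kappa> I \<psi>] S by (simp add: eq)
    have sub: "I \<rightarrow>\<^sub>E annA \<psi> I \<subseteq> I \<rightarrow>\<^sub>E A" by (rule PiE_mono) (rule annA_subset)
    have "(\<Sum>f\<in>{f \<in> I \<rightarrow>\<^sub>E A. f \<notin> I \<rightarrow>\<^sub>E annA \<psi> I}. \<rho> ^ energy w I f \<psi>)
        = (\<Sum>f\<in>(I \<rightarrow>\<^sub>E A) - (I \<rightarrow>\<^sub>E annA \<psi> I). \<rho> ^ energy w I f \<psi>)"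
      by (intro sum.cong) auto
    also have "\<dots> = (\<Sum>f\<in>I \<rightarrow>\<^sub>E A. \<rho> ^ energy w I f \<psi>) - (\<Sum>f\<in>I \<rightarrow>\<^sub>E annA \<psi> I. \<rho> ^ energy w I f \<psi>)"
      using fin sub by (rule sum_diff)
    also have "\<dots> = (\<Sum>a\<in>A. \<rho> ^ viol I a \<psi>) ^ L - ?h ^ L"
      using sum_rho_energy[OF I w finite_A] sum_rho_energy[OF I w finite_annA[of \<psi> I]] vz by (simp add: L_def)
    also have "\<dots> \<le> (?h + u) ^ L - ?h ^ L"
    proof -
      have "(\<Sum>a\<in>A. \<rho> ^ viol I a \<psi>) \<le> ?h + u"
        using sum_viol_le[of I \<psi> \<kappa>] vz unfolding eq by (simp add: u_def L_def)
      then show ?thesis using rho_pos by (intro diff_right_mono power_mono sum_nonneg) auto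
    qed
    finally have "real (card T) ^ L * (\<Sum>f\<in>{f \<in> I \<rightarrow>\<^sub>E A. f \<notin> I \<rightarrow>\<^sub>E annA \<psi> I}. \<rho> ^ energy w I f \<psi>)
       \<le> real (card T) ^ L * ((?h + u) ^ L - ?h ^ L)" by (intro mult_left_mono) auto
    also have "\<dots> = (?h * real (card T) + real (card T) * u) ^ L - (?h * real (card T)) ^ L"
      unfolding right_diff_distrib power_mult_distrib[symmetric] distrib_left by (simp add: mult.commute)
    also have "\<dots> \<le> (real N + real N * u) ^ L - real N ^ L"
      using hT cTN u0 by (intro diff_power_mono mult_right_mono) auto
    also have "\<dots> = real N ^ L * ((1 + u) ^ L - 1)"
      unfolding right_diff_distrib power_mult_distrib[symmetric] distrib_left by (simp add: mult.commute)
    finally show ?thesis .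
  qed
  have b0: "0 \<le> (1 + u) ^ L - 1" using u0 by simp
  have "real (card T) ^ L * (\<Sum>\<psi>\<in>?S. \<Sum>f\<in>{f \<in> I \<rightarrow>\<^sub>E A. f \<notin> I \<rightarrow>\<^sub>E annA \<psi> I}. \<rho> ^ energy w I f \<psi>)
      \<le> (\<Sum>\<psi>\<in>?S. real N ^ L * ((1 + u) ^ L - 1))"
    using inner by (subst sum_distrib_left) (rule sum_mono)
  also have "\<dots> = real (card ?S) * (real N ^ L * ((1 + u) ^ L - 1))" by simp
  also have "\<dots> \<le> real (card T) ^ L * (real N ^ L * ((1 + u) ^ L - 1))"
  proof (rule mult_right_mono)
    have "card ?S \<le> card (I \<rightarrow>\<^sub>E T)" using I finT by (intro card_mono finite_PiE) (auto simp: PiE_iff intro: extensional_arb)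
    also have "\<dots> = card T ^ L" using I by (simp add: card_PiE L_def)
    finally show "real (card ?S) \<le> real (card T) ^ L" by (simp only: of_nat_power[symmetric] of_nat_le_iff)
  qed (use b0 in auto)
  finally have le: "real (card T) ^ L * (\<Sum>\<psi>\<in>?S. \<Sum>f\<in>{f \<in> I \<rightarrow>\<^sub>E A. f \<notin> I \<rightarrow>\<^sub>E annA \<psi> I}. \<rho> ^ energy w I f \<psi>)
      \<le> real (card T) ^ L * (real N ^ L * ((1 + u) ^ L - 1))" .
  have "(\<Sum>\<psi>\<in>?S. \<Sum>f\<in>{f \<in> I \<rightarrow>\<^sub>E A. f \<notin> I \<rightarrow>\<^sub>E annA \<psi> I}. \<rho> ^ energy w I f \<psi>) \<le> real N ^ L * ((1 + u) ^ L - 1)"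
  proof (cases "real (card T) ^ L > 0")
    case True
    then show ?thesis using le by (rule mult_left_le_imp_le[rotated])
  next
    case False
    \<comment> \<open>With \<open>T\<close> empty and \<open>I\<close> nonempty no \<psi> takes its
      values in \<open>T\<close>, so the outer sum is empty.\<close>
    then have "L > 0" "T = {}" using finT by (auto simp: card_gt_0_iff zero_less_power_eq)
    then have "I \<noteq> {}" by (auto simp: L_def)
    with \<open>T = {}\<close> have S: "?S = {}" by auto
    show ?thesis unfolding S sum.empty using b0 by simp
  qed
  then show ?thesis
    unfolding weight_eq_sum_sum[OF I] L_def[symmetric] u_def[symmetric] using N_pos
    by (simp add: divide_le_eq mult.commute)
qed

text \<open>Fixing the two annihilators \<open>H\<close> and \<open>K\<close> confines
  \<open>f\<close> to \<open>K'\<close> and \<psi> to \<open>H'\<close>. If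
  \<open>card K' * card H'\<close> reached \<open>N\<close>, the bounds for \<open>(H, H')\<close>
  and \<open>(K', K)\<close> would force \<open>H' = K\<close> and \<open>K' = H\<close>, making the
  configuration ground. The product is an integer, so it drops to \<open>N - 1\<close>.\<close>

lemma weight_inside:
  assumes I: "finite I" and w: "\<And>i j. i \<in> I \<Longrightarrow> j \<in> I \<Longrightarrow> i \<le> j + w"
  shows "weight w I (\<lambda>f \<psi>. (annA \<psi> I = H \<and> annX f I = K) \<and> orthogonal I f \<psi> \<and> \<not> ground I f \<psi>)
    \<le> ((real N - 1) / real N) ^ card I"
proof -
  let ?C = "{(f, \<psi>). f \<in> I \<rightarrow>\<^sub>E A \<and> \<psi> \<in> I \<rightarrow>\<^sub>E X \<and> (annA \<psi> I = H \<and> annX f I = K) \<and> orthogonal I f \<psi> \<and> \<not> ground I f \<psi>}"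
  define H' where "H' = {t \<in> X. \<forall>a\<in>H. perp a t}"
  define K' where "K' = {a \<in> A. \<forall>t\<in>K. perp a t}"
  have fin: "finite H'" "finite K'" using finite_X finite_A by (auto simp: H'_def K'_def)
  have "(\<Sum>(f, \<psi>) \<in> ?C. \<rho> ^ energy w I f \<psi>) \<le> (\<Sum>(f, \<psi>) \<in> ?C. 1)"
    using rho_pos rho_less_1 by (intro sum_mono) (auto intro!: power_le_one)
  also have "\<dots> = real (card ?C)" by (simp add: case_prod_unfold)
  also have "\<dots> \<le> (real N - 1) ^ card I"
  proof (cases "?C = {}")
    case True
    show ?thesis unfolding True card.empty using N_pos by simp
  next
    case False
    then obtain f \<psi> where f: "f \<in> I \<rightarrow>\<^sub>E A" "\<psi> \<in> I \<rightarrow>\<^sub>E X" and HK: "H = annA \<psi> I" "K = annX f I"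
      and orth: "orthogonal I f \<psi>" and ng: "\<not> ground I f \<psi>" by auto
    have "card K' * card H' \<le> N - 1"
    proof (rule ccontr)
      assume "\<not> ?thesis"
      then have ge: "N \<le> card K' * card H'" by simp
      have HH': "card H * card H' \<le> N" by (rule card_perp) (auto simp: HK annA_def H'_def)
      have KK': "card K' * card K \<le> N" by (rule card_perp) (auto simp: HK annX_def K'_def)
      have HK': "H \<subseteq> K'" if "H' = K"
        using that by (auto simp: HK annA_def H'_def K'_def)
      have sub: "H' \<subseteq> K" using f orth by (auto simp: H'_def HK annX_def annA_def orthogonal_def PiE_iff)
      have K'pos: "card K' > 0" using ge N_pos by (metis less_le_trans mult_0 not_gr_zero not_less0)
      have "card K' * card K \<le> card K' * card H'" using KK' ge by (rule order_trans)
      then have "card K \<le> card H'" using K'pos by simp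
      then have eq: "H' = K" using sub finite_annX[of f I] by (simp add: HK card_seteq)
      have "K' \<subseteq> H"
        using f orth unfolding eq[symmetric] K'_def H'_def HK annA_def orthogonal_def by (auto simp: PiE_iff)
      then have "K' = H" using HK'[OF eq] by simp
      then have "card H * card K = N" using ge HH' eq by simp
      moreover have "\<forall>a\<in>H. \<forall>t\<in>K. perp a t" unfolding eq[symmetric] by (auto simp: H'_def)
      ultimately show False using ng orth by (simp add: ground_def HK)
    qed
    then have le: "real (card K' * card H') \<le> real N - 1"
      using N_pos by linarith
    have "?C \<subseteq> (I \<rightarrow>\<^sub>E K') \<times> (I \<rightarrow>\<^sub>E H')"
      by (auto simp: PiE_iff K'_def H'_def annA_def annX_def intro: extensional_arb)
    then have "card ?C \<le> card ((I \<rightarrow>\<^sub>E K') \<times> (I \<rightarrow>\<^sub>E H'))"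
      using I fin by (intro card_mono finite_cartesian_product finite_PiE) auto
    also have "\<dots> = (card K' * card H') ^ card I"
      using I by (simp add: card_PiE power_mult_distrib card_cartesian_product)
    finally have "real (card ?C) \<le> real (card K' * card H') ^ card I"
      by (simp only: of_nat_power[symmetric] of_nat_le_iff)
    also have "\<dots> \<le> (real N - 1) ^ card I" using le by (intro power_mono) auto
    finally show ?thesis .
  qed
  finally show ?thesis
    unfolding weight_def using N_pos by (simp add: power_divide divide_right_mono)
qed


text \<open>Three ways to miss the ground state: \<psi> has an exception; it has none but
  \<open>f\<close> leaves \<open>annA \<psi> I\<close>; or \<open>f\<close> and \<psi> are
  orthogonal without being extremal. Unions over the possible \<open>T\<close> and
  \<open>(H, K)\<close> give the factors \<open>2 ^ N\<close> and \<open>4 ^ N\<close>.\<close>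

lemma weight_nonground_le:
  assumes I: "finite I" "I \<noteq> {}" and w: "\<And>i j. i \<in> I \<Longrightarrow> j \<in> I \<Longrightarrow> i \<le> j + w"
    and x: "0 < x" "x \<le> 1" and \<kappa>: "0 \<le> \<kappa>" "real N * \<kappa> < 1"
  shows "weight w I (\<lambda>f \<psi>. \<not> ground I f \<psi>)
    \<le> 2 ^ N * (x powr (- real N * \<kappa>) * (1 + x * real N) * (1 - (1 - \<rho>) / real N + real N * (\<rho> powr \<kappa>) ^ card I)) ^ card I
      + 2 ^ N * ((1 + real N * (\<rho> powr \<kappa>) ^ card I) ^ card I - 1)
      + 4 ^ N * ((real N - 1) / real N) ^ card I"
proof -
  let ?P1 = "\<lambda>f \<psi>. \<exists>T\<in>Pow X. smallX \<kappa> I \<psi> = T \<and> (\<exists>j\<in>I. \<psi> j \<notin> T)"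
  let ?P2 = "\<lambda>f \<psi>. \<exists>T\<in>Pow X. (smallX \<kappa> I \<psi> = T \<and> (\<forall>j\<in>I. \<psi> j \<in> T)) \<and> f \<notin> I \<rightarrow>\<^sub>E annA \<psi> I"
  let ?P3 = "\<lambda>f \<psi>. \<exists>\<tau>\<in>Pow A \<times> Pow X. (annA \<psi> I = fst \<tau> \<and> annX f I = snd \<tau>) \<and> orthogonal I f \<psi> \<and> \<not> ground I f \<psi>"
  have "weight w I (\<lambda>f \<psi>. \<not> ground I f \<psi>) \<le> weight w I (\<lambda>f \<psi>. ?P1 f \<psi> \<or> (?P2 f \<psi> \<or> ?P3 f \<psi>))"
  proof (rule weight_mono[OF I(1)])
    fix f \<psi> assume f: "f \<in> I \<rightarrow>\<^sub>E A" "\<psi> \<in> I \<rightarrow>\<^sub>E X" and ng: "\<not> ground I f \<psi>"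
    have T: "smallX \<kappa> I \<psi> \<in> Pow X" by (auto simp: smallX_def)
    show "?P1 f \<psi> \<or> (?P2 f \<psi> \<or> ?P3 f \<psi>)"
    proof (cases "f \<in> I \<rightarrow>\<^sub>E annA \<psi> I")
      case True
      then have "orthogonal I f \<psi>" by (auto simp: orthogonal_def annA_def PiE_iff)
      then have "?P3 f \<psi>" using ng annA_subset annX_subset by (intro bexI[of _ "(annA \<psi> I, annX f I)"]) auto
      then show ?thesis by blast
    next
      case False
      then show ?thesis using T by blast
    qed
  qed
  also have "\<dots> \<le> weight w I ?P1 + weight w I (\<lambda>f \<psi>. ?P2 f \<psi> \<or> ?P3 f \<psi>)" by (rule weight_disj[OF I(1)])
  also have "\<dots> \<le> weight w I ?P1 + (weight w I ?P2 + weight w I ?P3)"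
    by (intro add_left_mono weight_disj[OF I(1)])
  also have "weight w I ?P1 \<le> (\<Sum>T\<in>Pow X. (x powr (- real N * \<kappa>) * (1 + x * real N) * (1 - (1 - \<rho>) / real N + real N * (\<rho> powr \<kappa>) ^ card I)) ^ card I)"
    by (rule order_trans[OF weight_Bex[OF I(1)] sum_mono[OF weight_exceptional[OF I w _ x \<kappa>]]])
      (simp_all add: finite_X)
  also have "weight w I ?P2 \<le> (\<Sum>T\<in>Pow X. (1 + real N * (\<rho> powr \<kappa>) ^ card I) ^ card I - 1)"
    by (rule order_trans[OF weight_Bex[OF I(1)] sum_mono[OF weight_outside[OF I(1) w _ \<kappa>(1)]]])
      (simp_all add: finite_X)
  also have "weight w I ?P3 \<le> (\<Sum>\<tau>\<in>Pow A \<times> Pow X. ((real N - 1) / real N) ^ card I)"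
    by (rule order_trans[OF weight_Bex[OF I(1)] sum_mono[OF weight_inside[OF I(1) w]]])
      (simp_all add: finite_X finite_A)
  finally show ?thesis
    by (simp add: card_Pow finite_X finite_A card_A card_X card_cartesian_product power_mult_distrib[symmetric])
qed

lemma exponential_beats_linear:
  fixes a b C :: real
  assumes "0 \<le> a" "a < b"
  shows "eventually (\<lambda>n. C * (1 + real n) * a ^ n \<le> b ^ n) sequentially"
proof -
  have b: "b > 0" using assms by simp
  have ab: "\<bar>a / b\<bar> < 1" using assms by simp
  have "(\<lambda>n. C * ((a / b) ^ n + real n * (a / b) ^ n)) \<longlonglongrightarrow> C * (0 + 0)"
    using ab powser_times_n_limit_0[of "a / b"]
    by (intro tendsto_intros LIMSEQ_abs_realpow_zero2) auto
  then have "eventually (\<lambda>n. C * ((a / b) ^ n + real n * (a / b) ^ n) < 1) sequentially"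
    by (rule order_tendstoD) simp
  then show ?thesis
  proof eventually_elim
    case (elim n)
    have "C * (1 + real n) * a ^ n = C * ((a / b) ^ n + real n * (a / b) ^ n) * b ^ n"
      using b by (simp add: power_divide field_simps)
    also have "\<dots> \<le> 1 * b ^ n" using elim b by (intro mult_right_mono) auto
    finally show ?case by simp
  qed
qed

text \<open>The order of choice matters: \<open>x\<close> is fixed so that \<open>1 + x * N\<close>
  uses up only half of the gap below 1, and then \<open>x powr (- N * \<kappa>)\<close> tends to 1
  as \<kappa> tends to 0.\<close>

lemma ex_parameters:
  obtains x \<kappa> :: real where "0 < x" "x \<le> 1" "0 < \<kappa>" "real N * \<kappa> < 1"
    "x powr (- real N * \<kappa>) * (1 + x * real N) * (1 - (1 - \<rho>) / real N) < 1"
proof -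
  define \<beta> where "\<beta> = 1 - (1 - \<rho>) / real N"
  have N1: "real N \<ge> 1" using N_pos by simp
  have \<beta>: "0 < \<beta>" "\<beta> < 1"
    using N1 rho_pos rho_less_1 by (auto simp: \<beta>_def field_simps)
  define c where "c = (1 + \<beta>) / 2"
  have c: "\<beta> < c" "c < 1" using \<beta> by (auto simp: c_def)
  define x where "x = min 1 ((c / \<beta> - 1) / real N)"
  have x: "0 < x" "x \<le> 1" using c \<beta> N_pos by (auto simp: x_def)
  have "x * real N \<le> c / \<beta> - 1" using N_pos unfolding x_def by (simp add: min_def field_simps)
  then have xc: "(1 + x * real N) * \<beta> \<le> c" using \<beta> by (simp add: field_simps)
  have "((\<lambda>\<kappa>. x powr (- real N * \<kappa>) * c) \<longlongrightarrow> x powr (- real N * 0) * c) (at_right 0)"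
    using x by (intro tendsto_intros) auto
  then have e1: "eventually (\<lambda>\<kappa>. x powr (- real N * \<kappa>) * c < 1) (at_right 0)"
    using c x by (intro order_tendstoD(2)) auto
  have "((\<lambda>\<kappa>. real N * \<kappa>) \<longlongrightarrow> real N * 0) (at_right 0)" by (intro tendsto_intros)
  then have e2: "eventually (\<lambda>\<kappa>. real N * \<kappa> < 1) (at_right 0)" by (rule order_tendstoD) simp
  have e3: "eventually (\<lambda>\<kappa>::real. 0 < \<kappa>) (at_right 0)" by (simp add: eventually_at_right_less)
  from eventually_happens'[OF _ eventually_conj[OF e1 eventually_conj[OF e2 e3]]]
  obtain \<kappa> where k: "x powr (- real N * \<kappa>) * c < 1" "real N * \<kappa> < 1" "0 < \<kappa>" by auto
  have "x powr (- real N * \<kappa>) * ((1 + x * real N) * \<beta>) \<le> x powr (- real N * \<kappa>) * c"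
    using xc by (intro mult_left_mono) auto
  then show ?thesis using that[OF x k(3,2)] k(1) by (simp add: \<beta>_def mult.assoc)
qed

text \<open>The constants depend on the pairing and on \<rho> only, so the bound holds for windows
  at every position and for every \<open>n\<close>.\<close>

lemma weight_nonground_small:
  obtains \<theta> L0 where "0 < \<theta>" "\<theta> < 1"
    "\<And>I w. finite I \<Longrightarrow> card I \<ge> L0 \<Longrightarrow> (\<And>i j. i \<in> I \<Longrightarrow> j \<in> I \<Longrightarrow> i \<le> j + w) \<Longrightarrow>
       weight w I (\<lambda>f \<psi>. \<not> ground I f \<psi>) \<le> \<theta> ^ card I"
proof -
  obtain x \<kappa> where x: "0 < x" "x \<le> 1" and \<kappa>: "0 < \<kappa>" "real N * \<kappa> < 1"
    and lt: "x powr (- real N * \<kappa>) * (1 + x * real N) * (1 - (1 - \<rho>) / real N) < 1"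
    using ex_parameters by metis
  define \<sigma> where "\<sigma> = \<rho> powr \<kappa>"
  have \<sigma>: "0 < \<sigma>" "\<sigma> < 1"
    using rho_pos rho_less_1 \<kappa> powr_less_mono2[of \<kappa> \<rho> 1] by (auto simp: \<sigma>_def)
  define a where "a = x powr (- real N * \<kappa>) * (1 + x * real N)"
  define \<beta> where "\<beta> = 1 - (1 - \<rho>) / real N"
  define \<alpha> where "\<alpha> = max 0 ((1 + a * \<beta>) / 2)"
  have a0: "a \<ge> 0" using x by (auto simp: a_def)
  have \<beta>0: "\<beta> \<ge> 0" using N_pos rho_pos rho_less_1 by (auto simp: \<beta>_def field_simps)
  have "a * \<beta> < 1" using lt by (simp add: a_def \<beta>_def)
  then have \<alpha>: "a * \<beta> < \<alpha>" "\<alpha> < 1" "0 \<le> \<alpha>" by (auto simp: \<alpha>_def max_def mult.commute)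
  define \<nu> where "\<nu> = (real N - 1) / real N"
  have \<nu>: "0 \<le> \<nu>" "\<nu> < 1" using N_pos by (auto simp: \<nu>_def)
  define \<theta>0 where "\<theta>0 = max \<alpha> (max \<nu> \<sigma>)"
  have \<theta>0: "0 \<le> \<theta>0" "\<theta>0 < 1" "\<alpha> \<le> \<theta>0" "\<nu> \<le> \<theta>0" "\<sigma> \<le> \<theta>0" using \<alpha> \<nu> \<sigma> by (auto simp: \<theta>0_def)
  define \<theta> where "\<theta> = (1 + \<theta>0) / 2"
  have \<theta>: "\<theta>0 < \<theta>" "\<theta> < 1" "0 < \<theta>" using \<theta>0 by (auto simp: \<theta>_def)
  define C :: real where "C = 2 ^ N + 2 ^ N * (2 * real N) + 4 ^ N"
  have s1: "\<bar>\<sigma>\<bar> < 1" using \<sigma> by simp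
  have "(\<lambda>n. a * (\<beta> + real N * \<sigma> ^ n)) \<longlonglongrightarrow> a * (\<beta> + real N * 0)"
    using s1 by (intro tendsto_intros LIMSEQ_abs_realpow_zero2)
  then have ev1: "eventually (\<lambda>n. a * (\<beta> + real N * \<sigma> ^ n) < \<alpha>) sequentially"
    using \<alpha> by (intro order_tendstoD(2)) auto
  have "(\<lambda>n. real N * (real n * \<sigma> ^ n)) \<longlonglongrightarrow> real N * 0"
    using s1 by (intro tendsto_intros powser_times_n_limit_0) auto
  then have ev2: "eventually (\<lambda>n. real N * (real n * \<sigma> ^ n) < 1) sequentially"
    by (rule order_tendstoD) simp
  have ev3: "eventually (\<lambda>n. C * (1 + real n) * \<theta>0 ^ n \<le> \<theta> ^ n) sequentially"
    by (rule exponential_beats_linear[OF \<theta>0(1) \<theta>(1)])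
  have "eventually (\<lambda>n. 2 ^ N * (a * (\<beta> + real N * \<sigma> ^ n)) ^ n + 2 ^ N * ((1 + real N * \<sigma> ^ n) ^ n - 1) + 4 ^ N * \<nu> ^ n \<le> \<theta> ^ n) sequentially"
    using ev1 ev2 ev3
  proof eventually_elim
    case (elim n)
    have p1: "(a * (\<beta> + real N * \<sigma> ^ n)) ^ n \<le> \<theta>0 ^ n"
      using elim(1) \<theta>0 a0 \<beta>0 \<sigma> by (intro power_mono mult_nonneg_nonneg) (auto intro!: add_nonneg_nonneg)
    have p3: "\<nu> ^ n \<le> \<theta>0 ^ n" using \<nu> \<theta>0 by (intro power_mono) auto
    \<comment> \<open>The power is at most \<open>exp u\<close>, and
      \<open>exp u \<le> 1 + 2 * u\<close> for \<open>u\<close> in the unit interval; subtracting 1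
      leaves a term linear in \<open>u\<close>.\<close>
    define u where "u = real n * (real N * \<sigma> ^ n)"
    have u: "0 \<le> u" "u \<le> 1" using elim(2) \<sigma> by (auto simp: u_def mult_ac)
    have "(1 + real N * \<sigma> ^ n) ^ n \<le> exp (real N * \<sigma> ^ n) ^ n"
      using \<sigma> by (intro power_mono exp_ge_add_one_self) auto
    also have "\<dots> = exp u" by (simp add: u_def exp_of_nat_mult)
    also have "\<dots> \<le> 1 + u + u\<^sup>2" using u by (rule exp_bound)
    also have "\<dots> \<le> 1 + 2 * u" using u by (simp add: power2_eq_square mult_left_le)
    finally have "(1 + real N * \<sigma> ^ n) ^ n - 1 \<le> 2 * real N * real n * \<sigma> ^ n" by (simp add: u_def mult_ac)
    also have "\<dots> \<le> 2 * real N * real n * \<theta>0 ^ n"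
      using \<sigma> \<theta>0 by (intro mult_left_mono power_mono) auto
    finally have p2: "(1 + real N * \<sigma> ^ n) ^ n - 1 \<le> 2 * real N * real n * \<theta>0 ^ n" .
    have "2 ^ N * (a * (\<beta> + real N * \<sigma> ^ n)) ^ n + 2 ^ N * ((1 + real N * \<sigma> ^ n) ^ n - 1) + 4 ^ N * \<nu> ^ n
        \<le> 2 ^ N * \<theta>0 ^ n + 2 ^ N * (2 * real N * real n * \<theta>0 ^ n) + 4 ^ N * \<theta>0 ^ n"
      using p1 p2 p3 by (intro add_mono mult_left_mono) auto
    also have "\<dots> \<le> C * (1 + real n) * \<theta>0 ^ n"
    proof -
      have "0 \<le> (2 ^ N * real n + 4 ^ N * real n + 2 ^ N * (2 * real N)) * \<theta>0 ^ n" using \<theta>0 by auto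
      then show ?thesis by (simp add: C_def algebra_simps)
    qed
    finally show ?case using elim(3) by linarith
  qed
  then obtain L1 where L1: "\<And>n. n \<ge> L1 \<Longrightarrow> 2 ^ N * (a * (\<beta> + real N * \<sigma> ^ n)) ^ n + 2 ^ N * ((1 + real N * \<sigma> ^ n) ^ n - 1) + 4 ^ N * \<nu> ^ n \<le> \<theta> ^ n"
    by (auto simp: eventually_sequentially)
  show ?thesis
  proof (rule that[of \<theta> "max L1 1", OF \<theta>(3,2)])
    fix I :: "nat set" and w assume I: "finite I" "card I \<ge> max L1 1" and w: "\<And>i j. i \<in> I \<Longrightarrow> j \<in> I \<Longrightarrow> i \<le> j + w"
    then have "I \<noteq> {}" by auto
    from order_trans[OF weight_nonground_le[OF I(1) this w x less_imp_le[OF \<kappa>(1)] \<kappa>(2), folded \<sigma>_def \<beta>_def \<nu>_def a_def] L1[of "card I"]] I(2)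
    show "weight w I (\<lambda>f \<psi>. \<not> ground I f \<psi>) \<le> \<theta> ^ card I" by auto
  qed
qed

section \<open>Chaining windows through the type of their ground configuration\<close>

definition gtypes :: "('a set \<times> 'b set) set" where
  "gtypes = {(H, K). H \<subseteq> A \<and> K \<subseteq> X \<and> (\<forall>a\<in>H. \<forall>t\<in>K. perp a t) \<and> card H * card K = N}"

text \<open>The type is the pair of annihilators; since a ground configuration is extremal, it is
  determined by either half and can be compared between windows.\<close>

definition gtype :: "'a set \<times> 'b set \<Rightarrow> nat set \<Rightarrow> (nat \<Rightarrow> 'a) \<Rightarrow> (nat \<Rightarrow> 'b) \<Rightarrow> bool" where
  "gtype \<tau> I f \<psi> \<longleftrightarrow> ground I f \<psi> \<and> annA \<psi> I = fst \<tau> \<and> annX f I = snd \<tau>"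

definition inside :: "'a set \<times> 'b set \<Rightarrow> nat set \<Rightarrow> (nat \<Rightarrow> 'a) \<Rightarrow> (nat \<Rightarrow> 'b) \<Rightarrow> bool" where
  "inside \<tau> I f \<psi> \<longleftrightarrow> (\<forall>i\<in>I. f i \<in> fst \<tau> \<and> \<psi> i \<in> snd \<tau>)"

lemma finite_gtypes: "finite gtypes"
  by (rule finite_subset[of _ "Pow A \<times> Pow X"]) (auto simp: gtypes_def finite_A finite_X)

lemma annX_restrict: "annX (restrict f I) I = annX f I"
  by (auto simp: annX_def)

lemma annA_restrict: "annA (restrict \<psi> I) I = annA \<psi> I"
  by (auto simp: annA_def)

lemma ground_restrict: "ground I (restrict f I) (restrict \<psi> I) \<longleftrightarrow> ground I f \<psi>"
  by (auto simp: ground_def annX_restrict annA_restrict orthogonal_def)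

lemma gtype_restrict: "gtype \<tau> I (restrict f I) (restrict \<psi> I) \<longleftrightarrow> gtype \<tau> I f \<psi>"
  by (simp add: gtype_def ground_restrict annX_restrict annA_restrict)

lemma inside_restrict: "J \<subseteq> I \<Longrightarrow> inside \<tau> J (restrict f I) (restrict \<psi> I) \<longleftrightarrow> inside \<tau> J f \<psi>"
  by (auto simp: inside_def)

lemma gtype_restrict': "J \<subseteq> I \<Longrightarrow> gtype \<tau> J (restrict f I) (restrict \<psi> I) \<longleftrightarrow> gtype \<tau> J f \<psi>"
  using gtype_restrict[of \<tau> J "restrict f I" "restrict \<psi> I"] gtype_restrict[of \<tau> J f \<psi>]
  by (simp add: Int_absorb1)

lemma ground_imp_gtype:
  assumes "ground I f \<psi>"
  shows "\<exists>\<tau>\<in>gtypes. gtype \<tau> I f \<psi>"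
  using assms annA_subset annX_subset
  by (intro bexI[of _ "(annA \<psi> I, annX f I)"]) (auto simp: gtype_def gtypes_def ground_def)

lemma gtype_imp_inside:
  assumes "gtype \<tau> I f \<psi>" "f \<in> I \<rightarrow> A" "\<psi> \<in> I \<rightarrow> X"
  shows "inside \<tau> I f \<psi>"
proof -
  have "orthogonal I f \<psi>" and \<tau>: "fst \<tau> = annA \<psi> I" "snd \<tau> = annX f I"
    using assms(1) by (simp_all add: gtype_def ground_def)
  then show ?thesis
    using assms(2,3) unfolding inside_def \<tau> by (auto simp: orthogonal_def annA_def annX_def Pi_iff)
qed

text \<open>There are at most \<open>(card H * card K) ^ card I = N ^ card I\<close> such
  configurations, each of weight at most 1 before normalisation.\<close>

lemma weight_inside_le:
  assumes "finite I" "\<tau> \<in> gtypes"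
  shows "weight w I (inside \<tau> I) \<le> 1"
proof -
  let ?C = "{(f, \<psi>). f \<in> I \<rightarrow>\<^sub>E A \<and> \<psi> \<in> I \<rightarrow>\<^sub>E X \<and> inside \<tau> I f \<psi>}"
  obtain H K where \<tau>: "\<tau> = (H, K)" "H \<subseteq> A" "K \<subseteq> X" "card H * card K = N"
    using assms by (auto simp: gtypes_def)
  have fin: "finite H" "finite K" using \<tau> finite_A finite_X finite_subset by auto
  have "(\<Sum>(f, \<psi>) \<in> ?C. \<rho> ^ energy w I f \<psi>) \<le> (\<Sum>(f, \<psi>) \<in> ?C. 1)"
    using rho_pos rho_less_1 by (intro sum_mono) (auto intro!: power_le_one)
  also have "\<dots> = real (card ?C)" by (simp add: case_prod_unfold)
  also have "card ?C \<le> card ((I \<rightarrow>\<^sub>E H) \<times> (I \<rightarrow>\<^sub>E K))"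
    using assms fin by (intro card_mono finite_cartesian_product finite_PiE) (auto simp: PiE_iff inside_def \<tau> intro: extensional_arb)
  also have "\<dots> = N ^ card I"
    using assms \<tau> by (simp add: card_PiE power_mult_distrib[symmetric] card_cartesian_product)
  finally show ?thesis unfolding weight_def using N_pos by simp
qed

lemma weight_gtype_le:
  assumes "finite I" "\<tau> \<in> gtypes"
  shows "weight w I (gtype \<tau> I) \<le> 1"
proof (rule order_trans[OF weight_mono[OF assms(1)] weight_inside_le[OF assms]])
  fix f \<psi> assume "f \<in> I \<rightarrow>\<^sub>E A" "\<psi> \<in> I \<rightarrow>\<^sub>E X" "gtype \<tau> I f \<psi>"
  then show "inside \<tau> I f \<psi>" by (intro gtype_imp_inside) (auto simp: PiE_def)
qed

text \<open>Orthogonality across \<open>I\<close> and \<open>J\<close> puts the values on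
  \<open>J\<close> into the type of \<open>I\<close>, so the annihilators over \<open>J\<close>
  contain those over \<open>I\<close>. Both pairs have sizes with product \<open>N\<close>, which
  turns the inclusions into equalities.\<close>

lemma gtype_propagates:
  assumes "gtype \<tau> I f \<psi>" "ground J f \<psi>" "orthogonal (I \<union> J) f \<psi>" "f \<in> J \<rightarrow> A" "\<psi> \<in> J \<rightarrow> X"
  shows "gtype \<tau> J f \<psi>"
proof -
  let ?H = "annA \<psi> I" and ?K = "annX f I"
  have g: "ground I f \<psi>" and \<tau>: "fst \<tau> = ?H" "snd \<tau> = ?K" using assms(1) by (auto simp: gtype_def)
  have f: "f i \<in> ?H" "\<psi> i \<in> ?K" if "i \<in> J" for i
    using assms(3-5) that by (auto simp: orthogonal_def annA_def annX_def Pi_iff)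
  have perp: "perp a t" if "a \<in> ?H" "t \<in> ?K" for a t using g that by (auto simp: ground_def)
  have HH: "?H \<subseteq> annA \<psi> J" "?K \<subseteq> annX f J"
    using perp f annA_subset[of \<psi> I] annX_subset[of f I] by (auto simp: annA_def[of \<psi> J] annX_def[of f J])
  have eqN: "card ?H * card ?K = N" "card (annA \<psi> J) * card (annX f J) = N"
    using g assms(2) by (auto simp: ground_def)
  have le: "card ?H \<le> card (annA \<psi> J)" "card ?K \<le> card (annX f J)"
    using HH finite_annA finite_annX by (auto intro: card_mono)
  have pos: "card ?H > 0" "card ?K > 0" using eqN N_pos by (auto intro!: Nat.gr0I)
  have "card (annA \<psi> J) \<le> card ?H"
  proof (rule ccontr)
    assume "\<not> ?thesis"
    then have "card ?H * card ?K < card (annA \<psi> J) * card ?K" using pos by simp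
    also have "\<dots> \<le> card (annA \<psi> J) * card (annX f J)" using le by simp
    finally show False using eqN by simp
  qed
  moreover have "card (annX f J) \<le> card ?K"
  proof (rule ccontr)
    assume "\<not> ?thesis"
    then have "card ?H * card ?K < card ?H * card (annX f J)" using pos by simp
    also have "\<dots> \<le> card (annA \<psi> J) * card (annX f J)" using le by simp
    finally show False using eqN by simp
  qed
  ultimately have "?H = annA \<psi> J" "?K = annX f J"
    using card_seteq[OF finite_annA HH(1)] card_seteq[OF finite_annX HH(2)] by blast+
  then show ?thesis using assms(2) \<tau> by (simp add: gtype_def)
qed


text \<open>A change of type leaves two possibilities: \<open>J\<close> is not ground, where the
  factor of \<open>I\<close> is at most 1, or the joint window is not ground. Each costs at most
  \<eta>.\<close>

lemma weight_gtype_changes: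
  assumes fin: "finite I" "finite J" "I \<inter> J = {}" and \<tau>: "\<tau> \<in> gtypes"
    and I: "weight w I (\<lambda>f \<psi>. \<not> ground I f \<psi>) \<le> \<eta>" "weight w J (\<lambda>f \<psi>. \<not> ground J f \<psi>) \<le> \<eta>"
      "weight w (I \<union> J) (\<lambda>f \<psi>. \<not> ground (I \<union> J) f \<psi>) \<le> \<eta>"
  shows "weight w (I \<union> J) (\<lambda>f \<psi>. gtype \<tau> I f \<psi> \<and> \<not> gtype \<tau> J f \<psi>) \<le> 2 * \<eta>"
proof -
  have "weight w (I \<union> J) (\<lambda>f \<psi>. gtype \<tau> I f \<psi> \<and> \<not> gtype \<tau> J f \<psi>)
      \<le> weight w (I \<union> J) (\<lambda>f \<psi>. (gtype \<tau> I f \<psi> \<and> \<not> ground J f \<psi>) \<or> \<not> ground (I \<union> J) f \<psi>)"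
  proof (rule weight_mono)
    fix f \<psi> assume "f \<in> I \<union> J \<rightarrow>\<^sub>E A" "\<psi> \<in> I \<union> J \<rightarrow>\<^sub>E X" "gtype \<tau> I f \<psi> \<and> \<not> gtype \<tau> J f \<psi>"
    then show "(gtype \<tau> I f \<psi> \<and> \<not> ground J f \<psi>) \<or> \<not> ground (I \<union> J) f \<psi>"
      using gtype_propagates[of \<tau> I f \<psi> J] by (auto simp: ground_def[of "I \<union> J"] PiE_iff)
  qed (use fin in auto)
  also have "\<dots> \<le> weight w (I \<union> J) (\<lambda>f \<psi>. gtype \<tau> I f \<psi> \<and> \<not> ground J f \<psi>) + weight w (I \<union> J) (\<lambda>f \<psi>. \<not> ground (I \<union> J) f \<psi>)"
    using fin by (intro weight_disj) auto
  also have "weight w (I \<union> J) (\<lambda>f \<psi>. gtype \<tau> I f \<psi> \<and> \<not> ground J f \<psi>) \<le> weight w I (gtype \<tau> I) * weight w J (\<lambda>f \<psi>. \<not> ground J f \<psi>)"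
    using fin by (intro weight_Un) (auto simp: gtype_restrict ground_restrict)
  also have "\<dots> \<le> 1 * \<eta>"
    using fin weight_gtype_le[OF fin(1) \<tau>] I weight_nonneg by (intro mult_mono) auto
  finally show ?thesis using I(3) by simp
qed

text \<open>A bound for the total weight: 1 for each type held throughout and 1 for everything
  else.\<close>

definition chain_const :: real where "chain_const = real (card gtypes) + 1"

context
  fixes l w n :: nat and \<eta> :: real
  assumes l: "l > 0" "3 * l \<le> w"
    and \<eta>: "\<And>I. finite I \<Longrightarrow> card I \<ge> l \<Longrightarrow> (\<And>i j. i \<in> I \<Longrightarrow> j \<in> I \<Longrightarrow> i \<le> j + w) \<Longrightarrow>
       weight w I (\<lambda>f \<psi>. \<not> ground I f \<psi>) \<le> \<eta>"
    and small: "\<eta> * (real (card gtypes) + 1) * (1 + 2 * real (card gtypes) * real n) \<le> 1"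
begin

lemma eta_nonneg: "0 \<le> \<eta>"
  by (rule order_trans[OF weight_nonneg \<eta>[of "{..<l}"]]) (use l in auto)

lemma chain_const_ge_1: "chain_const \<ge> 1" by (simp add: chain_const_def)

text \<open>The three bounds need one another: loss of a type uses the total weight of the shorter
  tail, absence of a common type uses the first bound for the first window, and the total weight is
  recovered from the second bound. Without the total weight in the induction, the constants would
  multiply along the windows.\<close>

lemma chain_bounds:
  assumes "a + l \<le> n"
  shows "(\<tau> \<in> gtypes \<longrightarrow> a + 2 * l \<le> n \<longrightarrow>
           weight w {a<..n} (\<lambda>f \<psi>. gtype \<tau> {a<..a + l} f \<psi> \<and> \<not> inside \<tau> {a + l<..n} f \<psi>) \<le> 2 * \<eta> * chain_const * real (n - a))
     \<and> weight w {a<..n} (\<lambda>f \<psi>. \<not> (\<exists>\<tau>\<in>gtypes. inside \<tau> {a<..n} f \<psi>)) \<le> \<eta> * chain_const * (1 + 2 * real (card gtypes) * real (n - a))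
     \<and> weight w {a<..n} (\<lambda>f \<psi>. True) \<le> chain_const"
  using assms
proof (induction "n - a" arbitrary: a \<tau> rule: less_induct)
  case less
  let ?t = "real (card gtypes)"
  let ?I = "{a<..a + l}"
  have \<eta>0: "\<eta> \<ge> 0" by (rule eta_nonneg)
  have C1: "chain_const \<ge> 1" by (rule chain_const_ge_1)
  have \<eta>C: "\<eta> \<le> \<eta> * chain_const" using mult_left_mono[OF C1 \<eta>0] by simp
  have I\<eta>: "weight w ?I (\<lambda>f \<psi>. \<not> ground ?I f \<psi>) \<le> \<eta>"
    using l by (intro \<eta>) auto
  have Y: "weight w {a<..n} (\<lambda>f \<psi>. gtype \<tau> ?I f \<psi> \<and> \<not> inside \<tau> {a + l<..n} f \<psi>) \<le> 2 * \<eta> * chain_const * real (n - a)"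
    if \<tau>: "\<tau> \<in> gtypes" and a2: "a + 2 * l \<le> n" for \<tau>
  proof (cases "a + 3 * l \<le> n")
    \<comment> \<open>Fewer than \<open>3 * l\<close> indices remain, so they all form one window of
      width at most \<open>w\<close>; the last piece may be longer than \<open>l\<close>.\<close>
    case False
    let ?J = "{a + l<..n}"
    have IJ: "?I \<union> ?J = {a<..n}" "?I \<inter> ?J = {}" using a2 l by auto
    have "weight w {a<..n} (\<lambda>f \<psi>. gtype \<tau> ?I f \<psi> \<and> \<not> inside \<tau> ?J f \<psi>)
        \<le> weight w {a<..n} (\<lambda>f \<psi>. gtype \<tau> ?I f \<psi> \<and> \<not> gtype \<tau> ?J f \<psi>)"
    proof (rule weight_mono)
      fix f \<psi> assume *: "f \<in> {a<..n} \<rightarrow>\<^sub>E A" "\<psi> \<in> {a<..n} \<rightarrow>\<^sub>E X" "gtype \<tau> ?I f \<psi> \<and> \<not> inside \<tau> ?J f \<psi>"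
      have "f \<in> ?J \<rightarrow> A" "\<psi> \<in> ?J \<rightarrow> X" using * by (auto simp: PiE_iff)
      then show "gtype \<tau> ?I f \<psi> \<and> \<not> gtype \<tau> ?J f \<psi>" using * gtype_imp_inside by blast
    qed auto
    also have "\<dots> \<le> 2 * \<eta>"
      unfolding IJ(1)[symmetric] using False a2 l
      by (intro weight_gtype_changes[OF _ _ IJ(2) \<tau>] \<eta>) (auto simp: card_Un_disjoint[OF _ _ IJ(2)])
    also have "\<dots> \<le> 2 * (\<eta> * chain_const) * 1" using \<eta>C by simp
    also have "\<dots> \<le> 2 * (\<eta> * chain_const) * real (n - a)"
      using \<eta>0 C1 a2 l by (intro mult_left_mono) auto
    finally show ?thesis by (simp add: mult.assoc)
  next
    case True
    let ?J = "{a + l<..a + 2 * l}" and ?R = "{a + 2 * l<..n}"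
    have sets: "{a<..n} = (?I \<union> ?J) \<union> ?R" "(?I \<union> ?J) \<inter> ?R = {}" "?I \<inter> ?J = {}"
      "{a<..n} = ?I \<union> {a + l<..n}" "?I \<inter> {a + l<..n} = {}" "{a + l<..n} = ?J \<union> ?R"
      using True l by auto
    have IH1: "weight w ?R (\<lambda>f \<psi>. True) \<le> chain_const"
      using less.hyps[of "a + 2 * l"] True l by auto
    have IH2: "weight w {a + l<..n} (\<lambda>f \<psi>. gtype \<tau> ?J f \<psi> \<and> \<not> inside \<tau> ?R f \<psi>) \<le> 2 * \<eta> * chain_const * real (n - (a + l))"
    proof -
      have e: "a + l + l = a + 2 * l" by simp
      have "n - (a + l) < n - a" "a + 2 * l \<le> n" "a + l + 2 * l \<le> n" using True l by auto
      then show ?thesis using less.hyps[of "a + l" \<tau>, unfolded e] \<tau> by blast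
    qed
    have "weight w {a<..n} (\<lambda>f \<psi>. gtype \<tau> ?I f \<psi> \<and> \<not> inside \<tau> {a + l<..n} f \<psi>)
      \<le> weight w {a<..n} (\<lambda>f \<psi>. (gtype \<tau> ?I f \<psi> \<and> \<not> gtype \<tau> ?J f \<psi>) \<or> (gtype \<tau> ?I f \<psi> \<and> gtype \<tau> ?J f \<psi> \<and> \<not> inside \<tau> ?R f \<psi>))"
    proof (rule weight_mono)
      fix f \<psi> assume *: "f \<in> {a<..n} \<rightarrow>\<^sub>E A" "\<psi> \<in> {a<..n} \<rightarrow>\<^sub>E X" "gtype \<tau> ?I f \<psi> \<and> \<not> inside \<tau> {a + l<..n} f \<psi>"
      have "f \<in> ?J \<rightarrow> A" "\<psi> \<in> ?J \<rightarrow> X" using * True by (auto simp: PiE_iff)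
      then have "gtype \<tau> ?J f \<psi> \<Longrightarrow> inside \<tau> ?J f \<psi>" by (rule gtype_imp_inside[rotated])
      then show "(gtype \<tau> ?I f \<psi> \<and> \<not> gtype \<tau> ?J f \<psi>) \<or> (gtype \<tau> ?I f \<psi> \<and> gtype \<tau> ?J f \<psi> \<and> \<not> inside \<tau> ?R f \<psi>)"
        using * sets(6) by (auto simp: inside_def)
    qed auto
    also have "\<dots> \<le> weight w {a<..n} (\<lambda>f \<psi>. gtype \<tau> ?I f \<psi> \<and> \<not> gtype \<tau> ?J f \<psi>)
        + weight w {a<..n} (\<lambda>f \<psi>. gtype \<tau> ?I f \<psi> \<and> gtype \<tau> ?J f \<psi> \<and> \<not> inside \<tau> ?R f \<psi>)"
      by (rule weight_disj) auto
    \<comment> \<open>A first change of type is local to two windows; the rest is unconstrained and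
      costs only its total weight.\<close>
    also have "weight w {a<..n} (\<lambda>f \<psi>. gtype \<tau> ?I f \<psi> \<and> \<not> gtype \<tau> ?J f \<psi>) \<le>
        weight w (?I \<union> ?J) (\<lambda>f \<psi>. gtype \<tau> ?I f \<psi> \<and> \<not> gtype \<tau> ?J f \<psi>) * weight w ?R (\<lambda>f \<psi>. True)"
      unfolding sets(1) using sets(2) by (intro weight_Un) (auto simp: gtype_restrict')
    also have "\<dots> \<le> (2 * \<eta>) * chain_const"
      using l \<eta>0 IH1 weight_nonneg
      by (intro mult_mono weight_gtype_changes[OF _ _ sets(3) \<tau>] \<eta>) (auto simp: card_Un_disjoint[OF _ _ sets(3)])
    also have "weight w {a<..n} (\<lambda>f \<psi>. gtype \<tau> ?I f \<psi> \<and> gtype \<tau> ?J f \<psi> \<and> \<not> inside \<tau> ?R f \<psi>)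
        \<le> weight w ?I (gtype \<tau> ?I) * weight w {a + l<..n} (\<lambda>f \<psi>. gtype \<tau> ?J f \<psi> \<and> \<not> inside \<tau> ?R f \<psi>)"
    proof (subst sets(4), rule weight_Un[OF sets(5)])
      fix f \<psi> assume *: "gtype \<tau> ?I f \<psi> \<and> gtype \<tau> ?J f \<psi> \<and> \<not> inside \<tau> ?R f \<psi>"
      have "?J \<subseteq> {a + l<..n}" "?R \<subseteq> {a + l<..n}" using True by auto
      then show "gtype \<tau> ?I (restrict f ?I) (restrict \<psi> ?I) \<and>
         gtype \<tau> ?J (restrict f {a + l<..n}) (restrict \<psi> {a + l<..n}) \<and>
         \<not> inside \<tau> ?R (restrict f {a + l<..n}) (restrict \<psi> {a + l<..n})"
        using * by (simp add: gtype_restrict' inside_restrict)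
    qed auto
    also have "\<dots> \<le> 1 * (2 * \<eta> * chain_const * real (n - (a + l)))"
      using IH2 weight_gtype_le[OF _ \<tau>] weight_nonneg by (intro mult_mono) auto
    also have "2 * \<eta> * chain_const + 1 * (2 * \<eta> * chain_const * real (n - (a + l))) = 2 * \<eta> * chain_const * (1 + real (n - (a + l)))"
      by (simp add: algebra_simps)
    \<comment> \<open>One window consumes \<open>l \<ge> 1\<close> indices, which pays for the
      additional summand 1.\<close>
    also have "\<dots> \<le> 2 * \<eta> * chain_const * real (n - a)"
      using \<eta>0 C1 True l by (intro mult_left_mono) auto
    finally show ?thesis by simp
  qed
  have Z: "weight w {a<..n} (\<lambda>f \<psi>. \<not> (\<exists>\<tau>\<in>gtypes. inside \<tau> {a<..n} f \<psi>)) \<le> \<eta> * chain_const * (1 + 2 * ?t * real (n - a))"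
  proof (cases "a + 2 * l \<le> n")
    case False
    have "weight w {a<..n} (\<lambda>f \<psi>. \<not> (\<exists>\<tau>\<in>gtypes. inside \<tau> {a<..n} f \<psi>)) \<le> weight w {a<..n} (\<lambda>f \<psi>. \<not> ground {a<..n} f \<psi>)"
    proof (rule weight_mono)
      fix f \<psi> assume *: "f \<in> {a<..n} \<rightarrow>\<^sub>E A" "\<psi> \<in> {a<..n} \<rightarrow>\<^sub>E X" "\<not> (\<exists>\<tau>\<in>gtypes. inside \<tau> {a<..n} f \<psi>)"
      show "\<not> ground {a<..n} f \<psi>"
      proof
        assume "ground {a<..n} f \<psi>"
        then obtain \<tau> where "\<tau> \<in> gtypes" "gtype \<tau> {a<..n} f \<psi>" using ground_imp_gtype by blast
        moreover have "f \<in> {a<..n} \<rightarrow> A" "\<psi> \<in> {a<..n} \<rightarrow> X" using *(1,2) by (simp_all add: PiE_def)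
        ultimately show False using *(3) gtype_imp_inside by blast
      qed
    qed auto
    also have "\<dots> \<le> \<eta>" using False less.prems l by (intro \<eta>) auto
    also have "\<dots> \<le> \<eta> * chain_const * (1 + 2 * ?t * real (n - a))"
      using \<eta>C mult_left_mono[of 1 "1 + 2 * ?t * real (n - a)" "\<eta> * chain_const"] \<eta>0 C1 by auto
    finally show ?thesis .
  next
    case True
    have sets: "{a<..n} = ?I \<union> {a + l<..n}" "?I \<inter> {a + l<..n} = {}" using True by auto
    have IH1: "weight w {a + l<..n} (\<lambda>f \<psi>. True) \<le> chain_const"
      using less.hyps[of "a + l"] True l by auto
    have "weight w {a<..n} (\<lambda>f \<psi>. \<not> (\<exists>\<tau>\<in>gtypes. inside \<tau> {a<..n} f \<psi>))
       \<le> weight w {a<..n} (\<lambda>f \<psi>. \<not> ground ?I f \<psi> \<or> (\<exists>\<tau>\<in>gtypes. gtype \<tau> ?I f \<psi> \<and> \<not> inside \<tau> {a + l<..n} f \<psi>))"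
    proof (rule weight_mono)
      fix f \<psi> assume *: "f \<in> {a<..n} \<rightarrow>\<^sub>E A" "\<psi> \<in> {a<..n} \<rightarrow>\<^sub>E X" "\<not> (\<exists>\<tau>\<in>gtypes. inside \<tau> {a<..n} f \<psi>)"
      show "\<not> ground ?I f \<psi> \<or> (\<exists>\<tau>\<in>gtypes. gtype \<tau> ?I f \<psi> \<and> \<not> inside \<tau> {a + l<..n} f \<psi>)"
      proof (cases "ground ?I f \<psi>")
        case g: True
        then obtain \<tau> where \<tau>: "\<tau> \<in> gtypes" "gtype \<tau> ?I f \<psi>" using ground_imp_gtype by blast
        have "f \<in> ?I \<rightarrow> A" "\<psi> \<in> ?I \<rightarrow> X" using * True by (auto simp: PiE_iff)
        then have "inside \<tau> ?I f \<psi>" using \<tau> gtype_imp_inside by blast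
        then have "\<not> inside \<tau> {a + l<..n} f \<psi>" using * \<tau> sets(1) by (fastforce simp: inside_def)
        then show ?thesis using \<tau> by blast
      qed simp
    qed auto
    also have "\<dots> \<le> weight w {a<..n} (\<lambda>f \<psi>. \<not> ground ?I f \<psi>) + weight w {a<..n} (\<lambda>f \<psi>. \<exists>\<tau>\<in>gtypes. gtype \<tau> ?I f \<psi> \<and> \<not> inside \<tau> {a + l<..n} f \<psi>)"
      by (rule weight_disj) auto
    also have "weight w {a<..n} (\<lambda>f \<psi>. \<not> ground ?I f \<psi>) \<le> weight w ?I (\<lambda>f \<psi>. \<not> ground ?I f \<psi>) * weight w {a + l<..n} (\<lambda>f \<psi>. True)"
      unfolding sets(1) using sets(2) by (intro weight_Un) (auto simp: ground_restrict)
    also have "\<dots> \<le> \<eta> * chain_const"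
      using I\<eta> IH1 \<eta>0 weight_nonneg by (intro mult_mono) auto
    also have "weight w {a<..n} (\<lambda>f \<psi>. \<exists>\<tau>\<in>gtypes. gtype \<tau> ?I f \<psi> \<and> \<not> inside \<tau> {a + l<..n} f \<psi>)
        \<le> (\<Sum>\<tau>\<in>gtypes. 2 * \<eta> * chain_const * real (n - a))"
      using Y[OF _ True] by (intro order_trans[OF weight_Bex sum_mono] finite_gtypes) auto
    finally show ?thesis by (simp add: algebra_simps)
  qed
  have "weight w {a<..n} (\<lambda>f \<psi>. True)
      \<le> weight w {a<..n} (\<lambda>f \<psi>. \<not> (\<exists>\<tau>\<in>gtypes. inside \<tau> {a<..n} f \<psi>) \<or> (\<exists>\<tau>\<in>gtypes. inside \<tau> {a<..n} f \<psi>))"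
    by (rule weight_mono) auto
  also have "\<dots> \<le> weight w {a<..n} (\<lambda>f \<psi>. \<not> (\<exists>\<tau>\<in>gtypes. inside \<tau> {a<..n} f \<psi>)) + weight w {a<..n} (\<lambda>f \<psi>. \<exists>\<tau>\<in>gtypes. inside \<tau> {a<..n} f \<psi>)"
    by (rule weight_disj) auto
  also have "weight w {a<..n} (\<lambda>f \<psi>. \<exists>\<tau>\<in>gtypes. inside \<tau> {a<..n} f \<psi>) \<le> (\<Sum>\<tau>\<in>gtypes. 1)"
    by (rule order_trans[OF weight_Bex[OF _ finite_gtypes] sum_mono[OF weight_inside_le]]) auto
  \<comment> \<open>The smallness of \<eta> closes the induction: the defective part weighs at most
    1 uniformly in \<open>a\<close>.\<close>
  also have "weight w {a<..n} (\<lambda>f \<psi>. \<not> (\<exists>\<tau>\<in>gtypes. inside \<tau> {a<..n} f \<psi>)) \<le> 1"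
  proof -
    note Z
    also have "\<eta> * chain_const * (1 + 2 * ?t * real (n - a)) \<le> \<eta> * chain_const * (1 + 2 * ?t * real n)"
      using \<eta>0 C1 by (intro mult_left_mono add_left_mono) auto
    also have "\<dots> \<le> 1" using small by (simp add: chain_const_def)
    finally show ?thesis .
  qed
  finally have "weight w {a<..n} (\<lambda>f \<psi>. True) \<le> chain_const" by (simp add: chain_const_def)
  then show ?case using Y Z by blast
qed

end

text \<open>A configuration lying inside a single pair \<open>(H, K)\<close> cannot be non-degenerate in \<open>f\<close> and
  non-trivial in \<open>\<psi>\<close> at the same time, so only the defective configurations contribute.\<close>

lemma weight_nondegenerate_le:
  assumes "l > 0" "3 * l \<le> w" "l \<le> n"
    and \<eta>: "\<And>I. finite I \<Longrightarrow> card I \<ge> l \<Longrightarrow> (\<And>i j. i \<in> I \<Longrightarrow> j \<in> I \<Longrightarrow> i \<le> j + w) \<Longrightarrow>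
       weight w I (\<lambda>f \<psi>. \<not> ground I f \<psi>) \<le> \<eta>"
    and small: "\<eta> * (real (card gtypes) + 1) * (1 + 2 * real (card gtypes) * real n) \<le> 1"
  shows "weight w {0<..n} (\<lambda>f \<psi>. annX f {0<..n} \<subseteq> {t0} \<and> (\<exists>j\<in>{0<..n}. \<psi> j \<noteq> t0))
    \<le> \<eta> * (real (card gtypes) + 1) * (1 + 2 * real (card gtypes) * real n)"
proof -
  have "weight w {0<..n} (\<lambda>f \<psi>. annX f {0<..n} \<subseteq> {t0} \<and> (\<exists>j\<in>{0<..n}. \<psi> j \<noteq> t0))
     \<le> weight w {0<..n} (\<lambda>f \<psi>. \<not> (\<exists>\<tau>\<in>gtypes. inside \<tau> {0<..n} f \<psi>))"
  proof (rule weight_mono)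
    fix f \<psi> assume *: "annX f {0<..n} \<subseteq> {t0} \<and> (\<exists>j\<in>{0<..n}. \<psi> j \<noteq> t0)"
    show "\<not> (\<exists>\<tau>\<in>gtypes. inside \<tau> {0<..n} f \<psi>)"
    proof
      assume "\<exists>\<tau>\<in>gtypes. inside \<tau> {0<..n} f \<psi>"
      then obtain H K where HK: "(H, K) \<in> gtypes" "inside (H, K) {0<..n} f \<psi>" by auto
      then have "K \<subseteq> annX f {0<..n}" by (auto simp: gtypes_def inside_def annX_def)
      then have "K \<subseteq> {t0}" using * by blast
      moreover obtain j where "j \<in> {0<..n}" "\<psi> j \<noteq> t0" using * by blast
      ultimately show False using HK(2) by (auto simp: inside_def)
    qed
  qed auto
  also have "\<dots> \<le> \<eta> * (real (card gtypes) + 1) * (1 + 2 * real (card gtypes) * real n)"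
  proof -
    have "0 + l \<le> n" using assms(3) by simp
    from chain_bounds[OF assms(1,2) \<eta> small this]
    have "weight w {0<..n} (\<lambda>f \<psi>. \<not> (\<exists>\<tau>\<in>gtypes. inside \<tau> {0<..n} f \<psi>)) \<le> \<eta> * chain_const * (1 + 2 * real (card gtypes) * real (n - 0))"
      by blast
    then show ?thesis unfolding chain_const_def by (simp only: diff_zero)
  qed
  finally show ?thesis .
qed

end

section \<open>Asymptotics along the logarithmic bandwidth\<close>

definition bandwidth :: "real \<Rightarrow> nat \<Rightarrow> nat" where
  "bandwidth \<delta> n = nat \<lfloor>ln (real n) powr (1 + \<delta>)\<rfloor>"

context pairing_bound
begin

lemma weight_nondegenerate_tendsto:
  assumes "\<delta> > 0"
  shows "(\<lambda>n. weight (bandwidth \<delta> n) {1..n}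
    (\<lambda>f \<psi>. annX f {1..n} \<subseteq> {t0} \<and> (\<exists>j\<in>{1..n}. \<psi> j \<noteq> t0))) \<longlonglongrightarrow> 0"
proof -
  obtain \<theta> L0 where \<theta>: "0 < \<theta>" "\<theta> < 1" and nonground:
    "\<And>I w. finite I \<Longrightarrow> card I \<ge> L0 \<Longrightarrow> (\<And>i j. i \<in> I \<Longrightarrow> j \<in> I \<Longrightarrow> i \<le> j + w) \<Longrightarrow>
       weight w I (\<lambda>f \<psi>. \<not> ground I f \<psi>) \<le> \<theta> ^ card I"
    using weight_nonground_small by blast
  define c where "c = - ln \<theta>"
  have c: "c > 0" using \<theta> by (simp add: c_def)
  \<comment> \<open>Three consecutive windows must fit into the band, hence a third of the
    bandwidth.\<close>
  define l where "l n = bandwidth \<delta> n div 3" for n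
  define t where "t = real (card gtypes)"
  define b where "b n = \<theta> ^ l n * (t + 1) * (1 + 2 * t * real n)" for n
  have l_ge: "real (l n) \<ge> ln (real n) powr (1 + \<delta>) / 3 - 2" for n
  proof -
    have "real (bandwidth \<delta> n) \<ge> ln (real n) powr (1 + \<delta>) - 1"
      unfolding bandwidth_def by linarith
    moreover have "real (l n) \<ge> real (bandwidth \<delta> n) / 3 - 1"
    proof -
      have "bandwidth \<delta> n \<le> 3 * l n + 2" unfolding l_def by presburger
      then show ?thesis by linarith
    qed
    ultimately show ?thesis by argo
  qed
  have l_le: "real (l n) \<le> ln (real n) powr (1 + \<delta>)" for n
  proof -
    have "real (l n) \<le> real (bandwidth \<delta> n)" by (simp add: l_def)
    also have "\<dots> \<le> ln (real n) powr (1 + \<delta>)" by (simp add: bandwidth_def)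
    finally show ?thesis .
  qed
  have \<theta>_l: "\<theta> ^ l n \<le> exp (- c * (ln (real n) powr (1 + \<delta>) / 3 - 2))" for n
  proof -
    have "\<theta> ^ l n = exp (- c * real (l n))"
      using \<theta> by (simp add: c_def powr_realpow[symmetric] powr_def mult.commute)
    also have "\<dots> \<le> exp (- c * (ln (real n) powr (1 + \<delta>) / 3 - 2))"
      using l_ge[of n] c by simp
    finally show ?thesis .
  qed
  \<comment> \<open>The decay is \<open>exp\<close> of a negative multiple of
    \<open>ln n powr (1 + \<delta>)\<close>, which is superpolynomial exactly because \<delta> is
    positive, and so beats the linear factor from the number of windows.\<close>
  have b_tendsto: "b \<longlonglongrightarrow> 0"
  proof (rule real_tendsto_sandwich[OF _ _ tendsto_const])
    show "eventually (\<lambda>n. 0 \<le> b n) sequentially"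
      using \<theta> by (intro always_eventually) (auto simp: b_def t_def intro!: mult_nonneg_nonneg add_nonneg_nonneg)
    show "eventually (\<lambda>n. b n \<le> exp (- c * (ln (real n) powr (1 + \<delta>) / 3 - 2)) * (t + 1) * (1 + 2 * t * real n)) sequentially"
      using \<theta>_l by (intro always_eventually allI) (auto simp: b_def t_def intro!: mult_right_mono add_nonneg_nonneg)
    show "(\<lambda>n. exp (- c * (ln (real n) powr (1 + \<delta>) / 3 - 2)) * (t + 1) * (1 + 2 * t * real n)) \<longlonglongrightarrow> 0"
      using c assms by real_asymp
  qed
  have e1: "eventually (\<lambda>n. b n < 1) sequentially" using b_tendsto by (rule order_tendstoD) simp
  have "filterlim (\<lambda>n. ln (real n) powr (1 + \<delta>) / 3 - 2) at_top sequentially"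
    using assms by real_asymp
  then have e2: "eventually (\<lambda>n. ln (real n) powr (1 + \<delta>) / 3 - 2 \<ge> real (max L0 1)) sequentially"
    by (simp add: filterlim_at_top)
  have e3: "eventually (\<lambda>n. ln (real n) powr (1 + \<delta>) \<le> real n) sequentially"
    using assms by real_asymp
  let ?W = "\<lambda>n. weight (bandwidth \<delta> n) {1..n} (\<lambda>f \<psi>. annX f {1..n} \<subseteq> {t0} \<and> (\<exists>j\<in>{1..n}. \<psi> j \<noteq> t0))"
  have "eventually (\<lambda>n. ?W n \<le> b n) sequentially"
    using e1 e2 e3
  proof eventually_elim
    case (elim n)
    have l1: "l n \<ge> max L0 1" using elim(2) l_ge[of n] by linarith
    have l2: "l n \<le> n" using elim(3) l_le[of n] by linarith
    have "weight (bandwidth \<delta> n) {0<..n} (\<lambda>f \<psi>. annX f {0<..n} \<subseteq> {t0} \<and> (\<exists>j\<in>{0<..n}. \<psi> j \<noteq> t0)) \<le> b n"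
      unfolding b_def t_def
    proof (rule weight_nondegenerate_le[where l = "l n"])
      fix I :: "nat set" assume I: "finite I" "card I \<ge> l n" "\<And>i j. i \<in> I \<Longrightarrow> j \<in> I \<Longrightarrow> i \<le> j + bandwidth \<delta> n"
      have "weight (bandwidth \<delta> n) I (\<lambda>f \<psi>. \<not> ground I f \<psi>) \<le> \<theta> ^ card I"
        using I l1 by (intro nonground) auto
      also have "\<dots> \<le> \<theta> ^ l n" using I \<theta> by (intro power_decreasing) auto
      finally show "weight (bandwidth \<delta> n) I (\<lambda>f \<psi>. \<not> ground I f \<psi>) \<le> \<theta> ^ l n" .
    qed (use l1 l2 elim(1) in \<open>auto simp: l_def b_def t_def\<close>)
    moreover have "{0<..n} = {1..n}" by auto
    ultimately show ?case by simp
  qed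
  then show ?thesis
    by (rule tendsto_sandwich[OF _ _ tendsto_const b_tendsto, rotated]) (simp add: weight_nonneg)
qed

end

section \<open>Characters of finite abelian groups\<close>

text \<open>Values off \<open>H\<close> are left free, so that one type of function serves for
  characters of all subgroups while they are being extended.\<close>

definition partial_char :: "('a, 'm) monoid_scheme \<Rightarrow> 'a set \<Rightarrow> ('a \<Rightarrow> complex) \<Rightarrow> bool" where
  "partial_char G H \<psi> \<longleftrightarrow> (\<forall>x\<in>H. \<psi> x \<noteq> 0) \<and> (\<forall>x\<in>H. \<forall>y\<in>H. \<psi> (x \<otimes>\<^bsub>G\<^esub> y) = \<psi> x * \<psi> y)"

definition characters :: "('a, 'm) monoid_scheme \<Rightarrow> ('a \<Rightarrow> complex) set" where
  "characters G = {\<psi> \<in> extensional (carrier G). partial_char G (carrier G) \<psi>}"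

definition annihilator :: "('a, 'm) monoid_scheme \<Rightarrow> 'a set \<Rightarrow> ('a \<Rightarrow> complex) set" where
  "annihilator G S = {\<psi> \<in> characters G. \<forall>x\<in>S. \<psi> x = 1}"

abbreviation trivial_char :: "('a, 'm) monoid_scheme \<Rightarrow> 'a \<Rightarrow> complex" where
  "trivial_char G \<equiv> (\<lambda>x\<in>carrier G. 1)"

locale finite_comm_group = comm_group G for G (structure) +
  assumes finite_carrier [simp]: "finite (carrier G)"
begin

lemma charI:
  assumes "\<And>x. x \<in> carrier G \<Longrightarrow> \<psi> x \<noteq> 0"
    and "\<And>x y. x \<in> carrier G \<Longrightarrow> y \<in> carrier G \<Longrightarrow> \<psi> (x \<otimes> y) = \<psi> x * \<psi> y"
    and "\<psi> \<in> extensional (carrier G)"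
  shows "\<psi> \<in> characters G"
  using assms by (simp add: characters_def partial_char_def)

lemma char_mult: "\<psi> \<in> characters G \<Longrightarrow> x \<in> carrier G \<Longrightarrow> y \<in> carrier G \<Longrightarrow> \<psi> (x \<otimes> y) = \<psi> x * \<psi> y"
  and char_nonzero: "\<psi> \<in> characters G \<Longrightarrow> x \<in> carrier G \<Longrightarrow> \<psi> x \<noteq> 0"
  and char_ext: "\<psi> \<in> characters G \<Longrightarrow> \<psi> \<in> extensional (carrier G)"
  by (auto simp: characters_def partial_char_def)

lemma char_one: "\<psi> \<in> characters G \<Longrightarrow> \<psi> \<one> = 1"
  using char_mult[of \<psi> \<one> \<one>] char_nonzero[of \<psi> \<one>] by simp

lemma char_pow:
  assumes "\<psi> \<in> characters G" "x \<in> carrier G"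
  shows "\<psi> (x [^] (n :: nat)) = \<psi> x ^ n"
  using assms by (induction n) (simp_all add: char_one char_mult)

lemma char_eqI:
  assumes "\<psi> \<in> characters G" "\<psi>' \<in> characters G" "\<And>x. x \<in> carrier G \<Longrightarrow> \<psi> x = \<psi>' x"
  shows "\<psi> = \<psi>'"
  using assms by (auto intro!: extensionalityI[of _ "carrier G"] char_ext)

lemma order_pos: "order G > 0"
  by (simp add: order_def card_gt_0_iff) (use one_closed in blast)

lemma char_power_order: "\<psi> \<in> characters G \<Longrightarrow> x \<in> carrier G \<Longrightarrow> \<psi> x ^ order G = 1"
  using char_pow[of \<psi> x "order G"] by (simp add: pow_order_eq_1 char_one)

lemma norm_char:
  assumes "\<psi> \<in> characters G" "x \<in> carrier G"
  shows "norm (\<psi> x) = 1"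
proof -
  have "norm (\<psi> x) ^ order G = 1" using char_power_order[OF assms] by (metis norm_one norm_power)
  then show ?thesis using power_eq_iff_eq_base[OF order_pos norm_ge_zero, of 1 "\<psi> x"] by simp
qed

lemma finite_characters: "finite (characters G)"
proof (rule finite_subset)
  show "characters G \<subseteq> carrier G \<rightarrow>\<^sub>E {z. z ^ order G = 1}"
    by (auto simp: PiE_iff char_power_order intro: extensional_arb[OF char_ext])
  show "finite (carrier G \<rightarrow>\<^sub>E {z :: complex. z ^ order G = 1})"
    using order_pos by (intro finite_PiE finite_carrier finite_roots_unity) simp
qed

lemma finite_annihilator: "finite (annihilator G S)"
  using finite_characters by (simp add: annihilator_def)

lemma trivial_char: "trivial_char G \<in> characters G"
  by (rule charI) auto

lemma char_times:
  assumes "\<psi> \<in> characters G" "\<psi>' \<in> characters G"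
  shows "(\<lambda>x\<in>carrier G. \<psi> x * \<psi>' x) \<in> characters G"
  using assms by (intro charI) (auto simp: char_mult char_nonzero)

lemma char_inverse:
  assumes "\<psi> \<in> characters G"
  shows "(\<lambda>x\<in>carrier G. inverse (\<psi> x)) \<in> characters G"
  using assms by (intro charI) (auto simp: char_mult char_nonzero)

lemma bij_betw_mult_left: "a \<in> carrier G \<Longrightarrow> bij_betw (\<lambda>x. a \<otimes> x) (carrier G) (carrier G)"
  by (rule bij_betwI[of _ _ _ "\<lambda>x. inv a \<otimes> x"]) (auto simp: m_assoc[symmetric])

lemma sum_char:
  assumes "\<psi> \<in> characters G"
  shows "(\<Sum>x\<in>carrier G. \<psi> x) = (if \<psi> = trivial_char G then of_nat (order G) else 0)"
proof (cases "\<psi> = trivial_char G")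
  case False
  then obtain a where a: "a \<in> carrier G" "\<psi> a \<noteq> 1"
    using char_eqI[OF assms trivial_char] by auto
  have "(\<Sum>x\<in>carrier G. \<psi> x) = (\<Sum>x\<in>carrier G. \<psi> (a \<otimes> x))"
    by (rule sum.reindex_bij_betw[OF bij_betw_mult_left[OF a(1)], symmetric])
  also have "\<dots> = \<psi> a * (\<Sum>x\<in>carrier G. \<psi> x)"
    using assms a by (simp add: sum_distrib_left char_mult)
  finally show ?thesis using a(2) False by simp
qed (simp add: order_def)

text \<open>Dual orthogonality: multiplication by a character of the annihilator that is not 1 at
  \<open>x\<close> permutes the annihilator and multiplies the sum by a number different from
  1.\<close>

lemma sum_annihilator:
  assumes "x \<in> carrier G" "S \<subseteq> carrier G"
  shows "(\<Sum>\<psi>\<in>annihilator G S. \<psi> x)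
    = (if \<forall>\<psi>\<in>annihilator G S. \<psi> x = 1 then of_nat (card (annihilator G S)) else 0)"
proof (cases "\<forall>\<psi>\<in>annihilator G S. \<psi> x = 1")
  case False
  then obtain \<psi>0 where \<psi>0: "\<psi>0 \<in> annihilator G S" "\<psi>0 x \<noteq> 1" by auto
  let ?f = "\<lambda>\<psi>. \<lambda>x\<in>carrier G. \<psi>0 x * \<psi> x"
  have "bij_betw ?f (annihilator G S) (annihilator G S)"
  proof (rule bij_betwI[of _ _ _ "\<lambda>\<psi>. \<lambda>x\<in>carrier G. inverse (\<psi>0 x) * \<psi> x"])
    show "?f \<in> annihilator G S \<rightarrow> annihilator G S"
      using \<psi>0 assms char_times by (auto simp: annihilator_def)
    show "(\<lambda>\<psi>. \<lambda>x\<in>carrier G. inverse (\<psi>0 x) * \<psi> x) \<in> annihilator G S \<rightarrow> annihilator G S"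
    proof
      fix \<psi> assume \<psi>: "\<psi> \<in> annihilator G S"
      have "(\<lambda>x\<in>carrier G. inverse (\<psi>0 x) * \<psi> x) = (\<lambda>x\<in>carrier G. (\<lambda>x\<in>carrier G. inverse (\<psi>0 x)) x * \<psi> x)"
        by auto
      also have "\<dots> \<in> characters G"
        using \<psi>0 \<psi> by (intro char_times char_inverse) (auto simp: annihilator_def)
      finally show "(\<lambda>x\<in>carrier G. inverse (\<psi>0 x) * \<psi> x) \<in> annihilator G S"
        using \<psi>0 \<psi> assms by (auto simp: annihilator_def)
    qed
  next
    fix \<psi> assume "\<psi> \<in> annihilator G S"
    then have \<psi>: "\<psi> \<in> extensional (carrier G)" by (simp add: annihilator_def char_ext)
    have nz: "\<psi>0 x \<noteq> 0" if "x \<in> carrier G" for x using \<psi>0 that by (auto simp: annihilator_def char_nonzero)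
    show "(\<lambda>x\<in>carrier G. inverse (\<psi>0 x) * ?f \<psi> x) = \<psi>"
      "?f (\<lambda>x\<in>carrier G. inverse (\<psi>0 x) * \<psi> x) = \<psi>"
      using nz by (auto intro!: extensionalityI[OF _ \<psi>])
  qed
  then have "(\<Sum>\<psi>\<in>annihilator G S. \<psi> x) = (\<Sum>\<psi>\<in>annihilator G S. ?f \<psi> x)"
    by (rule sum.reindex_bij_betw[symmetric])
  also have "\<dots> = \<psi>0 x * (\<Sum>\<psi>\<in>annihilator G S. \<psi> x)"
    using assms by (simp add: sum_distrib_left)
  finally have "(\<Sum>\<psi>\<in>annihilator G S. \<psi> x) = 0" using \<psi>0(2) by simp
  then show ?thesis by (simp only: if_not_P[OF False])
next
  case True
  then have "(\<Sum>\<psi>\<in>annihilator G S. \<psi> x) = (\<Sum>\<psi>\<in>annihilator G S. 1)" by (intro sum.cong) auto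
  then show ?thesis by (simp only: if_P[OF True]) simp
qed

text \<open>The sum of all values of the annihilator over the whole group is computed in both
  orders. The second factor is the double annihilator of \<open>S\<close>; for a subgroup,
  \<open>separating_char\<close> later identifies it with \<open>S\<close>.\<close>

lemma card_annihilator_mult:
  assumes "S \<subseteq> carrier G"
  shows "card (annihilator G S) * card {x \<in> carrier G. \<forall>\<psi>\<in>annihilator G S. \<psi> x = 1} = order G"
proof -
  let ?K = "annihilator G S"
  have triv: "trivial_char G \<in> ?K" using assms trivial_char by (auto simp: annihilator_def)
  have "of_nat (card ?K * card {x \<in> carrier G. \<forall>\<psi>\<in>?K. \<psi> x = 1})
      = (\<Sum>x\<in>carrier G. if \<forall>\<psi>\<in>?K. \<psi> x = 1 then (of_nat (card ?K) :: complex) else 0)"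
    by (simp add: sum.If_cases Int_def mult.commute)
  also have "\<dots> = (\<Sum>x\<in>carrier G. \<Sum>\<psi>\<in>?K. \<psi> x)"
    using sum_annihilator[OF _ assms] by (intro sum.cong) auto
  also have "\<dots> = (\<Sum>\<psi>\<in>?K. \<Sum>x\<in>carrier G. \<psi> x)" by (rule sum.swap)
  also have "\<dots> = (\<Sum>\<psi>\<in>?K. if \<psi> = trivial_char G then of_nat (order G) else 0)"
    by (intro sum.cong sum_char) (auto simp: annihilator_def)
  also have "\<dots> = of_nat (order G)" using triv finite_annihilator by simp
  finally show ?thesis by (simp only: of_nat_eq_iff)
qed

text \<open>This is the inequality \<open>card_perp\<close> of \<open>pairing_bound\<close> for a
  group and its characters: \<open>T\<close> lies in the annihilator of \<open>S\<close>, and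
  \<open>S\<close> in its double annihilator.\<close>

lemma card_perp_le:
  assumes "S \<subseteq> carrier G" "T \<subseteq> characters G" "\<And>x \<psi>. x \<in> S \<Longrightarrow> \<psi> \<in> T \<Longrightarrow> \<psi> x = 1"
  shows "card S * card T \<le> order G"
proof -
  have "card T \<le> card (annihilator G S)"
    using assms finite_annihilator by (intro card_mono) (auto simp: annihilator_def)
  moreover have "card S \<le> card {x \<in> carrier G. \<forall>\<psi>\<in>annihilator G S. \<psi> x = 1}"
    using assms by (intro card_mono) (auto simp: annihilator_def)
  ultimately have "card T * card S \<le> order G"
    unfolding card_annihilator_mult[OF assms(1), symmetric] by (rule mult_le_mono)
  then show ?thesis by (simp only: mult.commute)
qed

lemma partial_char_int_pow:
  assumes "subgroup H G" "partial_char G H \<phi>" "x \<in> H"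
  shows "\<phi> (x [^] (k :: int)) = \<phi> x powi k"
proof -
  have xG: "x \<in> carrier G" using assms by (meson subgroup.mem_carrier)
  have one: "\<phi> \<one> = 1"
    using assms subgroup.one_closed[OF assms(1)] by (force simp: partial_char_def)
  have nat: "x [^] n \<in> H \<and> \<phi> (x [^] n) = \<phi> x ^ n" for n :: nat
    using assms one xG by (induction n) (auto simp: partial_char_def subgroup.one_closed subgroup.m_closed)
  have inv: "\<phi> (inv y) = inverse (\<phi> y)" if "y \<in> H" for y
  proof -
    have "y \<in> carrier G" "inv y \<in> H" using that assms(1) by (auto simp: subgroup.mem_carrier subgroup.m_inv_closed)
    then have "\<phi> (y \<otimes> inv y) = \<phi> y * \<phi> (inv y)" using assms(2) that unfolding partial_char_def by blast
    then have "\<phi> y * \<phi> (inv y) = 1" using one \<open>y \<in> carrier G\<close> by simp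
    then show ?thesis by (rule inverse_unique[symmetric])
  qed
  show ?thesis
    using nat inv xG by (cases k rule: int_cases2) (auto simp: int_pow_int int_pow_neg power_int_minus)
qed

text \<open>On \<open>h \<otimes> a [^] k\<close> the extension must be
  \<open>\<phi> h * \<zeta> powi k\<close>. With \<open>d\<close> the least positive exponent
  carrying \<open>a\<close> into \<open>H\<close>, the only obstruction is that \<zeta> be a
  \<open>d\<close>-th root of \<open>\<phi> (a [^] d)\<close>.\<close>

lemma extend_char_step:
  assumes H: "subgroup H G" and \<phi>: "partial_char G H \<phi>" and a: "a \<in> carrier G"
    and d: "d > 0" "a [^] (d :: nat) \<in> H" "\<And>k::nat. 0 < k \<Longrightarrow> k < d \<Longrightarrow> a [^] k \<notin> H"
    and \<zeta>: "\<zeta> ^ d = \<phi> (a [^] d)"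
  obtains H' \<phi>' where "subgroup H' G" "H \<subseteq> H'" "a \<in> H'" "partial_char G H' \<phi>'"
    "\<And>h. h \<in> H \<Longrightarrow> \<phi>' h = \<phi> h" "\<phi>' a = \<zeta>"
proof -
  define H' where "H' = {h \<otimes> a [^] (k :: int) | h k. h \<in> H}"
  have HG: "h \<in> carrier G" if "h \<in> H" for h using H that by (meson subgroup.mem_carrier)
  have \<phi>0: "\<phi> h \<noteq> 0" if "h \<in> H" for h using \<phi> that by (auto simp: partial_char_def)
  have \<phi>m: "\<phi> (h \<otimes> h') = \<phi> h * \<phi> h'" if "h \<in> H" "h' \<in> H" for h h' using \<phi> that by (auto simp: partial_char_def)
  have \<zeta>0: "\<zeta> \<noteq> 0" using \<zeta> \<phi>0[OF d(2)] d(1) by (metis power_0_left neq0_conv)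
  \<comment> \<open>Division with remainder by \<open>d\<close>: by minimality,
    \<open>a [^] k\<close> lies in \<open>H\<close> only for multiples of \<open>d\<close>, where
    the condition on \<zeta> gives the value.\<close>
  have pow: "\<phi> (a [^] k) = \<zeta> powi k" if k: "a [^] k \<in> H" for k :: int
  proof -
    have dH: "a [^] (int d * q) \<in> H" "\<phi> (a [^] (int d * q)) = \<zeta> powi (int d * q)" for q
    proof -
      have eq: "a [^] (int d * q) = (a [^] d) [^] q"
        using a by (simp add: int_pow_pow int_pow_int[symmetric])
      show "a [^] (int d * q) \<in> H" unfolding eq by (rule subgroup_int_pow_closed[OF H d(2)])
      show "\<phi> (a [^] (int d * q)) = \<zeta> powi (int d * q)"
        unfolding eq partial_char_int_pow[OF H \<phi> d(2)] \<zeta>[symmetric]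
        by (simp add: power_int_mult power_int_of_nat)
    qed
    define r where "r = nat (k mod int d)"
    have r: "int r = k mod int d" using d by (simp add: r_def)
    have "a [^] int r = a [^] k \<otimes> inv (a [^] (int d * (k div int d)))"
    proof -
      have "int r = k - int d * (k div int d)" unfolding r by (simp add: minus_mult_div_eq_mod)
      then show ?thesis using a by (simp add: int_pow_diff)
    qed
    then have "a [^] r \<in> H"
      using k dH(1)[of "k div int d"] H by (simp add: int_pow_int subgroup.m_closed subgroup.m_inv_closed)
    moreover have "r < d" using r d(1) by (metis of_nat_less_iff of_nat_0_less_iff pos_mod_bound)
    ultimately have "r = 0" using d(3) by auto
    then have "k = int d * (k div int d)" using r by (metis mult_div_mod_eq add.right_neutral of_nat_0)
    then show ?thesis using dH(2) by metis
  qed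
  have wd: "\<phi> h * \<zeta> powi k = \<phi> h' * \<zeta> powi k'"
    if h: "h \<in> H" "h' \<in> H" and eq: "h \<otimes> a [^] k = h' \<otimes> a [^] k'" for h h' and k k' :: int
  proof -
    have "a [^] (k - k') = a [^] k \<otimes> inv (a [^] k')" using a by (simp add: int_pow_diff)
    also have "\<dots> = inv h \<otimes> (h \<otimes> a [^] k) \<otimes> inv (a [^] k')"
      using a HG[OF h(1)] by (simp add: m_assoc[symmetric])
    also have "\<dots> = inv h \<otimes> h'"
      unfolding eq using a HG[OF h(1)] HG[OF h(2)] by (simp add: m_assoc)
    finally have e: "a [^] (k - k') = inv h \<otimes> h'" .
    have inH: "inv h \<otimes> h' \<in> H" using H h by (simp add: subgroup.m_closed subgroup.m_inv_closed)
    have "\<phi> h' = \<phi> (h \<otimes> (inv h \<otimes> h'))" using HG[OF h(1)] HG[OF h(2)] by (simp add: m_assoc[symmetric])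
    also have "\<dots> = \<phi> h * \<zeta> powi (k - k')" using \<phi>m[OF h(1) inH] pow[of "k - k'"] e inH by simp
    finally show ?thesis using \<zeta>0 by (simp add: power_int_diff)
  qed
  \<comment> \<open>The choice picks some representation of \<open>x\<close>; by \<open>wd\<close>
    all representations give the same value.\<close>
  define \<phi>' where "\<phi>' x = (SOME z. \<exists>h\<in>H. \<exists>k::int. x = h \<otimes> a [^] k \<and> z = \<phi> h * \<zeta> powi k)" for x
  have \<phi>': "\<phi>' (h \<otimes> a [^] k) = \<phi> h * \<zeta> powi k" if "h \<in> H" for h and k :: int
    unfolding \<phi>'_def
  proof (rule some_equality)
    show "\<exists>h'\<in>H. \<exists>k'::int. h \<otimes> a [^] k = h' \<otimes> a [^] k' \<and> \<phi> h * \<zeta> powi k = \<phi> h' * \<zeta> powi k'"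
      using that by blast
    fix z assume "\<exists>h'\<in>H. \<exists>k'::int. h \<otimes> a [^] k = h' \<otimes> a [^] k' \<and> z = \<phi> h' * \<zeta> powi k'"
    then obtain h' and k' :: int where "h' \<in> H" "h \<otimes> a [^] k = h' \<otimes> a [^] k'" "z = \<phi> h' * \<zeta> powi k'" by blast
    then show "z = \<phi> h * \<zeta> powi k" using wd[OF that] by simp
  qed
  have H'sub: "subgroup H' G"
  proof
    show "H' \<subseteq> carrier G" using a HG by (auto simp: H'_def)
    show "\<one> \<in> H'" unfolding H'_def using subgroup.one_closed[OF H]
      by (intro CollectI exI[of _ \<one>] exI[of _ "0 :: int"]) simp
    fix x y assume "x \<in> H'" "y \<in> H'"
    then obtain h k h' k' where xy: "x = h \<otimes> a [^] (k :: int)" "y = h' \<otimes> a [^] (k' :: int)" "h \<in> H" "h' \<in> H"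
      by (auto simp: H'_def)
    have "x \<otimes> y = (h \<otimes> h') \<otimes> a [^] (k + k')"
      using xy a HG by (simp add: int_pow_mult m_ac)
    then show "x \<otimes> y \<in> H'" unfolding H'_def using xy subgroup.m_closed[OF H] by blast
    have "inv x = inv h \<otimes> a [^] (- k)"
      using xy a HG by (simp add: inv_mult int_pow_neg)
    then show "inv x \<in> H'" unfolding H'_def using xy subgroup.m_inv_closed[OF H] by blast
  qed
  have aH': "a = \<one> \<otimes> a [^] (1 :: int)" using a by simp
  have hH': "h = h \<otimes> a [^] (0 :: int)" if "h \<in> H" for h using HG[OF that] by simp
  have one: "\<phi> \<one> = 1" using \<phi>m[of \<one> \<one>] \<phi>0[of \<one>] subgroup.one_closed[OF H] by simp
  show ?thesis
  proof (rule that[OF H'sub])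
    show "H \<subseteq> H'" unfolding H'_def using hH' by blast
    show "a \<in> H'" unfolding H'_def using aH' subgroup.one_closed[OF H] by blast
    show "\<phi>' h = \<phi> h" if "h \<in> H" for h using \<phi>'[OF that, of 0] hH'[OF that] by simp
    show "\<phi>' a = \<zeta>" using \<phi>'[OF subgroup.one_closed[OF H], of 1] a one by simp
    show "partial_char G H' \<phi>'"
      unfolding partial_char_def
    proof (intro conjI ballI)
      fix x assume "x \<in> H'"
      then obtain h k where x: "x = h \<otimes> a [^] (k :: int)" "h \<in> H" by (auto simp: H'_def)
      show "\<phi>' x \<noteq> 0" using x \<phi>' \<phi>0 \<zeta>0 by simp
      fix y assume "y \<in> H'"
      then obtain h' k' where y: "y = h' \<otimes> a [^] (k' :: int)" "h' \<in> H" by (auto simp: H'_def)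
      have "x \<otimes> y = (h \<otimes> h') \<otimes> a [^] (k + k')"
        using x y a HG by (simp add: int_pow_mult m_ac)
      then show "\<phi>' (x \<otimes> y) = \<phi>' x * \<phi>' y"
        using x y \<phi>' \<phi>m subgroup.m_closed[OF H] \<zeta>0 by (simp add: power_int_add)
    qed
  qed
qed

lemma ex_min_power:
  assumes H: "subgroup H G" and a: "a \<in> carrier G"
  obtains d :: nat where "d > 0" "a [^] d \<in> H" "\<And>k. 0 < k \<Longrightarrow> k < d \<Longrightarrow> a [^] k \<notin> H"
proof -
  have ex: "\<exists>d. d > 0 \<and> a [^] (d :: nat) \<in> H"
    using order_pos a subgroup.one_closed[OF H] by (intro exI[of _ "order G"]) (simp add: pow_order_eq_1)
  show ?thesis
    using LeastI_ex[OF ex] not_less_Least[of _ "\<lambda>d. d > 0 \<and> a [^] d \<in> H"] by (intro that) auto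
qed

lemma ex_root_complex: "d > 0 \<Longrightarrow> c \<noteq> 0 \<Longrightarrow> \<exists>z :: complex. z ^ d = c"
  using card_nth_roots[of c d] by (metis (mono_tags, lifting) card.empty empty_Collect_eq less_irrefl)

lemma extend_char:
  assumes "subgroup H G" "partial_char G H \<phi>"
  shows "\<exists>\<psi>\<in>characters G. \<forall>h\<in>H. \<psi> h = \<phi> h"
  using assms
proof (induction "card (carrier G - H)" arbitrary: H \<phi> rule: less_induct)
  case less
  show ?case
  proof (cases "H = carrier G")
    case True
    then have "restrict \<phi> (carrier G) \<in> characters G"
      using less.prems by (auto simp: characters_def partial_char_def)
    then show ?thesis using True by (intro bexI[of _ "restrict \<phi> (carrier G)"]) auto
  next
    case False
    then obtain a where a: "a \<in> carrier G" "a \<notin> H" using less.prems(1) by (metis subgroup.subset subset_antisym subsetI)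
    obtain d :: nat where d: "d > 0" "a [^] d \<in> H" "\<And>k. 0 < k \<Longrightarrow> k < d \<Longrightarrow> a [^] k \<notin> H"
      using ex_min_power[OF less.prems(1) a(1)] by blast
    obtain \<zeta> where \<zeta>: "\<zeta> ^ d = \<phi> (a [^] d)"
      using ex_root_complex[OF d(1)] d(2) less.prems(2) by (metis partial_char_def)
    obtain H' \<phi>' where H': "subgroup H' G" "H \<subseteq> H'" "a \<in> H'" "partial_char G H' \<phi>'"
      "\<And>h. h \<in> H \<Longrightarrow> \<phi>' h = \<phi> h"
      using extend_char_step[OF less.prems a(1) d \<zeta>] by metis
    have "card (carrier G - H') < card (carrier G - H)"
      using a H' by (intro psubset_card_mono) auto
    from less.hyps[OF this H'(1,4)] show ?thesis using H'(2,5) by (metis subsetD)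
  qed
qed

text \<open>The trivial character of \<open>H\<close> has several extensions to \<open>a\<close>,
  one for each \<open>d\<close>-th root of unity; choose one with value different from 1.\<close>

lemma separating_char:
  assumes H: "subgroup H G" and a: "a \<in> carrier G" "a \<notin> H"
  shows "\<exists>\<psi>\<in>annihilator G H. \<psi> a \<noteq> 1"
proof -
  obtain d :: nat where d: "d > 0" "a [^] d \<in> H" "\<And>k. 0 < k \<Longrightarrow> k < d \<Longrightarrow> a [^] k \<notin> H"
    using ex_min_power[OF H a(1)] by blast
  \<comment> \<open>This is where \<open>a \<notin> H\<close> enters: it leaves room for a second
    root of unity.\<close>
  have "d \<noteq> 1" using d(2) a by auto
  then have "card {z :: complex. z ^ d = 1} > 1" using d(1) card_roots_unity_eq[of d] by simp
  then obtain \<zeta> :: complex where \<zeta>: "\<zeta> ^ d = 1" "\<zeta> \<noteq> 1"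
    by (metis (mono_tags, lifting) CollectI One_nat_def card_1_singleton_iff is_singletonI' is_singleton_altdef less_irrefl mem_Collect_eq card.empty not_less_zero)
  have "partial_char G H (\<lambda>_. 1)" by (simp add: partial_char_def)
  from extend_char_step[OF H this a(1) d, of \<zeta>] \<zeta>
  obtain H' \<phi>' where H': "subgroup H' G" "H \<subseteq> H'" "a \<in> H'" "partial_char G H' \<phi>'"
      "\<And>h. h \<in> H \<Longrightarrow> \<phi>' h = 1" "\<phi>' a = \<zeta>" by metis
  from extend_char[OF H'(1,4)] obtain \<psi> where "\<psi> \<in> characters G" "\<forall>h\<in>H'. \<psi> h = \<phi>' h" by blast
  then show ?thesis using H' \<zeta>(2) by (intro bexI[of _ \<psi>]) (auto simp: annihilator_def)
qed

lemma card_annihilator: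
  assumes "subgroup H G"
  shows "card (annihilator G H) * card H = order G"
proof -
  have "{x \<in> carrier G. \<forall>\<psi>\<in>annihilator G H. \<psi> x = 1} = H"
    using separating_char[OF assms] subgroup.subset[OF assms] by (auto simp: annihilator_def)
  then show ?thesis using card_annihilator_mult[OF subgroup.subset[OF assms]] by simp
qed

lemma sum_annihilator_subgroup:
  assumes "subgroup H G" "x \<in> carrier G"
  shows "(\<Sum>\<psi>\<in>annihilator G H. \<psi> x) = (if x \<in> H then of_nat (card (annihilator G H)) else 0)"
proof -
  have "(\<forall>\<psi>\<in>annihilator G H. \<psi> x = 1) \<longleftrightarrow> x \<in> H"
    using separating_char[OF assms(1)] assms(2) by (auto simp: annihilator_def)
  then show ?thesis using sum_annihilator[OF assms(2) subgroup.subset[OF assms(1)]] by simp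
qed

end

text \<open>Transports \<open>G/H\<close> and its dual to the fixed set \<open>{..<N}\<close>. The
  multiplication table \<open>tab\<close>, the label of the unit and the relation
  \<open>orth\<close> then range over a finite set that does not depend on the ambient group, while
  \<open>Q\<close> and \<open>c\<close> keep the link to it.\<close>

lemma (in finite_comm_group) quotient_pairing:
  assumes H: "subgroup H G" and N: "card H * N = order G"
  obtains Q c orth tab where
    "Q \<in> carrier G \<rightarrow> {..<N}" "tab \<in> {..<N} \<times> {..<N} \<rightarrow>\<^sub>E {..<N}"
    "\<And>x y. x \<in> carrier G \<Longrightarrow> y \<in> carrier G \<Longrightarrow> Q (x \<otimes> y) = tab (Q x, Q y)"
    "\<And>x. x \<in> carrier G \<Longrightarrow> Q x = Q \<one> \<longleftrightarrow> x \<in> H"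
    "bij_betw c {..<N} (annihilator G H)" "c 0 = trivial_char G"
    "orth \<subseteq> {..<N} \<times> {..<N}"
    "\<And>x t. x \<in> carrier G \<Longrightarrow> t < N \<Longrightarrow> (Q x, t) \<in> orth \<longleftrightarrow> c t x = 1"
    "\<And>S T. S \<subseteq> {..<N} \<Longrightarrow> T \<subseteq> {..<N} \<Longrightarrow> (\<And>s t. s \<in> S \<Longrightarrow> t \<in> T \<Longrightarrow> (s, t) \<in> orth) \<Longrightarrow> card S * card T \<le> N"
proof -
  have HG: "H \<subseteq> carrier G" by (rule subgroup.subset[OF H])
  have finH: "finite H" by (rule finite_subset[OF HG finite_carrier])
  have cH: "card H > 0" using finH subgroup.one_closed[OF H] by (auto simp: card_gt_0_iff)
  have "card (rcosets H) * card H = N * card H"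
    using lagrange_finite[OF finite_carrier H] N by (simp add: mult.commute)
  then have cr: "card (rcosets H) = N" using cH by simp
  have N0: "N > 0" using N order_pos by (cases N) auto
  then have "finite (rcosets H)" using cr card_ge_0_finite by blast
  then obtain b where b: "bij_betw b (rcosets H) {..<N}"
    using ex_bij_betw_finite_nat cr by (metis atLeast0LessThan)
  define Q where "Q x = b (H #> x)" for x
  have rc: "H #> x \<in> rcosets H" if "x \<in> carrier G" for x using rcosetsI[OF HG that] .
  have Qeq: "Q x = Q y \<longleftrightarrow> H #> x = H #> y" if "x \<in> carrier G" "y \<in> carrier G" for x y
    unfolding Q_def using b rc that by (metis bij_betw_def inj_on_eq_iff)
  have QN: "Q x < N" if "x \<in> carrier G" for x
    unfolding Q_def using bij_betwE[OF b] rc[OF that] by auto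
  have Qsurj: "\<exists>x\<in>carrier G. Q x = k" if "k < N" for k
  proof -
    have "k \<in> b ` (rcosets H)" using b that by (auto simp: bij_betw_def)
    then obtain R where R: "R \<in> rcosets H" "b R = k" by auto
    then obtain x where "x \<in> carrier G" "R = H #> x" by (auto simp: RCOSETS_def)
    then show ?thesis using R by (auto simp: Q_def)
  qed
  have same: "\<exists>h\<in>H. x = h \<otimes> y" if "x \<in> carrier G" "y \<in> carrier G" "Q x = Q y" for x y
  proof -
    have "x \<in> H #> y" using that Qeq[OF that(1,2)] rcos_self[OF that(1) H] by simp
    then show ?thesis by (auto simp: r_coset_def)
  qed
  have same': "Q (h \<otimes> x) = Q x" if "x \<in> carrier G" "h \<in> H" for h x
    using that HG repr_independence[of "h \<otimes> x" H x] rcosI[of h H x] H by (subst Qeq) auto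
  define rp where "rp k = (SOME x. x \<in> carrier G \<and> Q x = k)" for k
  have rp: "rp k \<in> carrier G" "Q (rp k) = k" if "k < N" for k
    using someI_ex[of "\<lambda>x. x \<in> carrier G \<and> Q x = k"] Qsurj[OF that] by (auto simp: rp_def)
  define tab where "tab = (\<lambda>(k, l)\<in>{..<N} \<times> {..<N}. Q (rp k \<otimes> rp l))"
  have tab: "tab \<in> {..<N} \<times> {..<N} \<rightarrow>\<^sub>E {..<N}" by (auto simp: tab_def rp QN)
  have Qtab: "Q (x \<otimes> y) = tab (Q x, Q y)" if x: "x \<in> carrier G" and y: "y \<in> carrier G" for x y
  proof -
    obtain h where h: "h \<in> H" "rp (Q x) = h \<otimes> x" using same[OF rp(1)[OF QN[OF x]] x] rp(2)[OF QN[OF x]] by auto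
    obtain k where k: "k \<in> H" "rp (Q y) = k \<otimes> y" using same[OF rp(1)[OF QN[OF y]] y] rp(2)[OF QN[OF y]] by auto
    have hk: "h \<in> carrier G" "k \<in> carrier G" using h k HG by auto
    have "rp (Q x) \<otimes> rp (Q y) = (h \<otimes> k) \<otimes> (x \<otimes> y)" using h k hk x y by (simp add: m_ac)
    then have "tab (Q x, Q y) = Q ((h \<otimes> k) \<otimes> (x \<otimes> y))" using QN x y by (simp add: tab_def)
    also have "\<dots> = Q (x \<otimes> y)" using x y h k subgroup.m_closed[OF H] by (intro same') auto
    finally show ?thesis by simp
  qed
  have Qone: "Q x = Q \<one> \<longleftrightarrow> x \<in> H" if xG: "x \<in> carrier G" for x
  proof
    assume "Q x = Q \<one>"
    then obtain h where "h \<in> H" "x = h \<otimes> \<one>" using same[OF xG one_closed] by auto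
    then show "x \<in> H" using subsetD[OF HG] r_one by metis
  next
    assume "x \<in> H"
    then show "Q x = Q \<one>" using same'[OF one_closed, of x] xG by simp
  qed
  have cann: "card (annihilator G H) = N"
    using card_annihilator[OF H] N cH by (metis mult.commute mult_cancel_right less_not_refl2)
  obtain c0 where c0: "bij_betw c0 {..<N} (annihilator G H)"
    using ex_bij_betw_nat_finite[OF finite_annihilator] cann by (metis atLeast0LessThan)
  have triv: "trivial_char G \<in> annihilator G H" using HG trivial_char by (auto simp: annihilator_def)
  obtain m where m: "m < N" "c0 m = trivial_char G"
  proof -
    have "trivial_char G \<in> c0 ` {..<N}" using triv bij_betw_imp_surj_on[OF c0] by simp
    then show ?thesis using that by force
  qed
  \<comment> \<open>The transposition moves the trivial character to label 0, so that the same label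
    means trivial for every \<open>H\<close>.\<close>
  define c where "c = c0 \<circ> Transposition.transpose 0 m"
  have "bij_betw (Transposition.transpose 0 m) {..<N} {..<N}"
    using m N0 by (intro bij_betw_transpose_iff) auto
  then have c: "bij_betw c {..<N} (annihilator G H)" unfolding c_def using c0 by (rule bij_betw_trans)
  have c_0: "c 0 = trivial_char G" using m by (simp add: c_def)
  define orth where "orth = {(k, t). k < N \<and> t < N \<and> c t (rp k) = 1}"
  have orth: "(Q x, t) \<in> orth \<longleftrightarrow> c t x = 1" if x: "x \<in> carrier G" and t: "t < N" for x t
  proof -
    obtain h where h: "h \<in> H" "rp (Q x) = h \<otimes> x" using same[OF rp(1)[OF QN[OF x]] x] rp(2)[OF QN[OF x]] by auto
    have "c t \<in> annihilator G H" using c t by (auto simp: bij_betw_def)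
    then have "c t (rp (Q x)) = c t x" using h HG x by (auto simp: annihilator_def char_mult)
    then show ?thesis using QN[OF x] t by (simp add: orth_def)
  qed
  have bound: "card S * card T \<le> N" if S: "S \<subseteq> {..<N}" and T: "T \<subseteq> {..<N}"
    and ST: "\<And>s t. s \<in> S \<Longrightarrow> t \<in> T \<Longrightarrow> (s, t) \<in> orth" for S T
  proof -
    \<comment> \<open>All fibres of \<open>Q\<close> have the size of \<open>H\<close>; pulling
      \<open>S\<close> back to the group and applying \<open>card_perp_le\<close> there gives the
      bound with a common factor \<open>card H\<close>.\<close>
    have fib: "card {x \<in> carrier G. Q x = k} = card H" if "k < N" for k
    proof -
      have "{x \<in> carrier G. Q x = k} = (\<lambda>h. h \<otimes> rp k) ` H"
        using same[OF _ rp(1)[OF that]] same'[OF rp(1)[OF that]] rp[OF that] HG by (auto simp: image_iff)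
      moreover have "inj_on (\<lambda>h. h \<otimes> rp k) H" using rp[OF that] HG by (intro inj_onI) (metis right_cancel subsetD)
      ultimately show ?thesis by (simp add: card_image)
    qed
    have "card {x \<in> carrier G. Q x \<in> S} = card (\<Union>k\<in>S. {x \<in> carrier G. Q x = k})"
      by (rule arg_cong[of _ _ card]) auto
    also have "\<dots> = (\<Sum>k\<in>S. card {x \<in> carrier G. Q x = k})"
      using S finite_subset by (intro card_UN_disjoint) auto
    also have "\<dots> = card S * card H" using fib S by (subst sum.cong[OF refl, of S _ "\<lambda>_. card H"]) auto
    finally have cS: "card {x \<in> carrier G. Q x \<in> S} = card S * card H" .
    have cT: "card (c ` T) = card T" using c T by (intro card_image) (auto simp: bij_betw_def intro: inj_on_subset)
    have "card {x \<in> carrier G. Q x \<in> S} * card (c ` T) \<le> order G"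
    proof (rule card_perp_le)
      show "c ` T \<subseteq> characters G" using c T by (auto simp: bij_betw_def annihilator_def)
      show "\<psi> x = 1" if x: "x \<in> {x \<in> carrier G. Q x \<in> S}" and \<psi>: "\<psi> \<in> c ` T" for x \<psi>
      proof -
        obtain t where t: "t \<in> T" "\<psi> = c t" using \<psi> by auto
        then have "(Q x, t) \<in> orth" using ST x by auto
        then show ?thesis using orth x t T by auto
      qed
    qed auto
    then have "(card S * card T) * card H \<le> N * card H"
      unfolding cS cT N[symmetric] by (simp add: mult_ac)
    then show ?thesis using cH by simp
  qed
  show ?thesis
    by (rule that[of Q tab c orth]) (use QN tab Qtab Qone c c_0 orth bound in \<open>auto simp: orth_def\<close>)
qed

section \<open>Vectors modulo q\<close>

definition zvec :: "nat \<Rightarrow> nat \<Rightarrow> (nat \<Rightarrow> int) monoid" where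
  "zvec n q = product_group {1..n} (\<lambda>_. integer_mod_group q)"

text \<open>The entry is \<open>1 mod q\<close> rather than 1, so that the vector stays in the
  carrier for \<open>q = 1\<close>.\<close>

definition unit_vec :: "nat \<Rightarrow> nat \<Rightarrow> nat \<Rightarrow> nat \<Rightarrow> int" where
  "unit_vec n q i = (\<lambda>j\<in>{1..n}. if j = i then 1 mod int q else 0)"

context
  fixes n q :: nat
  assumes q: "q > 0"
begin

lemma carrier_zvec: "carrier (zvec n q) = {1..n} \<rightarrow>\<^sub>E {0..<int q}"
  using q by (simp add: zvec_def carrier_integer_mod_group)

lemma mult_zvec: "v \<otimes>\<^bsub>zvec n q\<^esub> u = (\<lambda>i\<in>{1..n}. (v i + u i) mod int q)"
  by (simp add: zvec_def)

lemma one_zvec: "\<one>\<^bsub>zvec n q\<^esub> = (\<lambda>i\<in>{1..n}. 0)"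
  by (simp add: zvec_def)

lemma group_zvec: "group (zvec n q)"
  unfolding zvec_def by (rule product_group) simp

lemma finite_comm_group_zvec: "finite_comm_group (zvec n q)"
proof -
  interpret group "zvec n q" by (rule group_zvec)
  have "comm_group (zvec n q)"
    by (rule group_comm_groupI) (simp add: mult_zvec add.commute)
  then interpret comm_group "zvec n q" .
  show ?thesis by unfold_locales (simp add: carrier_zvec finite_PiE)
qed

lemma order_zvec: "order (zvec n q) = q ^ n"
  by (simp add: order_def carrier_zvec card_PiE)

lemma pow_zvec: "v [^]\<^bsub>zvec n q\<^esub> (m :: nat) = (\<lambda>i\<in>{1..n}. (int m * v i) mod int q)"
proof (induction m)
  case 0
  then show ?case by (simp add: one_zvec)
next
  case (Suc m)
  have "(int m * v i mod int q + v i) mod int q = int (Suc m) * v i mod int q" for i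
    by (simp add: algebra_simps mod_simps)
  then show ?case using Suc by (auto simp: mult_zvec)
qed

lemma unit_vec_closed: "unit_vec n q i \<in> carrier (zvec n q)"
  using q by (auto simp: carrier_zvec unit_vec_def)

text \<open>Every vector is reached from zero by raising entries by 1 below \<open>q\<close>; the
  equation offered in the step says that no reduction takes place.\<close>

lemma zvec_induct [consumes 1, case_names zero step]:
  assumes v: "v \<in> carrier (zvec n q)"
    and zero: "P \<one>\<^bsub>zvec n q\<^esub>"
    and step: "\<And>v i. v \<in> carrier (zvec n q) \<Longrightarrow> i \<in> {1..n} \<Longrightarrow> P v \<Longrightarrow> v i + 1 < int q \<Longrightarrow>
       v \<otimes>\<^bsub>zvec n q\<^esub> unit_vec n q i = v(i := v i + 1) \<Longrightarrow> P (v \<otimes>\<^bsub>zvec n q\<^esub> unit_vec n q i)"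
  shows "P v"
  using v
proof (induction "\<Sum>i\<in>{1..n}. nat (v i)" arbitrary: v rule: less_induct)
  case less
  note v = less.prems[unfolded carrier_zvec]
  show ?case
  proof (cases "\<forall>i\<in>{1..n}. v i = 0")
    case True
    then have "v = \<one>\<^bsub>zvec n q\<^esub>" using v by (auto simp: one_zvec PiE_iff intro!: extensionalityI[of _ "{1..n}"])
    then show ?thesis using zero by simp
  next
    case False
    then obtain i where i: "i \<in> {1..n}" "v i \<noteq> 0" by auto
    have bd: "0 \<le> v j" "v j < int q" if "j \<in> {1..n}" for j using v that by (auto simp: PiE_iff)
    have vi: "v i > 0" using bd[OF i(1)] i by auto
    let ?v = "v(i := v i - 1)"
    have closed: "?v \<in> carrier (zvec n q)"
    proof -
      have "v i - 1 < int q" using bd[OF i(1)] by simp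
      then show ?thesis unfolding carrier_zvec using v i vi by (auto simp: PiE_iff extensional_def)
    qed
    have "(\<Sum>j\<in>{1..n}. nat (?v j)) < (\<Sum>j\<in>{1..n}. nat (v j))"
      using i vi by (intro sum_strict_mono_ex1) auto
    then have IH: "P ?v" using closed by (rule less.hyps)
    have q1: "int q > 1" using bd[OF i(1)] vi by auto
    have eq: "?v \<otimes>\<^bsub>zvec n q\<^esub> unit_vec n q i = v"
      using v i vi bd q1 by (auto simp: mult_zvec unit_vec_def PiE_iff extensional_def)
    have "P (?v \<otimes>\<^bsub>zvec n q\<^esub> unit_vec n q i)"
      by (rule step[OF closed i(1) IH]) (use eq bd[OF i(1)] in auto)
    then show ?thesis using eq by simp
  qed
qed

lemma char_zvec:
  assumes "\<psi> \<in> characters (zvec n q)" "v \<in> carrier (zvec n q)"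
  shows "\<psi> v = (\<Prod>i\<in>{1..n}. \<psi> (unit_vec n q i) ^ nat (v i))"
proof -
  interpret finite_comm_group "zvec n q" by (rule finite_comm_group_zvec)
  show ?thesis using assms(2)
  proof (induction rule: zvec_induct)
    case zero
    have "nat (\<one>\<^bsub>zvec n q\<^esub> i) = 0" if "i \<in> {1..n}" for i using that by (simp add: one_zvec)
    then show ?case using char_one[OF assms(1)] by simp
  next
    case (step v i)
    have vi: "0 \<le> v i" using step by (auto simp: carrier_zvec PiE_iff)
    have "(\<Prod>j\<in>{1..n}. \<psi> (unit_vec n q j) ^ nat ((v(i := v i + 1)) j))
        = (\<Prod>j\<in>{1..n}. \<psi> (unit_vec n q j) ^ nat (v j) * (if j = i then \<psi> (unit_vec n q i) else 1))"
      using vi by (intro prod.cong) (auto simp: nat_add_distrib)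
    also have "\<dots> = \<psi> v * \<psi> (unit_vec n q i)"
      using step by (simp add: prod.distrib)
    also have "\<dots> = \<psi> (v \<otimes>\<^bsub>zvec n q\<^esub> unit_vec n q i)"
      using char_mult[OF assms(1) step(1) unit_vec_closed] by simp
    finally have "(\<Prod>j\<in>{1..n}. \<psi> (unit_vec n q j) ^ nat ((v(i := v i + 1)) j)) = \<psi> (v \<otimes>\<^bsub>zvec n q\<^esub> unit_vec n q i)" .
    moreover have eq: "v \<otimes>\<^bsub>zvec n q\<^esub> unit_vec n q i = v(i := v i + 1)" using step by blast
    ultimately show ?case by (simp only: eq)
  qed
qed

text \<open>Only compatibility with a common binary operation \<open>tab\<close> is asked for, so
  the lemma covers both homomorphisms and the labellings \<open>Q\<close> with their multiplication
  tables.\<close>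

lemma zvec_hom_eqI:
  assumes "v \<in> carrier (zvec n q)" "Q \<one>\<^bsub>zvec n q\<^esub> = Q' \<one>\<^bsub>zvec n q\<^esub>"
    and "\<And>i. i \<in> {1..n} \<Longrightarrow> Q (unit_vec n q i) = Q' (unit_vec n q i)"
    and "\<And>x y. x \<in> carrier (zvec n q) \<Longrightarrow> y \<in> carrier (zvec n q) \<Longrightarrow> Q (x \<otimes>\<^bsub>zvec n q\<^esub> y) = tab (Q x) (Q y)"
    and "\<And>x y. x \<in> carrier (zvec n q) \<Longrightarrow> y \<in> carrier (zvec n q) \<Longrightarrow> Q' (x \<otimes>\<^bsub>zvec n q\<^esub> y) = tab (Q' x) (Q' y)"
  shows "Q v = Q' v"
  using assms(1)
proof (induction rule: zvec_induct)
  case (step v i)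
  then show ?case
    unfolding assms(4)[OF step(1) unit_vec_closed] assms(5)[OF step(1) unit_vec_closed] using assms(3) by simp
qed (rule assms(2))

end

section \<open>Balanced entries and Fourier bounds\<close>

lemma norm_root_unity:
  fixes z :: complex
  assumes "z ^ m = 1" "m > 0"
  shows "norm z = 1"
proof -
  have "norm z ^ m = 1 ^ m" using assms(1) by (metis norm_one norm_power power_one)
  then show ?thesis using power_eq_iff_eq_base[OF assms(2) norm_ge_zero, of 1 z] by simp
qed

text \<open>There are finitely many roots, and a number of modulus 1 with real part 1 is 1.
  Including 0 in the maximum makes \<open>c\<close> nonnegative.\<close>

lemma root_unity_gap:
  assumes "m > 0"
  obtains c :: real where "0 \<le> c" "c < 1" "\<And>z :: complex. z ^ m = 1 \<Longrightarrow> z \<noteq> 1 \<Longrightarrow> Re z \<le> c"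
proof -
  let ?R = "insert 0 (Re ` {z :: complex. z ^ m = 1 \<and> z \<noteq> 1})"
  have fin: "finite ?R"
  proof (rule finite.insertI[OF finite_imageI])
    show "finite {z :: complex. z ^ m = 1 \<and> z \<noteq> 1}"
      by (rule finite_subset[OF _ finite_roots_unity[of m]]) (use assms in auto)
  qed
  have "Re z < 1" if "z ^ m = 1" "z \<noteq> 1" for z :: complex
  proof (rule ccontr)
    assume "\<not> Re z < 1"
    moreover have n: "norm z = 1" using that assms norm_root_unity by blast
    ultimately have "Re z = 1" using complex_Re_le_cmod[of z] by simp
    moreover then have "Im z = 0" using n cmod_power2[of z] by simp
    ultimately show False using that by (simp add: complex_eq_iff)
  qed
  then have "Max ?R < 1" using fin by (subst Max_less_iff) auto
  moreover have "0 \<le> Max ?R" using fin by (intro Max_ge) auto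
  moreover have "Re z \<le> Max ?R" if "z ^ m = 1" "z \<noteq> 1" for z :: complex
    using fin that by (intro Max_ge) auto
  ultimately show ?thesis using that by blast
qed

lemma coprime_powers_eq_1:
  fixes z :: complex
  assumes "z ^ a = 1" "z ^ b = 1" "coprime a b"
  shows "z = 1"
proof (cases "a = 0")
  case True
  then show ?thesis using assms by simp
next
  case False
  then obtain x y where "a * x = b * y + gcd a b" using bezout_nat by blast
  then have xy: "a * x = b * y + 1" using assms(3) by simp
  have "z ^ (a * x) = 1" "z ^ (b * y) = 1" using assms by (simp_all add: power_mult)
  then show ?thesis unfolding xy by (simp add: power_add)
qed

text \<open>The squared modulus of the expectation is the expectation of
  \<open>Re (z ^ (k - l))\<close> for two independent copies \<open>k\<close>, \<open>l\<close> of
  \<open>Y\<close>. Residues that differ modulo \<open>p\<close> occur with probability at least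
  \<epsilon> and contribute at most \<open>c < 1\<close>. The bound depends on \<open>p\<close>,
  \<open>K\<close> and \<epsilon> only, so it serves entries with different distributions.\<close>

lemma balanced_char_bound:
  assumes p: "prime p" and K: "K > 0" and \<epsilon>: "\<epsilon> > 0"
  obtains \<rho> :: real where "0 < \<rho>" "\<rho> < 1"
    "\<And>(M :: 'w measure) Y (z :: complex). prob_space M \<Longrightarrow> Y \<in> measurable M (count_space (UNIV :: int set)) \<Longrightarrow>
       (\<And>\<omega>. \<omega> \<in> space M \<Longrightarrow> Y \<omega> \<in> {0..<int (p ^ K)}) \<Longrightarrow>
       (\<And>t :: int. measure M {\<omega> \<in> space M. [Y \<omega> = t] (mod int p)} \<le> 1 - \<epsilon>) \<Longrightarrow>
       z ^ (p ^ K) = 1 \<Longrightarrow> z \<noteq> 1 \<Longrightarrow>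
       norm (\<integral>\<omega>. z ^ nat (Y \<omega>) \<partial>M) \<le> \<rho>"
proof -
  let ?q = "p ^ K"
  have p0: "p > 0" using p by (rule prime_gt_0_nat)
  have q0: "?q > 0" using p0 by simp
  obtain c where c: "0 \<le> c" "c < 1" and cR: "\<And>z :: complex. z ^ ?q = 1 \<Longrightarrow> z \<noteq> 1 \<Longrightarrow> Re z \<le> c"
    using root_unity_gap[OF q0] by blast
  define s where "s = sqrt (1 - (1 - c) * \<epsilon>)"
  have "1 - (1 - c) * \<epsilon> < 1" using c \<epsilon> by simp
  then have s1: "s < 1" by (simp add: s_def)
  show ?thesis
  \<comment> \<open>The maximum with \<open>1 / 2\<close> secures positivity, since \<open>s\<close>
    need not be positive.\<close>
  proof (rule that[of "max (1 / 2) s"])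
    fix M :: "'w measure" and Y :: "'w \<Rightarrow> int" and z :: complex
    assume M: "prob_space M" and Y: "Y \<in> measurable M (count_space UNIV)"
      and Yq: "\<And>\<omega>. \<omega> \<in> space M \<Longrightarrow> Y \<omega> \<in> {0..<int (p ^ K)}"
      and bal: "\<And>t. measure M {\<omega> \<in> space M. [Y \<omega> = t] (mod int p)} \<le> 1 - \<epsilon>"
      and z: "z ^ ?q = 1" "z \<noteq> 1"
    interpret prob_space M by (rule M)
    have nz: "norm z = 1" by (rule norm_root_unity[OF z(1) q0])
    define a where "a k = prob {\<omega> \<in> space M. Y \<omega> = int k}" for k :: nat
    have ev: "{\<omega> \<in> space M. P (Y \<omega>)} \<in> events" for P :: "int \<Rightarrow> bool"
      using measurable_sets[OF Y, of "{y. P y}"] by (simp add: vimage_def Int_def conj_commute)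
    have a0: "a k \<ge> 0" for k by (simp add: a_def)
    have sumP: "(\<Sum>k | k < ?q \<and> P k. a k) = prob {\<omega> \<in> space M. P (nat (Y \<omega>))}" for P
    proof -
      have "(\<Sum>k | k < ?q \<and> P k. a k) = prob (\<Union>k\<in>{k. k < ?q \<and> P k}. {\<omega> \<in> space M. Y \<omega> = int k})"
        unfolding a_def using ev by (intro finite_measure_finite_Union[symmetric]) (auto simp: disjoint_family_on_def)
      also have "(\<Union>k\<in>{k. k < ?q \<and> P k}. {\<omega> \<in> space M. Y \<omega> = int k}) = {\<omega> \<in> space M. P (nat (Y \<omega>))}"
      proof safe
        fix \<omega> assume "\<omega> \<in> space M" "P (nat (Y \<omega>))"
        moreover have "nat (Y \<omega>) < ?q" "Y \<omega> = int (nat (Y \<omega>))" using Yq[OF \<open>\<omega> \<in> space M\<close>] by (auto simp: nat_less_iff)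
        ultimately show "\<omega> \<in> (\<Union>k\<in>{k. k < ?q \<and> P k}. {\<omega> \<in> space M. Y \<omega> = int k})" by blast
      qed auto
      finally show ?thesis .
    qed
    have suma: "(\<Sum>k<?q. a k) = 1"
      using sumP[of "\<lambda>_. True"] prob_space by (simp add: lessThan_def)
    have E: "(\<integral>\<omega>. z ^ nat (Y \<omega>) \<partial>M) = (\<Sum>k<?q. of_real (a k) * z ^ k)"
    proof -
      have "(\<integral>\<omega>. z ^ nat (Y \<omega>) \<partial>M) = (\<integral>\<omega>. (\<Sum>k<?q. indicator {\<omega> \<in> space M. Y \<omega> = int k} \<omega> *\<^sub>R z ^ k) \<partial>M)"
      proof (rule Bochner_Integration.integral_cong[OF refl])
        fix \<omega> assume \<omega>: "\<omega> \<in> space M"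
        have "(\<Sum>k<?q. indicator {\<omega> \<in> space M. Y \<omega> = int k} \<omega> *\<^sub>R z ^ k) = (\<Sum>k<?q. if k = nat (Y \<omega>) then z ^ k else 0)"
          using \<omega> Yq[OF \<omega>] by (intro sum.cong) (auto simp: indicator_def)
        also have "\<dots> = z ^ nat (Y \<omega>)" using Yq[OF \<omega>] by (simp add: nat_less_iff)
        finally show "z ^ nat (Y \<omega>) = (\<Sum>k<?q. indicator {\<omega> \<in> space M. Y \<omega> = int k} \<omega> *\<^sub>R z ^ k)" by simp
      qed
      also have "\<dots> = (\<Sum>k<?q. \<integral>\<omega>. indicator {\<omega> \<in> space M. Y \<omega> = int k} \<omega> *\<^sub>R z ^ k \<partial>M)"
        using ev[of "\<lambda>y. y = int _"] by (intro Bochner_Integration.integral_sum integrable_scaleR_left integrable_real_indicator) (auto simp: emeasure_eq_measure)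
      also have "\<dots> = (\<Sum>k<?q. of_real (a k) * z ^ k)"
      proof (intro sum.cong refl)
        fix k
        have "{\<omega> \<in> space M. Y \<omega> = int k} \<inter> space M = {\<omega> \<in> space M. Y \<omega> = int k}" by auto
        then show "(\<integral>\<omega>. indicator {\<omega> \<in> space M. Y \<omega> = int k} \<omega> *\<^sub>R z ^ k \<partial>M) = of_real (a k) * z ^ k"
          using ev[of "\<lambda>y. y = int k"] by (simp add: a_def scaleR_conv_of_real)
      qed
      finally show ?thesis .
    qed
    \<comment> \<open>If \<open>k\<close> and \<open>l\<close> differ modulo \<open>p\<close>, their
      difference is coprime to the order \<open>p ^ K\<close>, so the quotient of the two powers is
      a root of unity different from 1 and the gap applies.\<close>
    have zz: "Re (z ^ k * cnj (z ^ l)) \<le> (if [k = l] (mod p) then 1 else c)" for k l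
    proof (cases "[k = l] (mod p)")
      case True
      have "Re (z ^ k * cnj (z ^ l)) \<le> norm (z ^ k * cnj (z ^ l))" by (rule complex_Re_le_cmod)
      also have "\<dots> = 1" using nz by (simp add: norm_mult norm_power)
      finally show ?thesis using True by simp
    next
      case False
      let ?w = "z ^ k * cnj (z ^ l)"
      have cz: "cnj z * z = 1" using nz by (simp add: complex_norm_square[symmetric] mult.commute)
      have "cnj z ^ ?q = 1" using z(1) by (metis complex_cnj_one complex_cnj_power)
      then have "?w ^ ?q = 1" using z(1)
        by (simp only: power_mult_distrib power_mult[symmetric] mult.commute[of _ ?q] complex_cnj_power)
          (simp add: power_mult)
      moreover have "?w \<noteq> 1"
      proof
        assume w: "?w = 1"
        have "z ^ k = z ^ k * (cnj z * z) ^ l" by (simp add: cz)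
        also have "\<dots> = ?w * z ^ l" by (simp add: power_mult_distrib mult_ac)
        finally have "z ^ k = ?w * z ^ l" .
        then have kl: "z ^ k = z ^ l" unfolding w mult_1_left .
        have zn: "z \<noteq> 0" using nz by auto
        define d where "d = (if k \<le> l then l - k else k - l)"
        have "z ^ d = 1"
        proof (cases "k \<le> l")
          case True
          then show ?thesis using kl zn by (simp add: d_def power_diff)
        next
          case False
          then show ?thesis using kl zn by (simp add: d_def power_diff)
        qed
        moreover have "coprime d ?q"
        proof -
          have "\<not> p dvd d"
            using False cong_altdef_nat[of k l p] cong_altdef_nat[of l k p] cong_sym_eq[of k l p]
            by (auto simp: d_def)
          then show ?thesis using p by (metis coprime_commute coprime_power_left_iff prime_imp_coprime_nat)
        qed
        ultimately show False using coprime_powers_eq_1[OF _ z(1)] z(2) by blast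
      qed
      ultimately show ?thesis using cR[of ?w] False by simp
    qed
    have "(norm (\<Sum>k<?q. of_real (a k) * z ^ k))\<^sup>2
        = Re ((\<Sum>k<?q. of_real (a k) * z ^ k) * cnj (\<Sum>l<?q. of_real (a l) * z ^ l))"
      by (simp only: complex_norm_square[symmetric] of_real_power[symmetric] Re_complex_of_real)
    also have "\<dots> = (\<Sum>k<?q. \<Sum>l<?q. a k * a l * Re (z ^ k * cnj (z ^ l)))"
    proof -
      have "(\<Sum>k<?q. of_real (a k) * z ^ k) * cnj (\<Sum>l<?q. of_real (a l) * z ^ l)
          = (\<Sum>k<?q. \<Sum>l<?q. of_real (a k * a l) * (z ^ k * cnj (z ^ l)))"
        by (simp add: sum_product cnj_sum mult_ac)
      moreover have "Re (of_real r * w) = r * Re w" for r :: real and w :: complex by simp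
      ultimately show ?thesis by (simp only: Re_sum)
    qed
    also have "\<dots> \<le> (\<Sum>k<?q. \<Sum>l<?q. a k * a l * (if [k = l] (mod p) then 1 else c))"
      using zz a0 by (intro sum_mono mult_left_mono mult_nonneg_nonneg) auto
    also have "\<dots> = (\<Sum>k<?q. a k * (\<Sum>l<?q. a l * (c + (1 - c) * (if [k = l] (mod p) then 1 else 0))))"
      by (auto simp: sum_distrib_left mult_ac intro!: sum.cong)
    also have "\<dots> = (\<Sum>k<?q. a k * (c + (1 - c) * (\<Sum>l<?q. if [k = l] (mod p) then a l else 0)))"
    proof (intro sum.cong refl arg_cong2[where f="(*)"])
      fix k
      have "(\<Sum>l<?q. a l * (c + (1 - c) * (if [k = l] (mod p) then 1 else 0)))
         = (\<Sum>l<?q. a l * c + (1 - c) * (if [k = l] (mod p) then a l else 0))"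
        by (intro sum.cong) (auto simp: algebra_simps)
      also have "\<dots> = c + (1 - c) * (\<Sum>l<?q. if [k = l] (mod p) then a l else 0)"
        by (simp add: sum.distrib sum_distrib_right[symmetric] sum_distrib_left[symmetric] suma)
      finally show "(\<Sum>l<?q. a l * (c + (1 - c) * (if [k = l] (mod p) then 1 else 0))) = c + (1 - c) * (\<Sum>l<?q. if [k = l] (mod p) then a l else 0)" .
    qed
    also have "\<dots> \<le> (\<Sum>k<?q. a k * (c + (1 - c) * (1 - \<epsilon>)))"
    proof (intro sum_mono mult_left_mono add_left_mono)
      fix k
      have "(\<Sum>l<?q. if [k = l] (mod p) then a l else 0) = (\<Sum>l | l < ?q \<and> [k = l] (mod p). a l)"
        by (simp add: sum.If_cases Int_def lessThan_def)
      also have "\<dots> = prob {\<omega> \<in> space M. [k = nat (Y \<omega>)] (mod p)}" by (rule sumP)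
      also have "{\<omega> \<in> space M. [k = nat (Y \<omega>)] (mod p)} = {\<omega> \<in> space M. [Y \<omega> = int k] (mod int p)}"
      proof (intro Collect_cong conj_cong refl)
        fix \<omega> assume "\<omega> \<in> space M"
        then have "Y \<omega> = int (nat (Y \<omega>))" using Yq[of \<omega>] by simp
        then show "[k = nat (Y \<omega>)] (mod p) \<longleftrightarrow> [Y \<omega> = int k] (mod int p)"
          by (metis cong_int_iff cong_sym_eq)
      qed
      also have "prob \<dots> \<le> 1 - \<epsilon>" by (rule bal)
      finally show "(\<Sum>l<?q. if [k = l] (mod p) then a l else 0) \<le> 1 - \<epsilon>" .
    qed (use a0 c in auto)
    also have "\<dots> = 1 - (1 - c) * \<epsilon>"
      by (simp only: sum_distrib_right[symmetric] suma) (simp add: algebra_simps)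
    finally have "norm (\<Sum>k<?q. of_real (a k) * z ^ k) \<le> s"
      unfolding s_def by (rule real_le_rsqrt)
    then show "norm (\<integral>\<omega>. z ^ nat (Y \<omega>) \<partial>M) \<le> max (1 / 2) s" unfolding E by simp
  qed (use s1 in auto)
qed


section \<open>Column probabilities of a random matrix of residues\<close>

locale random_matrix = prob_space M for M :: "'w measure" +
  fixes n q :: nat and X :: "nat \<Rightarrow> nat \<Rightarrow> 'w \<Rightarrow> int"
  assumes q_pos: "q > 0"
    and indep: "indep_vars (\<lambda>_. count_space UNIV) (\<lambda>(i, j). X i j) ({1..n} \<times> {1..n})"
    and range: "\<And>i j \<omega>. i \<in> {1..n} \<Longrightarrow> j \<in> {1..n} \<Longrightarrow> \<omega> \<in> space M \<Longrightarrow> X i j \<omega> \<in> {0..<int q}"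
begin

definition col :: "nat \<Rightarrow> 'w \<Rightarrow> nat \<Rightarrow> int" where
  "col j \<omega> = (\<lambda>i\<in>{1..n}. X i j \<omega>)"

lemma measurable_X:
  "i \<in> {1..n} \<Longrightarrow> j \<in> {1..n} \<Longrightarrow> X i j \<in> measurable M (count_space UNIV)"
  using indep by (auto simp: indep_vars_def)

lemma col_closed: "j \<in> {1..n} \<Longrightarrow> \<omega> \<in> space M \<Longrightarrow> col j \<omega> \<in> carrier (zvec n q)"
  using range by (auto simp: col_def carrier_zvec[OF q_pos])

lemma event_X:
  assumes "finite J" "J \<subseteq> {1..n} \<times> {1..n}"
  shows "{\<omega> \<in> space M. \<forall>(i, j)\<in>J. P i j (X i j \<omega>)} \<in> events"
proof -
  have "{\<omega> \<in> space M. P i j (X i j \<omega>)} \<in> events" if "(i, j) \<in> J" for i j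
  proof -
    have "X i j \<in> measurable M (count_space UNIV)" using that assms by (intro measurable_X) auto
    from measurable_sets[OF this, of "{x. P i j x}"] show ?thesis
      by (simp add: vimage_def Int_def conj_commute)
  qed
  then have "{\<omega> \<in> space M. \<forall>x\<in>J. P (fst x) (snd x) (X (fst x) (snd x) \<omega>)} \<in> events"
    using assms(1) by (intro sets.sets_Collect_finite_All) auto
  then show ?thesis by (simp add: case_prod_unfold)
qed

text \<open>Every event depending only on the entries is a finite union of elementary events.\<close>

lemma event_matrix: "{\<omega> \<in> space M. P (\<lambda>(i, j)\<in>{1..n} \<times> {1..n}. X i j \<omega>)} \<in> events"
proof -
  let ?I = "{1..n} \<times> {1..n}"
  let ?R = "{r \<in> ?I \<rightarrow>\<^sub>E {0..<int q}. P r}"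
  have "{\<omega> \<in> space M. P (\<lambda>(i, j)\<in>?I. X i j \<omega>)} = (\<Union>r\<in>?R. {\<omega> \<in> space M. \<forall>(i, j)\<in>?I. X i j \<omega> = r (i, j)})"
  proof safe
    fix \<omega> assume \<omega>: "\<omega> \<in> space M" and P: "P (\<lambda>(i, j)\<in>?I. X i j \<omega>)"
    have "(\<lambda>(i, j)\<in>?I. X i j \<omega>) \<in> ?R" using P range[OF _ _ \<omega>] by auto
    then show "\<omega> \<in> (\<Union>r\<in>?R. {\<omega> \<in> space M. \<forall>(i, j)\<in>?I. X i j \<omega> = r (i, j)})"
      using \<omega> by (intro UN_I[of "\<lambda>(i, j)\<in>?I. X i j \<omega>"]) auto
  next
    fix \<omega> r assume r: "r \<in> ?I \<rightarrow>\<^sub>E {0..<int q}" "P r" and eq: "\<forall>(i, j)\<in>?I. X i j \<omega> = r (i, j)"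
    have "(\<lambda>(i, j)\<in>?I. X i j \<omega>) = r"
      using r(1) eq by (intro extensionalityI[of _ ?I]) (auto simp: PiE_iff)
    then show "P (\<lambda>(i, j)\<in>?I. X i j \<omega>)" using r by simp
  qed
  also have "\<dots> \<in> events"
  proof (intro sets.finite_UN)
    show "finite ?R" by (rule finite_subset[of _ "?I \<rightarrow>\<^sub>E {0..<int q}"]) (auto intro!: finite_PiE)
    show "{\<omega> \<in> space M. \<forall>(i, j)\<in>?I. X i j \<omega> = r (i, j)} \<in> events" for r
      by (rule event_X) auto
  qed
  finally show ?thesis .
qed

lemma event_cols: "{\<omega> \<in> space M. P (\<lambda>j\<in>{1..n}. col j \<omega>)} \<in> events"
proof -
  have "{\<omega> \<in> space M. P (\<lambda>j\<in>{1..n}. col j \<omega>)}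
    = {\<omega> \<in> space M. (\<lambda>r. P (\<lambda>j\<in>{1..n}. \<lambda>i\<in>{1..n}. r (i, j))) (\<lambda>(i, j)\<in>{1..n} \<times> {1..n}. X i j \<omega>)}"
    by (intro Collect_cong conj_cong refl arg_cong[where f = P]) (auto simp: col_def intro!: restrict_ext)
  then show ?thesis using event_matrix[of "\<lambda>r. P (\<lambda>j\<in>{1..n}. \<lambda>i\<in>{1..n}. r (i, j))"] by simp
qed

lemma event_cols_in: "{\<omega> \<in> space M. \<forall>j\<in>{1..n}. col j \<omega> \<in> H} \<in> events"
proof -
  have "{\<omega> \<in> space M. \<forall>j\<in>{1..n}. col j \<omega> \<in> H} = {\<omega> \<in> space M. (\<lambda>c. \<forall>j\<in>{1..n}. c j \<in> H) (\<lambda>j\<in>{1..n}. col j \<omega>)}"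
    by auto
  then show ?thesis using event_cols[of "\<lambda>c. \<forall>j\<in>{1..n}. c j \<in> H"] by simp
qed

text \<open>The sum of the annihilator of \<open>H\<close> at \<open>v\<close> is \<open>N\<close>
  times the indicator of \<open>H\<close>. The product over the columns is expanded, each character
  is split along the unit vectors, and independence moves the expectation into the product over all
  entries.\<close>

lemma prob_cols_fourier:
  assumes H: "subgroup H (zvec n q)" and N: "card H * N = q ^ n"
  shows "complex_of_real (prob {\<omega> \<in> space M. \<forall>j\<in>{1..n}. col j \<omega> \<in> H}) =
    (\<Sum>u \<in> {1..n} \<rightarrow>\<^sub>E annihilator (zvec n q) H.
      \<Prod>(i, j)\<in>{1..n} \<times> {1..n}. \<integral>\<omega>. u j (unit_vec n q i) ^ nat (X i j \<omega>) \<partial>M) / of_nat N ^ n"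
proof -
  interpret G: finite_comm_group "zvec n q" by (rule finite_comm_group_zvec[OF q_pos])
  let ?U = "annihilator (zvec n q) H" and ?e = "unit_vec n q" and ?I = "{1..n} \<times> {1..n}"
  have finU: "finite ?U" by (rule G.finite_annihilator)
  have cH: "card H > 0" using N q_pos by (cases "card H") auto
  have "card ?U * card H = q ^ n" using G.card_annihilator[OF H] by (simp add: order_zvec[OF q_pos])
  then have cU: "card ?U = N" using N cH by (metis mult.commute mult_cancel_right less_not_refl2)
  have N0: "N > 0" using N q_pos by (cases N) auto
  have integ: "integrable M (\<lambda>\<omega>. u j (?e i) ^ nat (X i j \<omega>))"
    and meas: "(\<lambda>\<omega>. u j (?e i) ^ nat (X i j \<omega>)) \<in> borel_measurable M"
    if u: "u \<in> {1..n} \<rightarrow>\<^sub>E ?U" and ij: "i \<in> {1..n}" "j \<in> {1..n}" for u i j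
  proof -
    show meas: "(\<lambda>\<omega>. u j (?e i) ^ nat (X i j \<omega>)) \<in> borel_measurable M"
      using measurable_compose[OF measurable_X[OF ij], of "\<lambda>x. u j (?e i) ^ nat x" borel] by simp
    have "u j \<in> ?U" using u ij by auto
    then have "norm (u j (?e i)) = 1"
      by (intro G.norm_char unit_vec_closed[OF q_pos]) (auto simp: annihilator_def)
    then show "integrable M (\<lambda>\<omega>. u j (?e i) ^ nat (X i j \<omega>))"
      using meas by (intro integrable_const_bound[of _ 1]) (auto simp: norm_power)
  qed
  have ind: "indicator {\<omega> \<in> space M. \<forall>j\<in>{1..n}. col j \<omega> \<in> H} \<omega>
     = (\<Sum>u \<in> {1..n} \<rightarrow>\<^sub>E ?U. \<Prod>(i, j)\<in>?I. u j (?e i) ^ nat (X i j \<omega>)) / (of_nat N ^ n :: complex)"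
    if \<omega>: "\<omega> \<in> space M" for \<omega>
  proof -
    have "(\<Sum>u \<in> {1..n} \<rightarrow>\<^sub>E ?U. \<Prod>(i, j)\<in>?I. u j (?e i) ^ nat (X i j \<omega>))
        = (\<Sum>u \<in> {1..n} \<rightarrow>\<^sub>E ?U. \<Prod>j\<in>{1..n}. u j (col j \<omega>))"
    proof (rule sum.cong[OF refl])
      fix u assume u: "u \<in> {1..n} \<rightarrow>\<^sub>E ?U"
      have "(\<Prod>j\<in>{1..n}. u j (col j \<omega>)) = (\<Prod>j\<in>{1..n}. \<Prod>i\<in>{1..n}. u j (?e i) ^ nat (X i j \<omega>))"
      proof (rule prod.cong[OF refl])
        fix j assume j: "j \<in> {1..n}"
        have "u j \<in> characters (zvec n q)" using u j by (auto simp: annihilator_def)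
        from char_zvec[OF q_pos this col_closed[OF j \<omega>]]
        show "u j (col j \<omega>) = (\<Prod>i\<in>{1..n}. u j (?e i) ^ nat (X i j \<omega>))" by (simp add: col_def)
      qed
      also have "\<dots> = (\<Prod>i\<in>{1..n}. \<Prod>j\<in>{1..n}. u j (?e i) ^ nat (X i j \<omega>))" by (rule prod.swap)
      also have "\<dots> = (\<Prod>(i, j)\<in>?I. u j (?e i) ^ nat (X i j \<omega>))" by (rule prod.cartesian_product)
      finally show "(\<Prod>(i, j)\<in>?I. u j (?e i) ^ nat (X i j \<omega>)) = (\<Prod>j\<in>{1..n}. u j (col j \<omega>))" by simp
    qed
    also have "\<dots> = (\<Prod>j\<in>{1..n}. \<Sum>\<psi>\<in>?U. \<psi> (col j \<omega>))"
      using finU by (subst prod_sum_PiE) auto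
    also have "\<dots> = (\<Prod>j\<in>{1..n}. if col j \<omega> \<in> H then of_nat N else 0)"
      using G.sum_annihilator_subgroup[OF H] col_closed[OF _ \<omega>] cU by (intro prod.cong) auto
    also have "\<dots> = (if \<forall>j\<in>{1..n}. col j \<omega> \<in> H then of_nat N ^ n else 0)"
    proof (cases "\<forall>j\<in>{1..n}. col j \<omega> \<in> H")
      case True
      then have "(\<Prod>j\<in>{1..n}. if col j \<omega> \<in> H then of_nat N else 0 :: complex) = (\<Prod>j\<in>{1..n}. of_nat N)"
        by (intro prod.cong) auto
      then show ?thesis by (simp only: if_P[OF True] prod_constant card_atLeastAtMost) simp
    next
      case False
      then have "(\<Prod>j\<in>{1..n}. if col j \<omega> \<in> H then of_nat N else 0 :: complex) = 0"
        by (intro prod_zero) auto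
      then show ?thesis by (simp only: if_not_P[OF False])
    qed
    finally show ?thesis using \<omega> N0 by (auto simp: indicator_def)
  qed
  have "complex_of_real (prob {\<omega> \<in> space M. \<forall>j\<in>{1..n}. col j \<omega> \<in> H})
      = (\<integral>\<omega>. indicator {\<omega> \<in> space M. \<forall>j\<in>{1..n}. col j \<omega> \<in> H} \<omega> \<partial>M)"
  proof -
    let ?A = "{\<omega> \<in> space M. \<forall>j\<in>{1..n}. col j \<omega> \<in> H}"
    have "(\<integral>\<omega>. indicator ?A \<omega> \<partial>M) = (\<integral>\<omega>. complex_of_real (indicator ?A \<omega>) \<partial>M)"
      by (simp only: of_real_indicator)
    also have "\<dots> = complex_of_real (\<integral>\<omega>. indicator ?A \<omega> \<partial>M)" by (rule integral_complex_of_real)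
    also have "(\<integral>\<omega>. indicator ?A \<omega> \<partial>M) = prob (?A \<inter> space M)" by simp
    also have "?A \<inter> space M = ?A" by auto
    finally show ?thesis by simp
  qed
  also have "\<dots> = (\<integral>\<omega>. (\<Sum>u \<in> {1..n} \<rightarrow>\<^sub>E ?U. \<Prod>(i, j)\<in>?I. u j (?e i) ^ nat (X i j \<omega>)) / (of_nat N ^ n :: complex) \<partial>M)"
    using ind by (intro Bochner_Integration.integral_cong refl) auto
  also have "\<dots> = (\<integral>\<omega>. (\<Sum>u \<in> {1..n} \<rightarrow>\<^sub>E ?U. \<Prod>(i, j)\<in>?I. u j (?e i) ^ nat (X i j \<omega>)) \<partial>M) / of_nat N ^ n"
    by simp
  also have "(\<integral>\<omega>. (\<Sum>u \<in> {1..n} \<rightarrow>\<^sub>E ?U. \<Prod>(i, j)\<in>?I. u j (?e i) ^ nat (X i j \<omega>)) \<partial>M)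
     = (\<Sum>u \<in> {1..n} \<rightarrow>\<^sub>E ?U. \<Prod>(i, j)\<in>?I. \<integral>\<omega>. u j (?e i) ^ nat (X i j \<omega>) \<partial>M)"
  proof -
    have iv: "indep_vars (\<lambda>_. borel) (\<lambda>x \<omega>. u (snd x) (?e (fst x)) ^ nat (X (fst x) (snd x) \<omega>)) ?I"
      if u: "u \<in> {1..n} \<rightarrow>\<^sub>E ?U" for u
      using indep_vars_compose2[OF indep, of "\<lambda>x y. u (snd x) (?e (fst x)) ^ nat y" "\<lambda>_. borel"]
      by (simp add: case_prod_unfold)
    have int': "integrable M (\<lambda>\<omega>. u (snd x) (?e (fst x)) ^ nat (X (fst x) (snd x) \<omega>))"
      if "u \<in> {1..n} \<rightarrow>\<^sub>E ?U" "x \<in> ?I" for u x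
      using integ[OF that(1), of "fst x" "snd x"] that(2) by auto
    have "(\<integral>\<omega>. (\<Sum>u \<in> {1..n} \<rightarrow>\<^sub>E ?U. \<Prod>x\<in>?I. u (snd x) (?e (fst x)) ^ nat (X (fst x) (snd x) \<omega>)) \<partial>M)
       = (\<Sum>u \<in> {1..n} \<rightarrow>\<^sub>E ?U. \<integral>\<omega>. (\<Prod>x\<in>?I. u (snd x) (?e (fst x)) ^ nat (X (fst x) (snd x) \<omega>)) \<partial>M)"
      by (intro Bochner_Integration.integral_sum indep_vars_integrable iv int') auto
    also have "\<dots> = (\<Sum>u \<in> {1..n} \<rightarrow>\<^sub>E ?U. \<Prod>x\<in>?I. \<integral>\<omega>. u (snd x) (?e (fst x)) ^ nat (X (fst x) (snd x) \<omega>) \<partial>M)"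
      by (intro sum.cong refl indep_vars_lebesgue_integral iv int') auto
    finally show ?thesis by (simp add: case_prod_unfold)
  qed
  finally show ?thesis .
qed


text \<open>The family of trivial characters contributes exactly the main term
  \<open>1 / N ^ n\<close>; in every other family each band position with nontrivial value gains a
  factor \<rho>.\<close>

lemma prob_cols_error:
  assumes H: "subgroup H (zvec n q)" and N: "card H * N = q ^ n" and \<rho>: "0 < \<rho>" "\<rho> < 1"
    and bd: "\<And>i j (z :: complex). i \<in> {1..n} \<Longrightarrow> j \<in> {1..n} \<Longrightarrow> i \<le> j + w \<Longrightarrow> j \<le> i + w \<Longrightarrow> z ^ q = 1 \<Longrightarrow> z \<noteq> 1 \<Longrightarrow>
      norm (\<integral>\<omega>. z ^ nat (X i j \<omega>) \<partial>M) \<le> \<rho>"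
  shows "\<bar>prob {\<omega> \<in> space M. \<forall>j\<in>{1..n}. col j \<omega> \<in> H} - 1 / real N ^ n\<bar> \<le>
    (\<Sum>u \<in> ({1..n} \<rightarrow>\<^sub>E annihilator (zvec n q) H) - {\<lambda>j\<in>{1..n}. trivial_char (zvec n q)}.
      \<rho> ^ card {(i, j) \<in> {1..n} \<times> {1..n}. i \<le> j + w \<and> j \<le> i + w \<and> u j (unit_vec n q i) \<noteq> 1}) / real N ^ n"
proof -
  interpret G: finite_comm_group "zvec n q" by (rule finite_comm_group_zvec[OF q_pos])
  let ?U = "annihilator (zvec n q) H" and ?e = "unit_vec n q" and ?I = "{1..n} \<times> {1..n}"
  let ?triv = "\<lambda>j\<in>{1..n}. trivial_char (zvec n q)"
  define T where "T u = (\<Prod>(i, j)\<in>?I. \<integral>\<omega>. u j (?e i) ^ nat (X i j \<omega>) \<partial>M)" for u :: "nat \<Rightarrow> (nat \<Rightarrow> int) \<Rightarrow> complex"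
  have fin: "finite ({1..n} \<rightarrow>\<^sub>E ?U)" by (intro finite_PiE G.finite_annihilator) auto
  have e: "?e i \<in> carrier (zvec n q)" for i by (rule unit_vec_closed[OF q_pos])
  have triv: "?triv \<in> {1..n} \<rightarrow>\<^sub>E ?U"
    using G.trivial_char subgroup.subset[OF H] by (auto simp: annihilator_def)
  have Ttriv: "T ?triv = 1"
  proof -
    have "(\<integral>\<omega>. ?triv j (?e i) ^ nat (X i j \<omega>) \<partial>M) = 1" if "j \<in> {1..n}" for i j
      using that e by (simp add: prob_space)
    then show ?thesis unfolding T_def by (intro prod.neutral) auto
  qed
  have Tle: "norm (T u) \<le> \<rho> ^ card {(i, j) \<in> ?I. i \<le> j + w \<and> j \<le> i + w \<and> u j (?e i) \<noteq> 1}" (is "_ \<le> \<rho> ^ card ?S")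
    if u: "u \<in> {1..n} \<rightarrow>\<^sub>E ?U" for u
  proof -
    have uch: "u j \<in> characters (zvec n q)" if "j \<in> {1..n}" for j using u that by (auto simp: annihilator_def)
    have "norm (T u) = (\<Prod>x\<in>?I. norm (\<integral>\<omega>. u (snd x) (?e (fst x)) ^ nat (X (fst x) (snd x) \<omega>) \<partial>M))"
      unfolding T_def case_prod_unfold by (rule prod_norm[symmetric])
    also have "\<dots> \<le> (\<Prod>x\<in>?I. if x \<in> ?S then \<rho> else 1)"
    proof (intro prod_mono conjI)
      fix x assume x: "x \<in> ?I"
      obtain i j where ij: "x = (i, j)" "i \<in> {1..n}" "j \<in> {1..n}" using x by auto
      have n1: "norm (u j (?e i)) = 1" using G.norm_char[OF uch[OF ij(3)] e] .
      show "norm (\<integral>\<omega>. u (snd x) (?e (fst x)) ^ nat (X (fst x) (snd x) \<omega>) \<partial>M) \<le> (if x \<in> ?S then \<rho> else 1)"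
      proof (cases "x \<in> ?S")
        case True
        moreover have "u j (?e i) ^ q = 1"
        proof -
          have "?e i [^]\<^bsub>zvec n q\<^esub> q = \<one>\<^bsub>zvec n q\<^esub>" by (simp add: pow_zvec[OF q_pos] one_zvec[OF q_pos])
          then show ?thesis using G.char_pow[OF uch[OF ij(3)] e, of i q] G.char_one[OF uch[OF ij(3)]] by simp
        qed
        ultimately show ?thesis using bd[OF ij(2,3), of "u j (?e i)"] ij by auto
      next
        \<comment> \<open>Outside the band, or where the character is 1 on the unit vector, the
          factor is bounded by 1.\<close>
        case False
        have "norm (\<integral>\<omega>. u j (?e i) ^ nat (X i j \<omega>) \<partial>M) \<le> (\<integral>\<omega>. norm (u j (?e i) ^ nat (X i j \<omega>)) \<partial>M)"
          by (rule integral_norm_bound)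
        also have "\<dots> = 1" using n1 by (simp add: norm_power prob_space)
        finally show ?thesis unfolding if_not_P[OF False] by (simp add: ij)
      qed
    qed auto
    also have "\<dots> = \<rho> ^ card ?S"
    proof -
      have "?I \<inter> ?S = ?S" by auto
      then show ?thesis by (simp add: prod.If_cases)
    qed
    finally show ?thesis .
  qed
  have N0: "N > 0" using N q_pos by (cases N) auto
  have "complex_of_real (prob {\<omega> \<in> space M. \<forall>j\<in>{1..n}. col j \<omega> \<in> H} - 1 / real N ^ n)
      = (\<Sum>u \<in> {1..n} \<rightarrow>\<^sub>E ?U. T u) / of_nat N ^ n - 1 / of_nat N ^ n"
    using prob_cols_fourier[OF H N] by (simp add: T_def)
  also have "(\<Sum>u \<in> {1..n} \<rightarrow>\<^sub>E ?U. T u) = 1 + (\<Sum>u \<in> ({1..n} \<rightarrow>\<^sub>E ?U) - {?triv}. T u)"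
    using Ttriv by (subst sum.remove[OF fin triv]) simp
  finally have eq: "complex_of_real (prob {\<omega> \<in> space M. \<forall>j\<in>{1..n}. col j \<omega> \<in> H} - 1 / real N ^ n)
      = (\<Sum>u \<in> ({1..n} \<rightarrow>\<^sub>E ?U) - {?triv}. T u) / of_nat N ^ n"
    by (simp add: add_divide_distrib)
  have "\<bar>prob {\<omega> \<in> space M. \<forall>j\<in>{1..n}. col j \<omega> \<in> H} - 1 / real N ^ n\<bar>
      = norm ((\<Sum>u \<in> ({1..n} \<rightarrow>\<^sub>E ?U) - {?triv}. T u) / of_nat N ^ n)"
    unfolding eq[symmetric] norm_of_real ..
  also have "\<dots> = norm (\<Sum>u \<in> ({1..n} \<rightarrow>\<^sub>E ?U) - {?triv}. T u) / real N ^ n"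
    by (simp add: norm_divide norm_power)
  also have "\<dots> \<le> (\<Sum>u \<in> ({1..n} \<rightarrow>\<^sub>E ?U) - {?triv}. \<rho> ^ card {(i, j) \<in> ?I. i \<le> j + w \<and> j \<le> i + w \<and> u j (?e i) \<noteq> 1}) / real N ^ n"
    by (intro divide_right_mono order_trans[OF norm_sum] sum_mono Tle) auto
  finally show ?thesis .
qed

end

lemma abs_diff_le_bandwidth:
  assumes "i \<le> j + bandwidth \<delta> n" "j \<le> i + bandwidth \<delta> n"
  shows "\<bar>real i - real j\<bar> \<le> ln (real n) powr (1 + \<delta>)"
proof -
  have "real (bandwidth \<delta> n) \<le> ln (real n) powr (1 + \<delta>)"
    by (simp add: bandwidth_def)
  moreover have "real i \<le> real j + real (bandwidth \<delta> n)" "real j \<le> real i + real (bandwidth \<delta> n)"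
    using assms by linarith+
  ultimately show ?thesis by linarith
qed

text \<open>The subgroups are grouped by the finite model of their quotient. Within one group a
  subgroup is determined by the labels of the unit vectors, so the sum of the error bounds becomes
  part of the weight of one fixed pairing, to which \<open>weight_nondegenerate_tendsto\<close>
  applies.\<close>

theorem sum_prob_cols_error_tendsto:
  fixes \<Omega> :: "nat \<Rightarrow> 'w measure" and X :: "nat \<Rightarrow> nat \<Rightarrow> nat \<Rightarrow> 'w \<Rightarrow> int"
  assumes p: "prime p" and K: "K > 0" and \<epsilon>: "\<epsilon> > 0" and \<delta>: "\<delta> > 0"
    and rm: "\<And>n. n \<ge> 1 \<Longrightarrow> random_matrix (\<Omega> n) n (p ^ K) (X n)"
    and bal: "\<And>n i j t. n \<ge> 1 \<Longrightarrow> i \<in> {1..n} \<Longrightarrow> j \<in> {1..n} \<Longrightarrow>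
      \<bar>real i - real j\<bar> \<le> ln (real n) powr (1 + \<delta>) \<Longrightarrow>
      measure (\<Omega> n) {\<omega> \<in> space (\<Omega> n). [X n i j \<omega> = t] (mod int p)} \<le> 1 - \<epsilon>"
  shows "(\<lambda>n. \<Sum>H | subgroup H (zvec n (p ^ K)) \<and> card H * N = (p ^ K) ^ n.
      \<bar>measure (\<Omega> n) {\<omega> \<in> space (\<Omega> n). \<forall>j\<in>{1..n}. random_matrix.col n (X n) j \<omega> \<in> H} - 1 / real N ^ n\<bar>) \<longlonglongrightarrow> 0"
proof -
  define q where "q = p ^ K"
  have q: "q > 0" using p prime_gt_0_nat by (simp add: q_def)
  let ?e = "unit_vec"
  define \<H> where "\<H> n = {H. subgroup H (zvec n q) \<and> card H * N = q ^ n}" for n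
  define err where "err n H = \<bar>measure (\<Omega> n) {\<omega> \<in> space (\<Omega> n). \<forall>j\<in>{1..n}. random_matrix.col n (X n) j \<omega> \<in> H} - 1 / real N ^ n\<bar>" for n H
  obtain \<rho> :: real where \<rho>: "0 < \<rho>" "\<rho> < 1" and \<rho>b:
    "\<And>(M :: 'w measure) Y (z :: complex). prob_space M \<Longrightarrow> Y \<in> measurable M (count_space (UNIV :: int set)) \<Longrightarrow>
       (\<And>\<omega>. \<omega> \<in> space M \<Longrightarrow> Y \<omega> \<in> {0..<int (p ^ K)}) \<Longrightarrow>
       (\<And>t :: int. measure M {\<omega> \<in> space M. [Y \<omega> = t] (mod int p)} \<le> 1 - \<epsilon>) \<Longrightarrow>
       z ^ (p ^ K) = 1 \<Longrightarrow> z \<noteq> 1 \<Longrightarrow>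
       norm (\<integral>\<omega>. z ^ nat (Y \<omega>) \<partial>M) \<le> \<rho>"
    using balanced_char_bound[OF p K \<epsilon>] by blast
  have fin\<H>: "finite (\<H> n)" for n
  proof -
    interpret finite_comm_group "zvec n q" by (rule finite_comm_group_zvec[OF q])
    show ?thesis by (rule finite_subset[of _ "Pow (carrier (zvec n q))"]) (auto simp: \<H>_def dest: subgroup.subset)
  qed
  define good where "good n H Q c orth tab \<longleftrightarrow>
    Q \<in> carrier (zvec n q) \<rightarrow> {..<N} \<and> tab \<in> {..<N} \<times> {..<N} \<rightarrow>\<^sub>E {..<N} \<and>
    (\<forall>x\<in>carrier (zvec n q). \<forall>y\<in>carrier (zvec n q). Q (x \<otimes>\<^bsub>zvec n q\<^esub> y) = tab (Q x, Q y)) \<and>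
    (\<forall>x\<in>carrier (zvec n q). Q x = Q \<one>\<^bsub>zvec n q\<^esub> \<longleftrightarrow> x \<in> H) \<and>
    bij_betw c {..<N} (annihilator (zvec n q) H) \<and> c 0 = trivial_char (zvec n q) \<and>
    orth \<subseteq> {..<N} \<times> {..<N} \<and>
    (\<forall>x\<in>carrier (zvec n q). \<forall>t<N. (Q x, t) \<in> orth \<longleftrightarrow> c t x = 1) \<and>
    (\<forall>S T. S \<subseteq> {..<N} \<longrightarrow> T \<subseteq> {..<N} \<longrightarrow> (\<forall>s\<in>S. \<forall>t\<in>T. (s, t) \<in> orth) \<longrightarrow> card S * card T \<le> N)"
    for n H and Q :: "(nat \<Rightarrow> int) \<Rightarrow> nat" and c orth tab
  have "\<exists>Q c orth tab. good n H Q c orth tab" if "H \<in> \<H> n" for n H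
  proof -
    interpret finite_comm_group "zvec n q" by (rule finite_comm_group_zvec[OF q])
    have H: "subgroup H (zvec n q)" and N: "card H * N = order (zvec n q)"
      using that by (auto simp: \<H>_def order_zvec[OF q])
    show ?thesis
    proof (rule quotient_pairing[OF H N])
      fix Q c orth tab
      assume a1: "Q \<in> carrier (zvec n q) \<rightarrow> {..<N}" and a2: "tab \<in> {..<N} \<times> {..<N} \<rightarrow>\<^sub>E {..<N}"
        and a3: "\<And>x y. x \<in> carrier (zvec n q) \<Longrightarrow> y \<in> carrier (zvec n q) \<Longrightarrow> Q (x \<otimes>\<^bsub>zvec n q\<^esub> y) = tab (Q x, Q y)"
        and a4: "\<And>x. x \<in> carrier (zvec n q) \<Longrightarrow> Q x = Q \<one>\<^bsub>zvec n q\<^esub> \<longleftrightarrow> x \<in> H"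
        and a5: "bij_betw c {..<N} (annihilator (zvec n q) H)" and a6: "c 0 = trivial_char (zvec n q)"
        and a7: "orth \<subseteq> {..<N} \<times> {..<N}"
        and a8: "\<And>x t. x \<in> carrier (zvec n q) \<Longrightarrow> t < N \<Longrightarrow> (Q x, t) \<in> orth \<longleftrightarrow> c t x = 1"
        and a9: "\<And>S T. S \<subseteq> {..<N} \<Longrightarrow> T \<subseteq> {..<N} \<Longrightarrow> (\<And>s t. s \<in> S \<Longrightarrow> t \<in> T \<Longrightarrow> (s, t) \<in> orth) \<Longrightarrow> card S * card T \<le> N"
      have "good n H Q c orth tab"
        unfolding good_def
      proof (intro conjI ballI allI impI)
        show "card S * card T \<le> N" if "S \<subseteq> {..<N}" "T \<subseteq> {..<N}" "\<forall>s\<in>S. \<forall>t\<in>T. (s, t) \<in> orth" for S T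
          using that by (intro a9) auto
      qed (fact a1 a2 a3 a4 a5 a6 a7 a8)+
      then show ?thesis by blast
    qed
  qed
  then have ex: "\<exists>x. good n H (fst x) (fst (snd x)) (fst (snd (snd x))) (snd (snd (snd x)))" if "H \<in> \<H> n" for n H
    using that by fastforce
  define F where "F n H = (SOME x. good n H (fst x) (fst (snd x)) (fst (snd (snd x))) (snd (snd (snd x))))" for n H
  define Q c orth tab where "Q n H = fst (F n H)" and "c n H = fst (snd (F n H))"
    and "orth n H = fst (snd (snd (F n H)))" and "tab n H = snd (snd (snd (F n H)))" for n H
  have good: "good n H (Q n H) (c n H) (orth n H) (tab n H)" if "H \<in> \<H> n" for n H
    unfolding Q_def c_def orth_def tab_def F_def by (rule someI_ex[OF ex[OF that]])
  \<comment> \<open>These three components fix the pairing and make the labelling recoverable from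
    the unit vectors; the set \<D> of their values is finite and the same for all
    \<open>n\<close>.\<close>
  define data where "data n H = (tab n H, Q n H \<one>\<^bsub>zvec n q\<^esub>, orth n H)" for n H
  define \<D> where "\<D> = ({..<N} \<times> {..<N} \<rightarrow>\<^sub>E {..<N}) \<times> {..<N} \<times> Pow ({..<N} \<times> {..<N})"
  have fin\<D>: "finite \<D>" unfolding \<D>_def by (auto intro!: finite_PiE)
  have data: "data n ` \<H> n \<subseteq> \<D>" for n
  proof
    fix D assume "D \<in> data n ` \<H> n"
    then obtain H where H: "H \<in> \<H> n" "D = data n H" by auto
    have "\<one>\<^bsub>zvec n q\<^esub> \<in> carrier (zvec n q)" using group_zvec[OF q] by (simp add: group.is_monoid)
    moreover have "Q n H \<in> carrier (zvec n q) \<rightarrow> {..<N}" "tab n H \<in> {..<N} \<times> {..<N} \<rightarrow>\<^sub>E {..<N}"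
      "orth n H \<subseteq> {..<N} \<times> {..<N}"
      using good[OF H(1)] unfolding good_def by - (elim conjE, assumption)+
    ultimately show "D \<in> \<D>" unfolding H(2) data_def \<D>_def by auto
  qed
  have each: "(\<lambda>n. \<Sum>H | H \<in> \<H> n \<and> data n H = D. err n H) \<longlonglongrightarrow> 0" for D
  proof (cases "\<exists>n H. H \<in> \<H> n \<and> data n H = D")
    case False
    then have "{H. H \<in> \<H> n \<and> data n H = D} = {}" for n by auto
    then show ?thesis by (simp only: sum.empty tendsto_const)
  next
    case True
    obtain tb on orr where D: "D = (tb, on, orr)" by (cases D) auto
    obtain n0 H0 where n0: "H0 \<in> \<H> n0" "data n0 H0 = D" using True by blast
    have orr: "orr = orth n0 H0" using n0(2) by (simp add: D data_def)
    have N0: "N > 0" using n0(1) q by (cases N) (auto simp: \<H>_def)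
    \<comment> \<open>One witness \<open>(n0, H0)\<close> establishes the axioms for the relation
      \<open>orr\<close>; the interpretation is then free of \<open>n\<close>, as the passage to the
      limit requires.\<close>
    interpret pb: pairing_bound "{..<N}" "{..<N}" "\<lambda>a t. (a, t) \<in> orr" N \<rho>
    proof
      show "card S * card T \<le> N" if "S \<subseteq> {..<N}" "T \<subseteq> {..<N}" "\<And>s t. s \<in> S \<Longrightarrow> t \<in> T \<Longrightarrow> (s, t) \<in> orr" for S T
      proof -
        have "\<forall>S T. S \<subseteq> {..<N} \<longrightarrow> T \<subseteq> {..<N} \<longrightarrow> (\<forall>s\<in>S. \<forall>t\<in>T. (s, t) \<in> orr) \<longrightarrow> card S * card T \<le> N"
          using good[OF n0(1)] unfolding good_def orr by (elim conjE)
        then show ?thesis using that by simp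
      qed
    qed (use N0 \<rho> in auto)
    let ?W = "\<lambda>n. pb.weight (bandwidth \<delta> n) {1..n} (\<lambda>f \<psi>. pb.annX f {1..n} \<subseteq> {0} \<and> (\<exists>j\<in>{1..n}. \<psi> j \<noteq> 0))"
    have "(\<Sum>H | H \<in> \<H> n \<and> data n H = D. err n H) \<le> ?W n" if n: "n \<ge> 1" for n
    proof -
      interpret random_matrix "\<Omega> n" n q "X n" using rm[OF n] by (simp add: q_def)
      interpret G: finite_comm_group "zvec n q" by (rule finite_comm_group_zvec[OF q])
      have e: "unit_vec n q i \<in> carrier (zvec n q)" for i by (rule unit_vec_closed[OF q])
      define f where "f H = (\<lambda>i\<in>{1..n}. Q n H (unit_vec n q i))" for H
      let ?B = "{H. H \<in> \<H> n \<and> data n H = D}"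
      have fH: "f H \<in> {1..n} \<rightarrow>\<^sub>E {..<N}" if "H \<in> ?B" for H
      proof -
        have "good n H (Q n H) (c n H) (orth n H) (tab n H)" using good that by blast
        then have "Q n H \<in> carrier (zvec n q) \<rightarrow> {..<N}" unfolding good_def by (elim conjE)
        then show ?thesis using e by (auto simp: f_def)
      qed
      \<comment> \<open>Equal tables, equal labels of the unit and equal labels of the unit vectors
        give equal labellings, and the subgroup is the fibre over the unit.\<close>
      have inj: "inj_on f ?B"
      proof (rule inj_onI)
        fix H H' assume H: "H \<in> ?B" and H': "H' \<in> ?B" and ff: "f H = f H'"
        have one: "Q n H \<one>\<^bsub>zvec n q\<^esub> = Q n H' \<one>\<^bsub>zvec n q\<^esub>" and tab: "tab n H = tab n H'"
          using H H' by (auto simp: data_def D)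
        have hom: "\<forall>x\<in>carrier (zvec n q). \<forall>y\<in>carrier (zvec n q). Q n J (x \<otimes>\<^bsub>zvec n q\<^esub> y) = tab n J (Q n J x, Q n J y)"
          and ker: "\<forall>x\<in>carrier (zvec n q). Q n J x = Q n J \<one>\<^bsub>zvec n q\<^esub> \<longleftrightarrow> x \<in> J" if "J \<in> ?B" for J
        proof -
          have "good n J (Q n J) (c n J) (orth n J) (tab n J)" using good that by blast
          then show "\<forall>x\<in>carrier (zvec n q). \<forall>y\<in>carrier (zvec n q). Q n J (x \<otimes>\<^bsub>zvec n q\<^esub> y) = tab n J (Q n J x, Q n J y)"
            "\<forall>x\<in>carrier (zvec n q). Q n J x = Q n J \<one>\<^bsub>zvec n q\<^esub> \<longleftrightarrow> x \<in> J"
            unfolding good_def by - (elim conjE, assumption)+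
        qed
        have eq: "Q n H v = Q n H' v" if "v \<in> carrier (zvec n q)" for v
        proof (rule zvec_hom_eqI[where Q = "Q n H" and Q' = "Q n H'", OF q that one, where tab = "\<lambda>x y. tab n H (x, y)"])
          show "Q n H (unit_vec n q i) = Q n H' (unit_vec n q i)" if "i \<in> {1..n}" for i
            using fun_cong[OF ff, of i] that by (simp add: f_def)
        qed (use hom[OF H] hom[OF H'] tab in simp_all)
        have sub: "H \<subseteq> carrier (zvec n q)" "H' \<subseteq> carrier (zvec n q)"
          using H H' by (auto simp: \<H>_def dest: subgroup.subset)
        have "v \<in> H \<longleftrightarrow> v \<in> H'" if "v \<in> carrier (zvec n q)" for v
          unfolding bspec[OF ker[OF H] that, symmetric] bspec[OF ker[OF H'] that, symmetric] eq[OF that] one ..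
        then show "H = H'" using sub by blast
      qed
      \<comment> \<open>The inner sum of the weight for fixed \<open>F\<close>; it is 0 for
        degenerate \<open>F\<close>, so the sum may be enlarged to all \<open>F\<close>
        afterwards.\<close>
      define g where "g F = (\<Sum>\<psi> | \<psi> \<in> {1..n} \<rightarrow>\<^sub>E {..<N} \<and> (pb.annX F {1..n} \<subseteq> {0} \<and> (\<exists>j\<in>{1..n}. \<psi> j \<noteq> 0)).
          \<rho> ^ pb.energy (bandwidth \<delta> n) {1..n} F \<psi>) / real N ^ n" for F
      have finP: "finite ({1..n} \<rightarrow>\<^sub>E {..<N})" by (intro finite_PiE) auto
      have g0: "g F \<ge> 0" for F unfolding g_def using \<rho> by (intro divide_nonneg_nonneg sum_nonneg) auto
      have eg: "err n H \<le> g (f H)" if H: "H \<in> ?B" for H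
      proof -
        have gd: "good n H (Q n H) (c n H) (orth n H) (tab n H)" using good H by blast
        have sg: "subgroup H (zvec n q)" "card H * N = q ^ n" using H by (auto simp: \<H>_def)
        have or: "orth n H = orr" using H by (simp add: data_def D)
        have cb: "bij_betw (c n H) {..<N} (annihilator (zvec n q) H)" and c0: "c n H 0 = trivial_char (zvec n q)"
          and co: "\<And>x t. x \<in> carrier (zvec n q) \<Longrightarrow> t < N \<Longrightarrow> (Q n H x, t) \<in> orr \<longleftrightarrow> c n H t x = 1"
        proof -
          show "bij_betw (c n H) {..<N} (annihilator (zvec n q) H)" "c n H 0 = trivial_char (zvec n q)"
            using gd unfolding good_def by - (elim conjE, assumption)+
          have "\<forall>x\<in>carrier (zvec n q). \<forall>t<N. (Q n H x, t) \<in> orr \<longleftrightarrow> c n H t x = 1"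
            using gd unfolding good_def or by (elim conjE)
          then show "\<And>x t. x \<in> carrier (zvec n q) \<Longrightarrow> t < N \<Longrightarrow> (Q n H x, t) \<in> orr \<longleftrightarrow> c n H t x = 1" by blast
        qed
        let ?U = "annihilator (zvec n q) H" and ?triv = "\<lambda>j\<in>{1..n}. trivial_char (zvec n q)"
        \<comment> \<open>A character that is 1 on all unit vectors is trivial, and label 0 is the
          trivial character.\<close>
        have nondeg: "pb.annX (f H) {1..n} \<subseteq> {0}"
        proof
          fix t assume t: "t \<in> pb.annX (f H) {1..n}"
          then have tN: "t < N" and "\<forall>i\<in>{1..n}. (Q n H (unit_vec n q i), t) \<in> orr"
            by (auto simp: pb.annX_def f_def)
          then have one: "c n H t (unit_vec n q i) = 1" if "i \<in> {1..n}" for i using co[OF e tN] that by blast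
          have ct: "c n H t \<in> characters (zvec n q)" using cb tN by (auto simp: bij_betw_def annihilator_def)
          have "c n H t = trivial_char (zvec n q)"
          proof (rule G.char_eqI[OF ct G.trivial_char])
            fix v assume "v \<in> carrier (zvec n q)"
            then show "c n H t v = trivial_char (zvec n q) v"
              using char_zvec[OF q ct] one by simp
          qed
          then show "t \<in> {0}" using cb c0 tN N0 by (auto simp: bij_betw_def inj_on_def)
        qed
        have "err n H \<le> (\<Sum>u \<in> ({1..n} \<rightarrow>\<^sub>E ?U) - {?triv}.
            \<rho> ^ card {(i, j) \<in> {1..n} \<times> {1..n}. i \<le> j + bandwidth \<delta> n \<and> j \<le> i + bandwidth \<delta> n \<and> u j (unit_vec n q i) \<noteq> 1}) / real N ^ n"
          unfolding err_def
        proof (rule prob_cols_error[OF sg \<rho>])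
          fix i j z assume ij: "i \<in> {1..n}" "j \<in> {1..n}" "i \<le> j + bandwidth \<delta> n" "j \<le> i + bandwidth \<delta> n" "z ^ q = 1" "(z :: complex) \<noteq> 1"
          show "norm (\<integral>\<omega>. z ^ nat (X n i j \<omega>) \<partial>\<Omega> n) \<le> \<rho>"
          proof (rule \<rho>b)
            show "prob_space (\<Omega> n)" by unfold_locales
            show "X n i j \<in> measurable (\<Omega> n) (count_space UNIV)" by (rule measurable_X[OF ij(1,2)])
            show "X n i j \<omega> \<in> {0..<int (p ^ K)}" if "\<omega> \<in> space (\<Omega> n)" for \<omega>
              using range[OF ij(1,2) that] by (simp add: q_def)
            show "measure (\<Omega> n) {\<omega> \<in> space (\<Omega> n). [X n i j \<omega> = t] (mod int p)} \<le> 1 - \<epsilon>" for t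
              by (rule bal[OF n ij(1,2) abs_diff_le_bandwidth[OF ij(3,4)]])
          qed (use ij in \<open>auto simp: q_def\<close>)
        qed
        also have "(\<Sum>u \<in> ({1..n} \<rightarrow>\<^sub>E ?U) - {?triv}.
            \<rho> ^ card {(i, j) \<in> {1..n} \<times> {1..n}. i \<le> j + bandwidth \<delta> n \<and> j \<le> i + bandwidth \<delta> n \<and> u j (unit_vec n q i) \<noteq> 1})
          = (\<Sum>\<psi> | \<psi> \<in> {1..n} \<rightarrow>\<^sub>E {..<N} \<and> (pb.annX (f H) {1..n} \<subseteq> {0} \<and> (\<exists>j\<in>{1..n}. \<psi> j \<noteq> 0)).
          \<rho> ^ pb.energy (bandwidth \<delta> n) {1..n} (f H) \<psi>)"
        \<comment> \<open>Families of characters are renamed by \<open>c n H\<close>; the family of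
          trivial characters corresponds to the constant label 0.\<close>
        proof (rule sum.reindex_bij_witness[of _ "\<lambda>\<psi>. \<lambda>j\<in>{1..n}. c n H (\<psi> j)" "\<lambda>u. \<lambda>j\<in>{1..n}. inv_into {..<N} (c n H) (u j)"])
          let ?S = "{\<psi>. \<psi> \<in> {1..n} \<rightarrow>\<^sub>E {..<N} \<and> (pb.annX (f H) {1..n} \<subseteq> {0} \<and> (\<exists>j\<in>{1..n}. \<psi> j \<noteq> 0))}"
          have ci: "c n H (inv_into {..<N} (c n H) u) = u" "inv_into {..<N} (c n H) u < N" if "u \<in> ?U" for u
            using cb that f_inv_into_f[of u "c n H" "{..<N}"] inv_into_into[of u "c n H" "{..<N}"] by (auto simp: bij_betw_def)
          have ic: "inv_into {..<N} (c n H) (c n H t) = t" if "t < N" for t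
            using cb that by (simp add: bij_betw_def)
          have cU: "c n H t \<in> ?U" if "t < N" for t using cb that by (auto simp: bij_betw_def)
          fix u assume u: "u \<in> ({1..n} \<rightarrow>\<^sub>E ?U) - {?triv}"
          then have uU: "u j \<in> ?U" if "j \<in> {1..n}" for j using that by auto
          show uc: "(\<lambda>j\<in>{1..n}. c n H ((\<lambda>j\<in>{1..n}. inv_into {..<N} (c n H) (u j)) j)) = u"
            using u ci uU by (intro extensionalityI[of _ "{1..n}"]) (auto simp: PiE_iff)
          show "(\<lambda>j\<in>{1..n}. inv_into {..<N} (c n H) (u j)) \<in> ?S"
          proof -
            have "\<exists>j\<in>{1..n}. inv_into {..<N} (c n H) (u j) \<noteq> 0"
            proof (rule ccontr)
              assume "\<not> ?thesis"
              then have "u j = trivial_char (zvec n q)" if "j \<in> {1..n}" for j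
                using ci(1)[OF uU[OF that]] c0 that by auto
              then have "u = ?triv" using u by (intro extensionalityI[of _ "{1..n}"]) (auto simp: PiE_iff)
              then show False using u by simp
            qed
            then show ?thesis using nondeg ci(2) uU by auto
          qed
          show "\<rho> ^ pb.energy (bandwidth \<delta> n) {1..n} (f H) (\<lambda>j\<in>{1..n}. inv_into {..<N} (c n H) (u j))
             = \<rho> ^ card {(i, j) \<in> {1..n} \<times> {1..n}. i \<le> j + bandwidth \<delta> n \<and> j \<le> i + bandwidth \<delta> n \<and> u j (unit_vec n q i) \<noteq> 1}"
            unfolding pb.energy_def
          proof (intro arg_cong[where f = "\<lambda>S. \<rho> ^ card S"] Collect_cong)
            fix x :: "nat \<times> nat"
            show "(case x of (i, j) \<Rightarrow> (i, j) \<in> {1..n} \<times> {1..n} \<and> i \<le> j + bandwidth \<delta> n \<and> j \<le> i + bandwidth \<delta> n \<and> (f H i, (\<lambda>j\<in>{1..n}. inv_into {..<N} (c n H) (u j)) j) \<notin> orr)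
              \<longleftrightarrow> (case x of (i, j) \<Rightarrow> (i, j) \<in> {1..n} \<times> {1..n} \<and> i \<le> j + bandwidth \<delta> n \<and> j \<le> i + bandwidth \<delta> n \<and> u j (unit_vec n q i) \<noteq> 1)"
              using co[OF e ci(2)[OF uU]] ci(1)[OF uU] by (auto simp: f_def split: prod.splits)
          qed
        next
          fix \<psi> assume \<psi>: "\<psi> \<in> {\<psi>. \<psi> \<in> {1..n} \<rightarrow>\<^sub>E {..<N} \<and> (pb.annX (f H) {1..n} \<subseteq> {0} \<and> (\<exists>j\<in>{1..n}. \<psi> j \<noteq> 0))}"
          have ic: "inv_into {..<N} (c n H) (c n H t) = t" if "t < N" for t
            using cb that by (simp add: bij_betw_def)
          have cU: "c n H t \<in> ?U" if "t < N" for t using cb that by (auto simp: bij_betw_def)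
          have \<psi>N: "\<psi> j < N" if "j \<in> {1..n}" for j using \<psi> that by auto
          show "(\<lambda>j\<in>{1..n}. inv_into {..<N} (c n H) ((\<lambda>j\<in>{1..n}. c n H (\<psi> j)) j)) = \<psi>"
            using \<psi> ic \<psi>N by (intro extensionalityI[of _ "{1..n}"]) (auto simp: PiE_iff)
          obtain j where j: "j \<in> {1..n}" "\<psi> j \<noteq> 0" using \<psi> by blast
          have nt: "c n H (\<psi> j) \<noteq> trivial_char (zvec n q)"
            using cb c0 \<psi>N[OF j(1)] N0 j(2) by (metis bij_betw_def inj_on_eq_iff lessThan_iff)
          have "(\<lambda>j\<in>{1..n}. c n H (\<psi> j)) \<noteq> ?triv"
          proof
            assume "(\<lambda>j\<in>{1..n}. c n H (\<psi> j)) = ?triv"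
            from fun_cong[OF this, of j] j(1) nt show False by simp
          qed
          then show "(\<lambda>j\<in>{1..n}. c n H (\<psi> j)) \<in> ({1..n} \<rightarrow>\<^sub>E ?U) - {?triv}"
            using cU \<psi>N by auto
        qed
        finally show ?thesis unfolding g_def .
      qed
      have "(\<Sum>H\<in>?B. err n H) \<le> (\<Sum>H\<in>?B. g (f H))" by (rule sum_mono) (rule eg)
      also have "\<dots> = (\<Sum>F\<in>f ` ?B. g F)" by (simp add: sum.reindex[OF inj])
      also have "\<dots> \<le> (\<Sum>F\<in>{1..n} \<rightarrow>\<^sub>E {..<N}. g F)"
        using fH g0 finP by (intro sum_mono2) auto
      also have "\<dots> = ?W n"
      proof -
        have "?W n = (\<Sum>(F, \<psi>) \<in> Sigma ({1..n} \<rightarrow>\<^sub>E {..<N}) (\<lambda>F. {\<psi>. \<psi> \<in> {1..n} \<rightarrow>\<^sub>E {..<N} \<and> (pb.annX F {1..n} \<subseteq> {0} \<and> (\<exists>j\<in>{1..n}. \<psi> j \<noteq> 0))}).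
            \<rho> ^ pb.energy (bandwidth \<delta> n) {1..n} F \<psi>) / real N ^ n"
          unfolding pb.weight_def by (intro arg_cong2[where f = "(/)"] sum.cong) auto
        also have "\<dots> = (\<Sum>F\<in>{1..n} \<rightarrow>\<^sub>E {..<N}. g F)"
          unfolding g_def sum_divide_distrib[symmetric] using finP
          by (intro arg_cong2[where f = "(/)"] sum.Sigma[symmetric]) auto
        finally show ?thesis by simp
      qed
      finally show ?thesis .
    qed
    then have "eventually (\<lambda>n. (\<Sum>H | H \<in> \<H> n \<and> data n H = D. err n H) \<le> ?W n) sequentially"
      by (intro eventually_sequentiallyI[of 1]) auto
    then show ?thesis
      by (rule tendsto_sandwich[OF _ _ tendsto_const pb.weight_nondegenerate_tendsto[OF \<delta>], rotated])
        (auto intro!: always_eventually sum_nonneg simp: err_def)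
  qed
  \<comment> \<open>Finiteness of \<D> permits the limit to be taken termwise.\<close>
  have "(\<lambda>n. \<Sum>D\<in>\<D>. \<Sum>H | H \<in> \<H> n \<and> data n H = D. err n H) \<longlonglongrightarrow> (\<Sum>D\<in>\<D>. 0)"
    by (intro tendsto_sum each)
  moreover have "(\<Sum>D\<in>\<D>. \<Sum>H | H \<in> \<H> n \<and> data n H = D. err n H) = (\<Sum>H\<in>\<H> n. err n H)" for n
    by (rule sum.group[OF fin\<H> fin\<D> data])
  ultimately show ?thesis by (simp add: \<H>_def err_def q_def)
qed

section \<open>Counting generating families by alternating sums\<close>

text \<open>Moebius value of an \<open>r\<close>-dimensional space over the field with
  \<open>p\<close> elements divided by its number of ordered bases; the powers of \<open>p\<close>
  cancel.\<close>

definition bonf_coeff :: "nat \<Rightarrow> nat \<Rightarrow> real" where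
  "bonf_coeff p r = (\<Prod>i=1..r. 1 / (1 - real p ^ i))"

lemma bonf_coeff_Suc: "bonf_coeff p (Suc r) = bonf_coeff p r / (1 - real p ^ Suc r)"
  by (simp add: bonf_coeff_def)

text \<open>Newton interpolation at the nodes \<open>1, p, ..., p ^ m\<close>: both sides have
  degree \<open>m\<close> in \<open>y\<close>, and the right-hand side is the polynomial with value
  1 at the first node and 0 at the others. The coefficients are therefore its divided
  differences.\<close>

lemma bonf_sum_eq:
  fixes y :: real
  assumes "p > 1"
  shows "(\<Sum>r\<le>m. bonf_coeff p r * (\<Prod>i<r. y - real p ^ i)) = (\<Prod>i=1..m. (real p ^ i - y) / (real p ^ i - 1))"
proof (induction m)
  case 0
  then show ?case by (simp add: bonf_coeff_def)
next
  case (Suc m)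
  have ne: "real p ^ i - 1 \<noteq> 0" if "i \<ge> 1" for i
  proof -
    have "1 < real p ^ i" by (rule one_less_power) (use assms that in auto)
    then show ?thesis by simp
  qed
  have "bonf_coeff p (Suc m) * (\<Prod>i<Suc m. y - real p ^ i) = (\<Prod>i=1..m. (real p ^ i - y) / (real p ^ i - 1)) * ((1 - y) / (real p ^ Suc m - 1))"
  proof -
    \<comment> \<open>The unsummed terms have a product form of their own, which makes the sum
      telescope.\<close>
    have key: "bonf_coeff p r * (\<Prod>i<r. y - real p ^ i) * (real p ^ r - y) = (1 - y) * (\<Prod>i=1..r. (real p ^ i - y) / (real p ^ i - 1))" for r
    proof (induction r)
      case 0
      then show ?case by (simp add: bonf_coeff_def)
    next
      case (Suc r)
      have "bonf_coeff p (Suc r) * (\<Prod>i<Suc r. y - real p ^ i) * (real p ^ Suc r - y)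
          = (bonf_coeff p r * (\<Prod>i<r. y - real p ^ i) * (real p ^ r - y)) * ((real p ^ Suc r - y) / (real p ^ Suc r - 1))"
        using ne[of "Suc r"] by (simp add: bonf_coeff_Suc field_simps)
      then show ?case unfolding Suc.IH by simp
    qed
    have "bonf_coeff p (Suc m) * (\<Prod>i<Suc m. y - real p ^ i)
       = (bonf_coeff p m * (\<Prod>i<m. y - real p ^ i) * (real p ^ m - y)) / (real p ^ Suc m - 1)"
      using ne[of "Suc m"] by (simp add: bonf_coeff_Suc field_simps)
    then show ?thesis unfolding key by simp
  qed
  then have "(\<Sum>r\<le>Suc m. bonf_coeff p r * (\<Prod>i<r. y - real p ^ i))
      = (\<Prod>i=1..m. (real p ^ i - y) / (real p ^ i - 1)) * (1 + (1 - y) / (real p ^ Suc m - 1))"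
    using Suc by (simp add: distrib_left)
  also have "1 + (1 - y) / (real p ^ Suc m - 1) = (real p ^ Suc m - y) / (real p ^ Suc m - 1)"
    using ne[of "Suc m"] by (simp add: field_simps)
  finally show ?case by simp
qed

text \<open>At \<open>y = p ^ s\<close> the product is 1 for \<open>s = 0\<close>, vanishes for
  \<open>1 \<le> s \<le> m\<close>, and for \<open>s > m\<close> consists of \<open>m\<close>
  negative factors. Hence the truncation error has the sign \<open>(-1) ^ m\<close>.\<close>

lemma bonf_sign:
  assumes p: "p > 1"
  shows "even m \<Longrightarrow> (if s = 0 then 1 else 0) \<le> (\<Sum>r\<le>m. bonf_coeff p r * (\<Prod>i<r. real (p ^ s) - real p ^ i))"
    and "odd m \<Longrightarrow> (\<Sum>r\<le>m. bonf_coeff p r * (\<Prod>i<r. real (p ^ s) - real p ^ i)) \<le> (if s = 0 then 1 else 0)"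
proof -
  let ?P = "\<Prod>i=1..m. (real p ^ i - real p ^ s) / (real p ^ i - 1)"
  have pos: "real p ^ i - 1 > 0" if "i \<ge> 1" for i
  proof -
    have "1 < real p ^ i" by (rule one_less_power) (use p that in auto)
    then show ?thesis by simp
  qed
  have eq: "(\<Sum>r\<le>m. bonf_coeff p r * (\<Prod>i<r. real (p ^ s) - real p ^ i)) = ?P"
    using bonf_sum_eq[OF p, where m = m and y = "real (p ^ s)"] by simp
  have P0: "?P = 1" if "s = 0" using that pos by (intro prod.neutral) (auto simp: less_imp_neq[symmetric])
  have Ps: "?P = 0 \<or> (?P = (-1) ^ m * (\<Prod>i=1..m. (real p ^ s - real p ^ i) / (real p ^ i - 1)) \<and>
      0 \<le> (\<Prod>i=1..m. (real p ^ s - real p ^ i) / (real p ^ i - 1)))" if "s \<noteq> 0"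
  proof (cases "s \<le> m")
    case True
    then have "?P = 0" using that by (intro prod_zero) auto
    then show ?thesis by simp
  next
    case False
    have "?P = (\<Prod>i=1..m. (- 1) * ((real p ^ s - real p ^ i) / (real p ^ i - 1)))"
      by (intro prod.cong) (auto simp: minus_divide_left)
    also have "\<dots> = (-1) ^ m * (\<Prod>i=1..m. (real p ^ s - real p ^ i) / (real p ^ i - 1))"
      by (simp only: prod.distrib prod_constant card_atLeastAtMost) simp
    finally have "?P = (-1) ^ m * (\<Prod>i=1..m. (real p ^ s - real p ^ i) / (real p ^ i - 1))" .
    moreover have "0 \<le> (\<Prod>i=1..m. (real p ^ s - real p ^ i) / (real p ^ i - 1))"
    proof (intro prod_nonneg ballI divide_nonneg_nonneg)
      fix i assume "i \<in> {1..m}"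
      then show "0 \<le> real p ^ s - real p ^ i" using False p by (simp add: power_increasing)
    qed (use pos in \<open>auto intro: less_imp_le\<close>)
    ultimately show ?thesis by blast
  qed
  define P where "P = ?P"
  define Q where "Q = (\<Prod>i=1..m. (real p ^ s - real p ^ i) / (real p ^ i - 1))"
  have P: "s = 0 \<Longrightarrow> P = 1" "s \<noteq> 0 \<Longrightarrow> P = 0 \<or> (P = (-1) ^ m * Q \<and> 0 \<le> Q)"
    unfolding P_def Q_def using P0 Ps by blast+
  show "even m \<Longrightarrow> (if s = 0 then 1 else 0) \<le> (\<Sum>r\<le>m. bonf_coeff p r * (\<Prod>i<r. real (p ^ s) - real p ^ i))"
    unfolding eq P_def[symmetric] using P by (cases "s = 0") auto
  show "odd m \<Longrightarrow> (\<Sum>r\<le>m. bonf_coeff p r * (\<Prod>i<r. real (p ^ s) - real p ^ i)) \<le> (if s = 0 then 1 else 0)"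
    unfolding eq P_def[symmetric] using P by (cases "s = 0") auto
qed

text \<open>Euler's identity, from the functional equation \<open>e(x) = (1 - x / p) e(x / p)\<close> of
  \<open>e(x) = \<Sum>r. bonf_coeff p r * x ^ r\<close>.\<close>

lemma bonf_coeff_sums:
  assumes p: "p > 1"
  shows "(\<lambda>r. bonf_coeff p r) sums (\<Prod>k. 1 - 1 / real p ^ Suc k)"
proof -
  have pr: "real p \<ge> 2" using p by simp
  have ge: "real p ^ r - 1 \<ge> 1" if "r \<ge> 1" for r
  proof -
    have "real p ^ 1 \<le> real p ^ r" using pr that by (intro power_increasing) auto
    then show ?thesis using pr unfolding power_one_right by linarith
  qed
  have ne: "1 - real p ^ Suc r \<noteq> 0" for r using ge[of "Suc r"] by simp
  have bd: "\<bar>bonf_coeff p (Suc r)\<bar> \<le> \<bar>bonf_coeff p r\<bar> * (1 / (real p ^ Suc r - 1))" for r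
    using ge[of "Suc r"] by (simp add: bonf_coeff_Suc abs_divide abs_minus_commute[of 1])
  \<comment> \<open>From the second coefficient on, each step divides by at least 2; the extra
    factor 2 absorbs the case \<open>p = 2\<close>, where the first step need not decrease.\<close>
  have bound: "\<bar>bonf_coeff p r\<bar> \<le> 2 * (1 / 2) ^ r" for r
  proof -
    have b1: "\<bar>bonf_coeff p r\<bar> \<le> 1" for r
    proof (induction r)
      case (Suc r)
      have "\<bar>bonf_coeff p r\<bar> * (1 / (real p ^ Suc r - 1)) \<le> 1 * 1"
        using Suc ge[of "Suc r"] by (intro mult_mono) auto
      then show ?case using bd[of r] by simp
    qed (simp add: bonf_coeff_def)
    have "\<bar>bonf_coeff p (Suc r)\<bar> \<le> (1 / 2) ^ r" for r
    proof (induction r)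
      case 0
      then show ?case using b1[of 1] by simp
    next
      case (Suc r)
      have "2 ^ 2 \<le> real p ^ Suc (Suc r)"
        by (rule order_trans[OF power_mono[of 2 "real p" 2] power_increasing]) (use pr in auto)
      then have "1 / (real p ^ Suc (Suc r) - 1) \<le> 1 / 2" by (intro divide_left_mono) auto
      then have "\<bar>bonf_coeff p (Suc r)\<bar> * (1 / (real p ^ Suc (Suc r) - 1)) \<le> (1 / 2) ^ r * (1 / 2)"
        using Suc ge[of "Suc (Suc r)"] by (intro mult_mono) auto
      then show ?case using bd[of "Suc r"] by (simp add: mult.commute)
    qed
    then show ?thesis using b1[of 0] by (cases r) auto
  qed
  have summ: "summable (\<lambda>r. bonf_coeff p r * x ^ r)" if "\<bar>x\<bar> \<le> 1" for x :: real
  proof (rule summable_comparison_test'[of "\<lambda>r. 2 * (1 / 2) ^ r" 0])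
    show "norm (bonf_coeff p r * x ^ r) \<le> 2 * (1 / 2) ^ r" for r
    proof -
      have "\<bar>x\<bar> ^ r \<le> 1" using that by (simp add: power_le_one)
      then have "\<bar>bonf_coeff p r\<bar> * \<bar>x\<bar> ^ r \<le> (2 * (1 / 2) ^ r) * 1"
        using bound[of r] by (intro mult_mono) auto
      then show ?thesis by (simp add: abs_mult power_abs)
    qed
  qed (intro summable_mult summable_geometric, simp)
  define e where "e x = (\<Sum>r. bonf_coeff p r * x ^ r)" for x :: real
  \<comment> \<open>Coefficientwise: the factor \<open>1 - 1 / p ^ Suc r\<close> produced by the
    difference of the two series cancels the denominator of
    \<open>bonf_coeff p (Suc r)\<close>.\<close>
  have fe: "e x = (1 - x / real p) * e (x / real p)" if x: "\<bar>x\<bar> \<le> 1" for x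
  proof -
    have xp: "\<bar>x / real p\<bar> \<le> 1" using x pr by (simp add: abs_divide divide_le_eq)
    have "e x - e (x / real p) = (\<Sum>r. bonf_coeff p r * x ^ r - bonf_coeff p r * (x / real p) ^ r)"
      unfolding e_def by (rule suminf_diff[OF summ[OF x] summ[OF xp]])
    also have "\<dots> = (\<Sum>r. bonf_coeff p (Suc r) * x ^ Suc r - bonf_coeff p (Suc r) * (x / real p) ^ Suc r)"
      by (subst suminf_split_head[OF summable_diff[OF summ[OF x] summ[OF xp]]]) simp
    also have "(\<lambda>r. bonf_coeff p (Suc r) * x ^ Suc r - bonf_coeff p (Suc r) * (x / real p) ^ Suc r)
       = (\<lambda>r. (- x / real p) * (bonf_coeff p r * (x / real p) ^ r))"
    proof
      fix r
      have "bonf_coeff p (Suc r) * x ^ Suc r - bonf_coeff p (Suc r) * (x / real p) ^ Suc r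
         = bonf_coeff p (Suc r) * (real p ^ Suc r - 1) * (x / real p) ^ Suc r"
        using pr by (simp add: power_divide field_simps)
      also have "bonf_coeff p (Suc r) * (real p ^ Suc r - 1) = - bonf_coeff p r"
        unfolding bonf_coeff_Suc using ne[of r] by (simp add: field_simps)
      finally show "bonf_coeff p (Suc r) * x ^ Suc r - bonf_coeff p (Suc r) * (x / real p) ^ Suc r = (- x / real p) * (bonf_coeff p r * (x / real p) ^ r)"
        by simp
    qed
    also have "(\<Sum>r. (- x / real p) * (bonf_coeff p r * (x / real p) ^ r)) = (- x / real p) * e (x / real p)"
      unfolding e_def by (rule suminf_mult[OF summ[OF xp]])
    finally show ?thesis by (simp add: algebra_simps)
  qed
  have iter: "e 1 = (\<Prod>k<N. 1 - 1 / real p ^ Suc k) * e (1 / real p ^ N)" for N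
  proof (induction N)
    case (Suc N)
    have "e (1 / real p ^ N) = (1 - 1 / real p ^ N / real p) * e (1 / real p ^ N / real p)"
      using pr by (intro fe) (simp add: divide_le_eq one_le_power)
    then show ?case using Suc by (simp add: mult.commute)
  qed simp
  have conv: "convergent_prod (\<lambda>k. 1 - 1 / real p ^ Suc k)"
  proof -
    have "summable (\<lambda>k. norm ((1 - 1 / real p ^ Suc k) - 1))"
    proof -
      have "(\<lambda>k. norm ((1 - 1 / real p ^ Suc k) - 1)) = (\<lambda>k. (1 / real p) * (1 / real p) ^ k)"
        by (auto simp: power_divide)
      then show ?thesis using pr by (simp only:) (intro summable_mult summable_geometric, simp)
    qed
    then show ?thesis
      by (intro abs_convergent_prod_imp_convergent_prod) (simp add: summable_imp_abs_convergent_prod)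
  qed
  have "(\<lambda>N. \<Prod>k\<le>N. 1 - 1 / real p ^ Suc k) \<longlonglongrightarrow> (\<Prod>k. 1 - 1 / real p ^ Suc k)"
    by (rule convergent_prod_LIMSEQ[OF conv])
  then have L1: "(\<lambda>N. \<Prod>k<Suc N. 1 - 1 / real p ^ Suc k) \<longlonglongrightarrow> (\<Prod>k. 1 - 1 / real p ^ Suc k)"
    by (simp only: lessThan_Suc_atMost)
  \<comment> \<open>Iterating the functional equation from 1 pushes the argument to 0, where
    continuity and \<open>e 0 = 1\<close> leave the product alone.\<close>
  have "isCont e 0"
    unfolding e_def by (rule isCont_powser[where K = 1]) (use summ[of 1] in auto)
  moreover have "(\<lambda>N. 1 / real p ^ Suc N) \<longlonglongrightarrow> 0"
  proof -
    have "(\<lambda>N. (1 / real p) ^ Suc N) \<longlonglongrightarrow> 0"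
      using pr by (intro LIMSEQ_Suc LIMSEQ_power_zero) simp
    then show ?thesis by (simp add: power_divide)
  qed
  ultimately have "(\<lambda>N. e (1 / real p ^ Suc N)) \<longlonglongrightarrow> e 0" by (rule isCont_tendsto_compose)
  moreover have "e 0 = 1" unfolding e_def by (simp add: powser_zero bonf_coeff_def)
  ultimately have "(\<lambda>N. (\<Prod>k<Suc N. 1 - 1 / real p ^ Suc k) * e (1 / real p ^ Suc N)) \<longlonglongrightarrow> (\<Prod>k. 1 - 1 / real p ^ Suc k) * 1"
    using L1 by (intro tendsto_mult) auto
  then have "(\<lambda>N. e 1) \<longlonglongrightarrow> (\<Prod>k. 1 - 1 / real p ^ Suc k)"
    unfolding iter[symmetric] by simp
  then have "e 1 = (\<Prod>k. 1 - 1 / real p ^ Suc k)" by (simp add: LIMSEQ_const_iff)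
  then show ?thesis using summ[of 1] by (simp add: e_def sums_iff)
qed

section \<open>Lists of independent characters of order p\<close>

definition elem_chars :: "('a, 'm) monoid_scheme \<Rightarrow> nat \<Rightarrow> ('a \<Rightarrow> complex) set" where
  "elem_chars G p = {\<psi> \<in> characters G. \<forall>x\<in>carrier G. \<psi> x ^ p = 1}"

definition kers :: "('a, 'm) monoid_scheme \<Rightarrow> ('a \<Rightarrow> complex) list \<Rightarrow> 'a set" where
  "kers G \<psi>s = {x \<in> carrier G. \<forall>\<psi>\<in>set \<psi>s. \<psi> x = 1}"

text \<open>Linear independence over the field with \<open>p\<close> elements for lists from
  \<open>elem_chars\<close>: a new head must be nontrivial on the common kernel, equivalently lie
  outside the annihilator of that kernel.\<close>

fun indep_chars :: "('a, 'm) monoid_scheme \<Rightarrow> ('a \<Rightarrow> complex) list \<Rightarrow> bool" where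
  "indep_chars G [] \<longleftrightarrow> True"
| "indep_chars G (\<psi> # \<psi>s) \<longleftrightarrow> indep_chars G \<psi>s \<and> (\<exists>x\<in>kers G \<psi>s. \<psi> x \<noteq> 1)"

context finite_comm_group
begin

lemma subgroup_kers:
  assumes "set \<psi>s \<subseteq> characters G"
  shows "subgroup (kers G \<psi>s) G"
proof
  fix x y assume x: "x \<in> kers G \<psi>s" and y: "y \<in> kers G \<psi>s"
  have ch: "\<psi> \<in> characters G" if "\<psi> \<in> set \<psi>s" for \<psi> using assms that by auto
  have "\<psi> (x \<otimes> y) = 1" if "\<psi> \<in> set \<psi>s" for \<psi>
  proof -
    have "x \<in> carrier G" "y \<in> carrier G" "\<psi> x = 1" "\<psi> y = 1" using x y that unfolding kers_def by blast+
    then show ?thesis using char_mult[OF ch[OF that], of x y] by simp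
  qed
  then show "x \<otimes> y \<in> kers G \<psi>s" using x y by (simp add: kers_def)
  have "\<psi> (inv x) = 1" if "\<psi> \<in> set \<psi>s" for \<psi>
  proof -
    have "x \<in> carrier G" "\<psi> x = 1" using x that unfolding kers_def by blast+
    then show ?thesis using char_mult[OF ch[OF that], of x "inv x"] char_one[OF ch[OF that]] by simp
  qed
  then show "inv x \<in> kers G \<psi>s" using x by (auto simp: kers_def)
qed (use assms char_one in \<open>auto simp: kers_def\<close>)

text \<open>The sum of \<open>\<psi> x ^ k\<close> over \<open>k < p\<close> is \<open>p\<close>
  times the indicator of the kernel. Summed over \<open>Q\<close> in the other order, only
  \<open>k = 0\<close> survives, because primality keeps the other powers of \<psi> nontrivial on
  \<open>Q\<close>.\<close>

lemma card_subgroup_ker_char: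
  assumes Q: "subgroup Q G" and p: "prime p" and \<psi>: "\<psi> \<in> elem_chars G p" and x0: "x0 \<in> Q" "\<psi> x0 \<noteq> 1"
  shows "card Q = p * card {x \<in> Q. \<psi> x = 1}"
proof -
  have QG: "Q \<subseteq> carrier G" by (rule subgroup.subset[OF Q])
  have finQ: "finite Q" using QG finite_carrier by (rule finite_subset)
  have p0: "p > 0" using p by (rule prime_gt_0_nat)
  have \<psi>c: "\<psi> \<in> characters G" using \<psi> by (simp add: elem_chars_def)
  have \<psi>p: "\<psi> x ^ p = 1" if "x \<in> carrier G" for x using \<psi> that by (simp add: elem_chars_def)
  have zero: "(\<Sum>x\<in>Q. \<psi> x ^ k) = (if k = 0 then of_nat (card Q) else 0)" if "k < p" for k
  proof (cases "k = 0")
    case False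
    have "\<psi> x0 ^ k \<noteq> 1"
    proof
      assume "\<psi> x0 ^ k = 1"
      moreover have "coprime k p"
        using p False that by (metis coprime_commute nat_dvd_not_less neq0_conv prime_imp_coprime_nat)
      ultimately show False using coprime_powers_eq_1[of "\<psi> x0" k p] \<psi>p x0 QG by auto
    qed
    moreover have "(\<Sum>x\<in>Q. \<psi> x ^ k) = \<psi> x0 ^ k * (\<Sum>x\<in>Q. \<psi> x ^ k)"
    proof -
      have "bij_betw (\<lambda>x. x0 \<otimes> x) Q Q"
      proof (rule bij_betwI[of _ _ _ "\<lambda>x. inv x0 \<otimes> x"])
        show "(\<lambda>x. x0 \<otimes> x) \<in> Q \<rightarrow> Q" "(\<lambda>x. inv x0 \<otimes> x) \<in> Q \<rightarrow> Q"
          using x0 Q by (auto simp: subgroup.m_closed subgroup.m_inv_closed)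
      qed (use x0 QG in \<open>auto simp: m_assoc[symmetric] subset_iff\<close>)
      then have "(\<Sum>x\<in>Q. \<psi> x ^ k) = (\<Sum>x\<in>Q. \<psi> (x0 \<otimes> x) ^ k)"
        by (rule sum.reindex_bij_betw[symmetric])
      also have "\<dots> = \<psi> x0 ^ k * (\<Sum>x\<in>Q. \<psi> x ^ k)"
        unfolding sum_distrib_left using x0 QG \<psi>c
        by (intro sum.cong) (auto simp: char_mult power_mult_distrib subset_iff)
      finally show ?thesis .
    qed
    ultimately show ?thesis using False by simp
  qed simp
  have "of_nat (card Q) = (\<Sum>k<p. if k = 0 then of_nat (card Q) else (0 :: complex))"
    using p0 by simp
  also have "\<dots> = (\<Sum>k<p. \<Sum>x\<in>Q. \<psi> x ^ k)" using zero by (intro sum.cong) auto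
  also have "\<dots> = (\<Sum>x\<in>Q. \<Sum>k<p. \<psi> x ^ k)" by (rule sum.swap)
  also have "\<dots> = (\<Sum>x\<in>Q. if \<psi> x = 1 then of_nat p else 0)"
  proof (rule sum.cong[OF refl])
    fix x assume "x \<in> Q"
    then have "\<psi> x ^ p = 1" using \<psi>p QG by auto
    then show "(\<Sum>k<p. \<psi> x ^ k) = (if \<psi> x = 1 then of_nat p else 0)"
      using geometric_sum[of "\<psi> x" p] by auto
  qed
  also have "\<dots> = of_nat (p * card {x \<in> Q. \<psi> x = 1})"
    using finQ by (simp add: sum.If_cases Int_def mult.commute)
  finally show ?thesis by (simp only: of_nat_eq_iff)
qed

lemma card_kers:
  assumes p: "prime p" and "set \<psi>s \<subseteq> elem_chars G p" "indep_chars G \<psi>s"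
  shows "card (kers G \<psi>s) * p ^ length \<psi>s = order G"
  using assms(2,3)
proof (induction \<psi>s)
  case Nil
  then show ?case by (simp add: kers_def order_def)
next
  case (Cons \<psi> \<psi>s)
  obtain x0 where x0: "x0 \<in> kers G \<psi>s" "\<psi> x0 \<noteq> 1" using Cons.prems by auto
  have "set \<psi>s \<subseteq> characters G" using Cons.prems by (auto simp: elem_chars_def)
  then have "card (kers G \<psi>s) = p * card {x \<in> kers G \<psi>s. \<psi> x = 1}"
    using x0 Cons.prems by (intro card_subgroup_ker_char[OF subgroup_kers p]) auto
  moreover have "{x \<in> kers G \<psi>s. \<psi> x = 1} = kers G (\<psi> # \<psi>s)" by (auto simp: kers_def)
  ultimately show ?case using Cons by (simp add: mult_ac)
qed

text \<open>The heads excluded for a list of length \<open>r\<close> are the annihilator of its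
  common kernel, which has \<open>p ^ r\<close> elements since the kernel has index
  \<open>p ^ r\<close>.\<close>

lemma card_indep_lists:
  assumes p: "prime p" and S: "S \<subseteq> carrier G" "annihilator G S \<subseteq> elem_chars G p"
  shows "finite {\<psi>s. length \<psi>s = r \<and> set \<psi>s \<subseteq> annihilator G S \<and> indep_chars G \<psi>s}
    \<and> real (card {\<psi>s. length \<psi>s = r \<and> set \<psi>s \<subseteq> annihilator G S \<and> indep_chars G \<psi>s})
      = (\<Prod>i<r. real (card (annihilator G S)) - real p ^ i)"
proof (induction r)
  case 0
  have "{\<psi>s. length \<psi>s = 0 \<and> set \<psi>s \<subseteq> annihilator G S \<and> indep_chars G \<psi>s} = {[]}" by auto
  then show ?case by simp
next
  case (Suc r)
  let ?T = "\<lambda>r. {\<psi>s. length \<psi>s = r \<and> set \<psi>s \<subseteq> annihilator G S \<and> indep_chars G \<psi>s}"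
  let ?y = "card (annihilator G S)"
  have eq: "?T (Suc r) = (\<lambda>(\<psi>s, \<psi>). \<psi> # \<psi>s) ` Sigma (?T r) (\<lambda>\<psi>s. annihilator G S - annihilator G (kers G \<psi>s))"
  proof (intro equalityI subsetI)
    fix \<phi> assume \<phi>: "\<phi> \<in> ?T (Suc r)"
    then obtain \<psi> \<psi>s where "\<phi> = \<psi> # \<psi>s" by (cases \<phi>) auto
    then show "\<phi> \<in> (\<lambda>(\<psi>s, \<psi>). \<psi> # \<psi>s) ` Sigma (?T r) (\<lambda>\<psi>s. annihilator G S - annihilator G (kers G \<psi>s))"
    proof (intro image_eqI[of _ _ "(\<psi>s, \<psi>)"])
      have "\<psi> \<notin> annihilator G (kers G \<psi>s)"
        using \<phi> unfolding \<open>\<phi> = \<psi> # \<psi>s\<close> by (auto simp: annihilator_def[of G "kers G \<psi>s"])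
      then show "(\<psi>s, \<psi>) \<in> Sigma (?T r) (\<lambda>\<psi>s. annihilator G S - annihilator G (kers G \<psi>s))"
        using \<phi> unfolding \<open>\<phi> = \<psi> # \<psi>s\<close> by auto
    qed simp
  next
    fix \<phi> assume "\<phi> \<in> (\<lambda>(\<psi>s, \<psi>). \<psi> # \<psi>s) ` Sigma (?T r) (\<lambda>\<psi>s. annihilator G S - annihilator G (kers G \<psi>s))"
    then obtain \<psi> \<psi>s where "\<phi> = \<psi> # \<psi>s" "\<psi>s \<in> ?T r" "\<psi> \<in> annihilator G S" "\<psi> \<notin> annihilator G (kers G \<psi>s)"
      by auto
    moreover from this have "\<exists>x\<in>kers G \<psi>s. \<psi> x \<noteq> 1" by (auto simp: annihilator_def)
    ultimately show "\<phi> \<in> ?T (Suc r)" by auto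
  qed
  have inj: "inj_on (\<lambda>(\<psi>s, \<psi>). \<psi> # \<psi>s) (Sigma (?T r) (\<lambda>\<psi>s. annihilator G S - annihilator G (kers G \<psi>s)))"
    by (auto simp: inj_on_def)
  have each: "real (card (annihilator G S - annihilator G (kers G \<psi>s))) = real ?y - real p ^ r" if \<psi>s: "\<psi>s \<in> ?T r" for \<psi>s
  proof -
    have el: "set \<psi>s \<subseteq> elem_chars G p" and ch: "set \<psi>s \<subseteq> characters G" using \<psi>s S by (auto simp: elem_chars_def)
    have "card (annihilator G (kers G \<psi>s)) * card (kers G \<psi>s) = order G" by (rule card_annihilator[OF subgroup_kers[OF ch]])
    moreover have "card (kers G \<psi>s) * p ^ r = order G" using card_kers[OF p el] \<psi>s by auto
    moreover have "card (kers G \<psi>s) > 0" using calculation order_pos by (cases "card (kers G \<psi>s)") auto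
    ultimately have c: "card (annihilator G (kers G \<psi>s)) = p ^ r" by (metis mult.commute mult_cancel1 less_numeral_extra(3))
    have sub: "annihilator G (kers G \<psi>s) \<subseteq> annihilator G S"
      using \<psi>s S(1) by (auto simp: annihilator_def kers_def)
    have "card (annihilator G S - annihilator G (kers G \<psi>s)) = ?y - p ^ r"
      using sub finite_annihilator c by (simp add: card_Diff_subset)
    moreover have "p ^ r \<le> ?y" using card_mono[OF finite_annihilator sub] c by simp
    ultimately show ?thesis by (simp add: of_nat_diff)
  qed
  have fin: "finite (?T r)" using Suc by simp
  have "finite (?T (Suc r))"
    unfolding eq using fin finite_annihilator by (intro finite_imageI finite_SigmaI) auto
  moreover have "real (card (?T (Suc r))) = (\<Sum>\<psi>s\<in>?T r. real (card (annihilator G S - annihilator G (kers G \<psi>s))))"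
    unfolding eq card_image[OF inj] using fin finite_annihilator by (subst card_SigmaI) auto
  ultimately show ?case using each Suc by simp
qed

end

lemma (in group_hom) card_image_mult_card_kernel:
  assumes "finite (carrier G)"
  shows "card (h ` carrier G) * card (kernel G H h) = order G"
proof -
  let ?K = "kernel G H h"
  have val: "the_elem (h ` (?K #> g)) = h g" if "g \<in> carrier G" for g
  proof -
    have "h ` (?K #> g) = {h g}"
      using that G.one_closed by (auto simp: kernel_def r_coset_def image_iff intro!: exI[of _ "\<one>"])
    then show ?thesis by simp
  qed
  have "(\<lambda>X. the_elem (h ` X)) ` (rcosets ?K) = h ` carrier G"
    using val by (force simp: RCOSETS_def)
  moreover have "inj_on (\<lambda>X. the_elem (h ` X)) (rcosets ?K)"
    using FactGroup_inj_on by (simp add: FactGroup_def)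
  ultimately have "card (h ` carrier G) = card (rcosets ?K)" by (metis card_image)
  then show ?thesis using G.lagrange_finite[OF assms subgroup_kernel] by simp
qed

context finite_comm_group
begin

lemma finite_comm_group_subgroup:
  assumes "subgroup L G"
  shows "finite_comm_group (G\<lparr>carrier := L\<rparr>)"
proof -
  have LG: "L \<subseteq> carrier G" by (rule subgroup.subset[OF assms])
  interpret L: group "G\<lparr>carrier := L\<rparr>" by (rule subgroup_imp_group[OF assms])
  have "comm_group (G\<lparr>carrier := L\<rparr>)"
    using LG by (intro L.group_comm_groupI) (auto intro!: m_comm)
  then interpret L: comm_group "G\<lparr>carrier := L\<rparr>" .
  show ?thesis by unfold_locales (simp add: finite_subset[OF LG finite_carrier])
qed

lemma pow_group_hom: "group_hom G G (\<lambda>x. x [^] (k :: nat))"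
  by unfold_locales (auto intro!: homI simp: pow_mult_distrib m_comm)

lemma elem_chars_eq_annihilator: "elem_chars G p = annihilator G ((\<lambda>x. x [^] p) ` carrier G)"
  by (auto simp: elem_chars_def annihilator_def char_pow)

text \<open>Both numbers equal the index of the subgroup of \<open>p\<close>-th powers: one by
  duality, the other by the isomorphism theorem for the power map.\<close>

lemma card_elem_chars: "card (elem_chars G p) = card {x \<in> carrier G. x [^] p = \<one>}"
proof -
  interpret h: group_hom G G "\<lambda>x. x [^] p" by (rule pow_group_hom)
  let ?P = "(\<lambda>x. x [^] p) ` carrier G"
  have 1: "card ?P * card {x \<in> carrier G. x [^] p = \<one>} = order G"
    using h.card_image_mult_card_kernel by (simp add: kernel_def)
  have 2: "card (annihilator G ?P) * card ?P = order G"
    by (rule card_annihilator[OF h.img_is_subgroup])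
  have "card ?P > 0" using 2 order_pos by (cases "card ?P") auto
  moreover have "card (annihilator G ?P) * card ?P = card {x \<in> carrier G. x [^] p = \<one>} * card ?P"
    unfolding 2 1[symmetric] by (rule mult.commute)
  ultimately show ?thesis using one_closed unfolding elem_chars_eq_annihilator by auto
qed

lemma char_power: "\<psi> \<in> characters G \<Longrightarrow> (\<lambda>x\<in>carrier G. \<psi> x ^ k) \<in> characters G"
  by (rule charI) (auto simp: char_nonzero char_mult power_mult_distrib)

text \<open>Nakayama's lemma for \<open>p\<close>-groups, on the dual side: a character killing a proper subgroup has a
  nontrivial \<open>p\<close>-power that is killed by \<open>p\<close>.\<close>

lemma generate_eq_carrier_iff:
  assumes ord: "order G = p ^ a" and S: "S \<subseteq> carrier G"
  shows "generate G S = carrier G \<longleftrightarrow> annihilator G (S \<union> (\<lambda>x. x [^] p) ` carrier G) = {trivial_char G}"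
proof
  assume gen: "generate G S = carrier G"
  have "\<psi> = trivial_char G" if \<psi>: "\<psi> \<in> annihilator G (S \<union> (\<lambda>x. x [^] p) ` carrier G)" for \<psi>
  proof -
    have \<psi>c: "\<psi> \<in> characters G" using \<psi> by (simp add: annihilator_def)
    have "subgroup (kers G [\<psi>]) G" by (rule subgroup_kers) (use \<psi>c in simp)
    moreover have "S \<subseteq> kers G [\<psi>]" using \<psi> S by (auto simp: annihilator_def kers_def)
    ultimately have "carrier G \<subseteq> kers G [\<psi>]" using generate_subgroup_incl gen by blast
    then show ?thesis by (intro char_eqI[OF \<psi>c trivial_char]) (auto simp: kers_def)
  qed
  moreover have "trivial_char G \<in> annihilator G (S \<union> (\<lambda>x. x [^] p) ` carrier G)"
    using S trivial_char by (auto simp: annihilator_def)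
  ultimately show "annihilator G (S \<union> (\<lambda>x. x [^] p) ` carrier G) = {trivial_char G}" by blast
next
  assume triv: "annihilator G (S \<union> (\<lambda>x. x [^] p) ` carrier G) = {trivial_char G}"
  show "generate G S = carrier G"
  proof (rule ccontr)
    assume "generate G S \<noteq> carrier G"
    then obtain x where x: "x \<in> carrier G" "x \<notin> generate G S" using generate_incl[OF S] by blast
    obtain \<psi> where \<psi>: "\<psi> \<in> annihilator G (generate G S)" "\<psi> x \<noteq> 1"
      using separating_char[OF generate_is_subgroup[OF S] x] by blast
    have \<psi>c: "\<psi> \<in> characters G" using \<psi> by (simp add: annihilator_def)
    \<comment> \<open>The last exponent for which the power of \<psi> is still nontrivial is
      \<open>j - 1\<close>; that power is killed by \<open>p\<close> and still trivial on
      \<open>S\<close>.\<close>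
    define j where "j = (LEAST j. \<forall>x\<in>carrier G. \<psi> x ^ (p ^ j) = 1)"
    have ex: "\<forall>x\<in>carrier G. \<psi> x ^ (p ^ a) = 1" using char_power_order[OF \<psi>c] ord by simp
    have j: "\<forall>x\<in>carrier G. \<psi> x ^ (p ^ j) = 1" unfolding j_def by (rule LeastI[of _ a]) (rule ex)
    have "j \<noteq> 0"
    proof
      assume "j = 0"
      then have "\<psi> x ^ (p ^ 0) = 1" using j x(1) by blast
      then show False using \<psi>(2) by simp
    qed
    then obtain k where k: "j = Suc k" by (cases j) auto
    have "k < j" using k by simp
    then have nk: "\<not> (\<forall>x\<in>carrier G. \<psi> x ^ (p ^ k) = 1)" unfolding j_def by (rule not_less_Least)
    let ?\<phi> = "\<lambda>x\<in>carrier G. \<psi> x ^ (p ^ k)"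
    have "?\<phi> \<in> annihilator G (S \<union> (\<lambda>x. x [^] p) ` carrier G)"
    proof -
      have "\<psi> s = 1" if "s \<in> S" for s using \<psi>(1) that generate.incl[of s S G] by (auto simp: annihilator_def)
      moreover have "\<psi> (x [^] p) ^ (p ^ k) = 1" if "x \<in> carrier G" for x
        using j that unfolding k char_pow[OF \<psi>c that] by (simp add: power_mult[symmetric])
      ultimately show ?thesis using char_power[OF \<psi>c, of "p ^ k"] S by (auto simp: annihilator_def)
    qed
    then have eq: "?\<phi> = trivial_char G" using triv by blast
    have "\<psi> x ^ (p ^ k) = 1" if "x \<in> carrier G" for x using fun_cong[OF eq, of x] that by simp
    then show False using nk by blast
  qed
qed

definition indep_lists :: "nat \<Rightarrow> nat \<Rightarrow> ('a \<Rightarrow> complex) list set" where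
  "indep_lists p r = {\<psi>s. length \<psi>s = r \<and> set \<psi>s \<subseteq> elem_chars G p \<and> indep_chars G \<psi>s}"

lemma finite_indep_lists:
  assumes "prime p" shows "finite (indep_lists p r)"
  unfolding indep_lists_def elem_chars_eq_annihilator
  by (rule card_indep_lists[THEN conjunct1, OF assms]) (auto simp: elem_chars_eq_annihilator)

lemma card_indep_lists_elem:
  assumes "prime p"
  shows "real (card (indep_lists p r)) = (\<Prod>i<r. real (card {x \<in> carrier G. x [^] p = \<one>}) - real p ^ i)"
  unfolding card_elem_chars[symmetric]
  using card_indep_lists[of p "(\<lambda>x. x [^] p) ` carrier G" r] assms
  by (auto simp: elem_chars_eq_annihilator indep_lists_def)

text \<open>The characters of order dividing \<open>p\<close> that kill \<open>S\<close> form a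
  group of order \<open>p ^ s\<close>, and \<open>S\<close> generates exactly when
  \<open>s = 0\<close>. Counting independent lists in that group reduces the claim to
  \<open>bonf_sign\<close>.\<close>

lemma generate_bonferroni:
  assumes p: "prime p" and ord: "order G = p ^ a" and S: "S \<subseteq> carrier G"
  shows "even m \<Longrightarrow> (if generate G S = carrier G then 1 else 0) \<le> (\<Sum>r\<le>m. bonf_coeff p r * real (card {\<psi>s \<in> indep_lists p r. S \<subseteq> kers G \<psi>s}))"
    and "odd m \<Longrightarrow> (\<Sum>r\<le>m. bonf_coeff p r * real (card {\<psi>s \<in> indep_lists p r. S \<subseteq> kers G \<psi>s})) \<le> (if generate G S = carrier G then 1 else 0)"
proof -
  let ?P = "(\<lambda>x. x [^] p) ` carrier G"
  let ?A = "annihilator G (S \<union> ?P)"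
  have p1: "p > 1" using p by (rule prime_gt_1_nat)
  have SP: "S \<union> ?P \<subseteq> carrier G" using S by auto
  have "card ?A dvd p ^ a" unfolding ord[symmetric] by (rule dvdI[OF card_annihilator_mult[OF SP, symmetric]])
  then obtain s where s: "card ?A = p ^ s" using p by (auto simp: divides_primepow_nat)
  have Ael: "?A \<subseteq> elem_chars G p" unfolding elem_chars_eq_annihilator by (auto simp: annihilator_def)
  have eq: "{\<psi>s \<in> indep_lists p r. S \<subseteq> kers G \<psi>s} = {\<psi>s. length \<psi>s = r \<and> set \<psi>s \<subseteq> ?A \<and> indep_chars G \<psi>s}" for r
  proof -
    have "set \<psi>s \<subseteq> elem_chars G p \<and> S \<subseteq> kers G \<psi>s \<longleftrightarrow> set \<psi>s \<subseteq> ?A" for \<psi>s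
      using S unfolding elem_chars_eq_annihilator by (auto simp: annihilator_def kers_def subset_iff)
    then show ?thesis by (auto simp: indep_lists_def)
  qed
  have c: "real (card {\<psi>s \<in> indep_lists p r. S \<subseteq> kers G \<psi>s}) = (\<Prod>i<r. real (p ^ s) - real p ^ i)" for r
    unfolding eq s[symmetric] using card_indep_lists[OF p SP Ael] by blast
  have triv: "trivial_char G \<in> ?A" using SP trivial_char by (auto simp: annihilator_def)
  have "generate G S = carrier G \<longleftrightarrow> ?A = {trivial_char G}" by (rule generate_eq_carrier_iff[OF ord S])
  also have "\<dots> \<longleftrightarrow> card ?A = 1" using triv by (auto simp: card_1_singleton_iff)
  also have "\<dots> \<longleftrightarrow> s = 0" unfolding s using p1 by simp
  finally have gen: "generate G S = carrier G \<longleftrightarrow> s = 0" .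
  show "even m \<Longrightarrow> (if generate G S = carrier G then 1 else 0) \<le> (\<Sum>r\<le>m. bonf_coeff p r * real (card {\<psi>s \<in> indep_lists p r. S \<subseteq> kers G \<psi>s}))"
    unfolding c gen by (rule bonf_sign(1)[OF p1])
  show "odd m \<Longrightarrow> (\<Sum>r\<le>m. bonf_coeff p r * real (card {\<psi>s \<in> indep_lists p r. S \<subseteq> kers G \<psi>s})) \<le> (if generate G S = carrier G then 1 else 0)"
    unfolding c gen by (rule bonf_sign(2)[OF p1])
qed

text \<open>A subgroup above \<open>H\<close> is a union of cosets of \<open>H\<close>, hence
  determined by a subset of the \<open>N\<close> cosets. The bound depends on the index
  only.\<close>

lemma card_supergroups_le:
  assumes H: "subgroup H G" and N: "card H * N = order G"
  shows "card {L. subgroup L G \<and> H \<subseteq> L} \<le> 2 ^ N"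
proof -
  have HG: "H \<subseteq> carrier G" by (rule subgroup.subset[OF H])
  have cH: "card H > 0" using N order_pos by (cases "card H") auto
  have "card (rcosets H) * card H = N * card H" using lagrange_finite[OF finite_carrier H] N by (simp add: mult.commute)
  then have cr: "card (rcosets H) = N" using cH by simp
  have fr: "finite (rcosets H)" by (simp add: RCOSETS_def)
  let ?f = "\<lambda>L. {R \<in> rcosets H. R \<subseteq> L}"
  have un: "\<Union> (?f L) = L" if L: "subgroup L G" "H \<subseteq> L" for L
  proof (intro equalityI subsetI)
    fix x assume x: "x \<in> L"
    have xG: "x \<in> carrier G" using subgroup.subset[OF L(1)] x by auto
    have "H #> x \<subseteq> L" using L x by (auto simp: r_coset_def subgroup.m_closed)
    then show "x \<in> \<Union> (?f L)" using rcosetsI[OF HG xG] rcos_self[OF xG H] by blast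
  qed auto
  have "inj_on ?f {L. subgroup L G \<and> H \<subseteq> L}"
  proof (rule inj_onI)
    fix L L' assume L: "L \<in> {L. subgroup L G \<and> H \<subseteq> L}" "L' \<in> {L. subgroup L G \<and> H \<subseteq> L}" and eq: "?f L = ?f L'"
    have "L = \<Union> (?f L)" using un L by simp
    also have "\<dots> = L'" unfolding eq using un L by simp
    finally show "L = L'" .
  qed
  then have "card {L. subgroup L G \<and> H \<subseteq> L} \<le> card (Pow (rcosets H))"
    using fr by (intro card_inj_on_le[of ?f]) auto
  then show ?thesis using fr cr by (simp add: card_Pow)
qed

end

section \<open>Reduction of p-adic cokernels\<close>

text \<open>Lagrange in the quotient. With \<open>card B = p ^ e\<close>, this is how an isomorphism
  with \<open>B\<close> is turned into a statement about \<open>p ^ e\<close>-multiples.\<close>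

lemma (in group) Mod_iso_pow_mem:
  assumes N: "N \<lhd> G" and iso: "G Mod N \<cong> B" and x: "x \<in> carrier G"
  shows "x [^] card (carrier B) \<in> N"
proof -
  interpret N: normal N G by (rule N)
  interpret Q: group "G Mod N" by (rule N.factorgroup_is_group)
  interpret h: group_hom G "G Mod N" "\<lambda>a. N #> a"
    by unfold_locales (rule N.r_coset_hom_Mod)
  obtain f where "f \<in> iso (G Mod N) B" using iso by (auto simp: is_iso_def)
  then have "order (G Mod N) = card (carrier B)"
    by (auto simp: iso_def order_def dest: bij_betw_same_card)
  then have "(N #> x) [^]\<^bsub>G Mod N\<^esub> card (carrier B) = \<one>\<^bsub>G Mod N\<^esub>"
    using Q.pow_order_eq_1[of "N #> x"] h.hom_closed[OF x] by simp
  then have "N #> (x [^] card (carrier B)) = N"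
    using h.hom_nat_pow[OF x] by (simp add: FactGroup_def)
  then show ?thesis using coset_join1 N.subgroup_axioms x by blast
qed

text \<open>The composite of \<open>h\<close> with the projection modulo \<open>h\<close>
  I\<open>is onto, and its kernel is the preimage of\<close>h \<open>I\<close>; the inclusion of the
  kernel of \<open>h\<close> in \<open>I\<close> makes this preimage \<open>I\<close>.\<close>

lemma (in group_hom) Mod_iso_Mod_image:
  assumes surj: "h ` carrier G = carrier H" and I: "I \<lhd> G" and C: "h ` I \<lhd> H"
    and ker: "kernel G H h \<subseteq> I"
  shows "G Mod I \<cong> H Mod (h ` I)"
proof -
  interpret I: normal I G by (rule I)
  interpret C: normal "h ` I" H by (rule C)
  interpret Q: group "H Mod (h ` I)" by (rule C.factorgroup_is_group)
  let ?f = "\<lambda>x. h ` I #>\<^bsub>H\<^esub> h x"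
  interpret f: group_hom G "H Mod (h ` I)" ?f
  proof unfold_locales
    have "(\<lambda>a. h ` I #>\<^bsub>H\<^esub> a) \<circ> h \<in> hom G (H Mod (h ` I))"
      by (rule Group.hom_compose[OF homh C.r_coset_hom_Mod])
    then show "?f \<in> hom G (H Mod (h ` I))" by (simp add: comp_def)
  qed
  have "?f ` carrier G = carrier (H Mod (h ` I))"
  proof -
    have "?f ` carrier G = (\<lambda>x. h ` I #>\<^bsub>H\<^esub> x) ` (h ` carrier G)" by auto
    then show ?thesis unfolding surj by (auto simp: FactGroup_def RCOSETS_def)
  qed
  moreover have "kernel G (H Mod (h ` I)) ?f = I"
  proof (intro equalityI subsetI)
    fix x assume "x \<in> kernel G (H Mod (h ` I)) ?f"
    then have x: "x \<in> carrier G" and "h ` I #>\<^bsub>H\<^esub> h x = h ` I" by (auto simp: kernel_def FactGroup_def)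
    then have "h x \<in> h ` I" using H.coset_join1[OF _ _ C.subgroup_axioms] by simp
    then obtain y where y: "y \<in> I" "h x = h y" by auto
    have yG: "y \<in> carrier G" using y I.subset by auto
    have "h (x \<otimes> inv y) = \<one>\<^bsub>H\<^esub>" using x yG y by simp
    then have "x \<otimes> inv y \<in> I" using ker x yG by (auto simp: kernel_def)
    then have "(x \<otimes> inv y) \<otimes> y \<in> I" using y(1) by (rule I.m_closed)
    then show "x \<in> I" using x yG by (simp add: G.m_assoc)
  next
    fix x assume x: "x \<in> I"
    then have "h ` I #>\<^bsub>H\<^esub> h x = h ` I" using I.subset by (intro H.coset_join2 C.subgroup_axioms) auto
    then show "x \<in> kernel G (H Mod (h ` I)) ?f" using x I.subset by (auto simp: kernel_def FactGroup_def)
  qed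
  ultimately show ?thesis using f.FactGroup_iso by simp
qed

section \<open>The p-adic integers and vectors over them\<close>

context
  fixes p :: nat
  assumes p: "p > 0"
begin

lemma padic_carrier_iff:
  "x \<in> carrier (padic_int_ring p) \<longleftrightarrow> (\<forall>k. 0 \<le> x k \<and> x k < int p ^ k \<and> x (Suc k) mod int p ^ k = x k)"
  by (simp add: padic_int_ring_def)

lemma padic_carrier_mod:
  assumes "x \<in> carrier (padic_int_ring p)" "k \<le> l"
  shows "x l mod int p ^ k = x k"
  using assms(2)
proof (induction rule: dec_induct)
  case base
  then show ?case using assms(1) by (simp add: padic_carrier_iff)
next
  case (step l)
  have "int p ^ k dvd int p ^ l" using step by (intro le_imp_power_dvd) simp
  then have "x (Suc l) mod int p ^ k = (x (Suc l) mod int p ^ l) mod int p ^ k" by (simp add: mod_mod_cancel)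
  then show ?case using assms(1) step by (simp add: padic_carrier_iff)
qed

lemma padic_of_int_seq:
  assumes "\<And>k. s (Suc k) mod int p ^ k = s k mod int p ^ k"
  shows "(\<lambda>k. s k mod int p ^ k) \<in> carrier (padic_int_ring p)"
  using assms p by (simp add: padic_carrier_iff mod_mod_cancel le_imp_power_dvd)

lemma padic_mult_closed:
  assumes "x \<in> carrier (padic_int_ring p)" "y \<in> carrier (padic_int_ring p)"
  shows "x \<otimes>\<^bsub>padic_int_ring p\<^esub> y \<in> carrier (padic_int_ring p)"
proof -
  have "x (Suc k) * y (Suc k) mod int p ^ k = x k * y k mod int p ^ k" for k
    using assms by (metis mod_mult_eq padic_carrier_iff)
  from padic_of_int_seq[of "\<lambda>k. x k * y k", OF this] show ?thesis by (simp add: padic_int_ring_def)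
qed

lemma padic_add_closed:
  assumes "x \<in> carrier (padic_int_ring p)" "y \<in> carrier (padic_int_ring p)"
  shows "(\<lambda>k. (x k + y k) mod int p ^ k) \<in> carrier (padic_int_ring p)"
proof -
  have "(x (Suc k) + y (Suc k)) mod int p ^ k = (x k + y k) mod int p ^ k" for k
    using assms by (metis mod_add_eq padic_carrier_iff)
  from padic_of_int_seq[of "\<lambda>k. x k + y k", OF this] show ?thesis .
qed

lemma padic_add_comm_group: "comm_group (add_monoid (padic_int_ring p))"
proof (rule comm_groupI)
  fix x y z
  assume x: "x \<in> carrier (add_monoid (padic_int_ring p))"
  have x': "0 \<le> x k" "x k < int p ^ k" "x (Suc k) mod int p ^ k = x k" for k using x by (auto simp: padic_carrier_iff)
  show "\<one>\<^bsub>add_monoid (padic_int_ring p)\<^esub> \<otimes>\<^bsub>add_monoid (padic_int_ring p)\<^esub> x = x"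
    using x' by (auto simp: padic_int_ring_def)
  show "\<exists>y\<in>carrier (add_monoid (padic_int_ring p)). y \<otimes>\<^bsub>add_monoid (padic_int_ring p)\<^esub> x = \<one>\<^bsub>add_monoid (padic_int_ring p)\<^esub>"
  proof (rule bexI[of _ "\<lambda>k. (- x k) mod int p ^ k"])
    have "(- x (Suc k)) mod int p ^ k = (- x k) mod int p ^ k" for k using x'(3)[of k] by (metis mod_minus_eq)
    from padic_of_int_seq[of "\<lambda>k. - x k", OF this]
    show "(\<lambda>k. (- x k) mod int p ^ k) \<in> carrier (add_monoid (padic_int_ring p))" by simp
    show "(\<lambda>k. (- x k) mod int p ^ k) \<otimes>\<^bsub>add_monoid (padic_int_ring p)\<^esub> x = \<one>\<^bsub>add_monoid (padic_int_ring p)\<^esub>"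
      by (simp add: padic_int_ring_def mod_simps)
  qed
  assume y: "y \<in> carrier (add_monoid (padic_int_ring p))"
  show "x \<otimes>\<^bsub>add_monoid (padic_int_ring p)\<^esub> y \<in> carrier (add_monoid (padic_int_ring p))"
    using padic_add_closed[of x y] x y by (simp add: padic_int_ring_def)
  show "x \<otimes>\<^bsub>add_monoid (padic_int_ring p)\<^esub> y = y \<otimes>\<^bsub>add_monoid (padic_int_ring p)\<^esub> x"
    by (simp add: padic_int_ring_def add.commute)
  show "x \<otimes>\<^bsub>add_monoid (padic_int_ring p)\<^esub> y \<otimes>\<^bsub>add_monoid (padic_int_ring p)\<^esub> z
    = x \<otimes>\<^bsub>add_monoid (padic_int_ring p)\<^esub> (y \<otimes>\<^bsub>add_monoid (padic_int_ring p)\<^esub> z)"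
    by (simp add: padic_int_ring_def mod_simps add.assoc)
next
  have "(0 :: int) < int p ^ k" for k using p by simp
  then show "\<one>\<^bsub>add_monoid (padic_int_ring p)\<^esub> \<in> carrier (add_monoid (padic_int_ring p))"
    by (simp add: padic_int_ring_def)
qed

lemma padic_finsum:
  assumes "finite J" "\<And>j. j \<in> J \<Longrightarrow> f j \<in> carrier (padic_int_ring p)"
  shows "finsum (padic_int_ring p) f J k = (\<Sum>j\<in>J. f j k) mod int p ^ k"
    and "finsum (padic_int_ring p) f J \<in> carrier (padic_int_ring p)"
proof -
  interpret comm_group "add_monoid (padic_int_ring p)" by (rule padic_add_comm_group)
  have "finsum (padic_int_ring p) f J k = (\<Sum>j\<in>J. f j k) mod int p ^ k \<and>
      finsum (padic_int_ring p) f J \<in> carrier (padic_int_ring p)"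
    using assms unfolding finsum_def
  proof (induction J)
    case empty
    have "finprod (add_monoid (padic_int_ring p)) f {} = \<one>\<^bsub>add_monoid (padic_int_ring p)\<^esub>" by (rule finprod_empty)
    then show ?case using one_closed by (simp only:) (simp add: padic_int_ring_def)
  next
    case (insert j J)
    have f: "f \<in> J \<rightarrow> carrier (add_monoid (padic_int_ring p))" "f j \<in> carrier (add_monoid (padic_int_ring p))"
      using insert.prems by auto
    have "finprod (add_monoid (padic_int_ring p)) f (insert j J)
        = f j \<otimes>\<^bsub>add_monoid (padic_int_ring p)\<^esub> finprod (add_monoid (padic_int_ring p)) f J"
      by (rule finprod_insert[OF insert.hyps f])
    moreover have "f j \<otimes>\<^bsub>add_monoid (padic_int_ring p)\<^esub> finprod (add_monoid (padic_int_ring p)) f J \<in> carrier (add_monoid (padic_int_ring p))"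
      using f by (intro m_closed finprod_closed)
    moreover have "finprod (add_monoid (padic_int_ring p)) f J k = (\<Sum>j\<in>J. f j k) mod int p ^ k"
      using insert.IH insert.prems by simp
    ultimately show ?case using insert.hyps by (simp add: padic_int_ring_def mod_simps)
  qed
  then show "finsum (padic_int_ring p) f J k = (\<Sum>j\<in>J. f j k) mod int p ^ k"
    "finsum (padic_int_ring p) f J \<in> carrier (padic_int_ring p)" by auto
qed

lemma padic_vec_carrier: "carrier (padic_vec_group p n) = {1..n} \<rightarrow>\<^sub>E carrier (padic_int_ring p)"
  by (simp add: padic_vec_group_def)

lemma padic_vec_mult:
  "v \<otimes>\<^bsub>padic_vec_group p n\<^esub> u = (\<lambda>i\<in>{1..n}. \<lambda>k. (v i k + u i k) mod int p ^ k)"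
  by (simp add: padic_vec_group_def padic_int_ring_def)

lemma padic_vec_one: "\<one>\<^bsub>padic_vec_group p n\<^esub> = (\<lambda>i\<in>{1..n}. \<lambda>k. 0)"
  by (simp add: padic_vec_group_def padic_int_ring_def)

lemma padic_vec_comm_group: "comm_group (padic_vec_group p n)"
proof -
  interpret A: comm_group "add_monoid (padic_int_ring p)" by (rule padic_add_comm_group)
  interpret group "padic_vec_group p n"
    unfolding padic_vec_group_def by (rule product_group) (rule A.is_group)
  show ?thesis by (rule group_comm_groupI) (simp add: padic_vec_mult add.commute)
qed

lemma padic_vec_pow:
  assumes "v \<in> carrier (padic_vec_group p n)"
  shows "v [^]\<^bsub>padic_vec_group p n\<^esub> (m :: nat) = (\<lambda>i\<in>{1..n}. \<lambda>k. (int m * v i k) mod int p ^ k)"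
proof (induction m)
  case 0
  then show ?case by (simp add: padic_vec_one)
next
  case (Suc m)
  then show ?case by (auto simp: padic_vec_mult algebra_simps mod_simps intro!: restrict_ext)
qed

section \<open>Cokernels modulo a power of p\<close>

context
  fixes n :: nat and R :: "nat \<Rightarrow> nat \<Rightarrow> nat \<Rightarrow> int"
  assumes R: "\<And>i j. i \<in> {1..n} \<Longrightarrow> j \<in> {1..n} \<Longrightarrow> R i j \<in> carrier (padic_int_ring p)"
begin

lemma padic_mat_vec_apply:
  assumes "v \<in> carrier (padic_vec_group p n)" "i \<in> {1..n}"
  shows "padic_mat_vec p n R v i k = (\<Sum>j\<in>{1..n}. R i j k * v j k) mod int p ^ k"
proof -
  have vc: "v j \<in> carrier (padic_int_ring p)" if "j \<in> {1..n}" for j using assms that by (auto simp: padic_vec_carrier)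
  have "padic_mat_vec p n R v i k = (\<Sum>j\<in>{1..n}. (R i j \<otimes>\<^bsub>padic_int_ring p\<^esub> v j) k) mod int p ^ k"
  proof -
    have e: "padic_mat_vec p n R v i = finsum (padic_int_ring p) (\<lambda>j. R i j \<otimes>\<^bsub>padic_int_ring p\<^esub> v j) {1..n}"
      using assms(2) by (simp add: padic_mat_vec_def)
    show ?thesis unfolding e
      by (rule padic_finsum(1)) (auto intro!: padic_mult_closed R vc assms(2))
  qed
  also have "\<dots> = (\<Sum>j\<in>{1..n}. R i j k * v j k mod int p ^ k) mod int p ^ k" by (simp add: padic_int_ring_def)
  finally show ?thesis by (simp only: mod_sum_eq)
qed

lemma padic_mat_vec_closed:
  assumes "v \<in> carrier (padic_vec_group p n)"
  shows "padic_mat_vec p n R v \<in> carrier (padic_vec_group p n)"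
proof -
  have vc: "v j \<in> carrier (padic_int_ring p)" if "j \<in> {1..n}" for j using assms that by (auto simp: padic_vec_carrier)
  then show ?thesis
    using R by (auto simp: padic_mat_vec_def padic_vec_carrier intro!: padic_finsum padic_mult_closed)
qed

lemma padic_mat_vec_hom: "padic_mat_vec p n R \<in> hom (padic_vec_group p n) (padic_vec_group p n)"
proof (rule homI)
  interpret comm_group "padic_vec_group p n" by (rule padic_vec_comm_group)
  fix v u assume v: "v \<in> carrier (padic_vec_group p n)" and u: "u \<in> carrier (padic_vec_group p n)"
  show "padic_mat_vec p n R (v \<otimes>\<^bsub>padic_vec_group p n\<^esub> u) = padic_mat_vec p n R v \<otimes>\<^bsub>padic_vec_group p n\<^esub> padic_mat_vec p n R u"
  proof (rule extensionalityI[of _ "{1..n}"])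
    fix i assume i: "i \<in> {1..n}"
    show "padic_mat_vec p n R (v \<otimes>\<^bsub>padic_vec_group p n\<^esub> u) i = (padic_mat_vec p n R v \<otimes>\<^bsub>padic_vec_group p n\<^esub> padic_mat_vec p n R u) i"
    proof
      fix k
      have "(\<Sum>j\<in>{1..n}. R i j k * (v \<otimes>\<^bsub>padic_vec_group p n\<^esub> u) j k) mod int p ^ k
         = (\<Sum>j\<in>{1..n}. (R i j k * ((v j k + u j k) mod int p ^ k)) mod int p ^ k) mod int p ^ k"
        by (simp add: padic_vec_mult mod_sum_eq)
      also have "\<dots> = (\<Sum>j\<in>{1..n}. (R i j k * (v j k + u j k)) mod int p ^ k) mod int p ^ k"
        by (simp only: mod_mult_right_eq)
      also have "\<dots> = ((\<Sum>j\<in>{1..n}. R i j k * v j k) + (\<Sum>j\<in>{1..n}. R i j k * u j k)) mod int p ^ k"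
        by (simp only: mod_sum_eq distrib_left sum.distrib)
      finally show "padic_mat_vec p n R (v \<otimes>\<^bsub>padic_vec_group p n\<^esub> u) i k = (padic_mat_vec p n R v \<otimes>\<^bsub>padic_vec_group p n\<^esub> padic_mat_vec p n R u) i k"
        using i by (simp add: padic_mat_vec_apply[OF _ i] v u m_closed padic_vec_mult[where v = "padic_mat_vec p n R v"] mod_add_eq)
    qed
  qed (auto simp: padic_mat_vec_def padic_vec_mult)
qed (rule padic_mat_vec_closed)

text \<open>Nakayama by successive approximation: solving up to an error in \<open>p ^ Suc e\<close>
  can be repeated for the error itself, which is \<open>p\<close> times a vector of the same kind,
  and the corrections form a convergent series.\<close>

lemma padic_image_limit:
  assumes step: "\<And>v. v \<in> carrier (padic_vec_group p n) \<Longrightarrow>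
      \<exists>w\<in>carrier (padic_vec_group p n). \<exists>u\<in>carrier (padic_vec_group p n).
        v [^]\<^bsub>padic_vec_group p n\<^esub> (p ^ e) = padic_mat_vec p n R w \<otimes>\<^bsub>padic_vec_group p n\<^esub> u [^]\<^bsub>padic_vec_group p n\<^esub> (p ^ Suc e)"
    and v: "v \<in> carrier (padic_vec_group p n)"
  shows "v [^]\<^bsub>padic_vec_group p n\<^esub> (p ^ e) \<in> padic_mat_vec p n R ` carrier (padic_vec_group p n)"
proof -
  let ?V = "padic_vec_group p n"
  interpret comm_group ?V by (rule padic_vec_comm_group)
  obtain W U where WU: "\<And>v. v \<in> carrier ?V \<Longrightarrow> W v \<in> carrier ?V"
    "\<And>v. v \<in> carrier ?V \<Longrightarrow> U v \<in> carrier ?V"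
    "\<And>v. v \<in> carrier ?V \<Longrightarrow> v [^]\<^bsub>?V\<^esub> (p ^ e) = padic_mat_vec p n R (W v) \<otimes>\<^bsub>?V\<^esub> U v [^]\<^bsub>?V\<^esub> (p ^ Suc e)"
    using step by metis
  \<comment> \<open>The successive remainders; \<open>ws\<close> are the corresponding corrections,
    so that \<open>p ^ e * vs t = R (ws t) + p ^ Suc e * vs (Suc t)\<close>.\<close>
  define vs where "vs t = (U ^^ t) v" for t
  define ws where "ws t = W (vs t)" for t
  have vs: "vs t \<in> carrier ?V" for t
    unfolding vs_def by (induction t) (use v WU in auto)
  have ws: "ws t \<in> carrier ?V" for t using WU(1)[OF vs] by (simp add: ws_def)
  have wsc: "ws t i \<in> carrier (padic_int_ring p)" if "i \<in> {1..n}" for t i using ws[of t] that by (auto simp: padic_vec_carrier)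
  have rec: "[int p ^ e * vs t i k = (\<Sum>j\<in>{1..n}. R i j k * ws t j k) + int p ^ Suc e * vs (Suc t) i k] (mod int p ^ k)"
    if i: "i \<in> {1..n}" for t i k
  proof -
    have e1: "(vs t [^]\<^bsub>?V\<^esub> (p ^ e)) i k = (int p ^ e * vs t i k) mod int p ^ k"
      using i by (simp add: padic_vec_pow[OF vs])
    have "vs t [^]\<^bsub>?V\<^esub> (p ^ e) = padic_mat_vec p n R (ws t) \<otimes>\<^bsub>?V\<^esub> vs (Suc t) [^]\<^bsub>?V\<^esub> (p ^ Suc e)"
      using WU(3)[OF vs[of t]] by (simp add: vs_def ws_def)
    then have "(vs t [^]\<^bsub>?V\<^esub> (p ^ e)) i k = (padic_mat_vec p n R (ws t) i k + (int p ^ Suc e * vs (Suc t) i k) mod int p ^ k) mod int p ^ k"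
      using i by (simp add: padic_vec_mult padic_vec_pow[OF vs])
    then show ?thesis
      unfolding e1 padic_mat_vec_apply[OF ws i] cong_def by (simp only: mod_add_eq)
  qed
  \<comment> \<open>The series of \<open>p ^ t * ws t\<close>. Modulo \<open>p ^ k\<close> the terms
    with \<open>t \<ge> k\<close> vanish, so a finite sum gives each coordinate.\<close>
  define w where "w = (\<lambda>i\<in>{1..n}. \<lambda>k. (\<Sum>t<k. int p ^ t * ws t i k) mod int p ^ k)"
  have w: "w \<in> carrier ?V"
  proof -
    have "(\<lambda>k. (\<Sum>t<k. int p ^ t * ws t i k) mod int p ^ k) \<in> carrier (padic_int_ring p)" if i: "i \<in> {1..n}" for i
    proof (rule padic_of_int_seq)
      fix k
      have "(\<Sum>t<Suc k. int p ^ t * ws t i (Suc k)) mod int p ^ k = (\<Sum>t<k. int p ^ t * ws t i (Suc k)) mod int p ^ k"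
        by simp
      also have "\<dots> = (\<Sum>t<k. int p ^ t * (ws t i (Suc k) mod int p ^ k)) mod int p ^ k"
        by (subst (1 2) mod_sum_eq[symmetric]) (simp only: mod_mult_right_eq)
      also have "\<dots> = (\<Sum>t<k. int p ^ t * ws t i k) mod int p ^ k"
        using wsc[OF i] by (simp add: padic_carrier_iff)
      finally show "(\<Sum>t<Suc k. int p ^ t * ws t i (Suc k)) mod int p ^ k = (\<Sum>t<k. int p ^ t * ws t i k) mod int p ^ k" .
    qed
    then show ?thesis by (auto simp: w_def padic_vec_carrier)
  qed
  have "v [^]\<^bsub>?V\<^esub> (p ^ e) = padic_mat_vec p n R w"
  proof (rule extensionalityI[of _ "{1..n}"])
    fix i assume i: "i \<in> {1..n}"
    show "(v [^]\<^bsub>?V\<^esub> (p ^ e)) i = padic_mat_vec p n R w i"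
    proof
      fix k
      let ?q = "int p ^ k"
      have partial: "[(\<Sum>t<m. int p ^ t * (\<Sum>j\<in>{1..n}. R i j k * ws t j k)) + int p ^ (e + m) * vs m i k = int p ^ e * v i k] (mod ?q)" for m
      proof (induction m)
        case 0
        then show ?case by (simp add: vs_def)
      next
        case (Suc m)
        have "[int p ^ m * ((\<Sum>j\<in>{1..n}. R i j k * ws m j k) + int p ^ Suc e * vs (Suc m) i k) = int p ^ m * (int p ^ e * vs m i k)] (mod ?q)"
          using rec[OF i, of m k] by (intro cong_scalar_left) (rule cong_sym)
        then have c1: "[(\<Sum>t<m. int p ^ t * (\<Sum>j\<in>{1..n}. R i j k * ws t j k)) + int p ^ m * ((\<Sum>j\<in>{1..n}. R i j k * ws m j k) + int p ^ Suc e * vs (Suc m) i k)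
            = (\<Sum>t<m. int p ^ t * (\<Sum>j\<in>{1..n}. R i j k * ws t j k)) + int p ^ m * (int p ^ e * vs m i k)] (mod ?q)"
          by (intro cong_add cong_refl)
        have e1: "(\<Sum>t<m. int p ^ t * (\<Sum>j\<in>{1..n}. R i j k * ws t j k)) + int p ^ m * ((\<Sum>j\<in>{1..n}. R i j k * ws m j k) + int p ^ Suc e * vs (Suc m) i k)
            = (\<Sum>t<Suc m. int p ^ t * (\<Sum>j\<in>{1..n}. R i j k * ws t j k)) + int p ^ (e + Suc m) * vs (Suc m) i k"
          by (simp only: distrib_left sum.lessThan_Suc power_add power_Suc mult_ac add_ac)
        have e2: "(\<Sum>t<m. int p ^ t * (\<Sum>j\<in>{1..n}. R i j k * ws t j k)) + int p ^ m * (int p ^ e * vs m i k)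
            = (\<Sum>t<m. int p ^ t * (\<Sum>j\<in>{1..n}. R i j k * ws t j k)) + int p ^ (e + m) * vs m i k"
          by (simp only: power_add mult_ac)
        show ?case by (rule cong_trans[OF c1[unfolded e1 e2] Suc])
      qed
      have c1: "[(\<Sum>j\<in>{1..n}. R i j k * w j k) = (\<Sum>j\<in>{1..n}. R i j k * (\<Sum>t<k. int p ^ t * ws t j k))] (mod ?q)"
        by (intro cong_sum cong_scalar_left) (simp add: w_def cong_def)
      have e1: "(\<Sum>j\<in>{1..n}. R i j k * (\<Sum>t<k. int p ^ t * ws t j k)) = (\<Sum>t<k. int p ^ t * (\<Sum>j\<in>{1..n}. R i j k * ws t j k))"
        unfolding sum_distrib_left by (subst sum.swap) (simp only: mult_ac)
      \<comment> \<open>After \<open>k\<close> rounds the remainder carries the factor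
        \<open>p ^ (e + k)\<close> and disappears modulo \<open>p ^ k\<close>.\<close>
      have c2: "[(\<Sum>t<k. int p ^ t * (\<Sum>j\<in>{1..n}. R i j k * ws t j k)) = (\<Sum>t<k. int p ^ t * (\<Sum>j\<in>{1..n}. R i j k * ws t j k)) + int p ^ (e + k) * vs k i k] (mod ?q)"
      proof -
        have h: "int p ^ (e + k) * vs k i k = ?q * (int p ^ e * vs k i k)" by (simp add: power_add mult_ac)
        show ?thesis unfolding h cong_def by simp
      qed
      have "[(\<Sum>j\<in>{1..n}. R i j k * w j k) = int p ^ e * v i k] (mod ?q)"
        by (rule cong_trans[OF cong_trans[OF c1[unfolded e1] c2] partial])
      then show "(v [^]\<^bsub>?V\<^esub> (p ^ e)) i k = padic_mat_vec p n R w i k"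
        using i by (simp add: padic_vec_pow[OF v] padic_mat_vec_apply[OF w i] cong_def)
    qed
  qed (auto simp: padic_mat_vec_def padic_vec_pow[OF v])
  then show ?thesis using w by blast
qed


definition padic_reduce :: "nat \<Rightarrow> (nat \<Rightarrow> nat \<Rightarrow> int) \<Rightarrow> nat \<Rightarrow> int" where
  "padic_reduce K v = (\<lambda>i\<in>{1..n}. v i K)"

definition reduced_col :: "nat \<Rightarrow> nat \<Rightarrow> nat \<Rightarrow> int" where
  "reduced_col K j = (\<lambda>i\<in>{1..n}. R i j K)"

lemma pK_pos: "p ^ K > 0"
  using p by simp

lemma padic_reduce_hom: "padic_reduce K \<in> hom (padic_vec_group p n) (zvec n (p ^ K))"
proof (rule homI)
  fix v u assume v: "v \<in> carrier (padic_vec_group p n)" and u: "u \<in> carrier (padic_vec_group p n)"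
  show "padic_reduce K v \<in> carrier (zvec n (p ^ K))"
    using v by (auto simp: padic_reduce_def carrier_zvec[OF pK_pos] padic_vec_carrier padic_carrier_iff PiE_iff)
  show "padic_reduce K (v \<otimes>\<^bsub>padic_vec_group p n\<^esub> u) = padic_reduce K v \<otimes>\<^bsub>zvec n (p ^ K)\<^esub> padic_reduce K u"
    by (auto simp: padic_reduce_def mult_zvec[OF pK_pos] padic_vec_mult intro!: restrict_ext)
qed

lemma padic_reduce_surj: "padic_reduce K ` carrier (padic_vec_group p n) = carrier (zvec n (p ^ K))"
proof
  show "padic_reduce K ` carrier (padic_vec_group p n) \<subseteq> carrier (zvec n (p ^ K))"
    using padic_reduce_hom by (auto simp: hom_def)
  show "carrier (zvec n (p ^ K)) \<subseteq> padic_reduce K ` carrier (padic_vec_group p n)"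
  proof
    fix u assume u: "u \<in> carrier (zvec n (p ^ K))"
    let ?v = "\<lambda>i\<in>{1..n}. \<lambda>k. u i mod int p ^ k"
    have "?v \<in> carrier (padic_vec_group p n)"
      using padic_of_int_seq[of "\<lambda>k. u _"] by (auto simp: padic_vec_carrier)
    moreover have "padic_reduce K ?v = u"
      using u by (intro extensionalityI[of _ "{1..n}"]) (auto simp: padic_reduce_def carrier_zvec[OF pK_pos] PiE_iff)
    ultimately show "u \<in> padic_reduce K ` carrier (padic_vec_group p n)" by (metis imageI)
  qed
qed

text \<open>Exactness: a vector that vanishes modulo \<open>p ^ K\<close> can be divided by
  \<open>p ^ K\<close> within the \<open>p\<close>-adic integers.\<close>

lemma padic_reduce_ker:
  assumes v: "v \<in> carrier (padic_vec_group p n)" and ker: "padic_reduce K v = \<one>\<^bsub>zvec n (p ^ K)\<^esub>"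
  shows "\<exists>u\<in>carrier (padic_vec_group p n). v = u [^]\<^bsub>padic_vec_group p n\<^esub> (p ^ K)"
proof -
  have vc: "v i \<in> carrier (padic_int_ring p)" if "i \<in> {1..n}" for i using v that by (auto simp: padic_vec_carrier)
  have z: "v i K = 0" if "i \<in> {1..n}" for i
    using fun_cong[OF ker, of i] that by (simp add: padic_reduce_def one_zvec[OF pK_pos])
  let ?q = "int p ^ K"
  have q0: "?q > 0" using p by simp
  \<comment> \<open>Division loses \<open>K\<close> digits of precision, hence the shifted index
    \<open>k + K\<close>.\<close>
  define u where "u = (\<lambda>i\<in>{1..n}. \<lambda>k. v i (k + K) div ?q)"
  have uc: "(\<lambda>k. v i (k + K) div ?q) \<in> carrier (padic_int_ring p)" if i: "i \<in> {1..n}" for i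
    unfolding padic_carrier_iff
  proof (intro allI conjI)
    fix k
    have b: "0 \<le> v i (k + K)" "v i (k + K) < int p ^ k * ?q" "v i (Suc k + K) mod (?q * int p ^ k) = v i (k + K)"
    proof -
      have c: "\<forall>k. 0 \<le> v i k \<and> v i k < int p ^ k \<and> v i (Suc k) mod int p ^ k = v i k"
        by (rule padic_carrier_iff[THEN iffD1, OF vc[OF i]])
      have "0 \<le> v i (k + K)" "v i (k + K) < int p ^ (k + K)" "v i (Suc (k + K)) mod int p ^ (k + K) = v i (k + K)"
        using c by blast+
      then show "0 \<le> v i (k + K)" "v i (k + K) < int p ^ k * ?q" "v i (Suc k + K) mod (?q * int p ^ k) = v i (k + K)"
        by (simp_all only: power_add mult.commute[of ?q] add_Suc)
    qed
    show "0 \<le> v i (k + K) div ?q" using b q0 by (simp add: pos_imp_zdiv_nonneg_iff)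
    show "v i (k + K) div ?q < int p ^ k" 
    proof (rule ccontr)
      assume "\<not> ?thesis"
      then have "int p ^ k * ?q \<le> (v i (k + K) div ?q) * ?q" using q0 by (intro mult_right_mono) auto
      moreover have "(v i (k + K) div ?q) * ?q + v i (k + K) mod ?q = v i (k + K)" by (rule div_mult_mod_eq)
      moreover have "0 \<le> v i (k + K) mod ?q" using q0 by simp
      ultimately show False using b(2) by linarith
    qed
    show "v i (Suc k + K) div ?q mod int p ^ k = v i (k + K) div ?q"
    proof -
      have "v i (Suc k + K) mod (?q * int p ^ k) = ?q * (v i (Suc k + K) div ?q mod int p ^ k) + v i (Suc k + K) mod ?q"
        using q0 by (simp add: zmod_zmult2_eq)
      moreover have "v i (Suc k + K) mod ?q = 0" using padic_carrier_mod[OF vc[OF i], of K "Suc k + K"] z[OF i] by simp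
      ultimately have "v i (k + K) = ?q * (v i (Suc k + K) div ?q mod int p ^ k)" using b(3) by simp
      then show ?thesis using q0 by simp
    qed
  qed
  then have u: "u \<in> carrier (padic_vec_group p n)" by (auto simp: u_def padic_vec_carrier)
  have "v = u [^]\<^bsub>padic_vec_group p n\<^esub> (p ^ K)"
  proof (rule extensionalityI[of _ "{1..n}"])
    show "v \<in> extensional {1..n}" using v by (auto simp: padic_vec_carrier PiE_iff)
    show "u [^]\<^bsub>padic_vec_group p n\<^esub> (p ^ K) \<in> extensional {1..n}" by (simp add: padic_vec_pow[OF u])
    fix i assume i: "i \<in> {1..n}"
    show "v i = (u [^]\<^bsub>padic_vec_group p n\<^esub> (p ^ K)) i"
    proof
      fix k
      have "?q * (v i (k + K) div ?q) = v i (k + K)"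
        using padic_carrier_mod[OF vc[OF i], of K "k + K"] z[OF i] by (simp add: mod_eq_0_iff_dvd)
      moreover have "v i (k + K) mod int p ^ k = v i k" using padic_carrier_mod[OF vc[OF i], of k "k + K"] by simp
      ultimately show "v i k = (u [^]\<^bsub>padic_vec_group p n\<^esub> (p ^ K)) i k"
        using i unfolding padic_vec_pow[OF u] by (simp add: u_def)
    qed
  qed
  then show ?thesis using u by blast
qed

text \<open>Modulo \<open>p ^ K\<close> every \<open>p\<close>-adic coefficient is a natural number,
  so the reduced image consists of the combinations of the reduced columns that
  \<open>generate\<close> produces.\<close>

lemma padic_reduce_image:
  "padic_reduce K ` (padic_mat_vec p n R ` carrier (padic_vec_group p n))
    = generate (zvec n (p ^ K)) (reduced_col K ` {1..n})"
proof -
  let ?V = "zvec n (p ^ K)" and ?P = "padic_vec_group p n"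
  interpret V: finite_comm_group ?V by (rule finite_comm_group_zvec[OF pK_pos])
  interpret P: comm_group ?P by (rule padic_vec_comm_group)
  interpret m: group_hom ?P ?P "padic_mat_vec p n R" by unfold_locales (rule padic_mat_vec_hom)
  interpret r: group_hom ?P ?V "padic_reduce K" by unfold_locales (rule padic_reduce_hom)
  have colc: "reduced_col K j \<in> carrier ?V" if "j \<in> {1..n}" for j
    using R[OF _ that] by (auto simp: reduced_col_def carrier_zvec[OF pK_pos] padic_carrier_iff)
  then have cols: "reduced_col K ` {1..n} \<subseteq> carrier ?V" by auto
  \<comment> \<open>Natural coefficients suffice because the representatives \<open>v j K\<close>
    are nonnegative.\<close>
  have comb: "(\<lambda>i\<in>{1..n}. (\<Sum>j\<in>J. R i j K * int (c j)) mod int (p ^ K)) \<in> generate ?V (reduced_col K ` {1..n})"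
    if "finite J" "J \<subseteq> {1..n}" for J and c :: "nat \<Rightarrow> nat"
    using that
  proof (induction J)
    case empty
    have "(\<lambda>i\<in>{1..n}. (\<Sum>j\<in>{}. R i j K * int (c j)) mod int (p ^ K)) = \<one>\<^bsub>?V\<^esub>" by (simp add: one_zvec[OF pK_pos])
    then show ?case using generate.one by simp
  next
    case (insert j J)
    let ?x = "\<lambda>i\<in>{1..n}. (\<Sum>j\<in>J. R i j K * int (c j)) mod int (p ^ K)"
    have sg: "subgroup (generate ?V (reduced_col K ` {1..n})) ?V" by (rule V.generate_is_subgroup[OF cols])
    have "reduced_col K j \<in> generate ?V (reduced_col K ` {1..n})" using insert by (intro generate.incl) auto
    then have "reduced_col K j [^]\<^bsub>?V\<^esub> c j \<in> generate ?V (reduced_col K ` {1..n})"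
      using V.subgroup_int_pow_closed[OF sg, of _ "int (c j)"] by (simp add: int_pow_int)
    then have "?x \<otimes>\<^bsub>?V\<^esub> reduced_col K j [^]\<^bsub>?V\<^esub> c j \<in> generate ?V (reduced_col K ` {1..n})"
    proof (rule subgroup.m_closed[OF sg, rotated])
      show "?x \<in> generate ?V (reduced_col K ` {1..n})" using insert.IH insert.prems by blast
    qed
    moreover have "?x \<otimes>\<^bsub>?V\<^esub> reduced_col K j [^]\<^bsub>?V\<^esub> c j = (\<lambda>i\<in>{1..n}. (\<Sum>j\<in>insert j J. R i j K * int (c j)) mod int (p ^ K))"
      using insert(1,2) by (auto simp: mult_zvec[OF pK_pos] pow_zvec[OF pK_pos] reduced_col_def mod_simps algebra_simps intro!: restrict_ext)
    ultimately show ?case by (simp only:)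
  qed
  show ?thesis
  proof
    show "padic_reduce K ` (padic_mat_vec p n R ` carrier ?P) \<subseteq> generate ?V (reduced_col K ` {1..n})"
    proof clarify
      fix v assume v: "v \<in> carrier ?P"
      have v0: "0 \<le> v j K" if "j \<in> {1..n}" for j using v that by (auto simp: padic_vec_carrier padic_carrier_iff PiE_iff)
      have "padic_reduce K (padic_mat_vec p n R v) = (\<lambda>i\<in>{1..n}. (\<Sum>j\<in>{1..n}. R i j K * int (nat (v j K))) mod int (p ^ K))"
        using v0 by (auto simp: padic_reduce_def padic_mat_vec_apply[OF v] intro!: restrict_ext)
      then show "padic_reduce K (padic_mat_vec p n R v) \<in> generate ?V (reduced_col K ` {1..n})"
        using comb[of "{1..n}" "\<lambda>j. nat (v j K)"] by simp
    qed
    have "reduced_col K j \<in> padic_reduce K ` (padic_mat_vec p n R ` carrier ?P)" if j: "j \<in> {1..n}" for j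
    proof -
      define E where "E = (\<lambda>i\<in>{1..n}. \<lambda>k. (if i = j then 1 else 0) mod int p ^ k)"
      have e: "E \<in> carrier ?P"
        using padic_of_int_seq[of "\<lambda>k. if _ = j then 1 else 0"] by (auto simp: padic_vec_carrier E_def)
      have "padic_reduce K (padic_mat_vec p n R E) i = reduced_col K j i" if i: "i \<in> {1..n}" for i
      proof -
        have "padic_mat_vec p n R E i K = (\<Sum>l\<in>{1..n}. (R i l K * ((if l = j then 1 else 0) mod int p ^ K)) mod int p ^ K) mod int p ^ K"
          by (subst padic_mat_vec_apply[OF e i]) (simp add: mod_sum_eq E_def)
        also have "\<dots> = (\<Sum>l\<in>{1..n}. R i l K * (if l = j then 1 else 0)) mod int p ^ K"
          by (simp only: mod_mult_right_eq mod_sum_eq)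
        also have "(\<Sum>l\<in>{1..n}. R i l K * (if l = j then 1 else 0)) = R i j K"
          using j by (simp add: if_distrib[of "(*) _"] cong: if_cong)
        also have "R i j K mod int p ^ K = R i j K" using R[OF i j] by (simp add: padic_carrier_iff)
        finally show ?thesis using i by (simp add: padic_reduce_def reduced_col_def)
      qed
      then have "padic_reduce K (padic_mat_vec p n R E) = reduced_col K j"
        by (intro extensionalityI[of _ "{1..n}"]) (auto simp: padic_reduce_def reduced_col_def)
      then show ?thesis using e by (metis imageI)
    qed
    moreover have "subgroup (padic_reduce K ` (padic_mat_vec p n R ` carrier ?P)) ?V"
      by (intro r.subgroup_img_is_subgroup m.img_is_subgroup)
    ultimately show "generate ?V (reduced_col K ` {1..n}) \<subseteq> padic_reduce K ` (padic_mat_vec p n R ` carrier ?P)"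
      by (intro V.generate_subgroup_incl) auto
  qed
qed

text \<open>One exponent more than \<open>e\<close> is decisive: modulo \<open>p ^ Suc e\<close> one
  can see that \<open>p ^ e\<close> kills the quotient, and then everything divisible by
  \<open>p ^ Suc e\<close> lies in the image of the matrix, so reduction loses nothing.\<close>

lemma padic_cok_iso_iff:
  fixes B :: "('b, 'c) monoid_scheme"
  assumes card: "card (carrier B) = p ^ e"
  shows "padic_cok p n R \<cong> B \<longleftrightarrow>
    zvec n (p ^ Suc e) Mod generate (zvec n (p ^ Suc e)) (reduced_col (Suc e) ` {1..n}) \<cong> B"
proof -
  let ?K = "Suc e"
  let ?V = "zvec n (p ^ ?K)" and ?P = "padic_vec_group p n"
  interpret V: finite_comm_group ?V by (rule finite_comm_group_zvec[OF pK_pos])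
  interpret P: comm_group ?P by (rule padic_vec_comm_group)
  interpret m: group_hom ?P ?P "padic_mat_vec p n R" by unfold_locales (rule padic_mat_vec_hom)
  interpret r: group_hom ?P ?V "padic_reduce ?K" by unfold_locales (rule padic_reduce_hom)
  let ?I = "padic_mat_vec p n R ` carrier ?P"
  let ?C = "generate ?V (reduced_col ?K ` {1..n})"
  have I: "subgroup ?I ?P" by (rule m.img_is_subgroup)
  have IC: "padic_reduce ?K ` ?I = ?C" by (rule padic_reduce_image)
  have C: "subgroup ?C ?V" unfolding IC[symmetric] by (rule r.subgroup_img_is_subgroup[OF I])
  have In: "?I \<lhd> ?P" by (rule P.subgroup_imp_normal[OF I])
  have Cn: "?C \<lhd> ?V" by (rule V.subgroup_imp_normal[OF C])
  have cok: "padic_cok p n R = ?P Mod ?I" by (simp add: padic_cok_def)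
  \<comment> \<open>A multiple of \<open>p ^ Suc e\<close> is in particular a multiple of
    \<open>p ^ e\<close>.\<close>
  have powI: "kernel ?P ?V (padic_reduce ?K) \<subseteq> ?I" if *: "\<And>v. v \<in> carrier ?P \<Longrightarrow> v [^]\<^bsub>?P\<^esub> (p ^ e) \<in> ?I"
  proof
    fix v assume "v \<in> kernel ?P ?V (padic_reduce ?K)"
    then obtain u where u: "u \<in> carrier ?P" "v = u [^]\<^bsub>?P\<^esub> (p ^ ?K)"
      using padic_reduce_ker[of v ?K] by (auto simp: kernel_def)
    have "v = (u [^]\<^bsub>?P\<^esub> p) [^]\<^bsub>?P\<^esub> (p ^ e)" using u by (simp add: P.nat_pow_pow)
    then show "v \<in> ?I" using *[of "u [^]\<^bsub>?P\<^esub> p"] u by simp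
  qed
  have quot: "?P Mod ?I \<cong> ?V Mod ?C" if "\<And>v. v \<in> carrier ?P \<Longrightarrow> v [^]\<^bsub>?P\<^esub> (p ^ e) \<in> ?I"
    using r.Mod_iso_Mod_image[OF padic_reduce_surj In _ powI[OF that]] Cn unfolding IC by simp
  show ?thesis
  proof
    assume iso: "padic_cok p n R \<cong> B"
    then have "?P Mod ?I \<cong> ?V Mod ?C"
      using P.Mod_iso_pow_mem[OF In, of B] card unfolding cok by (intro quot) auto
    then have "?V Mod ?C \<cong> ?P Mod ?I" by (rule group.iso_sym[OF normal.factorgroup_is_group[OF In]])
    then show "?V Mod ?C \<cong> B" using iso iso_trans unfolding cok by blast
  next
    assume iso: "?V Mod ?C \<cong> B"
    \<comment> \<open>Modulo \<open>p ^ Suc e\<close> the vector \<open>p ^ e * v\<close> is in the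
      image; lifting back leaves an error in the kernel of the reduction, which is the hypothesis of
      \<open>padic_image_limit\<close>.\<close>
    have step: "\<exists>w\<in>carrier ?P. \<exists>u\<in>carrier ?P. v [^]\<^bsub>?P\<^esub> (p ^ e) = padic_mat_vec p n R w \<otimes>\<^bsub>?P\<^esub> u [^]\<^bsub>?P\<^esub> (p ^ Suc e)"
      if v: "v \<in> carrier ?P" for v
    proof -
      have "padic_reduce ?K v [^]\<^bsub>?V\<^esub> (p ^ e) \<in> ?C"
        using V.Mod_iso_pow_mem[OF Cn iso] r.hom_closed[OF v] card by simp
      then have "padic_reduce ?K (v [^]\<^bsub>?P\<^esub> (p ^ e)) \<in> padic_reduce ?K ` ?I"
        unfolding IC using r.hom_nat_pow[OF v] by simp
      then obtain w where w: "w \<in> carrier ?P" "padic_reduce ?K (v [^]\<^bsub>?P\<^esub> (p ^ e)) = padic_reduce ?K (padic_mat_vec p n R w)"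
        by auto
      let ?y = "padic_mat_vec p n R w" and ?x = "v [^]\<^bsub>?P\<^esub> (p ^ e)"
      have xy: "?x \<in> carrier ?P" "?y \<in> carrier ?P" using v w by auto
      have "padic_reduce ?K (inv\<^bsub>?P\<^esub> ?y \<otimes>\<^bsub>?P\<^esub> ?x) = \<one>\<^bsub>?V\<^esub>"
        using xy w(2) r.hom_closed[OF xy(2)] by (simp del: power_Suc)
      then obtain u where u: "u \<in> carrier ?P" "inv\<^bsub>?P\<^esub> ?y \<otimes>\<^bsub>?P\<^esub> ?x = u [^]\<^bsub>?P\<^esub> (p ^ ?K)"
        using padic_reduce_ker[of "inv\<^bsub>?P\<^esub> ?y \<otimes>\<^bsub>?P\<^esub> ?x" ?K] xy by auto
      have "?x = ?y \<otimes>\<^bsub>?P\<^esub> (inv\<^bsub>?P\<^esub> ?y \<otimes>\<^bsub>?P\<^esub> ?x)" using xy by (simp add: P.m_assoc[symmetric])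
      then show ?thesis using u w(1) by (metis)
    qed
    have "v [^]\<^bsub>?P\<^esub> (p ^ e) \<in> ?I" if "v \<in> carrier ?P" for v
      by (rule padic_image_limit[OF step that])
    then have "?P Mod ?I \<cong> ?V Mod ?C" by (rule quot)
    then show "padic_cok p n R \<cong> B" using iso iso_trans unfolding cok by blast
  qed
qed

end

end

section \<open>Moments of the cokernel\<close>

definition epis :: "('a, 'm) monoid_scheme \<Rightarrow> ('b, 'c) monoid_scheme \<Rightarrow> ('a \<Rightarrow> 'b) set" where
  "epis G B = {\<phi> \<in> extensional (carrier G). \<phi> \<in> hom G B \<and> \<phi> ` carrier G = carrier B}"

definition quot_subgroups :: "('a, 'm) monoid_scheme \<Rightarrow> ('b, 'c) monoid_scheme \<Rightarrow> 'a set set" where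
  "quot_subgroups G B = {L. subgroup L G \<and> G Mod L \<cong> B}"

text \<open>The surjections with kernel \<open>L\<close> form one free orbit under
  \<open>Aut B\<close>: composing a fixed surjection with automorphisms gives each of them
  once.\<close>

lemma (in finite_comm_group) card_epis_kernel:
  assumes B: "group B" and L: "L \<in> quot_subgroups G B"
  shows "card {\<phi> \<in> epis G B. kernel G B \<phi> = L} = card (auto B)"
proof -
  interpret B: group B by (rule B)
  have sL: "subgroup L G" and iso: "G Mod L \<cong> B" using L by (auto simp: quot_subgroups_def)
  have nL: "L \<lhd> G" by (rule subgroup_imp_normal[OF sL])
  interpret L: normal L G by (rule nL)
  obtain f where f: "f \<in> iso (G Mod L) B" using iso by (auto simp: is_iso_def)
  then have fh: "f \<in> hom (G Mod L) B" and fb: "bij_betw f (rcosets L) (carrier B)"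
    by (auto simp: iso_def FactGroup_def)
  interpret g: group_hom G B "\<lambda>x. f (L #> x)"
  proof unfold_locales
    show "(\<lambda>x. f (L #> x)) \<in> hom G B"
      using Group.hom_compose[OF L.r_coset_hom_Mod fh] by (simp add: comp_def)
  qed
  let ?g = "\<lambda>x. f (L #> x)"
  have gsurj: "\<exists>x\<in>carrier G. ?g x = b" if "b \<in> carrier B" for b
  proof -
    have "b \<in> f ` (rcosets L)" using fb that by (simp add: bij_betw_def)
    then show ?thesis by (auto simp: RCOSETS_def)
  qed
  have geq: "?g x = ?g y \<longleftrightarrow> x \<otimes> inv y \<in> L" if "x \<in> carrier G" "y \<in> carrier G" for x y
  proof -
    have "?g x = ?g y \<longleftrightarrow> L #> x = L #> y"
      using fb rcosetsI[OF L.subset that(1)] rcosetsI[OF L.subset that(2)] by (auto simp: bij_betw_def inj_on_eq_iff)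
    also have "\<dots> \<longleftrightarrow> x \<otimes> inv y \<in> L"
    proof
      assume "L #> x = L #> y"
      then have "x \<in> L #> y" using rcos_self[OF that(1) sL] by simp
      then obtain h where "h \<in> L" "x = h \<otimes> y" by (auto simp: r_coset_def)
      then show "x \<otimes> inv y \<in> L" using that L.subset by (simp add: m_assoc subset_iff)
    next
      assume "x \<otimes> inv y \<in> L"
      then have "(x \<otimes> inv y) \<otimes> y \<in> L #> y" using that L.subset by (intro rcosI) auto
      then have "x \<in> L #> y" using that by (simp add: m_assoc)
      then show "L #> x = L #> y" using repr_independence[OF _ that(2) sL] by simp
    qed
    finally show ?thesis .
  qed
  define s where "s b = (SOME x. x \<in> carrier G \<and> ?g x = b)" for b
  have s: "s b \<in> carrier G" "?g (s b) = b" if "b \<in> carrier B" for b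
    using someI_ex[of "\<lambda>x. x \<in> carrier G \<and> ?g x = b"] gsurj[OF that] by (auto simp: s_def)
  have gc: "?g x \<in> carrier B" if "x \<in> carrier G" for x using g.hom_closed[OF that] .
  let ?F = "\<lambda>\<alpha>. \<lambda>x\<in>carrier G. \<alpha> (?g x)"
  let ?E = "{\<phi> \<in> epis G B. kernel G B \<phi> = L}"
  have "bij_betw ?F (auto B) ?E"
  proof (rule bij_betwI')
    fix \<alpha> \<beta> assume a: "\<alpha> \<in> auto B" and b: "\<beta> \<in> auto B"
    show "(?F \<alpha> = ?F \<beta>) = (\<alpha> = \<beta>)"
    proof
      assume eq: "?F \<alpha> = ?F \<beta>"
      show "\<alpha> = \<beta>"
      proof (rule extensionalityI[of _ "carrier B"])
        fix c assume c: "c \<in> carrier B"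
        show "\<alpha> c = \<beta> c" using fun_cong[OF eq, of "s c"] s[OF c] by simp
      qed (use a b in \<open>auto simp: auto_def Bij_def\<close>)
    qed simp
  next
    fix \<alpha> assume a: "\<alpha> \<in> auto B"
    then have ah: "\<alpha> \<in> hom B B" and ab: "bij_betw \<alpha> (carrier B) (carrier B)" by (auto simp: auto_def Bij_def)
    interpret a: group_hom B B \<alpha> by unfold_locales (rule ah)
    have "?F \<alpha> \<in> hom G B" using g.hom_mult gc by (auto intro!: homI)
    moreover have "?F \<alpha> ` carrier G = carrier B"
    proof -
      have "?F \<alpha> ` carrier G = \<alpha> ` (?g ` carrier G)" by auto
      also have "?g ` carrier G = carrier B" using gc gsurj by (auto simp: image_iff)
      finally show ?thesis using ab by (simp add: bij_betw_def)
    qed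
    moreover have "kernel G B (?F \<alpha>) = L"
    proof -
      have "\<alpha> (?g x) = \<one>\<^bsub>B\<^esub> \<longleftrightarrow> x \<in> L" if x: "x \<in> carrier G" for x
      proof -
        have "\<alpha> (?g x) = \<one>\<^bsub>B\<^esub> \<longleftrightarrow> \<alpha> (?g x) = \<alpha> (?g \<one>)" by simp
        also have "\<dots> \<longleftrightarrow> ?g x = ?g \<one>"
          by (rule inj_on_eq_iff[OF bij_betw_imp_inj_on[OF ab] gc[OF x] gc[OF one_closed]])
        also have "\<dots> \<longleftrightarrow> x \<in> L" using geq[OF x one_closed] x by simp
        finally show ?thesis .
      qed
      then show ?thesis using L.subset by (auto simp: kernel_def)
    qed
    ultimately show "?F \<alpha> \<in> ?E" by (simp add: epis_def)
  next
    fix \<phi> assume \<phi>: "\<phi> \<in> ?E"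
    then have \<phi>h: "\<phi> \<in> hom G B" and \<phi>s: "\<phi> ` carrier G = carrier B" and \<phi>k: "kernel G B \<phi> = L" and \<phi>e: "\<phi> \<in> extensional (carrier G)"
      by (auto simp: epis_def)
    interpret h: group_hom G B \<phi> by unfold_locales (rule \<phi>h)
    have heq: "\<phi> x = \<phi> y \<longleftrightarrow> ?g x = ?g y" if "x \<in> carrier G" "y \<in> carrier G" for x y
    proof -
      have "\<phi> x = \<phi> y \<longleftrightarrow> x \<otimes> inv y \<in> kernel G B \<phi>"
      proof
        assume "\<phi> x = \<phi> y"
        then show "x \<otimes> inv y \<in> kernel G B \<phi>" using that by (simp add: kernel_def)
      next
        assume "x \<otimes> inv y \<in> kernel G B \<phi>"
        then have "\<phi> x \<otimes>\<^bsub>B\<^esub> inv\<^bsub>B\<^esub> \<phi> y = \<one>\<^bsub>B\<^esub>" using that by (simp add: kernel_def)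
        then have "inv\<^bsub>B\<^esub> (inv\<^bsub>B\<^esub> \<phi> y) = \<phi> x" by (rule B.inv_equality) (use that in auto)
        then show "\<phi> x = \<phi> y" using that by simp
      qed
      then show ?thesis unfolding \<phi>k geq[OF that] .
    qed
    \<comment> \<open>The automorphism relating \<phi> to the fixed surjection, defined through a
      section \<open>s\<close>; equal kernels make the value independent of the section.\<close>
    let ?\<alpha> = "\<lambda>b\<in>carrier B. \<phi> (s b)"
    have \<alpha>g: "?\<alpha> (?g x) = \<phi> x" if "x \<in> carrier G" for x
      using heq[OF s(1)[OF gc[OF that]] that] s(2)[OF gc[OF that]] gc[OF that] by simp
    have "?\<alpha> \<in> hom B B"
    proof (rule homI)
      fix b c assume b: "b \<in> carrier B" and c: "c \<in> carrier B"
      have "\<phi> (s (b \<otimes>\<^bsub>B\<^esub> c)) = \<phi> (s b \<otimes> s c)"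
        using s[OF b] s[OF c] s[OF B.m_closed[OF b c]] g.hom_mult[of "s b" "s c"] by (subst heq) auto
      then show "?\<alpha> (b \<otimes>\<^bsub>B\<^esub> c) = ?\<alpha> b \<otimes>\<^bsub>B\<^esub> ?\<alpha> c" using b c s by simp
    qed (use s in simp)
    moreover have "bij_betw ?\<alpha> (carrier B) (carrier B)"
      unfolding bij_betw_def
    proof
      show "inj_on ?\<alpha> (carrier B)"
      proof (rule inj_onI)
        fix b c assume b: "b \<in> carrier B" and c: "c \<in> carrier B" and "?\<alpha> b = ?\<alpha> c"
        then have "\<phi> (s b) = \<phi> (s c)" by simp
        then have "?g (s b) = ?g (s c)" using heq[OF s(1)[OF b] s(1)[OF c]] by simp
        then show "b = c" using s(2)[OF b] s(2)[OF c] by simp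
      qed
      show "?\<alpha> ` carrier B = carrier B"
      proof (intro equalityI subsetI)
        fix b assume "b \<in> carrier B"
        then have "b \<in> \<phi> ` carrier G" unfolding \<phi>s .
        then obtain x where x: "x \<in> carrier G" "\<phi> x = b" by blast
        then show "b \<in> ?\<alpha> ` carrier B" using \<alpha>g[OF x(1)] gc[OF x(1)] by (intro image_eqI[of _ _ "?g x"]) simp_all
      qed (use s in auto)
    qed
    ultimately have "?\<alpha> \<in> auto B" by (simp add: auto_def Bij_def)
    moreover have "\<phi> = ?F ?\<alpha>"
      using \<phi>e \<alpha>g by (intro extensionalityI[of _ "carrier G"]) auto
    ultimately show "\<exists>\<alpha>\<in>auto B. \<phi> = ?F \<alpha>" by blast
  qed
  then show ?thesis by (simp add: bij_betw_same_card)
qed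

text \<open>Sorting surjections by their kernel replaces the count of subgroups with quotient
  \<open>B\<close> by a count of surjections, which is easy to estimate; this is the origin of
  \<open>card (auto B)\<close> in the limit.\<close>

lemma (in finite_comm_group) card_epis:
  assumes B: "group B" and finB: "finite (carrier B)"
  shows "card (epis G B) = card (quot_subgroups G B) * card (auto B)"
proof -
  have fin: "finite (epis G B)"
    by (rule finite_subset[of _ "carrier G \<rightarrow>\<^sub>E carrier B"]) (auto simp: epis_def PiE_iff hom_def finB intro: extensional_arb intro!: finite_PiE)
  have finq: "finite (quot_subgroups G B)"
    by (rule finite_subset[of _ "Pow (carrier G)"]) (auto simp: quot_subgroups_def dest: subgroup.subset)
  have ker: "kernel G B \<phi> \<in> quot_subgroups G B" if "\<phi> \<in> epis G B" for \<phi>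
  proof -
    have "group_hom G B \<phi>" using that B is_group by (auto simp: epis_def group_hom_def group_hom_axioms_def)
    then interpret h: group_hom G B \<phi> .
    show ?thesis using that h.FactGroup_iso h.subgroup_kernel by (auto simp: quot_subgroups_def epis_def)
  qed
  have sub: "kernel G B ` epis G B \<subseteq> quot_subgroups G B" using ker by blast
  have "card (epis G B) = (\<Sum>L\<in>quot_subgroups G B. card {\<phi> \<in> epis G B. kernel G B \<phi> = L})"
    using sum.group[OF fin finq sub, of "\<lambda>_. 1 :: nat"] by simp
  also have "\<dots> = (\<Sum>L\<in>quot_subgroups G B. card (auto B))" by (intro sum.cong card_epis_kernel[OF B]) auto
  finally show ?thesis by simp
qed

context
  fixes B :: "('b, 'c) monoid_scheme" and q n :: nat
  assumes B: "comm_group B" and finB: "finite (carrier B)" and q: "q > 0"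
    and exponent: "\<And>b. b \<in> carrier B \<Longrightarrow> b [^]\<^bsub>B\<^esub> q = \<one>\<^bsub>B\<^esub>"
begin

text \<open>The images of the unit vectors can be prescribed freely because \<open>q\<close> kills
  \<open>B\<close>, so exponents matter only modulo \<open>q\<close>.\<close>

lemma hom_of_tuple:
  assumes b: "b \<in> {1..n} \<rightarrow>\<^sub>E carrier B"
  shows "\<exists>\<phi>\<in>extensional (carrier (zvec n q)). \<phi> \<in> hom (zvec n q) B \<and> (\<lambda>i\<in>{1..n}. \<phi> (unit_vec n q i)) = b"
proof -
  interpret B: comm_group B by (rule B)
  have bc: "b i \<in> carrier B" if "i \<in> {1..n}" for i using b that by auto
  let ?\<phi> = "\<lambda>v\<in>carrier (zvec n q). finprod B (\<lambda>i. b i [^]\<^bsub>B\<^esub> nat (v i)) {1..n}"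
  have powmod: "b i [^]\<^bsub>B\<^esub> (m mod q) = b i [^]\<^bsub>B\<^esub> m" if "i \<in> {1..n}" for i m
  proof -
    have "b i [^]\<^bsub>B\<^esub> m = b i [^]\<^bsub>B\<^esub> (q * (m div q) + m mod q)" by simp
    also have "\<dots> = (b i [^]\<^bsub>B\<^esub> q) [^]\<^bsub>B\<^esub> (m div q) \<otimes>\<^bsub>B\<^esub> b i [^]\<^bsub>B\<^esub> (m mod q)"
      using bc[OF that] by (simp only: B.nat_pow_mult[symmetric] B.nat_pow_pow)
    also have "\<dots> = b i [^]\<^bsub>B\<^esub> (m mod q)" using exponent[OF bc[OF that]] bc[OF that] by simp
    finally show ?thesis by simp
  qed
  have hom: "?\<phi> \<in> hom (zvec n q) B"
  proof (rule homI)
    fix v u assume v: "v \<in> carrier (zvec n q)" and u: "u \<in> carrier (zvec n q)"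
    show "?\<phi> v \<in> carrier B" using v bc by (auto intro!: B.finprod_closed)
    interpret G: finite_comm_group "zvec n q" by (rule finite_comm_group_zvec[OF q])
    have "finprod B (\<lambda>i. b i [^]\<^bsub>B\<^esub> nat ((v \<otimes>\<^bsub>zvec n q\<^esub> u) i)) {1..n}
        = finprod B (\<lambda>i. b i [^]\<^bsub>B\<^esub> nat (v i) \<otimes>\<^bsub>B\<^esub> b i [^]\<^bsub>B\<^esub> nat (u i)) {1..n}"
    proof (rule B.finprod_cong')
      fix i assume i: "i \<in> {1..n}"
      have pos: "0 \<le> v i" "0 \<le> u i" using v u i by (auto simp: carrier_zvec[OF q] PiE_iff)
      have "nat ((v \<otimes>\<^bsub>zvec n q\<^esub> u) i) = (nat (v i) + nat (u i)) mod q"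
        using i pos by (simp add: mult_zvec[OF q] nat_mod_distrib nat_add_distrib)
      then show "b i [^]\<^bsub>B\<^esub> nat ((v \<otimes>\<^bsub>zvec n q\<^esub> u) i) = b i [^]\<^bsub>B\<^esub> nat (v i) \<otimes>\<^bsub>B\<^esub> b i [^]\<^bsub>B\<^esub> nat (u i)"
        using powmod[OF i] bc[OF i] by (simp add: B.nat_pow_mult)
    qed (use bc in auto)
    also have "\<dots> = finprod B (\<lambda>i. b i [^]\<^bsub>B\<^esub> nat (v i)) {1..n} \<otimes>\<^bsub>B\<^esub> finprod B (\<lambda>i. b i [^]\<^bsub>B\<^esub> nat (u i)) {1..n}"
      using bc by (intro B.finprod_multf) auto
    finally show "?\<phi> (v \<otimes>\<^bsub>zvec n q\<^esub> u) = ?\<phi> v \<otimes>\<^bsub>B\<^esub> ?\<phi> u" using v u G.m_closed[OF v u] by simp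
  qed
  have "?\<phi> (unit_vec n q i) = b i" if i: "i \<in> {1..n}" for i
  proof -
    have "finprod B (\<lambda>j. b j [^]\<^bsub>B\<^esub> nat (unit_vec n q i j)) {1..n} = finprod B (\<lambda>j. if i = j then b j else \<one>\<^bsub>B\<^esub>) {1..n}"
    proof (rule B.finprod_cong')
      fix j assume j: "j \<in> {1..n}"
      have "nat (1 mod int q) = 1 mod q" using nat_mod_distrib[of 1 "int q"] by simp
      then show "b j [^]\<^bsub>B\<^esub> nat (unit_vec n q i j) = (if i = j then b j else \<one>\<^bsub>B\<^esub>)"
        using j powmod[OF j, of 1] bc[OF j] by (auto simp: unit_vec_def)
    qed (use bc in auto)
    also have "\<dots> = b i" using bc i by (intro B.finprod_singleton) auto
    finally show ?thesis using unit_vec_closed[OF q, of n i] by simp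
  qed
  then have "(\<lambda>i\<in>{1..n}. ?\<phi> (unit_vec n q i)) = b"
    using b by (intro extensionalityI[of _ "{1..n}"]) (auto simp: PiE_iff)
  then show ?thesis using hom by (intro bexI[of _ ?\<phi>]) auto
qed

text \<open>Almost all homomorphisms are onto: a non-surjective one maps the unit vectors into one
  of at most \<open>2 ^ card B\<close> proper subgroups, each of at most half the size.\<close>

lemma card_epis_zvec_bounds:
  "real (card (carrier B)) ^ n - 2 ^ card (carrier B) * (real (card (carrier B)) / 2) ^ n \<le> real (card (epis (zvec n q) B))"
  "real (card (epis (zvec n q) B)) \<le> real (card (carrier B)) ^ n"
proof -
  interpret B: comm_group B by (rule B)
  interpret G: finite_comm_group "zvec n q" by (rule finite_comm_group_zvec[OF q])
  let ?b = "card (carrier B)"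
  let ?t = "\<lambda>\<phi>. \<lambda>i\<in>{1..n}. \<phi> (unit_vec n q i)"
  let ?H = "{\<phi> \<in> extensional (carrier (zvec n q)). \<phi> \<in> hom (zvec n q) B}"
  have e: "unit_vec n q i \<in> carrier (zvec n q)" for i by (rule unit_vec_closed[OF q])
  have inj: "inj_on ?t ?H"
  proof (rule inj_onI)
    fix \<phi> \<psi> assume \<phi>: "\<phi> \<in> ?H" and \<psi>: "\<psi> \<in> ?H" and eq: "?t \<phi> = ?t \<psi>"
    interpret f: group_hom "zvec n q" B \<phi> using \<phi> by unfold_locales simp
    interpret g: group_hom "zvec n q" B \<psi> using \<psi> by unfold_locales simp
    show "\<phi> = \<psi>"
    proof (rule extensionalityI[of _ "carrier (zvec n q)"])
      fix v assume v: "v \<in> carrier (zvec n q)"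
      show "\<phi> v = \<psi> v"
      proof (rule zvec_hom_eqI[where Q = \<phi> and Q' = \<psi> and tab = "(\<otimes>\<^bsub>B\<^esub>)", OF q v])
        show "\<phi> (unit_vec n q i) = \<psi> (unit_vec n q i)" if "i \<in> {1..n}" for i
          using fun_cong[OF eq, of i] that by simp
      qed simp_all
    qed (use \<phi> \<psi> in auto)
  qed
  have img: "?t ` ?H = {1..n} \<rightarrow>\<^sub>E carrier B"
  proof (intro equalityI subsetI)
    fix b assume "b \<in> {1..n} \<rightarrow>\<^sub>E carrier B"
    then show "b \<in> ?t ` ?H" using hom_of_tuple[of b] by force
  qed (use e in \<open>auto simp: hom_def\<close>)
  have cH: "card ?H = ?b ^ n"
    using card_image[OF inj] unfolding img by (simp add: card_PiE)
  have finH: "finite ?H"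
  proof (rule finite_imageD[OF _ inj])
    show "finite (?t ` ?H)" unfolding img by (intro finite_PiE) (use finB in auto)
  qed
  have sub: "epis (zvec n q) B \<subseteq> ?H" by (auto simp: epis_def)
  have "card (epis (zvec n q) B) \<le> ?b ^ n" using card_mono[OF finH sub] cH by simp
  then show "real (card (epis (zvec n q) B)) \<le> real ?b ^ n"
    by (simp only: of_nat_power[symmetric] of_nat_le_iff)
  let ?P = "{K. subgroup K B \<and> K \<noteq> carrier B}"
  have finP: "finite ?P" by (rule finite_subset[of _ "Pow (carrier B)"]) (auto simp: finB dest: subgroup.subset)
  have half: "real (card K) \<le> real ?b / 2" if K: "K \<in> ?P" for K
  proof -
    have c: "card (rcosets\<^bsub>B\<^esub> K) * card K = ?b" using B.lagrange_finite[OF finB] K by (simp add: order_def)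
    have "K \<subset> carrier B" using K by (auto dest: subgroup.subset)
    then have lt: "card K < ?b" using finB by (rule psubset_card_mono[rotated])
    have "card (rcosets\<^bsub>B\<^esub> K) \<noteq> 0"
    proof
      assume "card (rcosets\<^bsub>B\<^esub> K) = 0"
      then have "?b = 0" using c by (simp only: mult_0)
      then show False using lt by (simp only: not_less0)
    qed
    moreover have "card (rcosets\<^bsub>B\<^esub> K) \<noteq> 1" using c lt by auto
    ultimately have "2 * card K \<le> card (rcosets\<^bsub>B\<^esub> K) * card K" by (intro mult_right_mono) auto
    then show ?thesis using c by linarith
  qed
  \<comment> \<open>The image of a non-surjective homomorphism serves as \<open>K\<close>.\<close>
  have "?t ` (?H - epis (zvec n q) B) \<subseteq> (\<Union>K\<in>?P. {1..n} \<rightarrow>\<^sub>E K)"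
  proof clarify
    fix \<phi> assume \<phi>: "\<phi> \<in> extensional (carrier (zvec n q))" "\<phi> \<in> hom (zvec n q) B" "\<phi> \<notin> epis (zvec n q) B"
    interpret f: group_hom "zvec n q" B \<phi> using \<phi> by unfold_locales simp
    have "subgroup (\<phi> ` carrier (zvec n q)) B" by (rule f.img_is_subgroup)
    moreover have "\<phi> ` carrier (zvec n q) \<noteq> carrier B" using \<phi> by (auto simp: epis_def)
    moreover have "?t \<phi> \<in> {1..n} \<rightarrow>\<^sub>E \<phi> ` carrier (zvec n q)" using e by auto
    ultimately show "?t \<phi> \<in> (\<Union>K\<in>?P. {1..n} \<rightarrow>\<^sub>E K)" by blast
  qed
  moreover have finU: "finite (\<Union>K\<in>?P. {1..n} \<rightarrow>\<^sub>E K)"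
    using finP finB by (auto intro!: finite_PiE dest: subgroup.subset finite_subset)
  ultimately have "card (?t ` (?H - epis (zvec n q) B)) \<le> card (\<Union>K\<in>?P. {1..n} \<rightarrow>\<^sub>E K)" by (rule card_mono[rotated])
  also have "\<dots> \<le> (\<Sum>K\<in>?P. card ({1..n} \<rightarrow>\<^sub>E K))" by (rule card_UN_le[OF finP])
  also have "card (?t ` (?H - epis (zvec n q) B)) = card (?H - epis (zvec n q) B)"
    by (intro card_image inj_on_subset[OF inj]) auto
  finally have "card (?H - epis (zvec n q) B) \<le> (\<Sum>K\<in>?P. card K ^ n)" by (simp add: card_PiE)
  then have "real (card (?H - epis (zvec n q) B)) \<le> real (\<Sum>K\<in>?P. card K ^ n)" by (rule of_nat_mono)
  also have "\<dots> = (\<Sum>K\<in>?P. real (card K) ^ n)" by simp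
  also have "\<dots> \<le> (\<Sum>K\<in>?P. (real ?b / 2) ^ n)" using half by (intro sum_mono power_mono) auto
  also have "\<dots> = real (card ?P) * (real ?b / 2) ^ n" by simp
  also have "\<dots> \<le> 2 ^ ?b * (real ?b / 2) ^ n"
  proof (rule mult_right_mono)
    have "card ?P \<le> card (Pow (carrier B))" by (rule card_mono) (auto simp: finB dest: subgroup.subset)
    then have "card ?P \<le> 2 ^ ?b" by (simp add: card_Pow finB)
    then have "real (card ?P) \<le> real (2 ^ ?b)" by (rule of_nat_mono)
    then show "real (card ?P) \<le> 2 ^ ?b" by simp
  qed simp
  finally have "real (card (?H - epis (zvec n q) B)) \<le> 2 ^ ?b * (real ?b / 2) ^ n" .
  moreover have "card (?H - epis (zvec n q) B) = ?b ^ n - card (epis (zvec n q) B)"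
    using card_Diff_subset[OF finite_subset[OF sub finH] sub] cH by simp
  moreover have "card (epis (zvec n q) B) \<le> ?b ^ n" by fact
  ultimately show "real ?b ^ n - 2 ^ ?b * (real ?b / 2) ^ n \<le> real (card (epis (zvec n q) B))"
    by (simp add: of_nat_diff)
qed

end

text \<open>Each coordinate ranges over the \<open>p\<close> multiples of \<open>p ^ e\<close>
  modulo \<open>p ^ Suc e\<close>.\<close>

lemma card_zvec_torsion:
  assumes p: "p > 0"
  shows "card {x \<in> carrier (zvec n (p ^ Suc e)). x [^]\<^bsub>zvec n (p ^ Suc e)\<^esub> p = \<one>\<^bsub>zvec n (p ^ Suc e)\<^esub>} = p ^ n"
proof -
  let ?q = "p ^ Suc e"
  have q: "?q > 0" using p by simp
  let ?A = "{a \<in> {0..<int ?q}. int p ^ e dvd a}"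
  have mod: "(int p * a) mod int ?q = 0 \<longleftrightarrow> int p ^ e dvd a" for a
    using p by (simp add: mod_eq_0_iff_dvd)
  have "{x \<in> carrier (zvec n ?q). x [^]\<^bsub>zvec n ?q\<^esub> p = \<one>\<^bsub>zvec n ?q\<^esub>} = {1..n} \<rightarrow>\<^sub>E ?A"
  proof (intro equalityI subsetI)
    fix x assume x: "x \<in> {x \<in> carrier (zvec n ?q). x [^]\<^bsub>zvec n ?q\<^esub> p = \<one>\<^bsub>zvec n ?q\<^esub>}"
    then have "x \<in> {1..n} \<rightarrow>\<^sub>E {0..<int ?q}" by (simp only: carrier_zvec[OF q] mem_Collect_eq)
    moreover have "int p ^ e dvd x i" if "i \<in> {1..n}" for i
    proof -
      have "(x [^]\<^bsub>zvec n ?q\<^esub> p) i = \<one>\<^bsub>zvec n ?q\<^esub> i" using x by simp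
      then have "(int p * x i) mod int ?q = 0" using that unfolding pow_zvec[OF q] one_zvec[OF q] by simp
      then show ?thesis unfolding mod .
    qed
    ultimately show "x \<in> {1..n} \<rightarrow>\<^sub>E ?A" by (auto simp: PiE_iff)
  next
    fix x assume x: "x \<in> {1..n} \<rightarrow>\<^sub>E ?A"
    then have "x \<in> carrier (zvec n ?q)" unfolding carrier_zvec[OF q] by (auto simp: PiE_iff)
    moreover have "x [^]\<^bsub>zvec n ?q\<^esub> p = \<one>\<^bsub>zvec n ?q\<^esub>"
      unfolding pow_zvec[OF q] one_zvec[OF q] using x mod by (intro restrict_ext) (auto simp: PiE_iff)
    ultimately show "x \<in> {x \<in> carrier (zvec n ?q). x [^]\<^bsub>zvec n ?q\<^esub> p = \<one>\<^bsub>zvec n ?q\<^esub>}" by simp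
  qed
  moreover have "card ?A = p"
  proof -
    have "?A = (\<lambda>k. int p ^ e * int k) ` {..<p}"
    proof (intro equalityI subsetI)
      fix a assume a: "a \<in> ?A"
      then obtain k where k: "a = int p ^ e * k" by auto
      have pe: "int p ^ e > 0" using p by simp
      have "k \<ge> 0" using a pe unfolding k by (simp add: zero_le_mult_iff)
      moreover have "k < int p" using a pe unfolding k by (simp add: mult.commute[of "int p"])
      ultimately show "a \<in> (\<lambda>k. int p ^ e * int k) ` {..<p}"
        unfolding k by (intro image_eqI[of _ _ "nat k"]) auto
    next
      fix a assume "a \<in> (\<lambda>k. int p ^ e * int k) ` {..<p}"
      then show "a \<in> ?A" using p by (auto simp: mult.commute[of "int p"])
    qed
    moreover have "inj_on (\<lambda>k. int p ^ e * int k) {..<p}" using p by (auto simp: inj_on_def)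
    ultimately show ?thesis by (simp add: card_image)
  qed
  ultimately show ?thesis by (simp add: card_PiE)
qed

section \<open>Subgroups with quotient B and their character lists\<close>

context
  fixes p e n :: nat and B :: "('b, 'c) monoid_scheme"
  assumes p: "prime p" and card_B: "card (carrier B) = p ^ e"
begin

abbreviation "V \<equiv> zvec n (p ^ Suc e)"

lemma q_pos': "p ^ Suc e > 0"
  using prime_gt_0_nat[OF p] by simp

lemma finite_quot_subgroups: "finite (quot_subgroups V B)"
proof -
  interpret finite_comm_group V by (rule finite_comm_group_zvec[OF q_pos'])
  show ?thesis by (rule finite_subset[of _ "Pow (carrier V)"]) (auto simp: quot_subgroups_def simp del: power_Suc dest: subgroup.subset)
qed

text \<open>The last fact is the other use of the exponent \<open>Suc e\<close>: the
  \<open>p\<close>-torsion of \<open>V\<close> is \<open>p ^ e * V\<close>, and this lies in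
  \<open>L\<close> because \<open>p ^ e\<close> kills \<open>V/L\<close>. Thus all these
  \<open>L\<close> have the same number of characters of order dividing \<open>p\<close>.\<close>

lemma quot_subgroup_facts:
  assumes L: "L \<in> quot_subgroups V B"
  shows "subgroup L V" "card L * p ^ e = (p ^ Suc e) ^ n" "\<exists>a. order (V\<lparr>carrier := L\<rparr>) = p ^ a"
    "card {x \<in> L. x [^]\<^bsub>V\<^esub> p = \<one>\<^bsub>V\<^esub>} = p ^ n"
proof -
  interpret finite_comm_group V by (rule finite_comm_group_zvec[OF q_pos'])
  show sL: "subgroup L V" using L by (simp add: quot_subgroups_def)
  have iso: "V Mod L \<cong> B" using L by (simp add: quot_subgroups_def)
  obtain f where "f \<in> iso (V Mod L) B" using iso by (auto simp: is_iso_def)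
  then have "card (rcosets\<^bsub>V\<^esub> L) = p ^ e"
    unfolding card_B[symmetric] by (auto simp: iso_def FactGroup_def dest: bij_betw_same_card)
  then show c: "card L * p ^ e = (p ^ Suc e) ^ n"
    using lagrange_finite[OF finite_carrier sL] by (simp add: order_zvec[OF q_pos'] mult.commute del: power_Suc)
  have "card L dvd p ^ (Suc e * n)" unfolding power_mult by (rule dvdI[OF c[symmetric]])
  then show "\<exists>a. order (V\<lparr>carrier := L\<rparr>) = p ^ a" using p by (auto simp: divides_primepow_nat order_def)
  have "{x \<in> L. x [^]\<^bsub>V\<^esub> p = \<one>\<^bsub>V\<^esub>} = {x \<in> carrier V. x [^]\<^bsub>V\<^esub> p = \<one>\<^bsub>V\<^esub>}"
  proof (intro equalityI subsetI)
    fix x assume x: "x \<in> {x \<in> carrier V. x [^]\<^bsub>V\<^esub> p = \<one>\<^bsub>V\<^esub>}"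
    have xc: "x \<in> {1..n} \<rightarrow>\<^sub>E {0..<int (p ^ Suc e)}" using x by (simp only: carrier_zvec[OF q_pos'] mem_Collect_eq)
    have dv: "int p ^ e dvd x i" if "i \<in> {1..n}" for i
    proof -
      have "(x [^]\<^bsub>V\<^esub> p) i = \<one>\<^bsub>V\<^esub> i" using x by simp
      then have "(int p * x i) mod int (p ^ Suc e) = 0" using that unfolding pow_zvec[OF q_pos'] one_zvec[OF q_pos'] by simp
      then show ?thesis using prime_gt_0_nat[OF p] by (simp add: mod_eq_0_iff_dvd)
    qed
    \<comment> \<open>A torsion vector is divisible by \<open>p ^ e\<close>; the quotient exhibits
      it as a \<open>p ^ e\<close>-multiple.\<close>
    define u where "u = (\<lambda>i\<in>{1..n}. x i div int p ^ e)"
    have pe: "int p ^ e \<ge> 1" using prime_gt_0_nat[OF p] by simp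
    have uc: "u \<in> carrier V"
    proof -
      have "0 \<le> x i div int p ^ e \<and> x i div int p ^ e < int (p ^ Suc e)" if "i \<in> {1..n}" for i
      proof -
        have b: "0 \<le> x i" "x i < int (p ^ Suc e)" using xc that by (auto simp: PiE_iff simp del: power_Suc of_nat_power)
        have "x i div int p ^ e \<le> x i" using zdiv_mono2[of "x i" 1 "int p ^ e"] b(1) pe by simp
        moreover have "0 < int p ^ e" using pe by linarith
        ultimately show ?thesis using b pos_imp_zdiv_nonneg_iff[of "int p ^ e" "x i"] by linarith
      qed
      then show ?thesis unfolding carrier_zvec[OF q_pos'] u_def by (auto simp del: power_Suc of_nat_power)
    qed
    have "x = u [^]\<^bsub>V\<^esub> (p ^ e)"
    proof (rule extensionalityI[of _ "{1..n}"])
      fix i assume i: "i \<in> {1..n}"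
      have "int (p ^ e) * (x i div int p ^ e) = x i" using dv[OF i] by simp
      moreover have "x i mod int (p ^ Suc e) = x i" using xc i by (auto simp: PiE_iff simp del: power_Suc of_nat_power)
      ultimately show "x i = (u [^]\<^bsub>V\<^esub> (p ^ e)) i" using i unfolding pow_zvec[OF q_pos'] u_def by (simp del: power_Suc of_nat_power)
    qed (use xc in \<open>auto simp: pow_zvec[OF q_pos'] PiE_iff simp del: power_Suc of_nat_power\<close>)
    moreover have "u [^]\<^bsub>V\<^esub> card (carrier B) \<in> L"
      by (rule Mod_iso_pow_mem[OF subgroup_imp_normal[OF sL] iso uc])
    ultimately have "x \<in> L" unfolding card_B by simp
    then show "x \<in> {x \<in> L. x [^]\<^bsub>V\<^esub> p = \<one>\<^bsub>V\<^esub>}" using x by simp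
  qed (use subgroup.subset[OF sL] in auto)
  then show "card {x \<in> L. x [^]\<^bsub>V\<^esub> p = \<one>\<^bsub>V\<^esub>} = p ^ n"
    using card_zvec_torsion[OF prime_gt_0_nat[OF p]] by simp
qed

abbreviation char_lists :: "nat \<Rightarrow> (nat \<Rightarrow> int) set \<Rightarrow> ((nat \<Rightarrow> int) \<Rightarrow> complex) list set" where
  "char_lists r L \<equiv> finite_comm_group.indep_lists (V\<lparr>carrier := L\<rparr>) p r"

text \<open>The common kernel of \<open>r\<close> independent characters has index
  \<open>p ^ r\<close> in \<open>L\<close>, hence index \<open>p ^ (e + r)\<close> in
  \<open>V\<close>: the same \<open>N\<close> for all \<open>L\<close> and all lists.\<close>

lemma char_lists_facts:
  assumes L: "L \<in> quot_subgroups V B"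
  shows "finite (char_lists r L)" "real (card (char_lists r L)) = (\<Prod>i<r. real p ^ n - real p ^ i)"
    and "\<psi>s \<in> char_lists r L \<Longrightarrow> subgroup (kers (V\<lparr>carrier := L\<rparr>) \<psi>s) V \<and>
      card (kers (V\<lparr>carrier := L\<rparr>) \<psi>s) * p ^ (e + r) = (p ^ Suc e) ^ n"
proof -
  interpret finite_comm_group V by (rule finite_comm_group_zvec[OF q_pos'])
  note Lf = quot_subgroup_facts[OF L]
  interpret GL: finite_comm_group "V\<lparr>carrier := L\<rparr>" by (rule finite_comm_group_subgroup[OF Lf(1)])
  show "finite (char_lists r L)" by (rule GL.finite_indep_lists[OF p])
  have "{x \<in> carrier (V\<lparr>carrier := L\<rparr>). x [^]\<^bsub>V\<lparr>carrier := L\<rparr>\<^esub> p = \<one>\<^bsub>V\<lparr>carrier := L\<rparr>\<^esub>} = {x \<in> L. x [^]\<^bsub>V\<^esub> p = \<one>\<^bsub>V\<^esub>}"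
    by (simp add: nat_pow_def del: power_Suc)
  then show "real (card (char_lists r L)) = (\<Prod>i<r. real p ^ n - real p ^ i)"
    using GL.card_indep_lists_elem[OF p, of r] Lf(4) by simp
  assume \<psi>s: "\<psi>s \<in> char_lists r L"
  then have el: "set \<psi>s \<subseteq> elem_chars (V\<lparr>carrier := L\<rparr>) p" "indep_chars (V\<lparr>carrier := L\<rparr>) \<psi>s" "length \<psi>s = r"
    by (auto simp: GL.indep_lists_def simp del: power_Suc)
  then have ch: "set \<psi>s \<subseteq> characters (V\<lparr>carrier := L\<rparr>)" by (auto simp: elem_chars_def)
  have "subgroup (kers (V\<lparr>carrier := L\<rparr>) \<psi>s) V"
    by (rule incl_subgroup[OF Lf(1) GL.subgroup_kers[OF ch]])
  moreover have "card (kers (V\<lparr>carrier := L\<rparr>) \<psi>s) * p ^ r = card L"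
    using GL.card_kers[OF p el(1,2)] el(3) by (simp add: order_def)
  then have "card (kers (V\<lparr>carrier := L\<rparr>) \<psi>s) * p ^ (e + r) = (p ^ Suc e) ^ n"
    unfolding Lf(2)[symmetric] by (simp add: power_add mult_ac)
  ultimately show "subgroup (kers (V\<lparr>carrier := L\<rparr>) \<psi>s) V \<and>
      card (kers (V\<lparr>carrier := L\<rparr>) \<psi>s) * p ^ (e + r) = (p ^ Suc e) ^ n" by blast
qed

text \<open>A subgroup \<open>H\<close> arises from a bounded number of pairs: at most
  \<open>2 ^ N\<close> groups \<open>L\<close> lie above it, and each entry of the list is one of at
  most \<open>N\<close> characters of \<open>L\<close> that kill \<open>H\<close>. The constant is
  free of \<open>n\<close>.\<close>

lemma sum_kers_le:
  assumes err: "\<And>H. err H \<ge> (0 :: real)"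
  shows "(\<Sum>L\<in>quot_subgroups V B. \<Sum>\<psi>s\<in>char_lists r L. err (kers (V\<lparr>carrier := L\<rparr>) \<psi>s))
    \<le> 2 ^ (p ^ (e + r)) * real ((p ^ (e + r)) ^ r) *
      (\<Sum>H | subgroup H V \<and> card H * p ^ (e + r) = (p ^ Suc e) ^ n. err H)"
proof -
  interpret finite_comm_group V by (rule finite_comm_group_zvec[OF q_pos'])
  let ?N = "p ^ (e + r)"
  let ?\<H> = "{H. subgroup H V \<and> card H * ?N = (p ^ Suc e) ^ n}"
  let ?P = "Sigma (quot_subgroups V B) (char_lists r)"
  let ?k = "\<lambda>(L, \<psi>s). kers (V\<lparr>carrier := L\<rparr>) \<psi>s"
  have finP: "finite ?P" using finite_quot_subgroups char_lists_facts(1) by (intro finite_SigmaI) auto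
  have fin\<H>: "finite ?\<H>" by (rule finite_subset[of _ "Pow (carrier V)"]) (auto simp del: power_Suc dest: subgroup.subset)
  have img: "?k ` ?P \<subseteq> ?\<H>" using char_lists_facts(3) by auto
  have "(\<Sum>L\<in>quot_subgroups V B. \<Sum>\<psi>s\<in>char_lists r L. err (kers (V\<lparr>carrier := L\<rparr>) \<psi>s)) = (\<Sum>x\<in>?P. err (?k x))"
    using finite_quot_subgroups char_lists_facts(1) by (subst sum.Sigma) (auto simp: case_prod_unfold)
  also have "\<dots> = (\<Sum>H\<in>?\<H>. \<Sum>x | x \<in> ?P \<and> ?k x = H. err (?k x))"
    by (rule sum.group[symmetric, OF finP fin\<H> img])
  also have "\<dots> \<le> (\<Sum>H\<in>?\<H>. 2 ^ ?N * real (?N ^ r) * err H)"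
  proof (rule sum_mono)
    fix H assume H: "H \<in> ?\<H>"
    have "(\<Sum>x | x \<in> ?P \<and> ?k x = H. err (?k x)) = real (card {x \<in> ?P. ?k x = H}) * err H" by simp
    also have "\<dots> \<le> 2 ^ ?N * real (?N ^ r) * err H"
    proof (intro mult_right_mono err)
      \<comment> \<open>All pairs with common kernel \<open>H\<close> are enclosed in a larger set
        that is easy to count: arbitrary supergroups with arbitrary lists from the
        annihilator.\<close>
      let ?S = "{L. subgroup L V \<and> H \<subseteq> L}"
      let ?T = "\<lambda>L. {\<psi>s. set \<psi>s \<subseteq> annihilator (V\<lparr>carrier := L\<rparr>) H \<and> length \<psi>s = r}"
      have finS: "finite ?S" by (rule finite_subset[of _ "Pow (carrier V)"]) (auto simp del: power_Suc dest: subgroup.subset)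
      have T: "finite (?T L)" "card (?T L) \<le> ?N ^ r" if L: "L \<in> ?S" for L
      proof -
        interpret GL: finite_comm_group "V\<lparr>carrier := L\<rparr>" using L by (intro finite_comm_group_subgroup) auto
        show "finite (?T L)" by (rule finite_lists_length_eq[OF GL.finite_annihilator])
        have HL: "subgroup H (V\<lparr>carrier := L\<rparr>)" using H L by (intro subgroup_incl) auto
        have "card (annihilator (V\<lparr>carrier := L\<rparr>) H) * card H = card L"
          using GL.card_annihilator[OF HL] by (simp add: order_def)
        also have "\<dots> \<le> card (carrier V)" using L by (intro card_mono finite_carrier) (auto simp del: power_Suc dest: subgroup.subset)
        also have "\<dots> = ?N * card H" using H order_zvec[OF q_pos', of n] by (simp add: order_def mult.commute)
        finally have "card (annihilator (V\<lparr>carrier := L\<rparr>) H) \<le> ?N"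
        proof -
          assume *: "card (annihilator (V\<lparr>carrier := L\<rparr>) H) * card H \<le> ?N * card H"
          have "card H > 0" using H q_pos' by (cases "card H") auto
          then show ?thesis using * by (simp del: power_add)
        qed
        then show "card (?T L) \<le> ?N ^ r" unfolding card_lists_length_eq[OF GL.finite_annihilator] by (rule power_mono) simp
      qed
      have sub: "{x \<in> ?P. ?k x = H} \<subseteq> Sigma ?S ?T"
      proof
        fix x assume "x \<in> {x \<in> ?P. ?k x = H}"
        then obtain L \<psi>s where x: "x = (L, \<psi>s)" and L: "L \<in> quot_subgroups V B" and \<psi>s: "\<psi>s \<in> char_lists r L"
          and k: "H = kers (V\<lparr>carrier := L\<rparr>) \<psi>s" by auto
        interpret GL: finite_comm_group "V\<lparr>carrier := L\<rparr>" by (rule finite_comm_group_subgroup[OF quot_subgroup_facts(1)[OF L]])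
        have l: "length \<psi>s = r" "set \<psi>s \<subseteq> elem_chars (V\<lparr>carrier := L\<rparr>) p"
          using \<psi>s unfolding GL.indep_lists_def by blast+
        have "set \<psi>s \<subseteq> annihilator (V\<lparr>carrier := L\<rparr>) H"
          using l(2) unfolding k by (auto simp: annihilator_def kers_def elem_chars_def simp del: power_Suc)
        moreover have "H \<subseteq> L" unfolding k by (auto simp: kers_def simp del: power_Suc)
        ultimately show "x \<in> Sigma ?S ?T" using l(1) quot_subgroup_facts(1)[OF L] unfolding x by blast
      qed
      have "card {x \<in> ?P. ?k x = H} \<le> card (Sigma ?S ?T)"
        using finS T by (intro card_mono[OF _ sub] finite_SigmaI) auto
      also have "\<dots> = (\<Sum>L\<in>?S. card (?T L))" using finS T by (intro card_SigmaI) auto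
      also have "\<dots> \<le> (\<Sum>L\<in>?S. ?N ^ r)" using T by (intro sum_mono) auto
      also have "\<dots> = card ?S * ?N ^ r" by simp
      also have "\<dots> \<le> 2 ^ ?N * ?N ^ r"
        using card_supergroups_le[of H ?N] H order_zvec[OF q_pos', of n] by (intro mult_right_mono) auto
      finally have "real (card {x \<in> ?P. ?k x = H}) \<le> real (2 ^ ?N * ?N ^ r)" by (rule of_nat_mono)
      then show "real (card {x \<in> ?P. ?k x = H}) \<le> 2 ^ ?N * real (?N ^ r)" by (simp only: of_nat_mult of_nat_power of_nat_numeral)
    qed
    finally show "(\<Sum>x | x \<in> ?P \<and> ?k x = H. err (?k x)) \<le> 2 ^ ?N * real (?N ^ r) * err H" .
  qed
  also have "\<dots> = 2 ^ ?N * real (?N ^ r) * (\<Sum>H\<in>?\<H>. err H)" by (rule sum_distrib_left[symmetric])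
  finally show ?thesis .
qed

context
  fixes M :: "'w measure" and X :: "nat \<Rightarrow> nat \<Rightarrow> 'w \<Rightarrow> int"
  assumes rm: "random_matrix M n (p ^ Suc e) X"
begin

abbreviation "mcol \<equiv> random_matrix.col n X"

text \<open>Expected number of pairs of a subgroup \<open>L\<close> with quotient \<open>B\<close>
  and an independent list of \<open>r\<close> characters of \<open>L\<close> that kills all
  columns.\<close>

definition moment :: "nat \<Rightarrow> real" where
  "moment r = (\<Sum>L\<in>quot_subgroups V B. \<Sum>\<psi>s\<in>char_lists r L.
     measure M {\<omega> \<in> space M. \<forall>j\<in>{1..n}. mcol j \<omega> \<in> kers (V\<lparr>carrier := L\<rparr>) \<psi>s})"

lemma moment_error:
  "\<bar>moment r - real (card (quot_subgroups V B)) * (\<Prod>i<r. real p ^ n - real p ^ i) / real (p ^ (e + r)) ^ n\<bar>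
    \<le> 2 ^ (p ^ (e + r)) * real ((p ^ (e + r)) ^ r) *
      (\<Sum>H | subgroup H V \<and> card H * p ^ (e + r) = (p ^ Suc e) ^ n.
        \<bar>measure M {\<omega> \<in> space M. \<forall>j\<in>{1..n}. mcol j \<omega> \<in> H} - 1 / real (p ^ (e + r)) ^ n\<bar>)"
proof -
  let ?c = "1 / real (p ^ (e + r)) ^ n"
  let ?m = "\<lambda>H. measure M {\<omega> \<in> space M. \<forall>j\<in>{1..n}. mcol j \<omega> \<in> H}"
  have "(\<Sum>L\<in>quot_subgroups V B. \<Sum>\<psi>s\<in>char_lists r L. ?c)
      = (\<Sum>L\<in>quot_subgroups V B. (\<Prod>i<r. real p ^ n - real p ^ i) * ?c)"
    using char_lists_facts(2) by (intro sum.cong) auto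
  then have c: "real (card (quot_subgroups V B)) * (\<Prod>i<r. real p ^ n - real p ^ i) / real (p ^ (e + r)) ^ n
      = (\<Sum>L\<in>quot_subgroups V B. \<Sum>\<psi>s\<in>char_lists r L. ?c)" by simp
  have "\<bar>moment r - real (card (quot_subgroups V B)) * (\<Prod>i<r. real p ^ n - real p ^ i) / real (p ^ (e + r)) ^ n\<bar>
     = \<bar>\<Sum>L\<in>quot_subgroups V B. \<Sum>\<psi>s\<in>char_lists r L. ?m (kers (V\<lparr>carrier := L\<rparr>) \<psi>s) - ?c\<bar>"
    unfolding c moment_def by (simp only: sum_subtractf)
  also have "\<dots> \<le> (\<Sum>L\<in>quot_subgroups V B. \<Sum>\<psi>s\<in>char_lists r L. \<bar>?m (kers (V\<lparr>carrier := L\<rparr>) \<psi>s) - ?c\<bar>)"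
    by (rule order_trans[OF sum_abs]) (intro sum_mono sum_abs)
  also have "\<dots> \<le> 2 ^ (p ^ (e + r)) * real ((p ^ (e + r)) ^ r) *
      (\<Sum>H | subgroup H V \<and> card H * p ^ (e + r) = (p ^ Suc e) ^ n. \<bar>?m H - ?c\<bar>)"
    by (rule sum_kers_le) simp
  finally show ?thesis .
qed

text \<open>For each \<open>L\<close> the inequalities of \<open>generate_bonferroni\<close> hold
  pointwise in the sample; they are integrated and summed over \<open>L\<close>.\<close>

lemma prob_generate_bounds:
  shows "even m \<Longrightarrow> (\<Sum>L\<in>quot_subgroups V B. measure M {\<omega> \<in> space M. generate V ((\<lambda>j. mcol j \<omega>) ` {1..n}) = L})
      \<le> (\<Sum>r\<le>m. bonf_coeff p r * moment r)"
    and "odd m \<Longrightarrow> (\<Sum>r\<le>m. bonf_coeff p r * moment r)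
      \<le> (\<Sum>L\<in>quot_subgroups V B. measure M {\<omega> \<in> space M. generate V ((\<lambda>j. mcol j \<omega>) ` {1..n}) = L})"
proof -
  interpret random_matrix M n "p ^ Suc e" X by (rule rm)
  interpret V: finite_comm_group V by (rule finite_comm_group_zvec[OF q_pos'])
  let ?S = "\<lambda>\<omega>. (\<lambda>j. col j \<omega>) ` {1..n}"
  let ?G = "\<lambda>L. {\<omega> \<in> space M. generate V (?S \<omega>) = L}"
  let ?A = "\<lambda>L \<psi>s. {\<omega> \<in> space M. \<forall>j\<in>{1..n}. col j \<omega> \<in> kers (V\<lparr>carrier := L\<rparr>) \<psi>s}"
  have evG: "?G L \<in> events" for L
  proof -
    have "?G L = {\<omega> \<in> space M. (\<lambda>c. generate V (c ` {1..n}) = L) (\<lambda>j\<in>{1..n}. col j \<omega>)}" by simp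
    then show ?thesis using event_cols[of "\<lambda>c. generate V (c ` {1..n}) = L"] by simp
  qed
  have evA: "?A L \<psi>s \<in> events" for L \<psi>s by (rule event_cols_in)
  have pw: "(even m \<longrightarrow> indicator (?G L) \<omega> \<le> (\<Sum>r\<le>m. bonf_coeff p r * (\<Sum>\<psi>s\<in>char_lists r L. indicator (?A L \<psi>s) \<omega>))) \<and>
      (odd m \<longrightarrow> (\<Sum>r\<le>m. bonf_coeff p r * (\<Sum>\<psi>s\<in>char_lists r L. indicator (?A L \<psi>s) \<omega>)) \<le> (indicator (?G L) \<omega> :: real))"
    if L: "L \<in> quot_subgroups V B" and \<omega>: "\<omega> \<in> space M" for L \<omega>
  proof -
    note Lf = quot_subgroup_facts[OF L]
    interpret GL: finite_comm_group "V\<lparr>carrier := L\<rparr>" by (rule V.finite_comm_group_subgroup[OF Lf(1)])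
    obtain a where a: "order (V\<lparr>carrier := L\<rparr>) = p ^ a" using Lf(3) by blast
    have Sc: "?S \<omega> \<subseteq> carrier V" using col_closed[OF _ \<omega>] by auto
    have cnt: "(\<Sum>\<psi>s\<in>char_lists r L. indicator (?A L \<psi>s) \<omega>) = real (card {\<psi>s \<in> char_lists r L. ?S \<omega> \<subseteq> kers (V\<lparr>carrier := L\<rparr>) \<psi>s})" for r
    proof -
      have "(\<Sum>\<psi>s\<in>char_lists r L. indicator (?A L \<psi>s) \<omega>) = (\<Sum>\<psi>s\<in>char_lists r L. if ?S \<omega> \<subseteq> kers (V\<lparr>carrier := L\<rparr>) \<psi>s then 1 else (0 :: real))"
        using \<omega> by (intro sum.cong) (auto simp: indicator_def)
      then show ?thesis using char_lists_facts(1)[OF L] by (simp add: sum.If_cases Int_def)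
    qed
    show ?thesis
    proof (cases "?S \<omega> \<subseteq> L")
      case True
      have "generate V (?S \<omega>) = generate (V\<lparr>carrier := L\<rparr>) (?S \<omega>)"
        by (rule V.generate_consistent[OF True Lf(1), symmetric])
      then have ind: "indicator (?G L) \<omega> = (if generate (V\<lparr>carrier := L\<rparr>) (?S \<omega>) = carrier (V\<lparr>carrier := L\<rparr>) then 1 else (0 :: real))"
        using \<omega> by (simp add: indicator_def)
      have S': "?S \<omega> \<subseteq> carrier (V\<lparr>carrier := L\<rparr>)" using True by simp
      show ?thesis unfolding cnt ind using GL.generate_bonferroni[OF p a S', of m] by blast
    next
      \<comment> \<open>If some column lies outside \<open>L\<close>, it lies in no common kernel,
        so both sides are 0.\<close>
      case False
      have "{\<psi>s \<in> char_lists r L. ?S \<omega> \<subseteq> kers (V\<lparr>carrier := L\<rparr>) \<psi>s} = {}" for r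
        using False by (auto simp: kers_def)
      then have z: "(\<Sum>r\<le>m. bonf_coeff p r * (\<Sum>\<psi>s\<in>char_lists r L. indicator (?A L \<psi>s) \<omega>)) = 0"
        unfolding cnt by (simp only:) simp
      have "generate V (?S \<omega>) \<noteq> L" using False generate.incl[of _ "?S \<omega>" V] by blast
      then have "indicator (?G L) \<omega> = (0 :: real)" by (simp add: indicator_def)
      then show ?thesis unfolding z by simp
    qed
  qed
  have intG: "integrable M (indicator (?G L) :: _ \<Rightarrow> real)" for L
    using evG[of L] by (intro integrable_real_indicator) (auto simp: emeasure_eq_measure)
  have intA: "integrable M (indicator (?A L \<psi>s) :: _ \<Rightarrow> real)" for L \<psi>s
    using evA[of L \<psi>s] by (intro integrable_real_indicator) (auto simp: emeasure_eq_measure)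
  have intS: "integrable M (\<lambda>\<omega>. \<Sum>r\<le>m. bonf_coeff p r * (\<Sum>\<psi>s\<in>char_lists r L. indicator (?A L \<psi>s) \<omega>))" for L
    by (intro Bochner_Integration.integrable_sum integrable_mult_right intA)
  have eG: "(\<integral>\<omega>. indicator (?G L) \<omega> \<partial>M) = prob (?G L)" for L
  proof -
    have "?G L \<inter> space M = ?G L" by auto
    then show ?thesis by simp
  qed
  have eA: "(\<integral>\<omega>. indicator (?A L \<psi>s) \<omega> \<partial>M) = prob (?A L \<psi>s)" for L \<psi>s
  proof -
    have "?A L \<psi>s \<inter> space M = ?A L \<psi>s" by auto
    then show ?thesis by simp
  qed
  have eS: "(\<integral>\<omega>. (\<Sum>r\<le>m. bonf_coeff p r * (\<Sum>\<psi>s\<in>char_lists r L. indicator (?A L \<psi>s) \<omega>)) \<partial>M)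
      = (\<Sum>r\<le>m. bonf_coeff p r * (\<Sum>\<psi>s\<in>char_lists r L. prob (?A L \<psi>s)))" for L
  proof -
    have "(\<integral>\<omega>. (\<Sum>r\<le>m. bonf_coeff p r * (\<Sum>\<psi>s\<in>char_lists r L. indicator (?A L \<psi>s) \<omega>)) \<partial>M)
       = (\<Sum>r\<le>m. \<integral>\<omega>. bonf_coeff p r * (\<Sum>\<psi>s\<in>char_lists r L. indicator (?A L \<psi>s) \<omega>) \<partial>M)"
      by (intro Bochner_Integration.integral_sum integrable_mult_right Bochner_Integration.integrable_sum intA)
    also have "\<dots> = (\<Sum>r\<le>m. bonf_coeff p r * (\<integral>\<omega>. (\<Sum>\<psi>s\<in>char_lists r L. indicator (?A L \<psi>s) \<omega>) \<partial>M))"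
      by (simp only: integral_mult_right_zero)
    also have "\<dots> = (\<Sum>r\<le>m. bonf_coeff p r * (\<Sum>\<psi>s\<in>char_lists r L. \<integral>\<omega>. indicator (?A L \<psi>s) \<omega> \<partial>M))"
      by (intro sum.cong refl arg_cong2[where f = "(*)"] Bochner_Integration.integral_sum intA)
    finally show ?thesis unfolding eA .
  qed
  have tot: "(\<Sum>r\<le>m. bonf_coeff p r * moment r) = (\<Sum>L\<in>quot_subgroups V B. \<Sum>r\<le>m. bonf_coeff p r * (\<Sum>\<psi>s\<in>char_lists r L. prob (?A L \<psi>s)))"
    unfolding moment_def sum_distrib_left[of "bonf_coeff p _" _ "quot_subgroups V B"] by (rule sum.swap)
  show "(\<Sum>L\<in>quot_subgroups V B. prob (?G L)) \<le> (\<Sum>r\<le>m. bonf_coeff p r * moment r)" if "even m"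
    unfolding tot
  proof (rule sum_mono)
    fix L assume L: "L \<in> quot_subgroups V B"
    show "prob (?G L) \<le> (\<Sum>r\<le>m. bonf_coeff p r * (\<Sum>\<psi>s\<in>char_lists r L. prob (?A L \<psi>s)))"
      unfolding eG[symmetric] eS[symmetric] by (rule integral_mono[OF intG intS]) (use pw[OF L] that in blast)
  qed
  show "(\<Sum>r\<le>m. bonf_coeff p r * moment r) \<le> (\<Sum>L\<in>quot_subgroups V B. prob (?G L))" if "odd m"
    unfolding tot
  proof (rule sum_mono)
    fix L assume L: "L \<in> quot_subgroups V B"
    show "(\<Sum>r\<le>m. bonf_coeff p r * (\<Sum>\<psi>s\<in>char_lists r L. prob (?A L \<psi>s))) \<le> prob (?G L)"
      unfolding eG[symmetric] eS[symmetric] by (rule integral_mono[OF intS intG]) (use pw[OF L] that in blast)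
  qed
qed

end

end

section \<open>Passage from residues to the limit distribution\<close>

lemma measurable_padic_coord:
  "(\<lambda>x. x k) \<in> measurable (padic_borel p) (count_space UNIV)"
proof -
  have o: "open ((\<lambda>x :: nat \<Rightarrow> int. x k) -` {a})" for a
    by (rule open_vimage[OF discrete_topology_class.open_discrete continuous_on_product_coordinates])
  have "(\<lambda>x :: nat \<Rightarrow> int. x k) \<in> measurable borel (count_space UNIV)"
    using borel_open[OF o] by (subst measurable_count_space_eq2_countable) auto
  then show ?thesis unfolding padic_borel_def by (rule measurable_restrict_space1)
qed

lemma random_matrix_residue:
  fixes M :: "nat \<Rightarrow> nat \<Rightarrow> 'w \<Rightarrow> nat \<Rightarrow> int"
  assumes p: "p > 0" and "prob_space \<Omega>"
    and indep: "prob_space.indep_vars \<Omega> (\<lambda>_. padic_borel p) (\<lambda>(i, j). M i j) ({1..n} \<times> {1..n})"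
  shows "random_matrix \<Omega> n (p ^ k) (\<lambda>i j \<omega>. M i j \<omega> k)"
    and "i \<in> {1..n} \<Longrightarrow> j \<in> {1..n} \<Longrightarrow> \<omega> \<in> space \<Omega> \<Longrightarrow> M i j \<omega> \<in> carrier (padic_int_ring p)"
proof -
  interpret prob_space \<Omega> by fact
  have meas: "M i j \<in> measurable \<Omega> (padic_borel p)" if "i \<in> {1..n}" "j \<in> {1..n}" for i j
    using indep that by (auto simp: indep_vars_def)
  show car: "M i j \<omega> \<in> carrier (padic_int_ring p)" if "i \<in> {1..n}" "j \<in> {1..n}" "\<omega> \<in> space \<Omega>" for i j \<omega>
    using measurable_space[OF meas[OF that(1,2)] that(3)] by (simp add: padic_borel_def space_restrict_space)
  show "random_matrix \<Omega> n (p ^ k) (\<lambda>i j \<omega>. M i j \<omega> k)"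
  proof unfold_locales
    have "indep_vars (\<lambda>_. count_space UNIV) (\<lambda>ij \<omega>. (\<lambda>x. x k) ((case ij of (i, j) \<Rightarrow> M i j) \<omega>)) ({1..n} \<times> {1..n})"
      by (rule indep_vars_compose2[OF indep]) (rule measurable_padic_coord)
    moreover have "(\<lambda>ij \<omega>. (case ij of (i, j) \<Rightarrow> M i j) \<omega> k) = (\<lambda>(i, j) \<omega>. M i j \<omega> k)" by auto
    ultimately show "indep_vars (\<lambda>_. count_space UNIV) (\<lambda>(i, j) \<omega>. M i j \<omega> k) ({1..n} \<times> {1..n})" by simp
    show "M i j \<omega> k \<in> {0..<int (p ^ k)}" if "i \<in> {1..n}" "j \<in> {1..n}" "\<omega> \<in> space \<Omega>" for i j \<omega>
      using car[OF that] by (simp add: padic_carrier_iff[OF p])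
  qed (use p in simp)
qed

text \<open>For fixed \<open>m\<close> the truncated sums converge in \<open>n\<close> to the
  partial sum times \<open>a\<close>; only then is \<open>m\<close> increased. No uniformity in
  \<open>r\<close> of the convergence of \<mu> is required of the moments.\<close>

lemma tendsto_of_bonferroni:
  fixes c :: "nat \<Rightarrow> real" and a s :: real
  assumes c: "c sums s" and \<mu>: "\<And>r. (\<lambda>n. \<mu> n r) \<longlonglongrightarrow> a"
    and upper: "\<And>m. even m \<Longrightarrow> \<forall>\<^sub>F n in sequentially. P n \<le> (\<Sum>r\<le>m. c r * \<mu> n r)"
    and lower: "\<And>m. odd m \<Longrightarrow> \<forall>\<^sub>F n in sequentially. (\<Sum>r\<le>m. c r * \<mu> n r) \<le> P n"
  shows "P \<longlonglongrightarrow> s * a"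
proof -
  have T: "(\<lambda>n. \<Sum>r\<le>m. c r * \<mu> n r) \<longlonglongrightarrow> (\<Sum>r\<le>m. c r) * a" for m
    unfolding sum_distrib_right by (intro tendsto_intros \<mu>)
  have S: "(\<lambda>m. (\<Sum>r\<le>m. c r) * a) \<longlonglongrightarrow> s * a"
    using c by (intro tendsto_mult_right) (simp add: sums_def_le)
  show ?thesis
  proof (rule order_tendstoI)
    fix b assume "b < s * a"
    then have "\<forall>\<^sub>F m in sequentially. b < (\<Sum>r\<le>m. c r) * a" by (rule order_tendstoD[OF S])
    then obtain m0 where m0: "\<And>m. m \<ge> m0 \<Longrightarrow> b < (\<Sum>r\<le>m. c r) * a" by (auto simp: eventually_sequentially)
    \<comment> \<open>A truncation point beyond \<open>m0\<close> of the parity that gives a lower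
      bound; the even one below serves for the upper bound.\<close>
    have o: "odd (2 * m0 + 1)" by simp
    show "\<forall>\<^sub>F n in sequentially. b < P n"
      using order_tendstoD(1)[OF T m0[of "2 * m0 + 1"]] lower[OF o] by (auto elim: eventually_elim2)
  next
    fix b assume "s * a < b"
    then have "\<forall>\<^sub>F m in sequentially. (\<Sum>r\<le>m. c r) * a < b" by (rule order_tendstoD[OF S])
    then obtain m0 where m0: "\<And>m. m \<ge> m0 \<Longrightarrow> (\<Sum>r\<le>m. c r) * a < b" by (auto simp: eventually_sequentially)
    have ev: "even (2 * m0)" by simp
    show "\<forall>\<^sub>F n in sequentially. P n < b"
      using order_tendstoD(2)[OF T m0[of "2 * m0"]] upper[OF ev] by (auto elim: eventually_elim2)
  qed
qed

text \<open>Surjections number asymptotically \<open>card B ^ n\<close>, and each subgroup accounts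
  for \<open>card (auto B)\<close> of them.\<close>

lemma card_quot_subgroups_tendsto:
  assumes p: "prime p" and B: "comm_group B" "card (carrier B) = p ^ e"
  shows "(\<lambda>n. real (card (quot_subgroups (zvec n (p ^ Suc e)) B)) / real (p ^ e) ^ n) \<longlonglongrightarrow> 1 / real (card (auto B))"
proof -
  interpret B: comm_group B by (rule B(1))
  let ?q = "p ^ Suc e" and ?b = "p ^ e"
  have q: "?q > 0" and b: "?b > 0" using prime_gt_0_nat[OF p] by auto
  have finB: "finite (carrier B)" using B(2) b card.infinite by fastforce
  have "x [^]\<^bsub>B\<^esub> ?q = \<one>\<^bsub>B\<^esub>" if "x \<in> carrier B" for x
  proof -
    have "x [^]\<^bsub>B\<^esub> (?b * p) = (x [^]\<^bsub>B\<^esub> ?b) [^]\<^bsub>B\<^esub> p" using that by (simp add: B.nat_pow_pow)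
    also have "\<dots> = \<one>\<^bsub>B\<^esub>" using B.pow_order_eq_1[OF that] B(2) by (simp add: order_def)
    finally show ?thesis by (simp add: mult.commute)
  qed
  note bounds = card_epis_zvec_bounds[OF B(1) finB q this, unfolded B(2)]
  have "card (auto B) > 0"
  proof -
    have "auto B \<subseteq> carrier B \<rightarrow>\<^sub>E carrier B"
      by (auto simp: auto_def Bij_def bij_betw_def PiE_def)
    then have "finite (auto B)" by (rule finite_subset) (intro finite_PiE finB)
    moreover have "(\<lambda>x\<in>carrier B. x) \<in> auto B" by (rule B.id_in_auto)
    ultimately show ?thesis by (auto simp: card_gt_0_iff)
  qed
  then have a: "real (card (auto B)) > 0" by simp
  have ep: "real (card (epis (zvec n ?q) B)) = real (card (quot_subgroups (zvec n ?q) B)) * real (card (auto B))" for n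
    using finite_comm_group.card_epis[OF finite_comm_group_zvec[OF q] B.is_group finB] by simp
  have "(\<lambda>n. real (card (epis (zvec n ?q) B)) / real ?b ^ n) \<longlonglongrightarrow> 1"
  proof (rule tendsto_sandwich)
    have "1 - 2 ^ ?b * (1 / 2) ^ n \<le> real (card (epis (zvec n ?q) B)) / real ?b ^ n" for n
      using bounds(1)[of n] b by (simp add: field_simps power_divide)
    then show "\<forall>\<^sub>F n in sequentially. 1 - 2 ^ ?b * (1 / 2) ^ n \<le> real (card (epis (zvec n ?q) B)) / real ?b ^ n" by simp
    have "real (card (epis (zvec n ?q) B)) / real ?b ^ n \<le> 1" for n
      using bounds(2)[of n] b by simp
    then show "\<forall>\<^sub>F n in sequentially. real (card (epis (zvec n ?q) B)) / real ?b ^ n \<le> 1" by simp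
    have "(\<lambda>n. 1 - 2 ^ ?b * (1 / 2) ^ n :: real) \<longlonglongrightarrow> 1 - 2 ^ ?b * 0" by (intro tendsto_intros) auto
    then show "(\<lambda>n. 1 - 2 ^ ?b * (1 / 2) ^ n :: real) \<longlonglongrightarrow> 1" by simp
  qed simp
  then have "(\<lambda>n. real (card (epis (zvec n ?q) B)) / real ?b ^ n / real (card (auto B))) \<longlonglongrightarrow> 1 / real (card (auto B))"
    using a by (intro tendsto_divide) auto
  moreover have "real (card (epis (zvec n ?q) B)) / real ?b ^ n / real (card (auto B))
      = real (card (quot_subgroups (zvec n ?q) B)) / real ?b ^ n" for n
    using a unfolding ep by simp
  ultimately show ?thesis by simp
qed


text \<open>The number of subgroups grows like \<open>p ^ (e * n)\<close> over
  \<open>card (auto B)\<close>, the number of lists like \<open>p ^ (r * n)\<close>, and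
  \<open>1 / N ^ n\<close> cancels both; so the limit is the same for every
  \<open>r\<close>.\<close>

lemma moment_tendsto:
  assumes p: "prime p" and B: "comm_group B" "card (carrier B) = p ^ e"
    and rm: "\<And>n. n \<ge> 1 \<Longrightarrow> random_matrix (\<Omega> n) n (p ^ Suc e) (X n)"
    and err: "\<And>N. (\<lambda>n. \<Sum>H | subgroup H (zvec n (p ^ Suc e)) \<and> card H * N = (p ^ Suc e) ^ n.
      \<bar>measure (\<Omega> n) {\<omega> \<in> space (\<Omega> n). \<forall>j\<in>{1..n}. random_matrix.col n (X n) j \<omega> \<in> H} - 1 / real N ^ n\<bar>) \<longlonglongrightarrow> 0"
  shows "(\<lambda>n. moment p e n B (\<Omega> n) (X n) r) \<longlonglongrightarrow> 1 / real (card (auto B))"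
proof -
  let ?N = "p ^ (e + r)"
  let ?main = "\<lambda>n. real (card (quot_subgroups (zvec n (p ^ Suc e)) B)) * (\<Prod>i<r. real p ^ n - real p ^ i) / real ?N ^ n"
  have p0: "real p > 1" using prime_gt_1_nat[OF p] by simp
  have "?main n = real (card (quot_subgroups (zvec n (p ^ Suc e)) B)) / real (p ^ e) ^ n * (\<Prod>i<r. 1 - real p ^ i * inverse (real p) ^ n)" for n
  proof -
    have "(\<Prod>i<r. real p ^ n - real p ^ i) = (\<Prod>i<r. real p ^ n * (1 - real p ^ i * inverse (real p) ^ n))"
      using p0 by (intro prod.cong) (auto simp: field_simps)
    also have "\<dots> = (real p ^ n) ^ r * (\<Prod>i<r. 1 - real p ^ i * inverse (real p) ^ n)" by (simp add: prod.distrib)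
    finally have 1: "(\<Prod>i<r. real p ^ n - real p ^ i) = (real p ^ n) ^ r * (\<Prod>i<r. 1 - real p ^ i * inverse (real p) ^ n)" .
    have 2: "real ?N ^ n = real (p ^ e) ^ n * (real p ^ n) ^ r"
      by (simp add: power_add power_mult_distrib power_commutes flip: power_mult) (simp add: mult.commute)
    have c: "a * (x * b) / (d * x) = a / d * b" if "x \<noteq> 0" for a b d x :: real using that by simp
    have "(real p ^ n) ^ r \<noteq> 0" using p0 by simp
    then show ?thesis unfolding 1 2 by (rule c)
  qed
  moreover have "(\<lambda>n. real (card (quot_subgroups (zvec n (p ^ Suc e)) B)) / real (p ^ e) ^ n * (\<Prod>i<r. 1 - real p ^ i * inverse (real p) ^ n))
      \<longlonglongrightarrow> 1 / real (card (auto B)) * (\<Prod>i<r. 1 - real p ^ i * 0)"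
  proof (intro tendsto_mult card_quot_subgroups_tendsto[OF p B] tendsto_prod tendsto_diff tendsto_const)
    show "(\<lambda>n. inverse (real p) ^ n) \<longlonglongrightarrow> 0" by (rule LIMSEQ_inverse_realpow_zero[OF p0, folded power_inverse])
  qed
  ultimately have main: "?main \<longlonglongrightarrow> 1 / real (card (auto B))" by simp
  let ?E = "\<lambda>n. 2 ^ (p ^ (e + r)) * real ((p ^ (e + r)) ^ r) *
      (\<Sum>H | subgroup H (zvec n (p ^ Suc e)) \<and> card H * ?N = (p ^ Suc e) ^ n.
        \<bar>measure (\<Omega> n) {\<omega> \<in> space (\<Omega> n). \<forall>j\<in>{1..n}. random_matrix.col n (X n) j \<omega> \<in> H} - 1 / real ?N ^ n\<bar>)"
  have E: "?E \<longlonglongrightarrow> 0" using tendsto_mult_left[OF err[of ?N], of "2 ^ (p ^ (e + r)) * real ((p ^ (e + r)) ^ r)"] by simp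
  have "\<forall>\<^sub>F n in sequentially. norm (moment p e n B (\<Omega> n) (X n) r - ?main n) \<le> ?E n"
  proof (rule eventually_sequentiallyI[of 1])
    fix n :: nat assume "1 \<le> n"
    from moment_error[OF p B(2) rm[OF this], of r]
    show "norm (moment p e n B (\<Omega> n) (X n) r - ?main n) \<le> ?E n" by (simp only: real_norm_def)
  qed
  then have "(\<lambda>n. moment p e n B (\<Omega> n) (X n) r - ?main n) \<longlonglongrightarrow> 0" by (rule Lim_null_comparison[OF _ E])
  from tendsto_add[OF this main] show ?thesis by simp
qed

text \<open>By \<open>padic_cok_iso_iff\<close> the event says that the subgroup generated by the
  reduced columns is one of the finitely many \<open>L\<close>; these events are disjoint. It also
  becomes measurable in this way.\<close>

lemma prob_padic_cok_eq_sum: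
  fixes M :: "nat \<Rightarrow> nat \<Rightarrow> 'w \<Rightarrow> nat \<Rightarrow> int"
  assumes p: "prime p" and card_B: "card (carrier B) = p ^ e"
    and rm: "random_matrix \<Omega> n (p ^ Suc e) (\<lambda>i j \<omega>. M i j \<omega> (Suc e))"
    and car: "\<And>i j \<omega>. i \<in> {1..n} \<Longrightarrow> j \<in> {1..n} \<Longrightarrow> \<omega> \<in> space \<Omega> \<Longrightarrow> M i j \<omega> \<in> carrier (padic_int_ring p)"
  shows "measure \<Omega> {\<omega> \<in> space \<Omega>. padic_cok p n (\<lambda>i j. M i j \<omega>) \<cong> B} =
    (\<Sum>L\<in>quot_subgroups (zvec n (p ^ Suc e)) B. measure \<Omega> {\<omega> \<in> space \<Omega>.
      generate (zvec n (p ^ Suc e)) ((\<lambda>j. random_matrix.col n (\<lambda>i j \<omega>. M i j \<omega> (Suc e)) j \<omega>) ` {1..n}) = L})"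
proof -
  let ?V = "zvec n (p ^ Suc e)"
  have p0: "p > 0" by (rule prime_gt_0_nat[OF p])
  interpret random_matrix \<Omega> n "p ^ Suc e" "\<lambda>i j \<omega>. M i j \<omega> (Suc e)" by (rule rm)
  interpret V: finite_comm_group ?V by (rule finite_comm_group_zvec[OF q_pos])
  let ?gen = "\<lambda>\<omega>. generate ?V ((\<lambda>j. col j \<omega>) ` {1..n})"
  let ?G = "\<lambda>L. {\<omega> \<in> space \<Omega>. ?gen \<omega> = L}"
  have "padic_cok p n (\<lambda>i j. M i j \<omega>) \<cong> B \<longleftrightarrow> ?gen \<omega> \<in> quot_subgroups ?V B" if \<omega>: "\<omega> \<in> space \<Omega>" for \<omega>
  proof -
    have R: "i \<in> {1..n} \<Longrightarrow> j \<in> {1..n} \<Longrightarrow> M i j \<omega> \<in> carrier (padic_int_ring p)" for i j using car \<omega> by blast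
    have "reduced_col n (\<lambda>i j. M i j \<omega>) (Suc e) = (\<lambda>j. col j \<omega>)"
      unfolding col_def by (rule ext, rule reduced_col_def[OF p0]) (rule R)
    moreover have "subgroup (?gen \<omega>) ?V" using col_closed[OF _ \<omega>] by (intro V.generate_is_subgroup) auto
    moreover have "padic_cok p n (\<lambda>i j. M i j \<omega>) \<cong> B \<longleftrightarrow>
        ?V Mod generate ?V (reduced_col n (\<lambda>i j. M i j \<omega>) (Suc e) ` {1..n}) \<cong> B"
      by (rule padic_cok_iso_iff[OF p0 _ card_B]) (rule R)
    ultimately show ?thesis by (simp only: quot_subgroups_def mem_Collect_eq simp_thms)
  qed
  then have "{\<omega> \<in> space \<Omega>. padic_cok p n (\<lambda>i j. M i j \<omega>) \<cong> B} = (\<Union>L\<in>quot_subgroups ?V B. ?G L)" by blast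
  moreover have "measure \<Omega> (\<Union>L\<in>quot_subgroups ?V B. ?G L) = (\<Sum>L\<in>quot_subgroups ?V B. measure \<Omega> (?G L))"
  proof (rule finite_measure_finite_Union[OF finite_quot_subgroups[OF p card_B]])
    have "?G L \<in> events" for L
      using event_cols[of "\<lambda>c. generate ?V (c ` {1..n}) = L"] by simp
    then show "?G ` quot_subgroups ?V B \<subseteq> events" by auto
    show "disjoint_family_on ?G (quot_subgroups ?V B)" by (auto simp: disjoint_family_on_def)
  qed
  ultimately show ?thesis by (simp only:)
qed

theorem theorem1p5:
  fixes p :: nat
    and \<delta> \<epsilon> :: real
    and B :: "('b, 'c) monoid_scheme"
    and \<Omega> :: "nat \<Rightarrow> 'w measure"
    and M :: "nat \<Rightarrow> nat \<Rightarrow> nat \<Rightarrow> 'w \<Rightarrow> nat \<Rightarrow> int"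
  assumes "prime p"
    and "\<delta> > 0" and "\<epsilon> > 0"
    and "comm_group B" and "finite (carrier B)" and "\<exists>e. card (carrier B) = p ^ e"
    and "\<And>n. n \<ge> 1 \<Longrightarrow> prob_space (\<Omega> n)"
    and "\<And>n. n \<ge> 1 \<Longrightarrow>
           prob_space.indep_vars (\<Omega> n) (\<lambda>_. padic_borel p) (\<lambda>(i, j). M n i j) ({1..n} \<times> {1..n})"
    and "\<And>n i j. n \<ge> 1 \<Longrightarrow> i \<in> {1..n} \<Longrightarrow> j \<in> {1..n} \<Longrightarrow>
           \<bar>real i - real j\<bar> \<le> ln (real n) powr (1 + \<delta>) \<Longrightarrow>
           padic_balanced p \<epsilon> (\<Omega> n) (M n i j)"
  shows "(\<lambda>n. measure (\<Omega> n) {\<omega> \<in> space (\<Omega> n). padic_cok p n (\<lambda>i j. M n i j \<omega>) \<cong> B})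
           \<longlonglongrightarrow> (\<Prod>k. 1 - 1 / real p ^ Suc k) / real (card (auto B))"
proof -
  note p = assms(1)
  have p0: "p > 0" by (rule prime_gt_0_nat[OF p])
  obtain e where card_B: "card (carrier B) = p ^ e" using assms(6) by blast
  \<comment> \<open>The digit with index \<open>Suc e\<close> is the residue modulo
    \<open>p ^ Suc e\<close>, the least precision that \<open>padic_cok_iso_iff\<close> works
    with.\<close>
  define X where "X n = (\<lambda>i j \<omega>. M n i j \<omega> (Suc e))" for n
  have rm: "random_matrix (\<Omega> n) n (p ^ Suc e) (X n)" if "n \<ge> 1" for n
    unfolding X_def by (rule random_matrix_residue(1)[OF p0 assms(7,8)[OF that]])
  have car: "M n i j \<omega> \<in> carrier (padic_int_ring p)"
    if "n \<ge> 1" "i \<in> {1..n}" "j \<in> {1..n}" "\<omega> \<in> space (\<Omega> n)" for n i j \<omega>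
    by (rule random_matrix_residue(2)[OF p0 assms(7,8)[OF that(1)] that(2-)])
  have bal: "measure (\<Omega> n) {\<omega> \<in> space (\<Omega> n). [X n i j \<omega> = t] (mod int p)} \<le> 1 - \<epsilon>"
    if n: "n \<ge> 1" and ij: "i \<in> {1..n}" "j \<in> {1..n}" and "\<bar>real i - real j\<bar> \<le> ln (real n) powr (1 + \<delta>)" for n i j t
  proof -
    \<comment> \<open>Balancedness is stated for the residue modulo \<open>p\<close>, that is for
      index 1; the residues of a \<open>p\<close>-adic integer are compatible.\<close>
    have "[X n i j \<omega> = t] (mod int p) \<longleftrightarrow> [M n i j \<omega> 1 = t] (mod int p)" if "\<omega> \<in> space (\<Omega> n)" for \<omega>
    proof -
      note c = car[OF n ij that]
      have "M n i j \<omega> (Suc e) mod int p = M n i j \<omega> 1" using padic_carrier_mod[OF p0 c, of 1 "Suc e"] by simp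
      moreover have "M n i j \<omega> 1 mod int p = M n i j \<omega> 1" using padic_carrier_mod[OF p0 c, of 1 1] by simp
      ultimately show ?thesis by (simp add: cong_def X_def)
    qed
    then have "{\<omega> \<in> space (\<Omega> n). [X n i j \<omega> = t] (mod int p)} = {\<omega> \<in> space (\<Omega> n). [M n i j \<omega> 1 = t] (mod int p)}" by blast
    then show ?thesis using assms(9)[OF that] by (simp add: padic_balanced_def)
  qed
  let ?P = "\<lambda>n. measure (\<Omega> n) {\<omega> \<in> space (\<Omega> n). padic_cok p n (\<lambda>i j. M n i j \<omega>) \<cong> B}"
  have P: "?P n = (\<Sum>L\<in>quot_subgroups (zvec n (p ^ Suc e)) B. measure (\<Omega> n) {\<omega> \<in> space (\<Omega> n).
      generate (zvec n (p ^ Suc e)) ((\<lambda>j. random_matrix.col n (X n) j \<omega>) ` {1..n}) = L})" if "n \<ge> 1" for n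
    using prob_padic_cok_eq_sum[OF p card_B rm[OF that, unfolded X_def] car[OF that]] unfolding X_def by simp
  \<comment> \<open>Since all moments have the limit \<open>1 / card (auto B)\<close>, the
    alternating series contributes only the sum of its coefficients, which is the infinite
    product.\<close>
  have "?P \<longlonglongrightarrow> (\<Prod>k. 1 - 1 / real p ^ Suc k) * (1 / real (card (auto B)))"
  proof (rule tendsto_of_bonferroni[OF bonf_coeff_sums[OF prime_gt_1_nat[OF p]]])
    show "(\<lambda>n. moment p e n B (\<Omega> n) (X n) r) \<longlonglongrightarrow> 1 / real (card (auto B))" for r
      by (rule moment_tendsto[OF p assms(4) card_B rm sum_prob_cols_error_tendsto[OF p zero_less_Suc assms(3,2) rm bal]])
    show "\<forall>\<^sub>F n in sequentially. ?P n \<le> (\<Sum>r\<le>m. bonf_coeff p r * moment p e n B (\<Omega> n) (X n) r)" if "even m" for m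
      using prob_generate_bounds(1)[OF p card_B rm that] P by (intro eventually_sequentiallyI[of 1]) (simp only:)
    show "\<forall>\<^sub>F n in sequentially. (\<Sum>r\<le>m. bonf_coeff p r * moment p e n B (\<Omega> n) (X n) r) \<le> ?P n" if "odd m" for m
      using prob_generate_bounds(2)[OF p card_B rm that] P by (intro eventually_sequentiallyI[of 1]) (simp only:)
  qed
  then show ?thesis by simp
qed

end
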